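(* Let $D$ be a domain in $\mathbb R^n$, $n\ge2$, and let $f_j$, $j=1,2,\dots$, be homeomorphisms of $D$ into $\mathbb R^n$ of class $W^{1,1}_{\rm loc}(D)$ converging locally uniformly to a mapping $f:D\to\mathbb R^n$ which is differentiable a.e. in $D$. Let $\Phi:[1,\infty]\to[0,\infty]$ be strictly convex and continuous from the left (in the topology of $[0,\infty]$) at the point $T=\sup\{t:\Phi(t)<\infty\}$. Then for every open set $\Omega\subseteq D$ $$\int_\Omega\Phi(P_f(x))\,dm(x)\le\liminf_{j\to\infty}\int_\Omega\Phi(P_{f_j}(x))\,dm(x).$$ Moreover, if $f$ is a homeomorphism and the right-hand side is finite, then $f\in W^{1,1}_{\rm loc}(\Omega)$; and if in addition $\limsup_{j\to\infty}\int_\Omega\Phi(P_{f_j}(x))\,dm(x)<\infty$, then $\partial_if_j\to\partial_if$ weakly in $L^1_{\rm loc}(\Omega)$ for all $i=1,\dots,n$.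
   Context: A function $\Phi:[1,\infty]\to[0,\infty]$ is strictly convex if it is nondecreasing, convex and $\lim_{t\to\infty}\Phi(t)/t=\infty$. For $x\in D$ with all first partials, $\|f'(x)\|=\sup_{|h|=1}|f'(x)h|$, $J_f(x)=\det f'(x)$; the outer dilatation is $K_f(x)=\|f'(x)\|^n/|J_f(x)|$ if $J_f(x)\ne0$, $K_f(x)=1$ if $f'(x)=0$, and $K_f(x)=\infty$ otherwise (including points without first partial derivatives). $P_f(x)=K_f(x)^{1/(n-1)}$. *)

theory Defs
  imports "HOL-Analysis.Analysis"
begin

definition has_partial :: "(real^'n \<Rightarrow> 'b::real_normed_vector) \<Rightarrow> real^'n \<Rightarrow> 'n \<Rightarrow> bool" where
  "has_partial f x i \<longleftrightarrow> (\<lambda>t. f (x + t *\<^sub>R axis i 1)) differentiable (at 0)"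

definition pd :: "(real^'n \<Rightarrow> 'b::real_normed_vector) \<Rightarrow> real^'n \<Rightarrow> 'n \<Rightarrow> 'b" where
  "pd f x i = vector_derivative (\<lambda>t. f (x + t *\<^sub>R axis i 1)) (at 0)"

definition has_all_partials :: "(real^'n \<Rightarrow> 'b::real_normed_vector) \<Rightarrow> real^'n \<Rightarrow> bool" where
  "has_all_partials f x \<longleftrightarrow> (\<forall>i. has_partial f x i)"

definition dmap :: "(real^'n \<Rightarrow> real^'m) \<Rightarrow> real^'n \<Rightarrow> real^'n \<Rightarrow> real^'m" where
  "dmap f x h = (\<Sum>i\<in>UNIV. (h $ i) *\<^sub>R pd f x i)"

definition dnorm :: "(real^'n \<Rightarrow> real^'m) \<Rightarrow> real^'n \<Rightarrow> real" where
  "dnorm f x = Sup {norm (dmap f x h) | h. norm h = 1}"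

definition jac :: "(real^'n \<Rightarrow> real^'n) \<Rightarrow> real^'n \<Rightarrow> real" where
  "jac f x = det (\<chi> k i. (pd f x i) $ k)"

definition outer_dil :: "(real^'n \<Rightarrow> real^'n) \<Rightarrow> real^'n \<Rightarrow> ennreal" where
  "outer_dil f x =
     (if has_all_partials f x then
        (if jac f x \<noteq> 0 then ennreal (dnorm f x ^ CARD('n) / \<bar>jac f x\<bar>)
         else if (\<forall>i. pd f x i = 0) then 1
         else \<infinity>)
      else \<infinity>)"

definition Pdil :: "(real^'n \<Rightarrow> real^'n) \<Rightarrow> real^'n \<Rightarrow> ennreal" where
  "Pdil f x = (if outer_dil f x = \<infinity> then \<infinity>
               else ennreal (enn2real (outer_dil f x) powr (1 / (real CARD('n) - 1))))"

definition strictly_convex_Phi :: "(ennreal \<Rightarrow> ennreal) \<Rightarrow> bool" where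
  "strictly_convex_Phi \<Phi> \<longleftrightarrow>
     (\<forall>s t. 1 \<le> s \<longrightarrow> s \<le> t \<longrightarrow> \<Phi> s \<le> \<Phi> t) \<and>
     (\<forall>s t l::real. 1 \<le> s \<longrightarrow> 1 \<le> t \<longrightarrow> 0 < l \<longrightarrow> l < 1 \<longrightarrow>
        \<Phi> (ennreal (l * s + (1 - l) * t)) \<le> ennreal l * \<Phi> (ennreal s) + ennreal (1 - l) * \<Phi> (ennreal t)) \<and>
     ((\<lambda>t::real. \<Phi> (ennreal t) / ennreal t) \<longlongrightarrow> \<infinity>) at_top"

definition Phi_T :: "(ennreal \<Rightarrow> ennreal) \<Rightarrow> ennreal" where
  "Phi_T \<Phi> = Sup {t. 1 \<le> t \<and> \<Phi> t < \<infinity>}"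

definition left_cont_at_T :: "(ennreal \<Rightarrow> ennreal) \<Rightarrow> bool" where
  "left_cont_at_T \<Phi> \<longleftrightarrow> (\<Phi> \<longlongrightarrow> \<Phi> (Phi_T \<Phi>)) (at (Phi_T \<Phi>) within {1..<Phi_T \<Phi>})"

definition locally_L1 :: "(real^'n \<Rightarrow> 'b::euclidean_space) \<Rightarrow> (real^'n) set \<Rightarrow> bool" where
  "locally_L1 g U \<longleftrightarrow> (\<forall>K. compact K \<and> K \<subseteq> U \<longrightarrow> g absolutely_integrable_on K)"

fun iter_pd :: "'n list \<Rightarrow> (real^'n \<Rightarrow> real) \<Rightarrow> real^'n \<Rightarrow> real" where
  "iter_pd [] \<phi> = \<phi>"
| "iter_pd (i # is) \<phi> = (\<lambda>x. pd (iter_pd is \<phi>) x i)"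

definition smooth_fun :: "(real^'n \<Rightarrow> real) \<Rightarrow> bool" where
  "smooth_fun \<phi> \<longleftrightarrow> (\<forall>is. continuous_on UNIV (iter_pd is \<phi>) \<and>
                        (\<forall>x i. has_partial (iter_pd is \<phi>) x i))"

definition test_fun :: "(real^'n) set \<Rightarrow> (real^'n \<Rightarrow> real) \<Rightarrow> bool" where
  "test_fun U \<phi> \<longleftrightarrow> smooth_fun \<phi> \<and> compact (closure {x. \<phi> x \<noteq> 0}) \<and> closure {x. \<phi> x \<noteq> 0} \<subseteq> U"

definition weak_partials :: "(real^'n) set \<Rightarrow> (real^'n \<Rightarrow> real^'m) \<Rightarrow> ('n \<Rightarrow> real^'n \<Rightarrow> real^'m) \<Rightarrow> bool" where
  "weak_partials U f g \<longleftrightarrow> (\<forall>i. locally_L1 (g i) U) \<and>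
     (\<forall>\<phi> i. test_fun U \<phi> \<longrightarrow>
        integral U (\<lambda>x. pd \<phi> x i *\<^sub>R f x) = - integral U (\<lambda>x. \<phi> x *\<^sub>R g i x))"

definition W11_loc :: "(real^'n) set \<Rightarrow> (real^'n \<Rightarrow> real^'m) \<Rightarrow> bool" where
  "W11_loc U f \<longleftrightarrow> locally_L1 f U \<and> (\<exists>g. weak_partials U f g)"

text \<open>Weak convergence in L^1_loc(U): weak convergence in L^1(K) (dual L^\<infinity>(K)) for every compact K \<subseteq> U.\<close>
definition weak_conv_L1_loc :: "(real^'n) set \<Rightarrow> (nat \<Rightarrow> real^'n \<Rightarrow> real^'m) \<Rightarrow> (real^'n \<Rightarrow> real^'m) \<Rightarrow> bool" where
  "weak_conv_L1_loc U gs g \<longleftrightarrow>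
     (\<forall>K h. compact K \<and> K \<subseteq> U \<and> h measurable_on K \<and> bounded (h ` K) \<longrightarrow>
        (\<lambda>j. integral K (\<lambda>x. h x *\<^sub>R gs j x)) \<longlonglongrightarrow> integral K (\<lambda>x. h x *\<^sub>R g x))"

definition locally_uniform_conv :: "(real^'n) set \<Rightarrow> (nat \<Rightarrow> real^'n \<Rightarrow> real^'m) \<Rightarrow> (real^'n \<Rightarrow> real^'m) \<Rightarrow> bool" where
  "locally_uniform_conv D fs f \<longleftrightarrow>
     (\<forall>x\<in>D. \<exists>e>0. cball x e \<subseteq> D \<and> uniform_limit (cball x e) fs f sequentially)"

end

theory Submission
  imports Defs
begin

text \<open>
  Put \<open>q = 1/(n - 1)\<close>. A matrix with operator norm \<open>N\<close>, determinant of modulus \<open>J\<close> and finite dilatation \<open>P\<close> satisfies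
  \<open>P \<ge> (1 + q) s\<^sup>q N - q s\<^sup>1\<^sup>+\<^sup>q J\<close> for every \<open>s \<ge> 0\<close>, with equality at \<open>s = N/J\<close>. Composing with an affine minorant
  of \<open>\<Phi>\<close> bounds \<open>\<Phi>(P)\<close> from below by an expression that is linear in a directional derivative and in \<open>J\<close>.
  Integrated against a bump function, the derivative of \<open>f\<^sub>j\<close> passes to the locally uniform limit by partial integration,
  while the integral of the Jacobian over a cube is at most the measure of the image of the cube. For an injective continuous
  Sobolev map this area inequality follows from covering almost all of the domain by sets on which the map is nearly affine.
  So at a point \<open>x\<close> of differentiability of \<open>f\<close>, for \<open>c < \<Phi>(P\<^sub>f(x))\<close>, the mean energy of \<open>f\<^sub>j\<close> over each small cube about
  \<open>x\<close> is eventually at least \<open>c\<close>, and lower semicontinuity follows from Fatou and Tonelli.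

  With \<open>s\<close> small and superlinear growth of \<open>\<Phi>\<close>, the same inequality shows that bounded energy makes the partial
  derivatives of the \<open>f\<^sub>j\<close> equi-integrable on compact sets. Difference quotients then identify the partial derivatives of
  \<open>f\<close> as weak ones, and weak convergence extends from bump functions to boxes, Borel sets and bounded functions.
\<close>

section \<open>Smooth bump functions\<close>

text \<open>The dilatation is built from classical partial derivatives, while the hypotheses supply
  weak ones. The link is finite energy: since \<open>\<Phi>\<close> is infinite at infinity, the
  partial derivatives then exist almost everywhere, and difference quotients identify them with the
  weak ones. Maps of infinite energy are avoided by passing to a subsequence that realises the lower
  limit. The obstacle is the Jacobian, which is not continuous under the available convergence. It
  enters the lower bound for \<open>\<Phi>(P)\<close> with a negative sign, so an upper bound for
  its integral is what counts: a small cube about a point of differentiability is mapped by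
  \<open>f\<^sub>j\<close> close to a linear image of the cube, whose measure is \<bar>det\<bar>
  times that of the cube. Orientation is not involved, only absolute values and injectivity. A
  homeomorphism of class W^{1,1} may map null sets to sets of positive measure, so the area
  inequality is proved in the direction that tolerates this.\<close>

text \<open>Smoothness is carried by the whole sequence of derivatives, because iterated partial
  derivatives of a product over the coordinates are products of members of such sequences.\<close>

definition smooth1 :: "(real \<Rightarrow> real) \<Rightarrow> bool" where
  "smooth1 \<psi> \<longleftrightarrow> (\<exists>d::nat \<Rightarrow> real \<Rightarrow> real. d 0 = \<psi> \<and> (\<forall>k x. (d k has_real_derivative d (Suc k) x) (at x)))"

text \<open>A class in which every member has a derivative inside the class consists of smooth
  functions: choosing a derivative and iterating the choice gives the required sequence.\<close>

lemma smooth1_coinduct: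
  assumes "P \<psi>" and step: "\<And>f. P f \<Longrightarrow> \<exists>f'. P f' \<and> (\<forall>x. (f has_real_derivative f' x) (at x))"
  shows "smooth1 \<psi>"
proof -
  obtain D where D: "\<And>f. P f \<Longrightarrow> P (D f) \<and> (\<forall>x. (f has_real_derivative D f x) (at x))"
    using step by metis
  define d where "d k = (D ^^ k) \<psi>" for k
  have "P (d k)" for k
    by (induction k) (auto simp: d_def assms(1) D)
  then have "\<forall>k x. (d k has_real_derivative d (Suc k) x) (at x)"
    using D by (auto simp: d_def)
  then show ?thesis
    unfolding smooth1_def by (intro exI[of _ d]) (auto simp: d_def)
qed

text \<open>The flat function exp(-1/z), extended by 0, together with its quotients by powers of z.
  Differentiation stays within linear combinations of this family.\<close>

definition flat_exp :: "nat \<Rightarrow> real \<Rightarrow> real" where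
  "flat_exp k z = (if 0 < z then exp (- 1 / z) / z ^ k else 0)"

lemma flat_exp_shift: "z ^ j * flat_exp (j + k) z = flat_exp k z"
  by (auto simp: flat_exp_def power_add)

lemma flat_exp_has_derivative:
  "(flat_exp k has_real_derivative (flat_exp (k + 2) z - k * flat_exp (k + 1) z)) (at z)"
proof (cases z "0::real" rule: linorder_cases)
  case less
  have "((\<lambda>_. 0) has_real_derivative 0) (at z)" by simp
  then have "(flat_exp k has_real_derivative 0) (at z)"
    by (rule has_field_derivative_transform_within_open[where S="{..<0}"])
       (use less in \<open>auto simp: flat_exp_def\<close>)
  then show ?thesis using less by (simp add: flat_exp_def)
next
  case equal
  \<comment> \<open>With w = 1/t the difference quotient at 0 from the right becomes w^(k+1)/exp w;
    from the left it vanishes.\<close>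
  have "((\<lambda>w::real. w ^ (k + 1) / exp w) \<longlongrightarrow> 0) at_top"
    by (rule tendsto_power_div_exp_0)
  then have "((\<lambda>t::real. inverse t ^ (k + 1) / exp (inverse t)) \<longlongrightarrow> 0) (at_right 0)"
    by (rule filterlim_compose[OF _ filterlim_inverse_at_top_right])
  then have r: "((\<lambda>t. flat_exp k t / t) \<longlongrightarrow> 0) (at_right 0)"
    by (rule Lim_transform_eventually)
       (auto simp: eventually_at_filter flat_exp_def exp_minus field_simps inverse_eq_divide)
  have l: "((\<lambda>t. flat_exp k t / t) \<longlongrightarrow> 0) (at_left 0)"
    by (rule tendsto_eventually) (auto simp: eventually_at_filter flat_exp_def)
  have "((\<lambda>t. flat_exp k t / t) \<longlongrightarrow> 0) (at 0)"
    using r l by (simp add: filterlim_at_split)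
  then show ?thesis using equal
    by (simp add: has_field_derivative_iff flat_exp_def)
next
  case greater
  have "((\<lambda>z. exp (- 1 / z) / z ^ k) has_real_derivative (flat_exp (k + 2) z - k * flat_exp (k + 1) z)) (at z)"
  proof -
    have 1: "((\<lambda>z. - 1 / z) has_real_derivative 1 / z\<^sup>2) (at z)"
      using greater by (auto intro!: derivative_eq_intros simp: power2_eq_square)
    have 2: "((\<lambda>z. exp (- 1 / z)) has_real_derivative exp (- 1 / z) * (1 / z\<^sup>2)) (at z)"
      by (rule DERIV_chain2[OF DERIV_exp 1])
    have 3: "((\<lambda>z. exp (- 1 / z) / z ^ k) has_real_derivative
        (exp (- 1 / z) * (1 / z\<^sup>2) * z ^ k - exp (- 1 / z) * (real k * z ^ (k - 1))) / (z ^ k * z ^ k)) (at z)"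
      using greater DERIV_pow[of k z] by (intro DERIV_divide 2) auto
    have "(exp (- 1 / z) * (1 / z\<^sup>2) * z ^ k - exp (- 1 / z) * (real k * z ^ (k - 1))) / (z ^ k * z ^ k)
        = flat_exp (k + 2) z - k * flat_exp (k + 1) z"
      using greater by (cases k) (simp_all add: flat_exp_def divide_simps power2_eq_square, simp add: algebra_simps)
    with 3 show ?thesis by simp
  qed
  then show ?thesis
    by (rule has_field_derivative_transform_within_open[where S="{0<..}"])
       (use greater in \<open>auto simp: flat_exp_def\<close>)
qed

text \<open>Products of a polynomial with \<open>flat_exp k\<close> of a fixed polynomial are closed
  under differentiation, once all terms of the derivative are written with the same index
  \<open>k + 2\<close>.\<close>

lemma smooth1_flat_exp_poly: "smooth1 (\<lambda>x. poly p x * flat_exp k (poly q x))"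
proof (rule smooth1_coinduct[where P="\<lambda>f. \<exists>p k. f = (\<lambda>x. poly p x * flat_exp k (poly q x))"])
  show "\<exists>p' k'. (\<lambda>x. poly p x * flat_exp k (poly q x)) = (\<lambda>x. poly p' x * flat_exp k' (poly q x))"
    by blast
next
  fix f assume "\<exists>p k. f = (\<lambda>x. poly p x * flat_exp k (poly q x))"
  then obtain p k where f: "f = (\<lambda>x. poly p x * flat_exp k (poly q x))" by blast
  \<comment> \<open>This is p' q^2 + p q' (1 - k q): the terms with indices \<open>k\<close> and
    \<open>k + 1\<close> are brought to index \<open>k + 2\<close> by the factors q^2 and q.\<close>
  define r where "r = pderiv p * q^2 + p * pderiv q * (1 - smult (real k) q)"
  have "(f has_real_derivative poly r x * flat_exp (k + 2) (poly q x)) (at x)" for x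
  proof -
    have e: "poly q x ^ 2 * flat_exp (k + 2) (poly q x) = flat_exp k (poly q x)"
            "poly q x * flat_exp (k + 2) (poly q x) = flat_exp (k + 1) (poly q x)"
      using flat_exp_shift[of "poly q x" 2 k] flat_exp_shift[of "poly q x" 1 "k+1"] by (simp_all add: add.commute)
    have "((\<lambda>x. poly p x * flat_exp k (poly q x)) has_real_derivative
        (poly (pderiv p) x * flat_exp k (poly q x) +
         (flat_exp (k + 2) (poly q x) - k * flat_exp (k + 1) (poly q x)) * poly (pderiv q) x * poly p x)) (at x)"
      by (rule DERIV_mult[OF poly_DERIV DERIV_chain2[OF flat_exp_has_derivative poly_DERIV]])
    also have "(poly (pderiv p) x * flat_exp k (poly q x) +
         (flat_exp (k + 2) (poly q x) - k * flat_exp (k + 1) (poly q x)) * poly (pderiv q) x * poly p x)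
        = poly r x * flat_exp (k + 2) (poly q x)"
      unfolding r_def e[symmetric] by (simp add: algebra_simps)
    finally show ?thesis by (simp add: f)
  qed
  then show "\<exists>f'. (\<exists>p k. f' = (\<lambda>x. poly p x * flat_exp k (poly q x))) \<and> (\<forall>x. (f has_real_derivative f' x) (at x))"
    by blast
qed

text \<open>The factor \<open>Suc m\<close> flattens the exponent, so the bumps increase with m to
  the indicator of the open interval; each is smooth because the parabola (x - a)(b - x) is positive
  exactly inside.\<close>

definition bump :: "real \<Rightarrow> real \<Rightarrow> nat \<Rightarrow> real \<Rightarrow> real" where
  "bump a b m x = (if a < x \<and> x < b then exp (- 1 / (real (Suc m) * (x - a) * (b - x))) else 0)"

lemma smooth1_bump:
  assumes "a < b" shows "smooth1 (bump a b m)"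
proof -
  define q where "q = smult (real (Suc m)) ([:-a, 1:] * [:b, -1:])"
  have "bump a b m = (\<lambda>x. poly 1 x * flat_exp 0 (poly q x))"
  proof
    fix x
    have "0 < (x - a) * (b - x) \<longleftrightarrow> a < x \<and> x < b"
      using assms by (auto simp: zero_less_mult_iff)
    moreover have "poly q x = real (Suc m) * ((x - a) * (b - x))"
      unfolding q_def by (simp add: algebra_simps)
    ultimately show "bump a b m x = poly 1 x * flat_exp 0 (poly q x)"
      by (simp add: bump_def flat_exp_def mult.assoc zero_less_mult_iff)
  qed
  then show ?thesis using smooth1_flat_exp_poly[of 1 0 q] by simp
qed

lemma bump_bounds: "0 \<le> bump a b m x" "bump a b m x \<le> 1"
proof -
  show "0 \<le> bump a b m x" by (simp add: bump_def)
  show "bump a b m x \<le> 1" by (auto simp: bump_def intro!: divide_nonneg_nonneg mult_nonneg_nonneg)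
qed

lemma bump_tendsto: "(\<lambda>m. bump a b m x) \<longlonglongrightarrow> indicator {a<..<b} x"
proof (cases "a < x \<and> x < b")
  case True
  define c where "c = (x - a) * (b - x)"
  have c: "c > 0" using True by (simp add: c_def)
  have "(\<lambda>m. - (1 / c) * (1 / real (Suc m))) \<longlonglongrightarrow> - (1 / c) * 0"
    by (intro tendsto_mult tendsto_const LIMSEQ_Suc[OF lim_1_over_n])
  then have "(\<lambda>m. exp (- (1 / c) * (1 / real (Suc m)))) \<longlonglongrightarrow> exp 0"
    by (intro tendsto_exp) simp
  then show ?thesis using True by (simp add: bump_def c_def mult.assoc mult.commute mult.left_commute)
next
  case False
  then have "bump a b m x = 0" for m by (auto simp: bump_def)
  then show ?thesis using False by (auto simp: indicator_def)
qed

section \<open>Partial derivatives of products of one-variable functions\<close>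

lemma has_derivative_pd:
  fixes f :: "real^'n \<Rightarrow> 'b::real_normed_vector"
  assumes "(f has_derivative f') (at x)"
  shows "has_partial f x i" "pd f x i = f' (axis i 1)"
proof -
  have 1: "((\<lambda>t::real. x + t *\<^sub>R axis i 1) has_derivative (\<lambda>t. t *\<^sub>R axis i 1)) (at 0)"
    by (auto intro!: derivative_eq_intros)
  have f: "(f has_derivative f') (at (x + 0 *\<^sub>R axis i 1))" using assms by simp
  have "((\<lambda>t. f (x + t *\<^sub>R axis i 1)) has_derivative (\<lambda>t. f' (t *\<^sub>R axis i 1))) (at 0)"
    using has_derivative_compose[OF 1 f] by simp
  moreover have "f' (t *\<^sub>R axis i 1) = t *\<^sub>R f' (axis i 1)" for t
    using assms by (simp add: has_derivative_def bounded_linear.linear linear_cmul)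
  ultimately have v: "((\<lambda>t. f (x + t *\<^sub>R axis i 1)) has_vector_derivative f' (axis i 1)) (at 0)"
    by (simp add: has_vector_derivative_def)
  then show "has_partial f x i" "pd f x i = f' (axis i 1)"
    by (auto simp: has_partial_def pd_def vector_derivative_at differentiable_def has_vector_derivative_def)
qed

lemma has_derivative_prod_components:
  fixes g g' :: "'n::finite \<Rightarrow> real \<Rightarrow> real" and x :: "real^'n"
  assumes "\<And>k. (g k has_real_derivative g' k (x$k)) (at (x$k))"
  shows "((\<lambda>x. \<Prod>k\<in>UNIV. g k (x$k)) has_derivative
      (\<lambda>h. \<Sum>i\<in>UNIV. h$i * (\<Prod>k\<in>UNIV. (if k = i then g' k else g k) (x$k)))) (at x)"
proof -
  have 1: "((\<lambda>x. g k (x$k)) has_derivative (\<lambda>h. h$k * g' k (x$k))) (at x)" for k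
  proof -
    have "((\<lambda>x. x$k) has_derivative (\<lambda>h. h$k)) (at x)"
      by (rule bounded_linear_imp_has_derivative[OF bounded_linear_vec_nth])
    from has_derivative_compose[OF this, of "g k" "(*) (g' k (x$k))"] assms[of k] show ?thesis
      by (simp add: has_field_derivative_def mult.commute)
  qed
  have "((\<lambda>x. \<Prod>k\<in>UNIV. g k (x$k)) has_derivative
     (\<lambda>h. \<Sum>i\<in>UNIV. (h$i * g' i (x$i)) * (\<Prod>j\<in>UNIV - {i}. g j (x$j)))) (at x)"
    by (rule has_derivative_prod) (rule 1)
  moreover have "(\<Prod>k\<in>UNIV. (if k = i then g' k else g k) (x$k)) = g' i (x$i) * (\<Prod>j\<in>UNIV - {i}. g j (x$j))" for i
    by (subst prod.remove[of UNIV i]) (auto intro!: prod.cong)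
  ultimately show ?thesis by (simp add: mult.assoc)
qed

text \<open>A partial derivative in coordinate i only raises the order of differentiation of the
  i-th factor, so an iterated one is determined by how often each coordinate occurs in the
  list.\<close>

lemma iter_pd_prod_components:
  fixes d :: "'n::finite \<Rightarrow> nat \<Rightarrow> real \<Rightarrow> real"
  assumes d: "\<And>i k x. (d i k has_real_derivative d i (Suc k) x) (at x)"
  shows "iter_pd is (\<lambda>x::real^'n. \<Prod>i\<in>UNIV. d i 0 (x$i)) = (\<lambda>x. \<Prod>i\<in>UNIV. d i (count_list is i) (x$i))"
proof (induction "is")
  case (Cons j "is")
  show ?case
  proof
    fix x :: "real^'n"
    have "((\<lambda>x. \<Prod>i\<in>UNIV. d i (count_list is i) (x$i)) has_derivative
      (\<lambda>h. \<Sum>i\<in>UNIV. h$i * (\<Prod>k\<in>UNIV. (if k = i then d k (Suc (count_list is k)) else d k (count_list is k)) (x$k)))) (at x)"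
      by (rule has_derivative_prod_components) (rule d)
    from has_derivative_pd(2)[OF this, where i=j]
    show "iter_pd (j # is) (\<lambda>x. \<Prod>i\<in>UNIV. d i 0 (x$i)) x = (\<Prod>i\<in>UNIV. d i (count_list (j # is) i) (x$i))"
      by (simp add: Cons axis_def if_distrib[where f="\<lambda>a. a * _"] cong: if_cong)
         (auto intro!: prod.cong)
  qed
qed simp

definition box_bump :: "real^'n \<Rightarrow> real^'n \<Rightarrow> nat \<Rightarrow> real^'n \<Rightarrow> real" where
  "box_bump a b m x = (\<Prod>k\<in>UNIV. bump (a$k) (b$k) m (x$k))"

lemma box_bump_outside: "x \<notin> box a b \<Longrightarrow> box_bump a b m x = 0"
  by (auto simp: box_bump_def mem_box_cart bump_def)

lemma box_bump_bounds: "0 \<le> box_bump a b m x" "box_bump a b m x \<le> 1"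
  by (auto simp: box_bump_def intro!: prod_nonneg prod_le_1 bump_bounds)

lemma box_bump_tendsto: "(\<lambda>m. box_bump a b m x) \<longlonglongrightarrow> indicator (box a b) x"
proof -
  have "(\<lambda>m. box_bump a b m x) \<longlonglongrightarrow> (\<Prod>k\<in>UNIV. indicator {a$k<..<b$k} (x$k))"
    unfolding box_bump_def by (intro tendsto_prod bump_tendsto)
  also have "(\<Prod>k\<in>UNIV. indicator {a$k<..<b$k} (x$k)) = (indicator (box a b) x :: real)"
    by (auto simp: indicator_def mem_box_cart)
  finally show ?thesis .
qed

lemma box_bump_shift: "box_bump (a + h) (b + h) m x = box_bump a b m (x - h)"
proof -
  have "bump (c + s) (d + s) m y = bump c d m (y - s)" for c d s y
  proof -
    have "y - (c + s) = y - s - c" "d + s - y = d - (y - s)" by simp_all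
    then show ?thesis by (simp only: bump_def less_diff_eq diff_less_eq)
  qed
  then show ?thesis by (simp add: box_bump_def)
qed

lemma box_bump_smooth:
  fixes a b :: "real^'n"
  assumes "box a b \<noteq> {}"
  shows "smooth_fun (box_bump a b m)"
    and "(box_bump a b m has_derivative (\<lambda>h. \<Sum>i\<in>UNIV. h$i * pd (box_bump a b m) x i)) (at x)"
proof -
  have ab: "a$k < b$k" for k   proof -
    obtain z where "z \<in> box a b" using assms by blast
    then show ?thesis using less_trans by (auto simp: mem_box_cart)
  qed
  have "\<forall>k. \<exists>d::nat \<Rightarrow> real \<Rightarrow> real. d 0 = bump (a$k) (b$k) m \<and> (\<forall>l x. (d l has_real_derivative d (Suc l) x) (at x))"
    using smooth1_bump[OF ab] by (auto simp: smooth1_def)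
  then obtain d where d0: "\<And>k. d k (0::nat) = bump (a$k) (b$k) m"
    and d: "\<And>k l x. (d k l has_real_derivative d k (Suc l) x) (at x)" by metis
  have eq: "box_bump a b m = (\<lambda>x. \<Prod>k\<in>UNIV. d k 0 (x$k))"
    by (auto simp: box_bump_def d0)
  have der: "((\<lambda>x. \<Prod>k\<in>UNIV. d k (c k) (x$k)) has_derivative
      (\<lambda>h. \<Sum>i\<in>UNIV. h$i * (\<Prod>k\<in>UNIV. (if k = i then d k (Suc (c k)) else d k (c k)) (x$k)))) (at x)" for c x
    by (rule has_derivative_prod_components) (rule d)
  show "smooth_fun (box_bump a b m)"
    unfolding smooth_fun_def eq iter_pd_prod_components[where d=d, OF d]
    by (auto intro!: has_derivative_continuous[OF der] has_derivative_pd(1)[OF der]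
        simp: continuous_on_eq_continuous_at)
  have "pd (box_bump a b m) x i = (\<Prod>k\<in>UNIV. (if k = i then d k (Suc 0) else d k 0) (x$k))" for i
    unfolding eq using has_derivative_pd(2)[OF der[of "\<lambda>_. 0"], where i=i]
    by (simp add: axis_def if_distrib[where f="\<lambda>a. a * _"] cong: if_cong)
  then show "(box_bump a b m has_derivative (\<lambda>h. \<Sum>i\<in>UNIV. h$i * pd (box_bump a b m) x i)) (at x)"
    using der[of "\<lambda>_. 0" x] by (simp add: eq[symmetric])
qed

lemma box_bump_support: "closure {x. box_bump a b m x \<noteq> 0} \<subseteq> cbox a b"
  using box_bump_outside[of _ a b m] by (intro closure_minimal) (auto intro: subsetD[OF box_subset_cbox])

lemma test_fun_box_bump:
  assumes "box a b \<noteq> {}" "cbox a b \<subseteq> U"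
  shows "test_fun U (box_bump a b m)"
  unfolding test_fun_def
proof (intro conjI box_bump_smooth(1)[OF assms(1)])
  show "compact (closure {x. box_bump a b m x \<noteq> 0})"
    using box_bump_support[of a b m] compact_cbox[of a b]
    by (metis bounded_cbox bounded_subset closed_closure compact_eq_bounded_closed)
qed (use box_bump_support[of a b m] assms(2) in auto)

lemma test_fun_pd:
  assumes "test_fun U \<phi>"
  shows "continuous_on UNIV \<phi>" "continuous_on UNIV (\<lambda>x. pd \<phi> x i)" "has_partial \<phi> x i"
    "x \<notin> closure {x. \<phi> x \<noteq> 0} \<Longrightarrow> pd \<phi> x i = 0"
proof -
  have s: "continuous_on UNIV (iter_pd is \<phi>)" "has_partial (iter_pd is \<phi>) x i" for "is" x i
    using assms by (auto simp: test_fun_def smooth_fun_def)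
  show "continuous_on UNIV \<phi>" "continuous_on UNIV (\<lambda>x. pd \<phi> x i)" "has_partial \<phi> x i"
    using s(1)[of "[]"] s(1)[of "[i]"] s(2)[of "[]"] by auto
  assume x: "x \<notin> closure {x. \<phi> x \<noteq> 0}"
  have "(\<phi> has_derivative (\<lambda>_. 0)) (at x)"
    by (rule has_derivative_transform_within_open[where f="\<lambda>_. 0" and s="- closure {x. \<phi> x \<noteq> 0}"])
       (use x closure_subset[of "{x. \<phi> x \<noteq> 0}"] in \<open>auto simp: open_Compl\<close>)
  from has_derivative_pd(2)[OF this] show "pd \<phi> x i = 0" .
qed

section \<open>Weak derivatives along lines\<close>

lemma norm_scaleR_le: "\<bar>s\<bar> \<le> 1 \<Longrightarrow> norm (s *\<^sub>R y) \<le> norm y"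
  by (simp add: mult_left_le_one_le)

lemma abs_box_bump_le: "\<bar>box_bump a b m x\<bar> \<le> 1"
  using box_bump_bounds[of a b m x] by simp

text \<open>A Dynkin argument: boxes form an intersection-stable generator of the Borel sets. The
  complement step uses that the integral over the whole space vanishes, which follows by exhausting
  it with cubes. Vanishing over all Borel sets then forces the function to be zero almost
  everywhere.\<close>

lemma AE_zero_if_box_integrals_zero:
  fixes w :: "'a::euclidean_space \<Rightarrow> 'b::{banach,second_countable_topology}"
  assumes w: "integrable lborel w" and z: "\<And>a b. (LINT x:box a b|lborel. w x) = 0"
  shows "AE x in lborel. w x = 0"
proof -
  have tot: "(LINT x|lborel. w x) = 0"
  proof -
    have "(\<lambda>n. LINT x:box (- real n *\<^sub>R One) (real n *\<^sub>R One)|lborel. w x) \<longlonglongrightarrow> (LINT x|lborel. w x)"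
      unfolding set_lebesgue_integral_def
    proof (rule integral_dominated_convergence[where w="\<lambda>x. norm (w x)"])
      show "AE x in lborel. (\<lambda>n. indicator (box (- real n *\<^sub>R One) (real n *\<^sub>R One)) x *\<^sub>R w x) \<longlonglongrightarrow> w x"
      proof (rule AE_I2)
        fix x :: 'a
        obtain N :: nat where N: "norm x < real N" using reals_Archimedean2 by blast
        have "\<forall>n\<ge>N. x \<in> box (- real n *\<^sub>R One) (real n *\<^sub>R One)"
          using N Basis_le_norm[of _ x] by (fastforce simp: mem_box abs_le_iff)
        then have "\<forall>\<^sub>F n in sequentially. indicator (box (- real n *\<^sub>R One) (real n *\<^sub>R One)) x *\<^sub>R w x = w x"
          by (auto simp: eventually_sequentially intro!: exI[of _ N])
        then show "(\<lambda>n. indicator (box (- real n *\<^sub>R One) (real n *\<^sub>R One)) x *\<^sub>R w x) \<longlonglongrightarrow> w x"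
          by (rule tendsto_eventually)
      qed
    qed (use w in \<open>auto simp: indicator_def\<close>)
    then show ?thesis using z by (simp add: LIMSEQ_const_iff)
  qed
  have "(LINT x:A|lborel. w x) = 0" if "A \<in> sets borel" for A
  proof -
    have A: "A \<in> sigma_sets UNIV (range (\<lambda>(a, b). box a b :: 'a set))"
      using that by (simp add: borel_eq_box)
    have st: "Int_stable (range (\<lambda>(a, b). box a b :: 'a set))"
      by (auto simp: Int_stable_def box_Int_box)
    have meas: "B \<in> sets borel" if "B \<in> sigma_sets UNIV (range (\<lambda>(a, b). box a b :: 'a set))" for B
      using that by (simp add: borel_eq_box)
    have ind: "set_integrable lborel B w" if "B \<in> sets borel" for B
      unfolding set_integrable_def using w that by (intro integrable_mult_indicator) auto
    have st2: "range (\<lambda>(a, b). box a b :: 'a set) \<subseteq> Pow UNIV" by simp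
    show ?thesis using st st2 A
    proof (induction rule: sigma_sets_induct_disjoint)
      case (compl A)
      have "(LINT x:A \<union> (UNIV - A)|lborel. w x) = (LINT x:A|lborel. w x) + (LINT x:UNIV - A|lborel. w x)"
        by (rule set_integral_Un) (use meas[OF compl(1)] in \<open>auto intro!: ind\<close>)
      then show ?case using compl tot by (simp add: set_lebesgue_integral_def)
    next
      case (union A)
      have "(LINT x:(\<Union>i. A i)|lborel. w x) = (\<Sum>i. LINT x:A i|lborel. w x)"
        by (rule lebesgue_integral_countable_add)
           (use union(1) meas[OF subsetD[OF union(2)]] in \<open>auto intro!: ind simp: disjoint_family_on_def\<close>)
      then show ?case using union by simp
      qed (use z in \<open>auto simp: set_lebesgue_integral_def\<close>)
  qed
  then show ?thesis
    using sigma_finite_measure.density_zero[OF sigma_finite_lborel w] by auto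
qed

section \<open>Translation invariance and integration along segments\<close>

lemma lborel_integral_translate:
  fixes g :: "'a::euclidean_space \<Rightarrow> 'b::{banach,second_countable_topology}"
  shows "(LINT x|lborel. g (x + c)) = (LINT x|lborel. g x)"
proof -
  have 0: "integral\<^sup>L (distr lborel borel ((+) c)) g = (LINT x|lborel. g (c + x))" if "g \<in> borel_measurable borel"
    using that by (intro integral_distr) auto
  have 1: "g \<in> borel_measurable borel" if "(\<lambda>x. g (x + c)) \<in> borel_measurable borel"
  proof -
    have "(\<lambda>x. g ((x - c) + c)) \<in> borel_measurable borel" using that by measurable
    then show ?thesis by simp
  qed
  show ?thesis
  proof (cases "g \<in> borel_measurable borel")
    case True
    then show ?thesis using 0 by (simp add: lborel_distr_plus add.commute)
  next
    case False
    \<comment> \<open>Neither g nor its translate is integrable here, and both integrals are 0 by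
      convention.\<close>
    have "\<not> integrable lborel g"
      using False by (intro notI) (drule borel_measurable_integrable, simp)
    moreover have "\<not> integrable lborel (\<lambda>x. g (x + c))"
    proof
      assume "integrable lborel (\<lambda>x. g (x + c))"
      from borel_measurable_integrable[OF this] have "(\<lambda>x. g (x + c)) \<in> borel_measurable borel" by simp
      with 1 False show False by blast
    qed
    ultimately
    show ?thesis by (simp add: not_integrable_integral_eq)
  qed
qed

lemma lborel_integrable_translate:
  fixes g :: "'a::euclidean_space \<Rightarrow> 'b::{banach,second_countable_topology}"
  assumes "integrable lborel g" shows "integrable lborel (\<lambda>x. g (x + c))"
proof -
  have "integrable (distr lborel borel ((+) c)) g"
    using assms by (simp add: lborel_distr_plus)
  then have "integrable lborel (\<lambda>x. g (c + x))"
    by (subst (asm) integrable_distr_eq) (use assms in auto)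
  then show ?thesis by (simp add: add.commute)
qed

lemma nn_integral_lborel_translate:
  fixes g :: "'a::euclidean_space \<Rightarrow> ennreal"
  assumes [measurable]: "g \<in> borel_measurable borel"
  shows "(\<integral>\<^sup>+x. g (x + c) \<partial>lborel) = (\<integral>\<^sup>+x. g x \<partial>lborel)"
proof -
  have "(\<integral>\<^sup>+x. g x \<partial>distr lborel borel ((+) c)) = (\<integral>\<^sup>+x. g (c + x) \<partial>lborel)"
    by (intro nn_integral_distr) auto
  then show ?thesis by (simp add: lborel_distr_plus add.commute)
qed

text \<open>By Tonelli and translation invariance the double integral of the norm is that of g
  alone. The joint integrability licenses exchanging integration over points x with integration
  along the segments from x to x + h.\<close>

lemma integrable_pair_translate:
  fixes g :: "'a::euclidean_space \<Rightarrow> 'b::euclidean_space"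
  assumes g: "integrable lborel g"
  shows "integrable (lborel \<Otimes>\<^sub>M lborel) (\<lambda>(x, s::real). indicator {0..1} s *\<^sub>R g (x + s *\<^sub>R h))"
proof -
  have [measurable]: "g \<in> borel_measurable borel" using g by simp
  have fin: "(\<integral>\<^sup>+x. norm (g x) \<partial>lborel) < \<infinity>" using g by (simp add: integrable_iff_bounded)
  have m: "(\<lambda>(x, s::real). indicator {0..1} s *\<^sub>R g (x + s *\<^sub>R h)) \<in> borel_measurable (lborel \<Otimes>\<^sub>M lborel)"
    by measurable
  have "(\<integral>\<^sup>+z. norm ((\<lambda>(x, s). indicator {0..1} s *\<^sub>R g (x + s *\<^sub>R h)) z) \<partial>(lborel \<Otimes>\<^sub>M lborel))
     = (\<integral>\<^sup>+s. \<integral>\<^sup>+x. ennreal (norm (indicator {0..1} s *\<^sub>R g (x + s *\<^sub>R h))) \<partial>lborel \<partial>lborel)"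
    by (subst lborel_pair.nn_integral_snd[symmetric]) auto
  also have "\<dots> = (\<integral>\<^sup>+s. indicator {0..1::real} s * (\<integral>\<^sup>+x. norm (g (x + s *\<^sub>R h)) \<partial>lborel) \<partial>lborel)"
    by (intro nn_integral_cong) (auto simp: indicator_def)
  also have "\<dots> = (\<integral>\<^sup>+s. indicator {0..1::real} s * (\<integral>\<^sup>+x. norm (g x) \<partial>lborel) \<partial>lborel)"
    by (subst nn_integral_lborel_translate[where g="\<lambda>x. norm (g x)"]) auto
  also have "\<dots> < \<infinity>"
    using fin by (subst nn_integral_multc) auto
  finally show ?thesis
    using m by (intro integrableI_bounded) auto
qed

lemma integrable_box_bump:
  fixes g :: "real^'n \<Rightarrow> 'b::euclidean_space"
  assumes ne: "box a b \<noteq> {}" and g: "integrable lborel g"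
  shows "integrable lborel (\<lambda>x. box_bump a b m x *\<^sub>R g x)"
proof (rule Bochner_Integration.integrable_bound[OF g])
  show "(\<lambda>x. box_bump a b m x *\<^sub>R g x) \<in> borel_measurable lborel"
    using test_fun_pd(1)[OF test_fun_box_bump[OF ne, of UNIV]] g
    by (intro borel_measurable_scaleR) (auto intro!: borel_measurable_continuous_onI)
  show "AE x in lborel. norm (box_bump a b m x *\<^sub>R g x) \<le> norm (g x)"
    by (intro AE_I2 norm_scaleR_le abs_box_bump_le)
qed

text \<open>The bumps of a box converge to its indicator, which reduces the claim to integrals over
  boxes; on a box with closure in V these determine z. Countably many closed boxes cover V, and
  their frontiers are null.\<close>

lemma AE_zero_if_box_bump_integrals_zero:
  fixes z :: "real^'n \<Rightarrow> 'b::euclidean_space"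
  assumes V: "open V" and intz: "integrable lborel z"
    and z0: "\<And>a b m. box a b \<noteq> {} \<Longrightarrow> cbox a b \<subseteq> V \<Longrightarrow> (LINT x|lborel. box_bump a b m x *\<^sub>R z x) = 0"
  shows "AE x in lborel. x \<in> V \<longrightarrow> z x = 0"
proof -
  have boxes: "(LINT x:box a b|lborel. z x) = 0" if "cbox a b \<subseteq> V" for a b
  proof (cases "box a b = {}")
    case False
    have ib: "integrable lborel (\<lambda>x. box_bump a b m x *\<^sub>R z x)" for m
      by (rule integrable_box_bump[OF False intz])
    have zero: "(LINT x|lborel. box_bump a b m x *\<^sub>R z x) = 0" for m by (rule z0[OF False that])
    have "(\<lambda>m. LINT x|lborel. box_bump a b m x *\<^sub>R z x) \<longlonglongrightarrow> (LINT x|lborel. indicator (box a b) x *\<^sub>R z x)"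
    proof (rule integral_dominated_convergence[where w="\<lambda>x. norm (z x)"])
      show "AE x in lborel. (\<lambda>m. box_bump a b m x *\<^sub>R z x) \<longlonglongrightarrow> indicator (box a b) x *\<^sub>R z x"
        by (intro AE_I2 tendsto_scaleR box_bump_tendsto tendsto_const)
      show "\<And>m. AE x in lborel. norm (box_bump a b m x *\<^sub>R z x) \<le> norm (z x)"
        by (intro AE_I2 norm_scaleR_le abs_box_bump_le)
      show "\<And>m. (\<lambda>x. box_bump a b m x *\<^sub>R z x) \<in> borel_measurable lborel"
        using borel_measurable_integrable[OF ib] by simp
    qed (use intz in \<open>auto intro!: borel_measurable_scaleR\<close>)
    then show ?thesis using zero by (simp add: LIMSEQ_const_iff set_lebesgue_integral_def)
  qed (simp add: set_lebesgue_integral_def)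
  have AEcbox: "AE x in lborel. x \<in> box a b \<longrightarrow> z x = 0" if ab: "cbox a b \<subseteq> V" for a b
  proof -
    have "AE x in lborel. indicator (box a b) x *\<^sub>R z x = 0"
    proof (rule AE_zero_if_box_integrals_zero)
      show "integrable lborel (\<lambda>x. indicator (box a b) x *\<^sub>R z x)"
        using intz by (intro integrable_mult_indicator) auto
      fix c d
      \<comment> \<open>Intersections of boxes are boxes, so an integral of the truncated function
        over any box is one over a box that is empty or has its closure inside V.\<close>
      obtain e f where ef: "box a b \<inter> box c d = box e f" by (rule that, rule box_Int_box)
      have "box e f \<subseteq> box a b" using ef by auto
      then have "box e f = {} \<or> cbox e f \<subseteq> cbox a b"
        by (metis closure_box closure_mono box_subset_cbox closed_cbox closure_minimal subset_trans)
      then have "(LINT x:box e f|lborel. z x) = 0"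
        using boxes ab by (auto simp: set_lebesgue_integral_def)
      then show "(LINT x:box c d|lborel. indicator (box a b) x *\<^sub>R z x) = 0"
        by (simp add: set_lebesgue_integral_def ef[symmetric] indicator_inter_arith mult.commute)
    qed
    then show ?thesis by eventually_elim (auto simp: indicator_def)
  qed
  obtain \<D> where \<D>: "countable \<D>" "\<D> \<subseteq> Pow V" "\<And>X. X \<in> \<D> \<Longrightarrow> \<exists>a b. X = cbox a b" "\<Union>\<D> = V"
    using open_countable_Union_open_cbox[OF V] by metis
  have "AE x in lborel. x \<in> X \<longrightarrow> z x = 0" if X: "X \<in> \<D>" for X
  proof -
    obtain a b where ab: "X = cbox a b" using \<D>(3)[OF X] by blast
    have "AE x in lborel. x \<notin> cbox a b - box a b"
      using negligible_frontier_interval[of a b] unfolding negligible_iff_null_sets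
      by (intro AE_not_in) (subst (asm) null_sets_completion_iff, auto)
    moreover have "AE x in lborel. x \<in> box a b \<longrightarrow> z x = 0"
      by (rule AEcbox) (use \<D>(2) X ab in auto)
    ultimately show ?thesis unfolding ab by eventually_elim auto
  qed
  then have "AE x in lborel. \<forall>X\<in>\<D>. x \<in> X \<longrightarrow> z x = 0"
    by (subst AE_ball_countable[OF \<D>(1)]) blast
  then show ?thesis by eventually_elim (use \<D>(4) in auto)
qed

text \<open>\<open>w\<close> stands for the weak gradient cut off by the indicator of \<open>K\<close>; testing against product bumps
  is enough to determine it, since translates of product bumps are again product bumps.\<close>

locale w11_local =
  fixes u :: "real^'n \<Rightarrow> 'b::euclidean_space" and w :: "'n \<Rightarrow> real^'n \<Rightarrow> 'b" and K :: "(real^'n) set"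
  assumes compactK: "compact K" and contu: "continuous_on K u" and intw: "\<And>i. integrable lborel (w i)"
    and weak: "\<And>a b m i. box a b \<noteq> {} \<Longrightarrow> cbox a b \<subseteq> K \<Longrightarrow>
      (LINT x|lborel. pd (box_bump a b m) x i *\<^sub>R (indicator K x *\<^sub>R u x)) = - (LINT x|lborel. box_bump a b m x *\<^sub>R w i x)"
begin

text \<open>Extension of \<open>u\<close> by 0, so that translates are defined on the whole space;
  \<open>W h\<close> below plays the role of the weak derivative in direction
  \<open>h\<close>.\<close>

definition U where "U x = indicator K x *\<^sub>R u x"
definition W where "W h x = (\<Sum>i\<in>UNIV. h$i *\<^sub>R w i x)" for h :: "real^'n"

lemma integrable_U: "integrable lborel U"
  using borel_integrable_compact[OF compactK contu] by (simp add: U_def[abs_def])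

lemma integrable_W: "integrable lborel (W h)"
  unfolding W_def by (auto intro!: intw)

text \<open>Translation moves the difference from U to the bump. The fundamental theorem of calculus
  writes the difference of bumps as an average of directional derivatives over the segment. Each of
  these, paired with U, is an instance of the weak derivative tested with a translated bump;
  translating back gives averages of \<open>W h\<close>.\<close>

lemma box_bump_line:
  assumes ne: "box a b \<noteq> {}" and sub: "\<And>x s. x \<in> cbox a b \<Longrightarrow> 0 \<le> s \<Longrightarrow> s \<le> 1 \<Longrightarrow> x + s *\<^sub>R h \<in> K"
  shows "(LINT x|lborel. box_bump a b m x *\<^sub>R (U (x + h) - U x)) =
         (LINT x|lborel. box_bump a b m x *\<^sub>R (LINT s|lborel. indicator {0..1} s *\<^sub>R W h (x + s *\<^sub>R h)))"
proof -
  define \<phi> where "\<phi> = box_bump a b m"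
  define \<psi> where "\<psi> y = (\<Sum>i\<in>UNIV. h$i * pd \<phi> y i)" for y
  have tf: "test_fun UNIV \<phi>" unfolding \<phi>_def by (rule test_fun_box_bump[OF ne]) simp
  have c\<phi>: "continuous_on UNIV \<phi>" and c\<psi>: "continuous_on UNIV \<psi>"
    using test_fun_pd[OF tf] by (auto simp: \<psi>_def intro!: continuous_intros)
  have [measurable]: "\<phi> \<in> borel_measurable borel" "\<psi> \<in> borel_measurable borel"
    using c\<phi> c\<psi> by (auto intro: borel_measurable_continuous_onI)
  have [measurable]: "U \<in> borel_measurable borel" "\<And>h. W h \<in> borel_measurable borel" "\<And>i. w i \<in> borel_measurable borel"
    using integrable_U integrable_W intw by (auto dest: borel_measurable_integrable)
  have b\<phi>: "norm (\<phi> y) \<le> 1" for y using box_bump_bounds[of a b m y] by (simp add: \<phi>_def)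
  obtain C where C: "C \<ge> 0" "\<And>y. norm (\<psi> y) \<le> C"
  proof -
    have "bounded (\<psi> ` cbox a b)"
      by (intro compact_imp_bounded compact_continuous_image compact_cbox continuous_on_subset[OF c\<psi>]) auto
    then obtain C where C: "\<And>y. y \<in> cbox a b \<Longrightarrow> norm (\<psi> y) \<le> C" by (auto simp: bounded_iff)
    have "pd \<phi> y i = 0" if "y \<notin> cbox a b" for y i
      using test_fun_pd(4)[OF tf] that box_bump_support[of a b m] by (auto simp: \<phi>_def)
    then have "norm (\<psi> y) \<le> max C 0" for y
      using C by (cases "y \<in> cbox a b") (force simp: \<psi>_def)+
    then show thesis using that[of "max C 0"] by auto
  qed
  have line: "\<phi> (y - h) - \<phi> y = - (LINT s|lborel. indicator {0..1} s *\<^sub>R \<psi> (y - s *\<^sub>R h))" for y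
  proof -
    have 1: "((\<lambda>s. \<phi> (y - s *\<^sub>R h)) has_vector_derivative - \<psi> (y - s *\<^sub>R h)) (at s within {0..1})" for s :: real
    proof -
      have d: "((\<lambda>s. y - s *\<^sub>R h) has_derivative (\<lambda>t. - (t *\<^sub>R h))) (at s within {0..1})"
        by (auto intro!: derivative_eq_intros)
      have "((\<lambda>s. \<phi> (y - s *\<^sub>R h)) has_derivative (\<lambda>t. \<Sum>i\<in>UNIV. (- (t *\<^sub>R h))$i * pd \<phi> (y - s *\<^sub>R h) i)) (at s within {0..1})"
        using has_derivative_compose[OF d box_bump_smooth(2)[OF ne]] by (simp add: \<phi>_def)
      moreover have "(\<Sum>i\<in>UNIV. (- (t *\<^sub>R h))$i * pd \<phi> (y - s *\<^sub>R h) i) = t *\<^sub>R - \<psi> (y - s *\<^sub>R h)" for t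
        by (simp add: \<psi>_def sum_distrib_left sum_negf algebra_simps)
      ultimately show ?thesis by (simp add: has_vector_derivative_def)
    qed
    have "(LINT s|lborel. indicator {0..1} s *\<^sub>R (- \<psi> (y - s *\<^sub>R h))) = \<phi> (y - 1 *\<^sub>R h) - \<phi> (y - 0 *\<^sub>R h)"
      by (rule integral_FTC_Icc[OF _ 1])
         (auto intro!: continuous_intros continuous_on_compose2[OF c\<psi>])
    then show ?thesis by simp
  qed
  have i\<phi>U: "integrable lborel (\<lambda>x. g x *\<^sub>R G x)"
    if "integrable lborel G" "g \<in> borel_measurable borel" "\<And>y. norm (g y) \<le> B" for g and G :: "real^'n \<Rightarrow> 'b" and B
  proof (rule Bochner_Integration.integrable_bound[where f="\<lambda>x. B *\<^sub>R G x"])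
    show "AE x in lborel. norm (g x *\<^sub>R G x) \<le> norm (B *\<^sub>R G x)"
    proof (intro AE_I2)
      fix x
      have "\<bar>g x\<bar> * norm (G x) \<le> \<bar>B\<bar> * norm (G x)"
        by (rule mult_right_mono) (use that(3)[of x] in auto)
      then show "norm (g x *\<^sub>R G x) \<le> norm (B *\<^sub>R G x)" by simp
    qed
  qed (use that in auto)
  have s1: "(LINT x|lborel. \<phi> x *\<^sub>R (U (x + h) - U x)) = (LINT y|lborel. (\<phi> (y - h) - \<phi> y) *\<^sub>R U y)"
  proof -
    have "(LINT x|lborel. \<phi> x *\<^sub>R U (x + h)) = (LINT y|lborel. \<phi> (y - h) *\<^sub>R U y)"
      using lborel_integral_translate[of "\<lambda>y. \<phi> (y - h) *\<^sub>R U y" h] by simp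
    moreover have "integrable lborel (\<lambda>x. \<phi> x *\<^sub>R U (x + h))" "integrable lborel (\<lambda>x. \<phi> x *\<^sub>R U x)"
      "integrable lborel (\<lambda>x. \<phi> (x - h) *\<^sub>R U x)"
      by (rule i\<phi>U[where B=1]; simp add: integrable_U lborel_integrable_translate b\<phi>[simplified])+
    ultimately show ?thesis
      by (simp add: scaleR_diff_right scaleR_diff_left)
  qed
  have pair1: "integrable (lborel \<Otimes>\<^sub>M lborel) (\<lambda>(y, s). indicator {0..1::real} s *\<^sub>R (\<psi> (y - s *\<^sub>R h) *\<^sub>R U y))"
  proof (rule Bochner_Integration.integrable_bound)
    show "integrable (lborel \<Otimes>\<^sub>M lborel) (\<lambda>(y, s::real). indicator {0..1} s *\<^sub>R (C *\<^sub>R U (y + s *\<^sub>R 0)))"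
      by (rule integrable_pair_translate) (simp add: integrable_U)
    show "AE z in lborel \<Otimes>\<^sub>M lborel. norm ((\<lambda>(y, s). indicator {0..1::real} s *\<^sub>R (\<psi> (y - s *\<^sub>R h) *\<^sub>R U y)) z)
       \<le> norm ((\<lambda>(y, s). indicator {0..1} s *\<^sub>R (C *\<^sub>R U (y + s *\<^sub>R 0))) z)"
      using C by (auto simp: split_beta indicator_def intro!: mult_right_mono)
  qed measurable
  have pair2: "integrable (lborel \<Otimes>\<^sub>M lborel) (\<lambda>(x, s). indicator {0..1::real} s *\<^sub>R (\<phi> x *\<^sub>R W h (x + s *\<^sub>R h)))"
  proof (rule Bochner_Integration.integrable_bound)
    show "integrable (lborel \<Otimes>\<^sub>M lborel) (\<lambda>(y, s::real). indicator {0..1} s *\<^sub>R W h (y + s *\<^sub>R h))"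
      by (rule integrable_pair_translate) (simp add: integrable_W)
    show "AE z in lborel \<Otimes>\<^sub>M lborel. norm ((\<lambda>(x, s). indicator {0..1::real} s *\<^sub>R (\<phi> x *\<^sub>R W h (x + s *\<^sub>R h))) z)
       \<le> norm ((\<lambda>(y, s). indicator {0..1} s *\<^sub>R W h (y + s *\<^sub>R h)) z)"
      using b\<phi> by (auto simp: split_beta indicator_def intro!: mult_left_le_one_le)
  qed measurable
  \<comment> \<open>The translated bump is again a product bump, and its closed box stays inside
    \<open>K\<close> because all segments starting in the original box do.\<close>
  have inner: "(LINT y|lborel. \<psi> (y - s *\<^sub>R h) *\<^sub>R U y) = - (LINT x|lborel. \<phi> x *\<^sub>R W h (x + s *\<^sub>R h))"
    if s: "0 \<le> s" "s \<le> 1" for s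
  proof -
    define \<phi>s where "\<phi>s = box_bump (a + s *\<^sub>R h) (b + s *\<^sub>R h) m"
    have \<phi>s: "\<phi>s y = \<phi> (y - s *\<^sub>R h)" for y by (simp add: \<phi>s_def \<phi>_def box_bump_shift)
    have pds: "pd \<phi>s y i = pd \<phi> (y - s *\<^sub>R h) i" for y i
      by (simp add: pd_def \<phi>s algebra_simps)
    have nes: "box (a + s *\<^sub>R h) (b + s *\<^sub>R h) \<noteq> {}"
    proof -
      obtain z where "z \<in> box a b" using ne by blast
      then have "z + s *\<^sub>R h \<in> box (a + s *\<^sub>R h) (b + s *\<^sub>R h)" by (simp add: mem_box_cart)
      then show ?thesis by blast
    qed
    have subs: "cbox (a + s *\<^sub>R h) (b + s *\<^sub>R h) \<subseteq> K"
    proof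
      fix z assume "z \<in> cbox (a + s *\<^sub>R h) (b + s *\<^sub>R h)"
      then have "z - s *\<^sub>R h \<in> cbox a b" by (simp add: mem_box_cart diff_le_eq le_diff_eq)
      from sub[OF this s] show "z \<in> K" by simp
    qed
    have tfs: "test_fun UNIV \<phi>s" unfolding \<phi>s_def by (rule test_fun_box_bump[OF nes]) simp
    have ipd: "integrable lborel (\<lambda>y. pd \<phi>s y i *\<^sub>R U y)" for i
    proof -
      have cont: "continuous_on UNIV (\<lambda>y. pd \<phi>s y i)" by (rule test_fun_pd(2)[OF tfs])
      have "continuous_on K (\<lambda>y. pd \<phi>s y i *\<^sub>R u y)"
        by (intro continuous_intros contu continuous_on_subset[OF cont]) auto
      from borel_integrable_compact[OF compactK this] show ?thesis
        by (simp add: U_def mult.commute)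
    qed
    have "(LINT y|lborel. \<psi> (y - s *\<^sub>R h) *\<^sub>R U y) = (LINT y|lborel. (\<Sum>i\<in>UNIV. h$i *\<^sub>R (pd \<phi>s y i *\<^sub>R U y)))"
      by (simp add: \<psi>_def pds scaleR_sum_left)
    also have "\<dots> = (\<Sum>i\<in>UNIV. h$i *\<^sub>R (LINT y|lborel. pd \<phi>s y i *\<^sub>R U y))"
      using ipd by (simp del: scaleR_scaleR)
    also have "\<dots> = (\<Sum>i\<in>UNIV. h$i *\<^sub>R - (LINT y|lborel. \<phi>s y *\<^sub>R w i y))"
      using weak[OF nes subs] by (simp add: \<phi>s_def U_def)
    also have "\<dots> = - (LINT y|lborel. (\<Sum>i\<in>UNIV. h$i *\<^sub>R (\<phi>s y *\<^sub>R w i y)))"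
    proof -
      have [measurable]: "\<phi>s \<in> borel_measurable borel"
        using test_fun_pd(1)[OF tfs] by (rule borel_measurable_continuous_onI)
      have "integrable lborel (\<lambda>y. \<phi>s y *\<^sub>R w i y)" for i
        by (rule i\<phi>U[where B=1]) (auto simp: intw \<phi>s b\<phi>[simplified])
      then show ?thesis by (simp add: sum_negf del: scaleR_scaleR)
    qed
    also have "\<dots> = - (LINT y|lborel. \<phi> (y - s *\<^sub>R h) *\<^sub>R W h y)"
      by (simp add: W_def \<phi>s scaleR_sum_right mult.commute)
    also have "(LINT y|lborel. \<phi> (y - s *\<^sub>R h) *\<^sub>R W h y) = (LINT x|lborel. \<phi> x *\<^sub>R W h (x + s *\<^sub>R h))"
      using lborel_integral_translate[of "\<lambda>y. \<phi> (y - s *\<^sub>R h) *\<^sub>R W h y" "s *\<^sub>R h"] by simp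
    finally show ?thesis .
  qed
  have "(LINT y|lborel. (\<phi> (y - h) - \<phi> y) *\<^sub>R U y) =
      - (LINT y|lborel. LINT s|lborel. indicator {0..1} s *\<^sub>R (\<psi> (y - s *\<^sub>R h) *\<^sub>R U y))"
  proof -
    have "(\<phi> (y - h) - \<phi> y) *\<^sub>R U y = - (LINT s|lborel. indicator {0..1} s *\<^sub>R (\<psi> (y - s *\<^sub>R h) *\<^sub>R U y))" for y
    proof -
      have "integrable lborel (\<lambda>s. indicator {0..1} s *\<^sub>R \<psi> (y - s *\<^sub>R h))"
        by (intro borel_integrable_compact continuous_on_compose2[OF c\<psi>] continuous_intros) auto
      then have "(LINT s|lborel. (indicator {0..1} s *\<^sub>R \<psi> (y - s *\<^sub>R h)) *\<^sub>R U y) =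
          (LINT s|lborel. indicator {0..1} s *\<^sub>R \<psi> (y - s *\<^sub>R h)) *\<^sub>R U y"
        by (intro integral_scaleR_left)
      then show ?thesis unfolding line by simp
    qed
    then show ?thesis by simp
  qed
  also have "\<dots> = - (LINT s|lborel. LINT y|lborel. indicator {0..1} s *\<^sub>R (\<psi> (y - s *\<^sub>R h) *\<^sub>R U y))"
    by (subst lborel_pair.Fubini_integral[OF pair1]) simp
  also have "\<dots> = (LINT s|lborel. LINT x|lborel. indicator {0..1} s *\<^sub>R (\<phi> x *\<^sub>R W h (x + s *\<^sub>R h)))"
  proof -
    have "- (LINT y|lborel. indicator {0..1} s *\<^sub>R (\<psi> (y - s *\<^sub>R h) *\<^sub>R U y)) =
        (LINT x|lborel. indicator {0..1} s *\<^sub>R (\<phi> x *\<^sub>R W h (x + s *\<^sub>R h)))" for s :: real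
      using inner[of s] by (cases "s \<in> {0..1}") (auto simp: indicator_def)
    then show ?thesis by (simp only: integral_minus[symmetric])
  qed
  also have "\<dots> = (LINT x|lborel. LINT s|lborel. indicator {0..1} s *\<^sub>R (\<phi> x *\<^sub>R W h (x + s *\<^sub>R h)))"
    by (subst lborel_pair.Fubini_integral[OF pair2]) simp
  also have "\<dots> = (LINT x|lborel. \<phi> x *\<^sub>R (LINT s|lborel. indicator {0..1} s *\<^sub>R W h (x + s *\<^sub>R h)))"
    by (simp only: scaleR_left_commute[of "indicator _ _"] integral_scaleR_right)
  finally show ?thesis unfolding \<phi>_def[symmetric] s1 .
qed

text \<open>The fundamental theorem of calculus along one fixed displacement h; the exceptional null
  set depends on h.\<close>

lemma AE_line:
  assumes V: "open V" and sub: "\<And>x s. x \<in> V \<Longrightarrow> 0 \<le> s \<Longrightarrow> s \<le> 1 \<Longrightarrow> x + s *\<^sub>R h \<in> K"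
  shows "AE x in lborel. x \<in> V \<longrightarrow> U (x + h) - U x = (LINT s|lborel. indicator {0..1} s *\<^sub>R W h (x + s *\<^sub>R h))"
proof -
  define z where "z x = U (x + h) - U x - (LINT s|lborel. indicator {0..1} s *\<^sub>R W h (x + s *\<^sub>R h))" for x
  have intI: "integrable lborel (\<lambda>x. LINT s|lborel. indicator {0..1} s *\<^sub>R W h (x + s *\<^sub>R h))"
    using lborel_pair.integrable_fst[OF integrable_pair_translate[OF integrable_W]] by simp
  have intz: "integrable lborel z"
    unfolding z_def using integrable_U intI lborel_integrable_translate[OF integrable_U] by auto
    have zero: "(LINT x|lborel. box_bump a b m x *\<^sub>R z x) = 0" if ne: "box a b \<noteq> {}" and ab: "cbox a b \<subseteq> V" for a b m
    proof -
      have 1: "integrable lborel (\<lambda>x. box_bump a b m x *\<^sub>R (U (x + h) - U x))"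
        by (rule integrable_box_bump[OF ne]) (auto intro!: integrable_U lborel_integrable_translate)
      have 2: "integrable lborel (\<lambda>x. box_bump a b m x *\<^sub>R (LINT s|lborel. indicator {0..1} s *\<^sub>R W h (x + s *\<^sub>R h)))"
        by (rule integrable_box_bump[OF ne intI])
      have "(LINT x|lborel. box_bump a b m x *\<^sub>R z x) =
        (LINT x|lborel. box_bump a b m x *\<^sub>R (U (x + h) - U x)) -
        (LINT x|lborel. box_bump a b m x *\<^sub>R (LINT s|lborel. indicator {0..1} s *\<^sub>R W h (x + s *\<^sub>R h)))"
        unfolding z_def scaleR_diff_right[of _ "U (_ + h) - U _"]
        by (rule Bochner_Integration.integral_diff[OF 1 2])
      also have "\<dots> = 0" using box_bump_line[OF ne, of h m] sub ab by (simp add: subset_iff)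
      finally show ?thesis .
    qed
  have "AE x in lborel. x \<in> V \<longrightarrow> z x = 0"
    by (rule AE_zero_if_box_bump_integrals_zero[OF V intz zero])
  then show ?thesis by eventually_elim (auto simp: z_def)
qed

end

section \<open>Nearly affine pieces of weakly differentiable maps\<close>

lemma nn_integral_lborel_affine:
  fixes G :: "'a::euclidean_space \<Rightarrow> ennreal" and c :: real
  assumes [measurable]: "G \<in> borel_measurable borel" and c: "c \<noteq> 0"
  shows "(\<integral>\<^sup>+z. G z \<partial>lborel) = ennreal (\<bar>c\<bar> ^ DIM('a)) * (\<integral>\<^sup>+h. G (t + c *\<^sub>R h) \<partial>lborel)"
  by (subst lborel_affine[OF c, of t])
     (simp add: nn_integral_density nn_integral_distr nn_integral_cmult)

text \<open>Absolute continuity of the integral: the part of the norm above a level n has integral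
  less than e/2, and the part below n contributes at most n times the measure of the set.\<close>

lemma integrable_small_on_small_sets:
  fixes f :: "'a \<Rightarrow> 'b::{banach, second_countable_topology}"
  assumes f: "integrable M f" and e: "e > 0"
  obtains d where "d > 0" "\<And>A. A \<in> sets M \<Longrightarrow> emeasure M A < ennreal d \<Longrightarrow> (\<integral>\<^sup>+x\<in>A. norm (f x) \<partial>M) \<le> ennreal e"
proof -
  have [measurable]: "f \<in> borel_measurable M" using f by simp
  define g where "g n x = max 0 (norm (f x) - real n)" for n x
  have "(\<lambda>n. LINT x|M. g n x) \<longlonglongrightarrow> (LINT x|M. 0)"
  proof (rule integral_dominated_convergence[where w="\<lambda>x. norm (f x)"])
    show "AE x in M. (\<lambda>n. g n x) \<longlonglongrightarrow> 0"
    proof (rule AE_I2)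
      fix x
      obtain N :: nat where N: "norm (f x) \<le> real N" using real_arch_simple by blast
      have "\<forall>\<^sub>F n in sequentially. g n x = 0"
        unfolding eventually_sequentially g_def by (rule exI[of _ N]) (use N in auto)
      then show "(\<lambda>n. g n x) \<longlonglongrightarrow> 0" by (rule tendsto_eventually)
    qed
  qed (use f in \<open>auto simp: g_def\<close>)
  then have "\<forall>\<^sub>F n in sequentially. (LINT x|M. g n x) < e / 2"
    using e by (intro order_tendstoD(2)) auto
  then obtain n where n: "(LINT x|M. g n x) < e / 2" by (auto simp: eventually_sequentially)
  have gi: "integrable M (g n)"
    unfolding g_def by (rule Bochner_Integration.integrable_bound[OF f]) auto
  show thesis
  proof (rule that[of "e / (2 * (real n + 1))"])
    show "e / (2 * (real n + 1)) > 0" using e by simp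
    fix A assume A[measurable]: "A \<in> sets M" and small: "emeasure M A < ennreal (e / (2 * (real n + 1)))"
    have "(\<integral>\<^sup>+x\<in>A. norm (f x) \<partial>M) \<le> (\<integral>\<^sup>+x. ennreal (g n x) + ennreal (real n) * indicator A x \<partial>M)"
      by (intro nn_integral_mono) (auto simp: g_def indicator_def ennreal_plus[symmetric] simp del: ennreal_plus intro!: ennreal_leI)
    also have "\<dots> = ennreal (LINT x|M. g n x) + ennreal (real n) * emeasure M A"
    proof -
      have [measurable]: "g n \<in> borel_measurable M" using gi by simp
      have "(\<integral>\<^sup>+x. ennreal (g n x) \<partial>M) = ennreal (LINT x|M. g n x)"
        by (rule nn_integral_eq_integral[OF gi]) (auto simp: g_def)
      then show ?thesis by (subst nn_integral_add) (auto simp: nn_integral_cmult_indicator)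
    qed
    also have "\<dots> \<le> ennreal (e / 2) + ennreal (real n) * ennreal (e / (2 * (real n + 1)))"
      using n small by (intro add_mono mult_left_mono ennreal_leI) auto
    also have "\<dots> = ennreal (e / 2 + real n * (e / (2 * (real n + 1))))"
      using e by (simp add: ennreal_mult'[symmetric])
    also have "\<dots> \<le> ennreal e"
      using e by (intro ennreal_leI) (simp add: field_simps)
    finally show "(\<integral>\<^sup>+x\<in>A. norm (f x) \<partial>M) \<le> ennreal e" .
  qed
qed

text \<open>One half of Lebesgue's differentiation theorem. Suppose that points with value at most e
  - 1/(k+1) have arbitrarily small balls of average above e. Vitali's theorem gives disjoint such
  balls that cover almost all of these points and lie in an open set barely larger than the sublevel
  set E. Comparing the two averages bounds the total measure of the balls.\<close>

lemma AE_ball_averages_le: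
  fixes f :: "'a::euclidean_space \<Rightarrow> real"
  assumes f: "integrable lborel f" and nonneg: "\<And>x. 0 \<le> f x" and e: "e > 0"
  shows "AE x in lebesgue. f x < e \<longrightarrow>
    (\<exists>r>0. \<forall>t. 0 < t \<longrightarrow> t \<le> r \<longrightarrow> (\<integral>\<^sup>+z\<in>cball x t. f z \<partial>lborel) \<le> ennreal e * emeasure lborel (cball x t))"
proof -
  have [measurable]: "f \<in> borel_measurable borel" using f by (auto dest: borel_measurable_integrable)
  define bad where "bad x t \<longleftrightarrow> (\<integral>\<^sup>+z\<in>cball x t. f z \<partial>lborel) > ennreal e * emeasure lborel (cball x t)" for x t
  define S where "S k = {x \<in> ball 0 (real k). f x \<le> e - 1 / real (Suc k) \<and> (\<forall>r>0. \<exists>t>0. t \<le> r \<and> bad x t)}" for k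
  have neg: "negligible (S k)" for k
    unfolding negligible_outer_le
  proof (intro allI impI)
    fix \<tau> :: real assume \<tau>: "\<tau> > 0"
    define E where "E = {x \<in> ball 0 (real k). f x \<le> e - 1 / real (Suc k)}"
    have Em[measurable]: "E \<in> sets borel" unfolding E_def by measurable
    \<comment> \<open>The gap between \<open>e\<close> and the values on \<open>E\<close> is at
      least 1/(k+1); after dividing by it the error \<open>\<tau>'\<close> becomes \<tau>.\<close>
    define \<tau>' where "\<tau>' = \<tau> / real (Suc k)"
    have \<tau>': "\<tau>' > 0" using \<tau> by (simp add: \<tau>'_def)
    obtain d where d: "d > 0" "\<And>A. A \<in> sets lborel \<Longrightarrow> emeasure lborel A < ennreal d \<Longrightarrow> (\<integral>\<^sup>+x\<in>A. norm (f x) \<partial>lborel) \<le> ennreal \<tau>'"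
      using integrable_small_on_small_sets[OF f \<tau>'] by blast
    obtain G where G: "open G" "E \<subseteq> G" "G - E \<in> lmeasurable" "emeasure lebesgue (G - E) < ennreal d"
      using sets_lebesgue_outer_open[of E d] d(1) Em by auto
    define Ix where "Ix = {(x, t). x \<in> S k \<and> 0 < t \<and> cball x t \<subseteq> G \<and> bad x t}"
    obtain C where C: "countable C" "C \<subseteq> Ix"
      "pairwise (\<lambda>i j. disjnt (cball (fst i) (snd i)) (cball (fst j) (snd j))) C"
      "negligible (S k - (\<Union>i\<in>C. cball (fst i) (snd i)))"
    proof (rule Vitali_covering_theorem_cballs[of Ix snd "S k" fst])
      fix x and d :: real assume x: "x \<in> S k" and d: "0 < d"
      then have "x \<in> G" using G(2) by (auto simp: S_def E_def)
      then obtain r where r: "r > 0" "cball x r \<subseteq> G" using G(1) open_contains_cball by blast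
      obtain t where t: "t > 0" "t \<le> min r (d/2)" "bad x t"
        using x r(1) d unfolding S_def by (auto dest!: spec[of _ "min r (d/2)"])
      have "cball x t \<subseteq> G" using r(2) t(2) by (auto simp: subset_iff)
      then show "\<exists>i. i \<in> Ix \<and> x \<in> cball (fst i) (snd i) \<and> snd i < d"
        using x t d by (intro exI[of _ "(x, t)"]) (auto simp: Ix_def)
    next
      show "\<And>i. i \<in> Ix \<Longrightarrow> 0 < snd i" by (auto simp: Ix_def)
    qed (rule that)
    define T where "T = (\<Union>i\<in>C. cball (fst i) (snd i))"
    have Tm[measurable]: "T \<in> sets borel" unfolding T_def using C(1) by (auto intro!: sets.countable_UN')
    have TG: "T \<subseteq> G"
    proof
      fix x assume "x \<in> T"
      then obtain i where i: "i \<in> C" "x \<in> cball (fst i) (snd i)" by (auto simp: T_def)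
      then have "i \<in> Ix" using C(2) by blast
      then show "x \<in> G" using i(2) by (auto simp: Ix_def subset_iff)
    qed
    have disj: "disjoint_family_on (\<lambda>i. cball (fst i) (snd i)) C"
      using C(3) by (auto simp: disjoint_family_on_def pairwise_def disjnt_def)
    have "ennreal e * emeasure lborel T = (\<integral>\<^sup>+i. ennreal e * emeasure lborel (cball (fst i) (snd i)) \<partial>count_space C)"
      unfolding T_def by (subst emeasure_UN_countable[OF _ C(1) disj]) (auto simp: nn_integral_cmult)
    also have "\<dots> \<le> (\<integral>\<^sup>+i. (\<integral>\<^sup>+z\<in>cball (fst i) (snd i). f z \<partial>lborel) \<partial>count_space C)"
      using C(2) by (intro nn_integral_mono) (auto simp: Ix_def bad_def)
    also have "\<dots> = (\<integral>\<^sup>+i. emeasure (density lborel f) (cball (fst i) (snd i)) \<partial>count_space C)"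
      by (intro nn_integral_cong) (auto simp: emeasure_density)
    also have "\<dots> = emeasure (density lborel f) T"
      unfolding T_def by (subst emeasure_UN_countable[OF _ C(1) disj]) auto
    also have "\<dots> = (\<integral>\<^sup>+z\<in>T. f z \<partial>lborel)" by (subst emeasure_density) auto
    \<comment> \<open>On \<open>E\<close> the values lie below e by the gap; the rest of the balls
      lies in \<open>G - E\<close>, where the integral is small by absolute continuity.\<close>
    also have "\<dots> \<le> (\<integral>\<^sup>+z. ennreal (e - 1 / real (Suc k)) * indicator T z + ennreal (f z) * indicator (T - E) z \<partial>lborel)"
      by (intro nn_integral_mono) (auto simp: indicator_def E_def intro!: ennreal_leI)
    also have "\<dots> = ennreal (e - 1 / real (Suc k)) * emeasure lborel T + (\<integral>\<^sup>+z\<in>T - E. f z \<partial>lborel)"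
      by (subst nn_integral_add) (auto simp: nn_integral_cmult_indicator)
    also have "(\<integral>\<^sup>+z\<in>T - E. f z \<partial>lborel) \<le> ennreal \<tau>'"
    proof -
      have "emeasure lborel (T - E) = emeasure lebesgue (T - E)" by simp
      also have "\<dots> \<le> emeasure lebesgue (G - E)"
        using TG G(3) by (intro emeasure_mono) (auto intro: fmeasurableD)
      also have "\<dots> < ennreal d" by (rule G(4))
      finally show ?thesis using d(2)[of "T - E"] nonneg by simp
    qed
    finally have main: "ennreal e * emeasure lborel T \<le> ennreal (e - 1 / real (Suc k)) * emeasure lborel T + ennreal \<tau>'"
      by (simp add: add_left_mono)
    have Tfin: "emeasure lborel T < \<infinity>"
    proof -
      have "emeasure lborel T = emeasure lebesgue T" by simp
      also have "\<dots> \<le> emeasure lebesgue (E \<union> (G - E))"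
      proof (rule emeasure_mono)
        have "E \<in> sets lebesgue" using Em by simp
        then show "E \<union> (G - E) \<in> sets lebesgue" using fmeasurableD[OF G(3)] by (rule sets.Un)
      qed (use TG G(2) in auto)
      also have "\<dots> \<le> emeasure lebesgue E + emeasure lebesgue (G - E)"
        using G(3) Em by (intro emeasure_subadditive) (auto intro: fmeasurableD)
      also have "\<dots> < \<infinity>"
      proof -
        have "emeasure lebesgue E \<le> emeasure lebesgue (ball 0 (real k) :: 'a set)"
          by (intro emeasure_mono) (auto simp: E_def)
        also have "\<dots> < \<infinity>" using emeasure_bounded_finite[of "ball (0::'a) (real k)"] by simp
        finally show ?thesis using G(4) by (simp add: less_top) (metis ennreal_less_top less_trans top.not_eq_extremum)
      qed
      finally show ?thesis .
    qed
    define m where "m = measure lborel T"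
    have mT: "emeasure lborel T = ennreal m" unfolding m_def using Tfin by (intro emeasure_eq_ennreal_measure) auto
    have m0: "0 \<le> m" by (simp add: m_def)
    have mle: "m \<le> \<tau>"
    proof (cases "e - 1 / real (Suc k) \<ge> 0")
      case True
      have "ennreal (e * m) \<le> ennreal ((e - 1 / real (Suc k)) * m + \<tau>')"
        using main True e m0 \<tau>' by (simp add: mT ennreal_mult'[symmetric] ennreal_plus[symmetric] del: ennreal_plus)
      then have "e * m \<le> (e - 1 / real (Suc k)) * m + \<tau>'"
        using True m0 \<tau>' by (subst (asm) ennreal_le_iff) auto
      then have "m / real (Suc k) \<le> \<tau>'" by (simp add: algebra_simps)
      then show ?thesis by (simp add: \<tau>'_def divide_le_cancel)
    next
      case False
      have "x \<notin> E" for x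
      proof
        assume "x \<in> E"
        then have "f x \<le> e - 1 / real (Suc k)" by (simp add: E_def)
        with False nonneg[of x] show False by linarith
      qed
      then have "E = {}" by blast
      then have "S k = {}" by (auto simp: S_def E_def)
      then have "Ix = {}" by (auto simp: Ix_def)
      then have "T = {}" using C(2) by (auto simp: T_def)
      then show ?thesis using \<tau> by (simp add: m_def)
    qed
    show "\<exists>T. S k \<subseteq> T \<and> T \<in> lmeasurable \<and> measure lebesgue T \<le> \<tau>"
    proof (intro exI[of _ "T \<union> (S k - T)"] conjI)
      have n: "negligible (S k - T)" using C(4) by (simp add: T_def)
      have Tl: "T \<in> lmeasurable" using Tm Tfin by (auto simp: fmeasurable_def)
      show "T \<union> (S k - T) \<in> lmeasurable" using Tl negligible_imp_measurable[OF n] by (rule fmeasurable.Un)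
      have "measure lebesgue (T \<union> (S k - T)) \<le> measure lebesgue T + measure lebesgue (S k - T)"
        using n Tl by (intro measure_Un_le) (auto intro: negligible_imp_sets fmeasurableD)
      also have "\<dots> \<le> \<tau>" using mle n by (simp add: negligible_imp_measure0 m_def)
      finally show "measure lebesgue (T \<union> (S k - T)) \<le> \<tau>" .
    qed auto
  qed
  have "negligible (\<Union>k. S k)" using neg by (rule negligible_Union_nat)
  then have "AE x in lebesgue. x \<notin> (\<Union>k. S k)"
    by (intro AE_not_in) (simp add: negligible_iff_null_sets)
  then show ?thesis
  proof (rule eventually_mono, intro impI)
    fix x assume x: "x \<notin> (\<Union>k. S k)" and fx: "f x < e"
    obtain k1 :: nat where k1: "norm x < real k1" using reals_Archimedean2 by blast
    obtain k2 :: nat where k2: "1 / real (Suc k2) < e - f x" using fx nat_approx_posE[of "e - f x"] by auto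
    define k where "k = max k1 k2"
    have "1 / real (Suc k) \<le> 1 / real (Suc k2)" by (intro divide_left_mono) (auto simp: k_def)
    then have "f x \<le> e - 1 / real (Suc k)" using k2 by simp
    moreover have "x \<in> ball 0 (real k)" using k1 by (simp add: k_def)
    ultimately have "\<not> (\<forall>r>0. \<exists>t>0. t \<le> r \<and> bad x t)" using x by (auto simp: S_def)
    then show "\<exists>r>0. \<forall>t. 0 < t \<longrightarrow> t \<le> r \<longrightarrow> (\<integral>\<^sup>+z\<in>cball x t. f z \<partial>lborel) \<le> ennreal e * emeasure lborel (cball x t)"
      unfolding bad_def by (metis not_less)
  qed
qed

context w11_local begin

text \<open>\<open>c\<close> is a candidate for a constant gradient: \<open>L c\<close> is the
  linear map with these partial derivatives, and \<open>dev c\<close> measures the distance of the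
  weak gradient from it on \<open>K\<close>.\<close>

definition L where "L c h = (\<Sum>i\<in>UNIV. h$i *\<^sub>R c i)" for c :: "'n \<Rightarrow> 'b" and h :: "real^'n"
definition dev where "dev c x = (\<Sum>i\<in>UNIV. norm (w i x - c i) * indicator K x)" for c :: "'n \<Rightarrow> 'b" and x

lemma measurable_U_w [measurable]: "U \<in> borel_measurable borel" "W h \<in> borel_measurable borel"
    "w i \<in> borel_measurable borel" "dev c \<in> borel_measurable borel" "K \<in> sets borel"
proof -
  show K: "K \<in> sets borel" using compactK by (simp add: borel_compact)
  show "U \<in> borel_measurable borel" "W h \<in> borel_measurable borel" and w[measurable]: "\<And>i. w i \<in> borel_measurable borel"
    using integrable_U integrable_W intw by (auto dest: borel_measurable_integrable)
  show "dev c \<in> borel_measurable borel" unfolding dev_def using K by measurable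
qed

lemma measurable_L: "L c \<in> borel_measurable borel"
  unfolding L_def by (intro borel_measurable_continuous_onI continuous_intros)

lemma dev_nonneg: "0 \<le> dev c x" by (auto simp: dev_def intro!: sum_nonneg)

lemma integrable_dev: "integrable lborel (dev c)"
proof -
  have iK: "integrable lborel (indicat_real K)"
    using emeasure_compact_finite[OF compactK] by (intro integrable_real_indicator) (auto simp: measurable_U_w)
  have "integrable lborel (\<lambda>x. norm (indicator K x *\<^sub>R w i x - indicator K x *\<^sub>R c i))" for i
    using iK by (intro integrable_norm Bochner_Integration.integrable_diff integrable_mult_indicator intw integrable_scaleR_left)
      (auto simp: measurable_U_w)
  moreover have "norm (w i x - c i) * indicator K x = norm (indicator K x *\<^sub>R w i x - indicator K x *\<^sub>R c i)" for i x
    by (auto simp: indicator_def)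
  ultimately show ?thesis unfolding dev_def by simp
qed

lemma norm_W_diff_le: "x \<in> K \<Longrightarrow> norm (W h x - L c h) \<le> norm h * dev c x"
proof -
  assume x: "x \<in> K"
  have "norm (W h x - L c h) = norm (\<Sum>i\<in>UNIV. h$i *\<^sub>R (w i x - c i))"
    by (simp add: W_def L_def sum_subtractf scaleR_diff_right)
  also have "\<dots> \<le> (\<Sum>i\<in>UNIV. norm h * norm (w i x - c i))"
    by (intro order_trans[OF norm_sum] sum_mono) (auto intro!: mult_right_mono component_le_norm_cart)
  finally show ?thesis using x by (simp add: dev_def sum_distrib_left)
qed

text \<open>The mean value inequality for u - L c along a segment. Written with nonnegative
  integrals it is a jointly measurable predicate of x and h, so that almost-everywhere quantifiers
  can be interchanged.\<close>

definition line_ineq where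
  "line_ineq c x h \<longleftrightarrow> ennreal (norm (U (x + h) - U x - L c h)) \<le> ennreal (norm h) * (\<integral>\<^sup>+s\<in>{0..1}. dev c (x + s *\<^sub>R h) \<partial>lborel)"

lemma AE_line_ineq:
  assumes V: "open V" and sub: "\<And>x s. x \<in> V \<Longrightarrow> 0 \<le> s \<Longrightarrow> s \<le> 1 \<Longrightarrow> x + s *\<^sub>R h \<in> K"
  shows "AE x in lborel. x \<in> V \<longrightarrow> line_ineq c x h"
proof -
  have "AE x in lborel. integrable lborel (\<lambda>s::real. indicator {0..1} s *\<^sub>R W h (x + s *\<^sub>R h))"
    using lborel_pair.AE_integrable_fst[OF integrable_pair_translate[OF integrable_W[of h], of h]] by simp
  moreover have "AE x in lborel. x \<in> V \<longrightarrow> U (x + h) - U x = (LINT s|lborel. indicator {0..1} s *\<^sub>R W h (x + s *\<^sub>R h))"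
    by (rule AE_line[OF V sub])
  ultimately show ?thesis
  proof eventually_elim
    case (elim x)
    show ?case
    proof
      assume x: "x \<in> V"
      have i: "integrable lborel (\<lambda>s::real. indicator {0..1} s *\<^sub>R (W h (x + s *\<^sub>R h) - L c h))"
        using elim(1) by (simp add: scaleR_diff_right)
      have "(LINT s|lborel. indicator {0..1::real} s *\<^sub>R (W h (x + s *\<^sub>R h) - L c h)) =
        (LINT s|lborel. indicator {0..1} s *\<^sub>R W h (x + s *\<^sub>R h)) - (LINT s|lborel. indicator {0..1::real} s *\<^sub>R L c h)"
        unfolding scaleR_diff_right using elim(1) by (intro Bochner_Integration.integral_diff) auto
      then have "U (x + h) - U x - L c h = (LINT s|lborel. indicator {0..1::real} s *\<^sub>R (W h (x + s *\<^sub>R h) - L c h))"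
        using elim(2) x by simp
      then have "ennreal (norm (U (x + h) - U x - L c h)) \<le> (\<integral>\<^sup>+s. norm (indicator {0..1::real} s *\<^sub>R (W h (x + s *\<^sub>R h) - L c h)) \<partial>lborel)"
        using integral_norm_bound_ennreal[OF i] by simp
      also have "\<dots> \<le> (\<integral>\<^sup>+s. ennreal (norm h) * (ennreal (dev c (x + s *\<^sub>R h)) * indicator {0..1} s) \<partial>lborel)"
        using norm_W_diff_le[OF sub[OF x]]
        by (intro nn_integral_mono) (auto simp: indicator_def ennreal_mult'[symmetric] intro!: ennreal_leI)
      also have "\<dots> = ennreal (norm h) * (\<integral>\<^sup>+s\<in>{0..1}. dev c (x + s *\<^sub>R h) \<partial>lborel)"
        by (subst nn_integral_cmult) auto
      finally show "line_ineq c x h" by (simp add: line_ineq_def)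
    qed
  qed
qed

text \<open>For each fixed \<open>h\<close> the inequality holds at almost every \<open>x\<close>;
  Fubini turns this into a null set of points \<open>x\<close> outside of which almost every
  displacement is good.\<close>

lemma AE_AE_line_ineq:
  assumes V: "open V" and sub: "\<And>x. x \<in> V \<Longrightarrow> cball x \<rho> \<subseteq> K"
  shows "AE x in lborel. x \<in> V \<longrightarrow> (AE h in lborel. norm h \<le> \<rho> \<longrightarrow> line_ineq c x h)"
proof -
  have [measurable]: "V \<in> sets borel" using V by simp
  have [measurable]: "L c \<in> borel_measurable borel" by (rule measurable_L)
  have "AE h in lborel. AE x in lborel. x \<in> V \<and> norm h \<le> \<rho> \<longrightarrow> line_ineq c x h"
  proof (rule AE_I2)
    fix h :: "real^'n"
    show "AE x in lborel. x \<in> V \<and> norm h \<le> \<rho> \<longrightarrow> line_ineq c x h"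
    proof (cases "norm h \<le> \<rho>")
      case True
      have "x + s *\<^sub>R h \<in> K" if "x \<in> V" "0 \<le> s" "s \<le> 1" for x s
      proof -
        have "norm (s *\<^sub>R h) \<le> norm h" using that by (intro norm_scaleR_le) auto
        then have "x + s *\<^sub>R h \<in> cball x \<rho>" using True by (simp add: dist_norm)
        then show ?thesis using sub[OF that(1)] by blast
      qed
      then have "AE x in lborel. x \<in> V \<longrightarrow> line_ineq c x h" by (intro AE_line_ineq[OF V])
      then show ?thesis by eventually_elim auto
    qed simp
  qed
  then have "AE x in lborel. AE h in lborel. x \<in> V \<and> norm h \<le> \<rho> \<longrightarrow> line_ineq c x h"
  proof -
    have "Measurable.pred (lborel \<Otimes>\<^sub>M lborel) (\<lambda>p. fst p \<in> V \<and> norm (snd p) \<le> \<rho> \<longrightarrow> line_ineq c (fst p) (snd p))"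
      unfolding line_ineq_def by measurable
    then show "(AE h in lborel. AE x in lborel. x \<in> V \<and> norm h \<le> \<rho> \<longrightarrow> line_ineq c x h) \<Longrightarrow> ?thesis"
      by (subst lborel_pair.AE_commute) (simp_all add: pred_def)
  qed
  then show ?thesis by eventually_elim auto
qed

text \<open>The sets of bad intermediate points around x and around y each occupy at most the
  fraction \<open>1 / steep\<close> of a ball of radius |x - y|, while the ball of half that radius
  about the midpoint occupies 2^(-n). Since 2/2^(n+2) < 2^(-n), a point good for both
  remains.\<close>

definition steep :: real where "steep = 2 ^ (CARD('n) + 2)"

text \<open>The mean value inequality holds only for almost every displacement and may fail for the
  one from x to y. Both points are therefore compared with a common intermediate point; Chebyshev's
  inequality makes most points of the ball suitable as soon as the averages of \<open>dev c\<close>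
  are small.\<close>

lemma close_points:
  assumes x: "AE h in lborel. norm h \<le> \<rho> \<longrightarrow> line_ineq c x h"
    and y: "AE h in lborel. norm h \<le> \<rho> \<longrightarrow> line_ineq c y h"
    and avx: "\<And>t. 0 < t \<Longrightarrow> t \<le> r \<Longrightarrow> (\<integral>\<^sup>+z\<in>cball x t. dev c z \<partial>lborel) \<le> ennreal e * emeasure lborel (cball x t)"
    and avy: "\<And>t. 0 < t \<Longrightarrow> t \<le> r \<Longrightarrow> (\<integral>\<^sup>+z\<in>cball y t. dev c z \<partial>lborel) \<le> ennreal e * emeasure lborel (cball y t)"
    and d: "dist x y \<le> r" "dist x y \<le> \<rho>" and e: "e > 0"
  shows "norm (U x - U y - L c (x - y)) \<le> 2 * steep * e * norm (x - y)"
proof (cases "x = y")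
  case False
  define \<delta> where "\<delta> = dist x y"
  have \<delta>: "\<delta> > 0" "\<delta> \<le> r" "\<delta> \<le> \<rho>" using False d by (auto simp: \<delta>_def)
  define lam where "lam = steep * e * \<delta>"
  have steep: "steep > 0" by (simp add: steep_def)
  have lam: "lam > 0" using \<delta> e steep by (simp add: lam_def)
  define b where "b = measure lborel (cball (0::real^'n) \<delta>)"
  have Lm[measurable]: "L c \<in> borel_measurable borel" by (rule measurable_L)
  have cb: "emeasure lborel (cball z t) = ennreal (t ^ CARD('n) / \<delta> ^ CARD('n)) * ennreal b" if "0 < t" for z :: "real^'n" and t
  proof -
    have *: "emeasure lborel (cball z t) = ennreal (unit_ball_vol (real CARD('n)) * t ^ CARD('n))" if "0 < t" for z :: "real^'n" and t
      using that by (simp add: emeasure_cball)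
    have "b = unit_ball_vol (real CARD('n)) * \<delta> ^ CARD('n)"
      unfolding b_def measure_def using *[OF \<delta>(1), of 0] \<delta> by simp
    then show ?thesis using *[OF that] \<delta> that by (simp add: ennreal_mult'[symmetric])
  qed
  have cbm[measurable]: "cball z t \<in> sets borel" for z :: "real^'n" and t by simp
  have i01[measurable]: "{0..1::real} \<in> sets borel" by simp
  have b: "b > 0" unfolding b_def using \<delta> by (simp add: content_cball_pos)
  define bad where "bad z = {\<xi> \<in> cball z \<delta>. lam < norm (U \<xi> - U z - L c (\<xi> - z))}" for z
  have badm[measurable]: "bad z \<in> sets borel" for z unfolding bad_def by measurable
  have est: "emeasure lborel (bad z) \<le> ennreal (b / steep)"
    if z: "AE h in lborel. norm h \<le> \<rho> \<longrightarrow> line_ineq c z h"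
      and av: "\<And>t. 0 < t \<Longrightarrow> t \<le> r \<Longrightarrow> (\<integral>\<^sup>+x\<in>cball z t. dev c x \<partial>lborel) \<le> ennreal e * emeasure lborel (cball z t)" for z
  proof -
    have "ennreal lam * emeasure lborel (bad z) = (\<integral>\<^sup>+\<xi>. ennreal lam * indicator (bad z) \<xi> \<partial>lborel)"
      by (simp add: nn_integral_cmult_indicator)
    also have "\<dots> = (\<integral>\<^sup>+h. ennreal lam * indicator (bad z) (h + z) \<partial>lborel)"
      by (rule nn_integral_lborel_translate[symmetric]) measurable
    \<comment> \<open>Chebyshev: on the bad set the deviation exceeds \<open>lam\<close>, and the
      mean value inequality bounds it by \<delta> times the integral of \<open>dev c\<close> along
      the segment.\<close>
    also have "\<dots> \<le> (\<integral>\<^sup>+h. ennreal \<delta> * (\<integral>\<^sup>+s. ennreal (dev c (z + s *\<^sub>R h)) * indicator (cball 0 \<delta>) h * indicator {0..1::real} s \<partial>lborel) \<partial>lborel)"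
    proof (rule nn_integral_mono_AE, use z in eventually_elim)
      case (elim h)
      show ?case
      proof (cases "h + z \<in> bad z")
        case True
        then have h: "norm h \<le> \<delta>" and big: "lam < norm (U (z + h) - U z - L c h)"
          by (auto simp: bad_def dist_norm add.commute)
        have "ennreal lam \<le> ennreal (norm (U (z + h) - U z - L c h))" using big by (intro ennreal_leI) auto
        also have "\<dots> \<le> ennreal (norm h) * (\<integral>\<^sup>+s\<in>{0..1}. dev c (z + s *\<^sub>R h) \<partial>lborel)"
          using elim h \<delta> by (auto simp: line_ineq_def)
        also have "\<dots> \<le> ennreal \<delta> * (\<integral>\<^sup>+s\<in>{0..1}. dev c (z + s *\<^sub>R h) \<partial>lborel)"
          using h by (intro mult_right_mono ennreal_leI) auto
        finally show ?thesis using True h by (simp add: indicator_def)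
      qed simp
    qed
    also have "\<dots> = ennreal \<delta> * (\<integral>\<^sup>+h. \<integral>\<^sup>+s. ennreal (dev c (z + s *\<^sub>R h)) * indicator (cball 0 \<delta>) h * indicator {0..1::real} s \<partial>lborel \<partial>lborel)"
      by (rule nn_integral_cmult) measurable
    also have "(\<integral>\<^sup>+h. \<integral>\<^sup>+s. ennreal (dev c (z + s *\<^sub>R h)) * indicator (cball 0 \<delta>) h * indicator {0..1::real} s \<partial>lborel \<partial>lborel) =
       (\<integral>\<^sup>+s. \<integral>\<^sup>+h. ennreal (dev c (z + s *\<^sub>R h)) * indicator (cball 0 \<delta>) h * indicator {0..1::real} s \<partial>lborel \<partial>lborel)"
      by (rule lborel_pair.Fubini') measurable
    also have "\<dots> \<le> (\<integral>\<^sup>+s. (ennreal e * ennreal b) * indicator {0..1::real} s \<partial>lborel)"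
    proof (rule nn_integral_mono_AE)
      \<comment> \<open>The value s = 0 is excluded because the substitution y = z + s h degenerates
        there; for s > 0 its factor s^n cancels against the measure of the ball of radius s
        \<delta>.\<close>
      have "AE s in lborel. s \<noteq> (0::real)" by (rule AE_lborel_singleton)
      then show "AE s in lborel. (\<integral>\<^sup>+h. ennreal (dev c (z + s *\<^sub>R h)) * indicator (cball 0 \<delta>) h * indicator {0..1::real} s \<partial>lborel)
          \<le> (ennreal e * ennreal b) * indicator {0..1::real} s"
      proof eventually_elim
        case (elim s)
        show ?case
        proof (cases "s \<in> {0..1}")
          case True
          then have s: "0 < s" "s \<le> 1" using elim by auto
          have "ennreal (s ^ CARD('n)) * (\<integral>\<^sup>+h. ennreal (dev c (z + s *\<^sub>R h)) * indicator (cball 0 \<delta>) h \<partial>lborel)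
             = ennreal (s ^ CARD('n)) * (\<integral>\<^sup>+h. ennreal (dev c (z + s *\<^sub>R h)) * indicator (cball z (s * \<delta>)) (z + s *\<^sub>R h) \<partial>lborel)"
            using s by (intro arg_cong2[where f="(*)"] refl nn_integral_cong) (auto simp: indicator_def dist_norm)
          also have "\<dots> = (\<integral>\<^sup>+y\<in>cball z (s * \<delta>). dev c y \<partial>lborel)"
            using s nn_integral_lborel_affine[of "\<lambda>y. ennreal (dev c y) * indicator (cball z (s * \<delta>)) y" s z] by simp
          also have "\<dots> \<le> ennreal e * emeasure lborel (cball z (s * \<delta>))"
            using s \<delta> by (intro av) (auto intro: order_trans[OF mult_left_le_one_le])
          also have "\<dots> = ennreal (s ^ CARD('n)) * (ennreal e * ennreal b)"
            using s \<delta> by (subst cb) (auto simp: power_mult_distrib ac_simps)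
          finally have "(\<integral>\<^sup>+h. ennreal (dev c (z + s *\<^sub>R h)) * indicator (cball 0 \<delta>) h \<partial>lborel) \<le> ennreal e * ennreal b"
            using s by (subst (asm) ennreal_mult_le_mult_iff) auto
          then show ?thesis using True by simp
        qed simp
      qed
    qed
    also have "\<dots> = ennreal e * ennreal b" by (simp add: nn_integral_cmult_indicator)
    finally have le: "ennreal lam * emeasure lborel (bad z) \<le> ennreal \<delta> * (ennreal e * ennreal b)" 
      by (simp add: mult_left_mono)
    have "emeasure lborel (bad z) \<le> emeasure lborel (cball z \<delta>)"
      by (intro emeasure_mono) (auto simp: bad_def)
    then have fin: "emeasure lborel (bad z) < \<infinity>" using cb[OF \<delta>(1), of z]
      by (simp add: ennreal_mult'[symmetric]) (meson ennreal_less_top le_less_trans)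
    then obtain q where q: "emeasure lborel (bad z) = ennreal q" "q \<ge> 0"
      by (metis emeasure_eq_ennreal_measure infinity_ennreal_def less_irrefl measure_nonneg)
    have "lam * q \<le> \<delta> * (e * b)"
      using le q lam \<delta> e b by (simp add: ennreal_mult'[symmetric])
    then have "q \<le> b / steep" using \<delta> e steep by (simp add: lam_def field_simps)
    then show ?thesis using q by (auto intro: ennreal_leI)
  qed
  define mid where "mid = midpoint x y"
  have midsub: "cball mid (\<delta> / 2) \<subseteq> cball x \<delta> \<inter> cball y \<delta>"
  proof
    fix z assume z: "z \<in> cball mid (\<delta> / 2)"
    have "dist x mid = \<delta> / 2" "dist y mid = \<delta> / 2" by (auto simp: mid_def \<delta>_def dist_midpoint)
    then show "z \<in> cball x \<delta> \<inter> cball y \<delta>"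
      using z dist_triangle[of x z mid] dist_triangle[of y z mid] by simp
  qed
  have "\<not> cball mid (\<delta> / 2) \<subseteq> bad x \<union> bad y"
  proof
    assume "cball mid (\<delta> / 2) \<subseteq> bad x \<union> bad y"
    then have "emeasure lborel (cball mid (\<delta> / 2)) \<le> emeasure lborel (bad x \<union> bad y)"
      by (intro emeasure_mono) auto
    also have "\<dots> \<le> emeasure lborel (bad x) + emeasure lborel (bad y)"
      by (intro emeasure_subadditive) auto
    also have "\<dots> \<le> ennreal (b / steep) + ennreal (b / steep)"
      by (intro add_mono est x y avx avy)
    also have "\<dots> = ennreal (2 * b / steep)" using b steep by (simp add: ennreal_plus[symmetric] del: ennreal_plus)
    finally have "ennreal ((\<delta> / 2) ^ CARD('n) / \<delta> ^ CARD('n) * b) \<le> ennreal (2 * b / steep)"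
      using \<delta> b ennreal_mult'[of "(\<delta> / 2) ^ CARD('n) / \<delta> ^ CARD('n)" b] by (subst (asm) cb) auto
    then have "(\<delta> / 2) ^ CARD('n) / \<delta> ^ CARD('n) * b \<le> 2 * b / steep"
      using b steep by (subst (asm) ennreal_le_iff) auto
    then have "(1 / 2 ^ CARD('n)) * b \<le> (2 / steep) * b" using \<delta> by (simp add: power_divide)
    then have "1 / 2 ^ CARD('n) \<le> 2 / steep" using b by (rule mult_right_le_imp_le)
    then show False by (simp add: steep_def field_simps)
  qed
  then obtain \<xi> where \<xi>: "\<xi> \<in> cball x \<delta>" "\<xi> \<in> cball y \<delta>" "\<xi> \<notin> bad x" "\<xi> \<notin> bad y"
    using midsub by blast
  have Ld: "L c (\<xi> - y) - L c (\<xi> - x) = L c (x - y)"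
    by (simp add: L_def sum_subtractf[symmetric] scaleR_diff_left[symmetric])
  have "norm (U x - U y - L c (x - y)) = norm ((U \<xi> - U y - L c (\<xi> - y)) - (U \<xi> - U x - L c (\<xi> - x)))"
    unfolding Ld[symmetric] by (simp add: algebra_simps)
  also have "\<dots> \<le> norm (U \<xi> - U y - L c (\<xi> - y)) + norm (U \<xi> - U x - L c (\<xi> - x))" by (rule norm_triangle_ineq4)
  also have "\<dots> \<le> lam + lam" using \<xi> by (intro add_mono) (auto simp: bad_def)
  finally show ?thesis by (simp add: lam_def \<delta>_def dist_norm mult_ac)
qed (simp add: L_def)

text \<open>Points whose averages are small up to the same radius \<open>r j\<close>, and which lie
  in one ball of radius \<open>r j / 2\<close>, are close enough for the two-point estimate.
  Countably many centres suffice. Passing to closures keeps the estimate by continuity and yields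
  compact pieces, so that the measurability of the sets \<open>A j\<close> never has to be
  discussed.\<close>

lemma lipschitz_pieces:
  assumes V: "open V" and sub: "\<And>x. x \<in> V \<Longrightarrow> cball x \<rho> \<subseteq> K" and \<rho>: "\<rho> > 0" and e: "e > 0"
  obtains F :: "nat \<Rightarrow> (real^'n) set"
    where "\<And>k. compact (F k)" "\<And>k. F k \<subseteq> K"
      "\<And>k x y. x \<in> F k \<Longrightarrow> y \<in> F k \<Longrightarrow> norm (u x - u y - L c (x - y)) \<le> 2 * steep * e * norm (x - y)"
      "AE x in lebesgue. x \<in> V \<and> dev c x < e \<longrightarrow> x \<in> (\<Union>k. F k)"
proof -
  define r where "r j = min \<rho> (1 / real (Suc j))" for j
  have r: "r j > 0" "r j \<le> \<rho>" for j using \<rho> by (auto simp: r_def)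
  define A where "A j = {x \<in> V. (AE h in lborel. norm h \<le> \<rho> \<longrightarrow> line_ineq c x h) \<and>
     (\<forall>t. 0 < t \<longrightarrow> t \<le> r j \<longrightarrow> (\<integral>\<^sup>+z\<in>cball x t. dev c z \<partial>lborel) \<le> ennreal e * emeasure lborel (cball x t))}" for j
  obtain Q :: "(real^'n) set" where Q: "countable Q" "\<And>X. open X \<Longrightarrow> X \<noteq> {} \<Longrightarrow> \<exists>q\<in>Q. q \<in> X"
    using countable_dense_setE by metis
  have Qne: "Q \<noteq> {}" using Q(2)[of UNIV] by auto
  define G where "G = (\<lambda>(j, q). closure (A j \<inter> cball q (r j / 2)))"
  define F where "F k = G (from_nat_into ((UNIV::nat set) \<times> Q) k)" for k
  have cnt: "countable (UNIV \<times> Q :: (nat \<times> (real^'n)) set)" using Q(1) by auto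
  have nonem: "(UNIV \<times> Q :: (nat \<times> (real^'n)) set) \<noteq> {}" using Qne by auto
  have VK: "V \<subseteq> K"
  proof
    fix x assume "x \<in> V" then show "x \<in> K" using sub[of x] \<rho> by auto
  qed
  have GK: "G i \<subseteq> K" for i
  proof -
    obtain j q where i: "i = (j, q)" by (cases i)
    have "A j \<subseteq> K" using VK by (auto simp: A_def)
    then show ?thesis unfolding i G_def prod.case
      by (intro closure_minimal compact_imp_closed[OF compactK]) auto
  qed
  have Gc: "compact (G i)" for i
  proof -
    have "bounded (G i)" using GK compact_imp_bounded[OF compactK] bounded_subset by blast
    then show ?thesis by (auto simp: G_def compact_eq_bounded_closed split: prod.splits)
  qed
  have Gl: "norm (u x - u y - L c (x - y)) \<le> 2 * steep * e * norm (x - y)" if "x \<in> G i" "y \<in> G i" for x y i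
  proof -
    obtain j q where i: "i = (j, q)" by (cases i)
    define B where "B = A j \<inter> cball q (r j / 2)"
    have Gi: "G i = closure B" by (simp add: G_def i B_def)
    have base: "norm (u x - u y - L c (x - y)) \<le> 2 * steep * e * norm (x - y)" if "x \<in> B" "y \<in> B" for x y
    proof -
      have "dist x y \<le> r j" using that dist_triangle3[of x y q] by (auto simp: B_def dist_commute)
      then have "norm (U x - U y - L c (x - y)) \<le> 2 * steep * e * norm (x - y)"
        using that r[of j] by (intro close_points[where \<rho>=\<rho> and r="r j"]) (auto simp: B_def A_def e)
      moreover have "x \<in> K" "y \<in> K" using that VK by (auto simp: B_def A_def)
      ultimately show ?thesis by (simp add: U_def)
    qed
    have BK: "closure B \<subseteq> K" using GK[of i] Gi by simp
    obtain X where X: "\<And>n. X n \<in> B" "X \<longlonglongrightarrow> x" using \<open>x \<in> G i\<close> unfolding Gi closure_sequential by blast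
    obtain Y where Y: "\<And>n. Y n \<in> B" "Y \<longlonglongrightarrow> y" using \<open>y \<in> G i\<close> unfolding Gi closure_sequential by blast
    have inK: "X n \<in> K" "Y n \<in> K" "x \<in> K" "y \<in> K" for n
      using X Y BK closure_subset \<open>x \<in> G i\<close> \<open>y \<in> G i\<close> Gi by blast+
    have uX: "(\<lambda>n. u (X n)) \<longlonglongrightarrow> u x" and uY: "(\<lambda>n. u (Y n)) \<longlonglongrightarrow> u y"
      using contu X Y inK unfolding continuous_on_sequentially by (auto simp: comp_def)
    have Lc: "(\<lambda>n. L c (X n - Y n)) \<longlonglongrightarrow> L c (x - y)"
      unfolding L_def by (intro tendsto_intros X Y)
    show ?thesis
      by (rule LIMSEQ_le[OF tendsto_norm[OF tendsto_diff[OF tendsto_diff[OF uX uY] Lc]]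
            tendsto_mult[OF tendsto_const tendsto_norm[OF tendsto_diff[OF X(2) Y(2)]]]])
         (use base X Y in blast)
  qed
  have "AE x in lebesgue. x \<in> V \<and> dev c x < e \<longrightarrow> x \<in> (\<Union>k. F k)"
  proof -
    have "AE x in lebesgue. x \<in> V \<longrightarrow> (AE h in lborel. norm h \<le> \<rho> \<longrightarrow> line_ineq c x h)"
      using AE_AE_line_ineq[OF V sub] by (rule AE_completion)
    with AE_ball_averages_le[OF integrable_dev dev_nonneg e, of c] show ?thesis
    proof eventually_elim
      case (elim x)
      show ?case
      proof
        assume x: "x \<in> V \<and> dev c x < e"
        then obtain s where s: "s > 0" "\<forall>t. 0 < t \<longrightarrow> t \<le> s \<longrightarrow> (\<integral>\<^sup>+z\<in>cball x t. dev c z \<partial>lborel) \<le> ennreal e * emeasure lborel (cball x t)"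
          using elim by blast
        obtain j where j: "1 / real (Suc j) < s" using s(1) nat_approx_posE by blast
        then have "r j \<le> s" by (simp add: r_def)
        then have xA: "x \<in> A j" using x elim s by (auto simp: A_def)
        obtain q where q: "q \<in> Q" "q \<in> ball x (r j / 2)" using Q(2)[of "ball x (r j / 2)"] r[of j] by auto
        then have "x \<in> G (j, q)" using xA by (auto simp: G_def dist_commute intro!: closure_subset[THEN subsetD])
        moreover have "(j, q) \<in> range (from_nat_into ((UNIV::nat set) \<times> Q))"
          using range_from_nat_into[OF nonem cnt] q by auto
        ultimately show "x \<in> (\<Union>k. F k)" by (auto simp: F_def)
      qed
    qed
  qed
  then show thesis using that[of F] Gc GK Gl by (auto simp: F_def)
qed

end

section \<open>Measure of nearly linear images\<close>

text \<open>\<open>measure_linear_image\<close> in the library requires a well-ordered index type, so vectors indexed by a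
  merely finite type are relabelled by a well-ordered copy of it.\<close>

typedef 'a ord_copy = "UNIV :: 'a set" morphisms of_copy to_copy by simp

instance ord_copy :: (finite) finite
proof
  have "(UNIV :: 'a ord_copy set) = to_copy ` UNIV"
    by (metis UNIV_eq_I of_copy_inverse rangeI)
  then show "finite (UNIV :: 'a ord_copy set)" by (metis finite_imageI finite)
qed

instantiation ord_copy :: (finite) wellorder
begin

definition less_eq_ord_copy :: "'a ord_copy \<Rightarrow> 'a ord_copy \<Rightarrow> bool" where
  "less_eq_ord_copy x y \<longleftrightarrow> to_nat_on (UNIV :: 'a set) (of_copy x) \<le> to_nat_on (UNIV :: 'a set) (of_copy y)"

definition less_ord_copy :: "'a ord_copy \<Rightarrow> 'a ord_copy \<Rightarrow> bool" where
  "less_ord_copy x y \<longleftrightarrow> to_nat_on (UNIV :: 'a set) (of_copy x) < to_nat_on (UNIV :: 'a set) (of_copy y)"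

instance
proof
  fix x y :: "'a ord_copy"
  have inj: "inj (to_nat_on (UNIV :: 'a set))" by (intro inj_on_to_nat_on countable_finite) simp
  show "x = y" if "x \<le> y" "y \<le> x"
    using that inj by (auto simp: less_eq_ord_copy_def inj_eq of_copy_inject)
next
  fix P and a :: "'a ord_copy"
  assume step: "\<And>x. (\<And>y. y < x \<Longrightarrow> P y) \<Longrightarrow> P (x :: 'a ord_copy)"
  show "P a"
    by (induction a rule: measure_induct_rule[where f="\<lambda>x. to_nat_on (UNIV :: 'a set) (of_copy x)"])
       (rule step, auto simp: less_ord_copy_def)
qed (auto simp: less_eq_ord_copy_def less_ord_copy_def)

end

lemma bij_of_copy: "bij of_copy"
  by (rule bijI') (auto simp: of_copy_inject intro: to_copy_inverse[symmetric])

definition relabel :: "real^'n \<Rightarrow> real^'n ord_copy" where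
  "relabel x = (\<chi> k. x $ of_copy k)"

definition unlabel :: "real^'n ord_copy \<Rightarrow> real^'n" where
  "unlabel y = (\<chi> i. y $ to_copy i)"

lemma relabel_unlabel [simp]: "relabel (unlabel y) = y" "unlabel (relabel x) = x"
  by (simp_all add: relabel_def unlabel_def vec_eq_iff of_copy_inverse to_copy_inverse)

lemma linear_relabel: "linear relabel" and linear_unlabel: "linear unlabel"
  by (auto intro!: linearI simp: relabel_def unlabel_def vec_eq_iff)

lemma emeasure_lborel_box_cart:
  fixes l u :: "real^'n"
  assumes "\<And>i. l $ i \<le> u $ i"
  shows "emeasure lborel (box l u) = (\<Prod>i\<in>UNIV. u $ i - l $ i)"
proof -
  have B: "(Basis :: (real^'n) set) = (\<lambda>i. axis i 1) ` UNIV" by (auto simp: Basis_vec_def)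
  have inj: "inj (\<lambda>i::'n. axis i (1::real))" by (auto simp: inj_on_def axis_eq_axis)
  have "emeasure lborel (box l u) = (\<Prod>b\<in>Basis. (u - l) \<bullet> b)"
    using assms by (intro emeasure_lborel_box) (auto simp: Basis_vec_def inner_axis)
  also have "(\<Prod>b\<in>Basis. (u - l) \<bullet> b) = (\<Prod>i\<in>UNIV. u $ i - l $ i)"
    unfolding B by (subst prod.reindex[OF inj]) (auto simp: inner_axis)
  finally show ?thesis .
qed

text \<open>Relabelling maps boxes to boxes with the same side lengths, and Lebesgue measure is
  determined by its values on boxes.\<close>

lemma distr_relabel: "distr lborel borel relabel = (lborel :: (real^('n::finite) ord_copy) measure)"
proof (rule lborel_eqI[symmetric])
  have [measurable]: "relabel \<in> borel_measurable borel"
    using linear_relabel by (intro borel_measurable_continuous_onI linear_continuous_on linear_conv_bounded_linear[THEN iffD1])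
  fix l u :: "real^'n ord_copy" assume lu: "\<And>b. b \<in> Basis \<Longrightarrow> l \<bullet> b \<le> u \<bullet> b"
  then have lu': "l $ k \<le> u $ k" for k by (force simp: Basis_vec_def inner_axis)
  have "relabel -` box l u = box (unlabel l) (unlabel u)"
  proof -
    have "(\<forall>k. l $ k < x $ of_copy k \<and> x $ of_copy k < u $ k) \<longleftrightarrow>
      (\<forall>i. l $ to_copy i < x $ i \<and> x $ i < u $ to_copy i)" for x
      by (metis of_copy_inverse to_copy_inverse UNIV_I)
    then show ?thesis by (auto simp: mem_box_cart relabel_def unlabel_def)
  qed
  then have "emeasure (distr lborel borel relabel) (box l u) = emeasure lborel (box (unlabel l) (unlabel u))"
    by (subst emeasure_distr) auto
  also have "\<dots> = ennreal (\<Prod>i\<in>UNIV. u $ to_copy i - l $ to_copy i)"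
    using lu' by (subst emeasure_lborel_box_cart) (auto simp: unlabel_def)
  also have "(\<Prod>i\<in>UNIV. u $ to_copy i - l $ to_copy i) = (\<Prod>k\<in>UNIV. u $ k - l $ k)"
    by (rule prod.reindex_bij_witness[where i=of_copy and j=to_copy]) (auto simp: of_copy_inverse to_copy_inverse)
  also have "ennreal \<dots> = emeasure lborel (box l u)"
    using lu' by (subst emeasure_lborel_box_cart) auto
  also have "\<dots> = (\<Prod>b\<in>Basis. (u - l) \<bullet> b)" using lu by (rule emeasure_lborel_box)
  finally show "emeasure (distr lborel borel relabel) (box l u) = (\<Prod>b\<in>Basis. (u - l) \<bullet> b)" .
qed simp

text \<open>In the Leibniz formula, conjugation with the bijection of index types is a bijection of
  permutations that preserves signs.\<close>

lemma det_relabel: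
  fixes A :: "real^'n^'n"
  shows "det (\<chi> k l. A $ of_copy k $ of_copy l) = det A"
proof -
  let ?B = "(\<chi> k l. A $ of_copy k $ of_copy l) :: real^'n ord_copy^'n ord_copy"
  have injc: "inj (to_copy :: 'n \<Rightarrow> _)" by (metis injI to_copy_inverse UNIV_I)
  have bijc: "bij (to_copy :: 'n \<Rightarrow> _)" "bij (of_copy :: 'n ord_copy \<Rightarrow> _)"
    by (metis bij_of_copy bijI injc of_copy_inverse surjI) (rule bij_of_copy)
  have "det A = (\<Sum>p | p permutes UNIV. of_int (sign p) * (\<Prod>i\<in>UNIV. A $ i $ p i))" by (simp add: det_def)
  also have "\<dots> = (\<Sum>q | q permutes UNIV. of_int (sign q) * (\<Prod>k\<in>UNIV. ?B $ k $ q k))"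
  proof (rule sum.reindex_bij_witness[where j="map_permutation UNIV to_copy" and i="map_permutation UNIV of_copy"])
    fix p :: "'n \<Rightarrow> 'n" assume "p \<in> {p. p permutes UNIV}"
    then have p: "p permutes UNIV" by simp
    show "map_permutation UNIV of_copy (map_permutation UNIV to_copy p) = p"
      by (rule map_permutation_compose_inv[OF _ p]) (use bijc in \<open>auto simp: to_copy_inverse\<close>)
    show "map_permutation UNIV to_copy p \<in> {p. p permutes UNIV}"
      using map_permutation_permutes[OF bijc(1) p] by simp
    have ap: "map_permutation UNIV to_copy p (to_copy i) = to_copy (p i)" for i
      by (rule map_permutation_apply[OF injc]) simp
    have "(\<Prod>k\<in>UNIV. ?B $ k $ map_permutation UNIV to_copy p k) = (\<Prod>i\<in>UNIV. A $ i $ p i)"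
    proof (rule prod.reindex_bij_witness[where i=to_copy and j=of_copy])
      fix k :: "'n ord_copy"
      have "map_permutation UNIV to_copy p k = to_copy (p (of_copy k))"
        using ap[of "of_copy k"] by (simp add: of_copy_inverse)
      then show "A $ of_copy k $ p (of_copy k) = ?B $ k $ map_permutation UNIV to_copy p k"
        by (simp add: to_copy_inverse)
    qed (auto simp: of_copy_inverse to_copy_inverse)
    moreover have "sign (map_permutation UNIV to_copy p) = sign p"
      by (rule sign_map_permutation[OF injc p]) simp
    ultimately show "of_int (sign (map_permutation UNIV to_copy p)) * (\<Prod>k\<in>UNIV. ?B $ k $ map_permutation UNIV to_copy p k)
       = of_int (sign p) * (\<Prod>i\<in>UNIV. A $ i $ p i)" by simp
  next
    fix q :: "'n ord_copy \<Rightarrow> 'n ord_copy" assume "q \<in> {q. q permutes UNIV}"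
    then have q: "q permutes UNIV" by simp
    show "map_permutation UNIV to_copy (map_permutation UNIV of_copy q) = q"
      by (rule map_permutation_compose_inv[OF _ q]) (use bijc in \<open>auto simp: of_copy_inverse\<close>)
    show "map_permutation UNIV of_copy q \<in> {p. p permutes UNIV}"
      using map_permutation_permutes[OF bijc(2) q] by simp
  qed
  also have "\<dots> = det ?B" by (simp add: det_def)
  finally show ?thesis by simp
qed

text \<open>It suffices to treat images of boxes. They are compact, hence Borel, and relabelling
  preserves the measure of compact sets, so the formula is transported from the ordered index
  type.\<close>

proposition measure_linear_image_finite:
  fixes f :: "real^'n \<Rightarrow> real^'n"
  assumes f: "linear f" and S: "S \<in> lmeasurable"
  shows "f ` S \<in> lmeasurable" "measure lebesgue (f ` S) = \<bar>det (matrix f)\<bar> * measure lebesgue S"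
proof -
  define F where "F = relabel \<circ> f \<circ> unlabel"
  have lF: "linear F" unfolding F_def by (intro linear_compose linear_unlabel linear_relabel f)
  have "matrix F = (\<chi> k l. matrix f $ of_copy k $ of_copy l)"
  proof -
    have "unlabel (axis l 1) = axis (of_copy l) 1" for l :: "'n ord_copy"
      by (auto simp: unlabel_def axis_def vec_eq_iff to_copy_inverse of_copy_inverse)
    then show ?thesis by (simp add: matrix_def F_def relabel_def)
  qed
  then have detF: "det (matrix F) = det (matrix f)" by (simp add: det_relabel)
  have [measurable]: "relabel \<in> borel_measurable borel"
    using linear_relabel by (intro borel_measurable_continuous_onI linear_continuous_on linear_conv_bounded_linear[THEN iffD1])
  have meas: "measure lebesgue (unlabel ` T) = measure lebesgue T" if T: "compact T" for T :: "(real^'n ord_copy) set"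
  proof -
    have Tb: "T \<in> sets borel" using T by (rule borel_compact)
    have "compact (unlabel ` T)"
      using T linear_unlabel by (intro compact_continuous_image linear_continuous_on linear_conv_bounded_linear[THEN iffD1])
    then have uT: "unlabel ` T \<in> sets borel" by (rule borel_compact)
    have eq: "relabel -` T = unlabel ` T"
    proof (intro set_eqI iffI)
      fix x assume "x \<in> relabel -` T"
      then show "x \<in> unlabel ` T" by (intro image_eqI[of _ _ "relabel x"]) auto
    qed auto
    have "emeasure lborel T = emeasure (distr lborel borel relabel) T" by (simp add: distr_relabel)
    also have "\<dots> = emeasure lborel (unlabel ` T)" using Tb by (subst emeasure_distr) (auto simp: eq)
    finally show ?thesis using Tb uT by (simp add: measure_def)
  qed
  have im: "measure lebesgue (f ` cbox a b) = \<bar>det (matrix f)\<bar> * measure lebesgue (cbox a b)" for a b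
  proof -
    let ?C = "relabel ` cbox a b"
    have c: "compact ?C"
      using linear_relabel by (intro compact_continuous_image linear_continuous_on linear_conv_bounded_linear[THEN iffD1]) auto
    have c2: "compact (F ` ?C)"
      using lF by (intro compact_continuous_image[OF _ c] linear_continuous_on linear_conv_bounded_linear[THEN iffD1])
    have "f ` cbox a b = unlabel ` (F ` ?C)" by (auto simp: F_def image_image)
    then have "measure lebesgue (f ` cbox a b) = measure lebesgue (F ` ?C)" using meas[OF c2] by simp
    also have "\<dots> = \<bar>det (matrix F)\<bar> * measure lebesgue ?C"
      by (rule measure_linear_image[OF lF]) (use c lmeasurable_compact in auto)
    also have "measure lebesgue ?C = measure lebesgue (cbox a b)" using meas[OF c] by (simp add: image_image)
    finally show ?thesis by (simp add: detF)
  qed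
  from measure_linear_sufficient[OF f S im]
  show "f ` S \<in> lmeasurable" "measure lebesgue (f ` S) = \<bar>det (matrix f)\<bar> * measure lebesgue S" by auto
qed

section \<open>Images of maps close to a translation\<close>

lemma emeasure_UN_le_nn_integral:
  assumes I: "countable I" and A: "\<And>i. i \<in> I \<Longrightarrow> A i \<in> sets M"
  shows "emeasure M (\<Union>i\<in>I. A i) \<le> (\<integral>\<^sup>+i. emeasure M (A i) \<partial>count_space I)"
proof -
  have "(\<Union>i\<in>I. A i) \<in> sets M" by (intro sets.countable_UN' I) (use A in auto)
  then have "emeasure M (\<Union>i\<in>I. A i) = (\<integral>\<^sup>+x. indicator (\<Union>i\<in>I. A i) x \<partial>M)" by simp
  also have "\<dots> \<le> (\<integral>\<^sup>+x. \<integral>\<^sup>+i. indicator (A i) x \<partial>count_space I \<partial>M)"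
  proof (rule nn_integral_mono)
    fix x
    show "indicator (\<Union>i\<in>I. A i) x \<le> (\<integral>\<^sup>+i. indicator (A i) x \<partial>count_space I)"
    proof (cases "x \<in> (\<Union>i\<in>I. A i)")
      case True
      then obtain i where i: "i \<in> I" "x \<in> A i" by blast
      then have "indicator (A i) x \<le> (\<integral>\<^sup>+i. indicator (A i) x \<partial>count_space I)"
        by (intro nn_integral_ge_point) auto
      then show ?thesis using i True by simp
    qed simp
  qed
  also have "\<dots> = (\<integral>\<^sup>+i. emeasure M (A i) \<partial>count_space I)"
    using A by (subst nn_integral_count_space_nn_integral[OF I]) (auto intro!: nn_integral_cong)
  finally show ?thesis .
qed

lemma emeasure_le_coordinate_spread:
  fixes X :: "(real^'n) set"
  assumes l: "0 \<le> l" and X: "\<And>p q k. p \<in> X \<Longrightarrow> q \<in> X \<Longrightarrow> \<bar>p$k - q$k\<bar> \<le> l"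
  obtains a where "X \<subseteq> cbox a (a + vec l)" "emeasure lborel (cbox a (a + vec l)) = ennreal (l ^ CARD('n))"
proof -
  define a :: "real^'n" where "a = (\<chi> k. Inf ((\<lambda>x. x$k) ` X))"
  have "X \<subseteq> cbox a (a + vec l)"
  proof
    fix p assume p: "p \<in> X"
    have "a$k \<le> p$k \<and> p$k \<le> a$k + l" for k
    proof
      have low: "q$k \<ge> p$k - l" if "q \<in> X" for q using X[OF p that, of k] by simp
      then have "bdd_below ((\<lambda>x. x$k) ` X)" by (auto simp: bdd_below_def)
      then show "a$k \<le> p$k" unfolding a_def using p by (auto intro!: cInf_lower)
      have "p$k - l \<le> Inf ((\<lambda>x. x$k) ` X)" using p low by (intro cInf_greatest) auto
      then show "p$k \<le> a$k + l" by (simp add: a_def)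
    qed
    then show "p \<in> cbox a (a + vec l)" by (simp add: mem_box_cart)
  qed
  moreover have "emeasure lborel (cbox a (a + vec l)) = ennreal (l ^ CARD('n))"
  proof -
    have "emeasure lborel (cbox a (a + vec l)) = emeasure lborel (box a (a + vec l))"
      by (simp add: emeasure_lborel_cbox_eq emeasure_lborel_box_eq)
    also have "\<dots> = ennreal (l ^ CARD('n))" using l by (subst emeasure_lborel_box_cart) auto
    finally show ?thesis .
  qed
  ultimately show thesis using that by blast
qed

text \<open>The part of T in a cube of side s is mapped into a cube of side (1 + \<eta> n) s: the
  map changes differences of coordinates by at most \<eta> times the norm of p - q, and that norm is
  at most n s. Cubes covering T with total measure close to that of T give the estimate.\<close>

lemma emeasure_near_translation_image:
  fixes \<zeta> :: "real^'n \<Rightarrow> real^'n"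
  assumes T: "compact T" and im: "\<zeta> ` T \<in> sets borel" and \<eta>: "\<eta> \<ge> 0"
    and near: "\<And>p q. p \<in> T \<Longrightarrow> q \<in> T \<Longrightarrow> norm (\<zeta> p - \<zeta> q - (p - q)) \<le> \<eta> * norm (p - q)"
  shows "emeasure lborel (\<zeta> ` T) \<le> ennreal ((1 + \<eta> * CARD('n)) ^ CARD('n)) * emeasure lborel T"
proof -
  define c where "c = 1 + \<eta> * CARD('n)"
  have c: "c \<ge> 1" using \<eta> by (simp add: c_def)
  obtain B where B: "B > 0" "\<And>x. x \<in> T \<Longrightarrow> norm x \<le> B"
    using compact_imp_bounded[OF T] by (auto simp: bounded_pos)
  define a b :: "real^'n" where "a = vec (- B)" and "b = vec B"
  have Tab: "T \<subseteq> cbox a b"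
    using B component_le_norm_cart by (auto simp: a_def b_def mem_box_cart abs_le_iff) (smt (verit, best) component_le_norm_cart)+
  have abne: "box a b \<noteq> {}" using B(1) by (auto simp: a_def b_def box_ne_empty inner_vec_def Basis_vec_def inner_axis)
  have Tl: "T \<in> lmeasurable" using T lmeasurable_compact by blast
  have "emeasure lborel (\<zeta> ` T) \<le> ennreal (c ^ CARD('n) * (measure lebesgue T + \<tau>))" if \<tau>: "\<tau> > 0" for \<tau>
  proof -
    obtain \<D> where \<D>: "countable \<D>" "\<And>X. X \<in> \<D> \<Longrightarrow> X \<subseteq> cbox a b \<and> X \<noteq> {} \<and> (\<exists>c d. X = cbox c d)"
        "pairwise (\<lambda>A B. interior A \<inter> interior B = {}) \<D>"
        "\<And>u v. cbox u v \<in> \<D> \<Longrightarrow> \<exists>n. \<forall>i \<in> Basis. v \<bullet> i - u \<bullet> i = (b \<bullet> i - a \<bullet> i)/2^n"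
        "\<And>X. \<lbrakk>X \<in> \<D>; box a b \<noteq> {}\<rbrakk> \<Longrightarrow> interior X \<noteq> {}"
        "T \<subseteq> \<Union>\<D>" "\<Union>\<D> \<in> lmeasurable" "measure lebesgue (\<Union>\<D>) \<le> measure lebesgue T + \<tau>"
      using measurable_outer_intervals_bounded[OF Tl Tab \<tau>] by metis
    have "\<exists>C. \<zeta> ` (T \<inter> X) \<subseteq> C \<and> C \<in> sets borel \<and> emeasure lborel C \<le> ennreal (c ^ CARD('n)) * emeasure lborel (interior X)" if X: "X \<in> \<D>" for X
    proof -
      obtain u v where uv: "X = cbox u v" using \<D>(2)[OF X] by blast
      obtain m where m: "\<And>i. i \<in> Basis \<Longrightarrow> v \<bullet> i - u \<bullet> i = (b \<bullet> i - a \<bullet> i)/2^m" using \<D>(4) X uv by blast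
      define s where "s = 2 * B / 2 ^ m"
      have s: "v$k - u$k = s" for k
      proof -
        have "axis k 1 \<in> (Basis :: (real^'n) set)" by (auto simp: Basis_vec_def)
        from m[OF this] show ?thesis by (simp add: inner_axis a_def b_def s_def)
      qed
      have s0: "s > 0" using B(1) by (simp add: s_def)
      have d: "\<bar>(\<zeta> p)$k - (\<zeta> q)$k\<bar> \<le> c * s" if "p \<in> T \<inter> X" "q \<in> T \<inter> X" for p q k
      proof -
        have pq: "\<bar>(p - q)$j\<bar> \<le> s" for j
        proof -
          have "u$j \<le> p$j" "p$j \<le> v$j" "u$j \<le> q$j" "q$j \<le> v$j" using that uv by (auto simp: mem_box_cart)
          then show ?thesis using s[of j] by (simp add: abs_le_iff)
        qed
        have "norm (p - q) \<le> (\<Sum>j\<in>UNIV. \<bar>(p - q)$j\<bar>)" by (rule norm_le_l1_cart)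
        also have "\<dots> \<le> (\<Sum>j\<in>(UNIV::'n set). s)" by (intro sum_mono pq)
        finally have n: "norm (p - q) \<le> CARD('n) * s" by simp
        have "\<bar>(\<zeta> p - \<zeta> q - (p - q))$k\<bar> \<le> norm (\<zeta> p - \<zeta> q - (p - q))" by (rule component_le_norm_cart)
        also have "\<dots> \<le> \<eta> * norm (p - q)" using near that by auto
        also have "\<dots> \<le> \<eta> * (CARD('n) * s)" using n \<eta> by (rule mult_left_mono)
        finally have "\<bar>(\<zeta> p)$k - (\<zeta> q)$k\<bar> \<le> \<bar>(p - q)$k\<bar> + \<eta> * (CARD('n) * s)" by simp
        also have "\<dots> \<le> s + \<eta> * (CARD('n) * s)" using pq[of k] by simp
        finally show ?thesis by (simp add: c_def algebra_simps)
      qed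
      have "0 \<le> c * s" using c s0 by simp
      then obtain e where e: "\<zeta> ` (T \<inter> X) \<subseteq> cbox e (e + vec (c * s))" "emeasure lborel (cbox e (e + vec (c * s))) = ennreal ((c * s) ^ CARD('n))"
        by (rule emeasure_le_coordinate_spread[where X="\<zeta> ` (T \<inter> X)"]) (use d in auto)
      have "emeasure lborel (interior X) = ennreal (s ^ CARD('n))"
      proof -
        have "u$i \<le> v$i" for i using s[of i] s0 by linarith
        from emeasure_lborel_box_cart[OF this] show ?thesis by (simp add: uv interior_cbox s)
      qed
      then have "emeasure lborel (cbox e (e + vec (c * s))) \<le> ennreal (c ^ CARD('n)) * emeasure lborel (interior X)"
        using c s0 e(2) by (simp add: power_mult_distrib ennreal_mult')
      then show ?thesis using e(1) by (intro exI[of _ "cbox e (e + vec (c * s))"]) auto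
    qed
    then obtain C where C: "\<And>X. X \<in> \<D> \<Longrightarrow> \<zeta> ` (T \<inter> X) \<subseteq> C X" "\<And>X. X \<in> \<D> \<Longrightarrow> C X \<in> sets borel"
      "\<And>X. X \<in> \<D> \<Longrightarrow> emeasure lborel (C X) \<le> ennreal (c ^ CARD('n)) * emeasure lborel (interior X)" by metis
    have "\<zeta> ` T \<subseteq> (\<Union>X\<in>\<D>. C X)"
    proof
      fix z assume "z \<in> \<zeta> ` T"
      then obtain x where x: "x \<in> T" "z = \<zeta> x" by blast
      then obtain X where "X \<in> \<D>" "x \<in> X" using \<D>(6) by blast
      then show "z \<in> (\<Union>X\<in>\<D>. C X)" using C(1)[of X] x by blast
    qed
    then have "emeasure lborel (\<zeta> ` T) \<le> emeasure lborel (\<Union>X\<in>\<D>. C X)"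
      using C(2) \<D>(1) by (intro emeasure_mono) (auto intro!: sets.countable_UN')
    also have "\<dots> \<le> (\<integral>\<^sup>+X. emeasure lborel (C X) \<partial>count_space \<D>)"
      using C(2) by (intro emeasure_UN_le_nn_integral \<D>(1)) auto
    also have "\<dots> \<le> (\<integral>\<^sup>+X. ennreal (c ^ CARD('n)) * emeasure lborel (interior X) \<partial>count_space \<D>)"
      using C(3) by (intro nn_integral_mono) auto
    also have "\<dots> = ennreal (c ^ CARD('n)) * (\<integral>\<^sup>+X. emeasure lborel (interior X) \<partial>count_space \<D>)"
      by (rule nn_integral_cmult) auto
    \<comment> \<open>The cubes overlap only in their frontiers; passing to interiors makes the sum
      of measures the measure of a disjoint union.\<close>
    also have "(\<integral>\<^sup>+X. emeasure lborel (interior X) \<partial>count_space \<D>) = emeasure lborel (\<Union>X\<in>\<D>. interior X)"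
      using \<D>(3) by (intro emeasure_UN_countable[symmetric] \<D>(1)) (auto simp: disjoint_family_on_def pairwise_def)
    also have "\<dots> = emeasure lebesgue (\<Union>X\<in>\<D>. interior X)"
    proof -
      have "(\<Union>X\<in>\<D>. interior X) \<in> sets borel" by (intro borel_open open_UN) auto
      then show ?thesis by simp
    qed
    also have "\<dots> \<le> emeasure lebesgue (\<Union>\<D>)"
      using \<D>(7) interior_subset by (intro emeasure_mono) (auto intro: fmeasurableD)
    also have "\<dots> = ennreal (measure lebesgue (\<Union>\<D>))" using \<D>(7) by (simp add: emeasure_eq_measure2)
    also have "\<dots> \<le> ennreal (measure lebesgue T + \<tau>)" using \<D>(8) by (rule ennreal_leI)
    finally have "emeasure lborel (\<zeta> ` T) \<le> ennreal (c ^ CARD('n)) * ennreal (measure lebesgue T + \<tau>)"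
      by (simp add: mult_left_mono)
    then show ?thesis using c \<tau> by (simp add: ennreal_mult')
  qed
  then have le: "emeasure lborel (\<zeta> ` T) \<le> ennreal (c ^ CARD('n) * (measure lebesgue T + 1 / real (Suc j)))" for j by simp
  have "(\<lambda>j. ennreal (c ^ CARD('n) * (measure lebesgue T + 1 / real (Suc j)))) \<longlonglongrightarrow> ennreal (c ^ CARD('n) * (measure lebesgue T + 0))"
    by (intro tendsto_ennrealI tendsto_intros LIMSEQ_Suc[OF lim_1_over_n])
  then have "emeasure lborel (\<zeta> ` T) \<le> ennreal (c ^ CARD('n) * measure lebesgue T)"
    using le by (intro LIMSEQ_le_const[where X="\<lambda>j. ennreal (c ^ CARD('n) * (measure lebesgue T + 1 / real (Suc j)))"]) auto
  also have "\<dots> = ennreal (c ^ CARD('n)) * emeasure lborel T"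
  proof -
    have "emeasure lborel T = emeasure lebesgue T" using T by (simp add: borel_compact)
    then show ?thesis using Tl c by (simp add: emeasure_eq_measure2 ennreal_mult')
  qed
  finally show ?thesis by (simp add: c_def)
qed

section \<open>The area inequality\<close>

locale w11_injective = w11_local u w K for u :: "real^'n \<Rightarrow> real^'n" and w K +
  assumes inj_u: "inj_on u K"
begin

definition grad where "grad x = (\<chi> i. w i x)"

lemma linear_L: "linear (L c)"
  by (auto intro!: linearI simp: L_def scaleR_add_left sum.distrib scaleR_sum_right)

lemma det_L: "det (matrix (L (($) c))) = det c"
proof -
  have "matrix (L (($) c)) = transpose c"
    by (simp add: matrix_def L_def transpose_def vec_eq_iff axis_def if_distrib[where f="\<lambda>a. a * _"] cong: if_cong)
  then show ?thesis by (simp add: det_transpose)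
qed

text \<open>A lower bound for the measure of the image is obtained by reversing roles: \<zeta> = A
  u^{-1} is close to a translation on the image of T and maps it onto the linear image of T. Since
  \<eta> < 1/2, the norm of A(x - y) is at most twice that of u x - u y, which makes the error 2
  \<eta>; the hypothesis is calibrated so that 2 \<eta> n = \<epsilon>.\<close>

lemma area_piece_compact:
  assumes T: "compact T" "T \<subseteq> K" and \<epsilon>: "0 < \<epsilon>" "\<epsilon> < 1"
    and near: "\<And>x y. x \<in> T \<Longrightarrow> y \<in> T \<Longrightarrow> norm (u x - u y - L (($) c) (x - y)) \<le> \<epsilon> / (2 * CARD('n)) * norm (L (($) c) (x - y))"
  shows "ennreal \<bar>det c\<bar> * emeasure lborel T \<le> ennreal ((1 + \<epsilon>) ^ CARD('n)) * emeasure lborel (u ` T)"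
proof -
  define A where "A = L (($) c)"
  define \<eta> where "\<eta> = \<epsilon> / (2 * CARD('n))"
  have card1: "real CARD('n) \<ge> 1" by (simp add: Suc_leI)
  have "\<eta> \<le> \<epsilon> / 2" unfolding \<eta>_def using \<epsilon> card1 by (intro divide_left_mono) auto
  moreover have "0 < \<eta>" using \<epsilon> by (simp add: \<eta>_def)
  ultimately have \<eta>: "0 < \<eta>" "\<eta> < 1 / 2" using \<epsilon> by linarith+
  define \<zeta> where "\<zeta> z = A (inv_into T u z)" for z
  have inj: "inj_on u T" using inj_u T(2) inj_on_subset by blast
  have z: "\<zeta> (u x) = A x" if "x \<in> T" for x using inj that by (simp add: \<zeta>_def)
  have zim: "\<zeta> ` (u ` T) = A ` T" using z by (auto simp: image_image)
  have cu: "compact (u ` T)"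
    by (intro compact_continuous_image T(1) continuous_on_subset[OF contu T(2)])
  have cA: "compact (A ` T)" unfolding A_def
    by (intro compact_continuous_image T(1) linear_continuous_on linear_conv_bounded_linear[THEN iffD1] linear_L)
  have "emeasure lborel (\<zeta> ` (u ` T)) \<le> ennreal ((1 + (2 * \<eta>) * CARD('n)) ^ CARD('n)) * emeasure lborel (u ` T)"
  proof (rule emeasure_near_translation_image[OF cu])
    show "\<zeta> ` (u ` T) \<in> sets borel" using cA by (simp add: zim borel_compact)
    show "0 \<le> 2 * \<eta>" using \<eta> by simp
    fix p q assume "p \<in> u ` T" "q \<in> u ` T"
    then obtain x y where xy: "x \<in> T" "y \<in> T" "p = u x" "q = u y" by blast
    have lin: "A x - A y = A (x - y)" using linear_diff[OF linear_L] by (simp add: A_def)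
    have 1: "norm (u x - u y - A (x - y)) \<le> \<eta> * norm (A (x - y))"
      using near[OF xy(1,2)] by (simp add: A_def \<eta>_def)
    have "norm (A (x - y)) \<le> norm (u x - u y) + norm (u x - u y - A (x - y))"
      using norm_triangle_ineq4[of "u x - u y" "u x - u y - A (x - y)"] by simp
    with 1 have "norm (A (x - y)) \<le> norm (u x - u y) + \<eta> * norm (A (x - y))" by linarith
    also have "\<eta> * norm (A (x - y)) \<le> (1 / 2) * norm (A (x - y))" using \<eta> by (intro mult_right_mono) auto
    finally have 2: "norm (A (x - y)) \<le> 2 * norm (u x - u y)" by simp
    have "norm (\<zeta> p - \<zeta> q - (p - q)) = norm (u x - u y - A (x - y))"
      using xy z lin by (simp add: norm_minus_commute)
    also have "\<dots> \<le> \<eta> * (2 * norm (u x - u y))" using 1 2 \<eta> by (smt (verit) mult_left_mono)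
    finally show "norm (\<zeta> p - \<zeta> q - (p - q)) \<le> (2 * \<eta>) * norm (p - q)" using xy by simp
  qed
  also have "(2 * \<eta>) * CARD('n) = \<epsilon>" using card1 by (simp add: \<eta>_def)
  finally have 1: "emeasure lborel (A ` T) \<le> ennreal ((1 + \<epsilon>) ^ CARD('n)) * emeasure lborel (u ` T)"
    by (simp add: zim)
  have Tl: "T \<in> lmeasurable" using T lmeasurable_compact by blast
  have "emeasure lborel (A ` T) = emeasure lebesgue (A ` T)" using cA by (simp add: borel_compact)
  also have "\<dots> = ennreal (\<bar>det (matrix A)\<bar> * measure lebesgue T)"
    using measure_linear_image_finite[OF linear_L Tl, of "($) c"] by (simp add: A_def emeasure_eq_measure2)
  also have "\<dots> = ennreal \<bar>det c\<bar> * emeasure lborel T"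
  proof -
    have "emeasure lborel T = emeasure lebesgue T" using T by (simp add: borel_compact)
    then show ?thesis using Tl det_L by (simp add: emeasure_eq_measure2 ennreal_mult' A_def)
  qed
  finally show ?thesis using 1 by simp
qed

text \<open>Inner regularity exhausts Y by compact sets up to a null set. The image of that null set
  may be large or non-measurable, so the conclusion refers only to the sigma-compact part
  Y'.\<close>

lemma area_piece:
  assumes F: "F \<subseteq> K" and Y: "Y \<in> sets borel" "Y \<subseteq> F" and \<epsilon>: "0 < \<epsilon>" "\<epsilon> < 1"
    and near: "\<And>x y. x \<in> F \<Longrightarrow> y \<in> F \<Longrightarrow> norm (u x - u y - L (($) c) (x - y)) \<le> \<epsilon> / (2 * CARD('n)) * norm (L (($) c) (x - y))"
  obtains Y' where "Y' \<subseteq> Y" "u ` Y' \<in> sets borel"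
    "ennreal \<bar>det c\<bar> * emeasure lborel Y \<le> ennreal ((1 + \<epsilon>) ^ CARD('n)) * emeasure lborel (u ` Y')"
proof -
  have "Y \<in> sets lebesgue" using Y(1) by simp
  then obtain N C where NC: "negligible N" "\<And>n::nat. compact (C n)" "Y = (\<Union>n. C n) \<union> N"
    using lebesgue_regular_inner by metis
  define B where "B m = (\<Union>n\<le>m. C n)" for m :: nat
  define Y' where "Y' = (\<Union>n. C n)"
  have BY: "B m \<subseteq> Y'" "(\<Union>m. B m) = Y'" for m by (auto simp: B_def Y'_def)
  have Bc: "compact (B m)" for m unfolding B_def using NC(2) by (intro compact_UN) auto
  have Y'F: "Y' \<subseteq> F" using NC(3) Y(2) by (auto simp: Y'_def)
  have Y'b: "Y' \<in> sets borel" unfolding Y'_def using NC(2) by (auto simp: borel_compact)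
  have uY': "u ` Y' \<in> sets borel"
  proof -
    have "u ` Y' = (\<Union>n. u ` C n)" by (auto simp: Y'_def)
    moreover have "compact (u ` C n)" for n
      using Y'F F by (intro compact_continuous_image NC(2) continuous_on_subset[OF contu]) (auto simp: Y'_def)
    ultimately show ?thesis by (auto simp: borel_compact)
  qed
  have le: "ennreal \<bar>det c\<bar> * emeasure lborel (B m) \<le> ennreal ((1 + \<epsilon>) ^ CARD('n)) * emeasure lborel (u ` Y')" for m
  proof -
    have "ennreal \<bar>det c\<bar> * emeasure lborel (B m) \<le> ennreal ((1 + \<epsilon>) ^ CARD('n)) * emeasure lborel (u ` B m)"
      using BY(1)[of m] Y'F F by (intro area_piece_compact[OF Bc _ \<epsilon>] near) blast+
    also have "\<dots> \<le> ennreal ((1 + \<epsilon>) ^ CARD('n)) * emeasure lborel (u ` Y')"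
      using BY(1) uY' by (intro mult_left_mono emeasure_mono) auto
    finally show ?thesis .
  qed
  have "emeasure lborel Y = emeasure lborel Y'"
  proof -
    have n: "N \<in> null_sets lebesgue" using NC(1) by (simp add: negligible_iff_null_sets)
    have "emeasure lebesgue (Y' \<union> N) = emeasure lebesgue Y'"
      using n Y'b by (intro emeasure_Un_null_set) auto
    then show ?thesis using NC(3) Y(1) Y'b by (simp add: Y'_def)
  qed
  moreover have "(\<lambda>m. ennreal \<bar>det c\<bar> * emeasure lborel (B m)) \<longlonglongrightarrow> ennreal \<bar>det c\<bar> * emeasure lborel Y'"
  proof (intro ennreal_tendsto_cmult)
    show "(\<lambda>m. emeasure lborel (B m)) \<longlonglongrightarrow> emeasure lborel Y'"
      unfolding BY(2)[symmetric]
    proof (rule Lim_emeasure_incseq)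
      show "incseq B"
      proof (rule incseq_SucI)
        show "B m \<subseteq> B (Suc m)" for m unfolding B_def by (rule UN_mono) auto
      qed
    qed (use Bc in \<open>auto simp: borel_compact\<close>)
  qed simp
  ultimately have "ennreal \<bar>det c\<bar> * emeasure lborel Y \<le> ennreal ((1 + \<epsilon>) ^ CARD('n)) * emeasure lborel (u ` Y')"
    using le by (intro LIMSEQ_le_const2[where X="\<lambda>m. ennreal \<bar>det c\<bar> * emeasure lborel (B m)"]) auto
  then show thesis using that[of Y'] uY' NC(3) by (auto simp: Y'_def)
qed

text \<open>\<open>c\<close> will run through a countable dense set, and
  \<open>1 / real (Suc k)\<close> is the tolerance. The first condition compares determinants of
  nearby matrices with that of \<open>c\<close>; the second turns the Lipschitz error of the pieces
  into an error relative to \<open>L\<close> of \<open>c\<close>, and it forces \<open>c\<close> to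
  be invertible.\<close>

definition good_pair :: "real \<Rightarrow> real^'n^'n \<Rightarrow> nat \<Rightarrow> bool" where
  "good_pair \<epsilon> c k \<longleftrightarrow>
     (\<forall>A. (\<Sum>i\<in>UNIV. norm (A$i - c$i)) < 1 / real (Suc k) \<longrightarrow> \<bar>det A\<bar> \<le> (1 + \<epsilon>) * \<bar>det c\<bar>) \<and>
     (\<forall>h. 2 * steep * (1 / real (Suc k)) * norm h \<le> \<epsilon> / (2 * CARD('n)) * norm (L (($) c) h))"

lemma norm_le_sum_rows: "norm (A :: real^'n^'n) \<le> (\<Sum>i\<in>UNIV. norm (A$i))"
  by (simp add: norm_vec_def L2_set_le_sum)

text \<open>The determinant is continuous, and an invertible A satisfies a lower bound \<mu> |h| for
  the image of h, half of which survives for nearby matrices. So matrices close enough to A qualify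
  with a fine enough tolerance.\<close>

lemma ex_good_pair:
  fixes A :: "real^'n^'n"
  assumes A: "det A \<noteq> 0" and \<epsilon>: "0 < \<epsilon>" "\<epsilon> < 1" and dense: "\<And>X :: (real^'n^'n) set. open X \<Longrightarrow> X \<noteq> {} \<Longrightarrow> \<exists>q\<in>Q. q \<in> X"
  obtains c k where "c \<in> Q" "good_pair \<epsilon> c k" "(\<Sum>i\<in>UNIV. norm (A$i - c$i)) < 1 / real (Suc k)"
proof -
  define a where "a = \<bar>det A\<bar>"
  have a: "a > 0" using A by (simp add: a_def)
  have cdet: "continuous_on UNIV (det :: real^'n^'n \<Rightarrow> real)"
    unfolding det_def by (intro continuous_intros)
  have steep: "steep > 0" by (simp add: steep_def)
  obtain \<delta> where \<delta>: "\<delta> > 0" "\<And>A'. dist A' A < \<delta> \<Longrightarrow> dist (det A') (det A) < a * (\<epsilon> / 4)"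
    using cdet[unfolded continuous_on_iff, rule_format, of A "a * (\<epsilon> / 4)"] a \<epsilon> by auto
  have injA: "inj (L (($) A))"
    using det_nz_iff_inj[OF linear_L, of "($) A"] A det_L[of A] by simp
  obtain \<mu> where \<mu>: "\<mu> > 0" "\<And>h. \<mu> * norm h \<le> norm (L (($) A) h)"
    using linear_inj_bounded_below_pos[OF linear_L injA] by (metis mult.commute)
  have pos: "0 < min (\<delta> / 2) (\<mu> / 2 * \<epsilon> / (4 * steep * CARD('n)))"
    using \<delta>(1) \<mu>(1) \<epsilon> steep by simp
  obtain k where "1 / real (Suc k) < min (\<delta> / 2) (\<mu> / 2 * \<epsilon> / (4 * steep * CARD('n)))"
    by (rule nat_approx_posE[OF pos])
  \<comment> \<open>\<delta>/2 because two such distances are added; the second bound makes 2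
    \<open>steep\<close> / \<open>Suc k\<close> at most (\<epsilon>/(2 n)) (\<mu>/2).\<close>
  then have k: "1 / real (Suc k) < \<delta> / 2" "1 / real (Suc k) < \<mu> / 2 * \<epsilon> / (4 * steep * CARD('n))" by auto
  \<comment> \<open>The entry \<mu>/2 preserves half of the lower bound for A when A is replaced by
    \<open>c\<close>.\<close>
  define \<kappa> where "\<kappa> = min (1 / real (Suc k)) (\<mu> / 2)"
  have \<kappa>: "\<kappa> > 0" using \<mu> by (simp add: \<kappa>_def)
  have op: "open {c :: real^'n^'n. (\<Sum>i\<in>UNIV. norm (A$i - c$i)) < \<kappa>}"
    by (intro open_Collect_less continuous_intros)
  obtain c where c: "c \<in> Q" "(\<Sum>i\<in>UNIV. norm (A$i - c$i)) < \<kappa>"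
  proof -
    have "A \<in> {c :: real^'n^'n. (\<Sum>i\<in>UNIV. norm (A$i - c$i)) < \<kappa>}" using \<kappa> by simp
    then have "\<exists>q\<in>Q. q \<in> {c :: real^'n^'n. (\<Sum>i\<in>UNIV. norm (A$i - c$i)) < \<kappa>}" by (intro dense op) blast
    then show thesis using that by blast
  qed
  have ck: "(\<Sum>i\<in>UNIV. norm (A$i - c$i)) < 1 / real (Suc k)" using c(2) by (simp add: \<kappa>_def)
  have det_close: "\<bar>det A'\<bar> \<le> a * (1 + \<epsilon> / 4)" "a * (1 - \<epsilon> / 4) \<le> \<bar>det A'\<bar>" if "dist A' A < \<delta>" for A'
    using \<delta>(2)[OF that] by (auto simp: a_def dist_real_def algebra_simps abs_if split: if_splits)
  have distc: "dist c A < \<delta>"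
  proof -
    have "dist c A \<le> (\<Sum>i\<in>UNIV. norm (A$i - c$i))"
      using norm_le_sum_rows[of "A - c"] by (simp add: dist_norm norm_minus_commute)
    then show ?thesis using ck k(1) \<delta>(1) by simp
  qed
  have "good_pair \<epsilon> c k" unfolding good_pair_def
  proof (intro conjI allI impI)
    fix A' :: "real^'n^'n" assume A': "(\<Sum>i\<in>UNIV. norm (A'$i - c$i)) < 1 / real (Suc k)"
    have "dist A' A \<le> dist A' c + dist c A" by (rule dist_triangle)
    also have "\<dots> \<le> (\<Sum>i\<in>UNIV. norm (A'$i - c$i)) + (\<Sum>i\<in>UNIV. norm (A$i - c$i))"
      using norm_le_sum_rows[of "A - c"] norm_le_sum_rows[of "A' - c"] by (simp add: dist_norm norm_minus_commute)
    also have "\<dots> < \<delta>" using A' ck k(1) by simp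
    finally have "\<bar>det A'\<bar> \<le> a * (1 + \<epsilon> / 4)" by (rule det_close)
    also have "\<dots> \<le> (1 + \<epsilon>) * (a * (1 - \<epsilon> / 4))"
    proof -
      \<comment> \<open>The assumption \<epsilon> < 1 enters through \<epsilon>^2 \<le>
        \<epsilon>.\<close>
      have "1 + \<epsilon> / 4 \<le> (1 + \<epsilon>) * (1 - \<epsilon> / 4)"
      proof -
        have "\<epsilon> * \<epsilon> \<le> \<epsilon> * 1" using \<epsilon> by (intro mult_left_mono) auto
        moreover have "(1 + \<epsilon>) * (1 - \<epsilon> / 4) = 1 + 3 * \<epsilon> / 4 - \<epsilon> * \<epsilon> / 4" by (simp add: field_simps)
        ultimately show ?thesis using \<epsilon> by linarith
      qed
      then show ?thesis using a mult_left_mono[of "1 + \<epsilon> / 4" "(1 + \<epsilon>) * (1 - \<epsilon> / 4)" a] by (simp add: mult_ac)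
    qed
    also have "\<dots> \<le> (1 + \<epsilon>) * \<bar>det c\<bar>" using det_close(2)[OF distc] \<epsilon> by (intro mult_left_mono) auto
    finally show "\<bar>det A'\<bar> \<le> (1 + \<epsilon>) * \<bar>det c\<bar>" .
  next
    fix h :: "real^'n"
    have "norm (L (($) A) h - L (($) c) h) = norm (\<Sum>i\<in>UNIV. h$i *\<^sub>R (A$i - c$i))"
      by (simp add: L_def sum_subtractf scaleR_diff_right)
    also have "\<dots> \<le> (\<Sum>i\<in>UNIV. norm h * norm (A$i - c$i))"
      by (intro order_trans[OF norm_sum] sum_mono) (auto intro!: mult_right_mono component_le_norm_cart)
    also have "\<dots> = norm h * (\<Sum>i\<in>UNIV. norm (A$i - c$i))" by (simp add: sum_distrib_left)
    also have "\<dots> \<le> norm h * (\<mu> / 2)" using c(2) by (intro mult_left_mono) (auto simp: \<kappa>_def)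
    finally have "\<mu> / 2 * norm h \<le> norm (L (($) c) h)"
      using \<mu>(2)[of h] norm_triangle_ineq2[of "L (($) A) h" "L (($) c) h"] by (simp add: algebra_simps)
    then have "\<epsilon> / (2 * CARD('n)) * (\<mu> / 2 * norm h) \<le> \<epsilon> / (2 * CARD('n)) * norm (L (($) c) h)"
      using \<epsilon> by (intro mult_left_mono) auto
    moreover have "2 * steep * (1 / real (Suc k)) * norm h \<le> \<epsilon> / (2 * CARD('n)) * (\<mu> / 2 * norm h)"
    proof -
      have "2 * steep * (1 / real (Suc k)) \<le> 2 * steep * (\<mu> / 2 * \<epsilon> / (4 * steep * CARD('n)))"
        using k(2) steep by (intro mult_left_mono) auto
      also have "\<dots> = \<epsilon> / (2 * CARD('n)) * (\<mu> / 2)" using steep by (simp add: field_simps)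
      finally have "2 * steep * (1 / real (Suc k)) * norm h \<le> \<epsilon> / (2 * CARD('n)) * (\<mu> / 2) * norm h"
        by (rule mult_right_mono) simp
      then show ?thesis by (simp only: mult.assoc)
    qed
    ultimately show "2 * steep * (1 / real (Suc k)) * norm h \<le> \<epsilon> / (2 * CARD('n)) * norm (L (($) c) h)" by linarith
  qed
  then show thesis using that c(1) ck by blast
qed

lemma measurable_grad [measurable]: "(\<lambda>x. det (grad x)) \<in> borel_measurable borel"
proof -
  have cdet: "continuous_on UNIV (det :: real^'n^'n \<Rightarrow> real)"
    unfolding det_def by (intro continuous_intros)
  have "grad \<in> borel_measurable borel"
  proof -
    have "continuous_on UNIV (axis i :: real^'n \<Rightarrow> real^'n^'n)" for i :: 'n
      by (intro linear_continuous_on linear_conv_bounded_linear[THEN iffD1] linearI) (auto simp: axis_def vec_eq_iff)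
    then have "(\<lambda>x. axis i (w i x)) \<in> borel_measurable borel" for i
      by (intro measurable_compose[OF measurable_U_w(3)] borel_measurable_continuous_onI)
    then have "(\<lambda>x. \<Sum>i\<in>UNIV. axis i (w i x)) \<in> borel_measurable borel"
      by (intro borel_measurable_sum)
    moreover have "(\<Sum>i\<in>UNIV. axis i (w i x)) = grad x" for x
      by (simp add: grad_def vec_eq_iff axis_def if_distrib[where f="\<lambda>a. a $ _"] cong: if_cong)
    ultimately show ?thesis by simp
  qed
  then show ?thesis by (rule measurable_compose[OF _ borel_measurable_continuous_onI[OF cdet]])
qed

text \<open>Points where the weak gradient is singular contribute nothing. All others lie, up to a
  null set, in pieces indexed by a matrix from a countable dense set, a tolerance and a number. On
  each piece the integrand is at most (1 + \<epsilon>) times a constant determinant, and the image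
  is estimated from below. After the pieces are made disjoint, injectivity makes their images
  disjoint, so the estimates add up inside the image of K.\<close>

lemma area_le_eps:
  assumes V: "open V" and sub: "\<And>x. x \<in> V \<Longrightarrow> cball x \<rho> \<subseteq> K" and \<rho>: "\<rho> > 0" and \<epsilon>: "0 < \<epsilon>" "\<epsilon> < 1"
  shows "(\<integral>\<^sup>+x\<in>V. \<bar>det (grad x)\<bar> \<partial>lborel) \<le> ennreal ((1 + \<epsilon>) * (1 + \<epsilon>) ^ CARD('n)) * emeasure lborel (u ` K)"
proof -
  obtain Q :: "(real^'n^'n) set" where Q: "countable Q" "\<And>X. open X \<Longrightarrow> X \<noteq> {} \<Longrightarrow> \<exists>q\<in>Q. q \<in> X"
    using countable_dense_setE by metis
  have VK: "V \<subseteq> K"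
  proof
    fix x assume "x \<in> V" then show "x \<in> K" using sub[of x] \<rho> by auto
  qed
  define pieces where "pieces c k F \<longleftrightarrow> (\<forall>l. compact (F l) \<and> F l \<subseteq> K) \<and>
     (\<forall>l. \<forall>x\<in>F l. \<forall>y\<in>F l. norm (u x - u y - L (($) c) (x - y)) \<le> 2 * steep * (1 / real (Suc k)) * norm (x - y)) \<and>
     (AE x in lebesgue. x \<in> V \<and> dev (($) c) x < 1 / real (Suc k) \<longrightarrow> x \<in> (\<Union>l. F l))"
    for c :: "real^'n^'n" and k and F :: "nat \<Rightarrow> (real^'n) set"
  have "\<exists>F. pieces c k F" for c k
  proof -
    have k0: "0 < 1 / real (Suc k)" by simp
    show ?thesis
    proof (rule lipschitz_pieces[OF V sub \<rho> k0, of "($) c"])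
      fix F :: "nat \<Rightarrow> (real^'n) set"
      assume F: "\<And>l. compact (F l)" "\<And>l. F l \<subseteq> K"
        "\<And>l x y. x \<in> F l \<Longrightarrow> y \<in> F l \<Longrightarrow> norm (u x - u y - L (($) c) (x - y)) \<le> 2 * steep * (1 / real (Suc k)) * norm (x - y)"
        "AE x in lebesgue. x \<in> V \<and> dev (($) c) x < 1 / real (Suc k) \<longrightarrow> x \<in> (\<Union>l. F l)"
      have "pieces c k F" unfolding pieces_def using F(1-3) by (intro conjI F(4)) simp_all
      then show ?thesis by blast
    qed
  qed
  then obtain F where pF: "\<And>c k. pieces c k (F c k)" by metis
  have F: "compact (F c k l)" "F c k l \<subseteq> K"
    "x \<in> F c k l \<Longrightarrow> y \<in> F c k l \<Longrightarrow> norm (u x - u y - L (($) c) (x - y)) \<le> 2 * steep * (1 / real (Suc k)) * norm (x - y)"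
    "AE x in lebesgue. x \<in> V \<and> dev (($) c) x < 1 / real (Suc k) \<longrightarrow> x \<in> (\<Union>l. F c k l)" for c k l x y
  proof -
    note p = pF[of c k, unfolded pieces_def]
    show "compact (F c k l)" "F c k l \<subseteq> K" using p[THEN conjunct1] by blast+
    show "AE x in lebesgue. x \<in> V \<and> dev (($) c) x < 1 / real (Suc k) \<longrightarrow> x \<in> (\<Union>l. F c k l)"
      by (rule p[THEN conjunct2, THEN conjunct2])
    show "norm (u x - u y - L (($) c) (x - y)) \<le> 2 * steep * (1 / real (Suc k)) * norm (x - y)"
      if "x \<in> F c k l" "y \<in> F c k l"
      using p[THEN conjunct2, THEN conjunct1, rule_format, OF that] .
  qed
  define I where "I = {(c, k, l :: nat). c \<in> Q \<and> good_pair \<epsilon> c k}"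
  have cI: "countable I"
  proof -
    have "I \<subseteq> Q \<times> (UNIV :: (nat \<times> nat) set)" by (auto simp: I_def)
    then show ?thesis by (rule countable_subset) (intro countable_SIGMA Q(1) countableI_type)
  qed
  define Z where "Z = (\<lambda>(c, k, l). {x \<in> F c k l \<inter> V. dev (($) c) x < 1 / real (Suc k)})"
  have Zb: "Z i \<in> sets borel" for i
  proof -
    obtain c k l where i: "i = (c, k, l)" by (cases i) auto
    have 1: "{x \<in> space borel. dev (($) c) x < 1 / real (Suc k)} \<in> sets borel" by measurable
    have 2: "F c k l \<in> sets borel" "V \<in> sets borel" using F(1) V by (auto simp: borel_compact)
    have "Z i = F c k l \<inter> V \<inter> {x \<in> space borel. dev (($) c) x < 1 / real (Suc k)}" by (auto simp: Z_def i)
    then show ?thesis using 1 2 by (simp only: sets.Int)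
  qed
  define e where "e = from_nat_into I"
  \<comment> \<open>\<open>from_nat_into\<close> is unspecified on the empty set, hence the case
    distinction.\<close>
  define Y where "Y j = (if I = {} then {} else disjointed (\<lambda>j. Z (e j)) j)" for j
  have Yb[measurable]: "Y j \<in> sets borel" for j
    unfolding Y_def disjointed_def using Zb by auto
  have Ydisj: "disjoint_family Y"
    using disjoint_family_disjointed[of "\<lambda>j. Z (e j)"] by (cases "I = {}") (auto simp: Y_def disjoint_family_on_def)
  have YU: "(\<Union>j. Y j) = (\<Union>i\<in>I. Z i)"
  proof (cases "I = {}")
    case False
    have "(\<Union>j. Y j) = (\<Union>j. Z (e j))" using False by (simp add: Y_def UN_disjointed_eq)
    also have "\<dots> = (\<Union>i\<in>range e. Z i)" by blast
    also have "range e = I" unfolding e_def by (rule range_from_nat_into[OF False cI])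
    finally show ?thesis .
  qed (simp add: Y_def)
  have YK: "Y j \<subseteq> K" for j using YU VK by (auto simp: Z_def split: prod.splits)
  have piece: "\<exists>Y'. Y' \<subseteq> Y j \<and> u ` Y' \<in> sets borel \<and> (\<integral>\<^sup>+x\<in>Y j. \<bar>det (grad x)\<bar> \<partial>lborel) \<le> ennreal ((1 + \<epsilon>) * (1 + \<epsilon>) ^ CARD('n)) * emeasure lborel (u ` Y')" for j
  proof (cases "I = {}")
    case False
    obtain c k l where ckl: "e j = (c, k, l)" by (cases "e j") auto
    have "e j \<in> I" using False by (simp add: e_def from_nat_into)
    then have good: "good_pair \<epsilon> c k" by (simp add: ckl I_def)
    have YZ: "Y j \<subseteq> Z (c, k, l)" using False disjointed_subset[of "\<lambda>j. Z (e j)" j] by (simp add: Y_def ckl)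
    then have YF: "Y j \<subseteq> F c k l" by (auto simp: Z_def)
    have near: "norm (u x - u y - L (($) c) (x - y)) \<le> \<epsilon> / (2 * CARD('n)) * norm (L (($) c) (x - y))"
      if "x \<in> F c k l" "y \<in> F c k l" for x y
      by (rule order_trans[OF F(3)[OF that] good[unfolded good_pair_def, THEN conjunct2, rule_format]])
    obtain Y' where Y': "Y' \<subseteq> Y j" "u ` Y' \<in> sets borel"
      "ennreal \<bar>det c\<bar> * emeasure lborel (Y j) \<le> ennreal ((1 + \<epsilon>) ^ CARD('n)) * emeasure lborel (u ` Y')"
      by (rule area_piece[OF F(2) Yb YF \<epsilon> near])
    have "(\<integral>\<^sup>+x\<in>Y j. \<bar>det (grad x)\<bar> \<partial>lborel) \<le> (\<integral>\<^sup>+x. ennreal ((1 + \<epsilon>) * \<bar>det c\<bar>) * indicator (Y j) x \<partial>lborel)"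
    proof (rule nn_integral_mono)
      fix x
      show "ennreal \<bar>det (grad x)\<bar> * indicator (Y j) x \<le> ennreal ((1 + \<epsilon>) * \<bar>det c\<bar>) * indicator (Y j) x"
      proof (cases "x \<in> Y j")
        case True
        then have "x \<in> K" "dev (($) c) x < 1 / real (Suc k)" using YZ VK by (auto simp: Z_def)
        then have "(\<Sum>i\<in>UNIV. norm (grad x $ i - c $ i)) < 1 / real (Suc k)" by (simp add: dev_def grad_def)
        then have "\<bar>det (grad x)\<bar> \<le> (1 + \<epsilon>) * \<bar>det c\<bar>" using good by (simp add: good_pair_def)
        then show ?thesis using True by (simp add: ennreal_leI)
      qed simp
    qed
    also have "\<dots> = ennreal (1 + \<epsilon>) * (ennreal \<bar>det c\<bar> * emeasure lborel (Y j))"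
    proof -
      have "ennreal ((1 + \<epsilon>) * \<bar>det c\<bar>) = ennreal (1 + \<epsilon>) * ennreal \<bar>det c\<bar>"
        using \<epsilon> by (intro ennreal_mult) auto
      moreover have "Y j \<in> sets lborel" by simp
      ultimately show ?thesis by (simp only: nn_integral_cmult_indicator) (simp only: mult.assoc)
    qed
    also have "\<dots> \<le> ennreal (1 + \<epsilon>) * (ennreal ((1 + \<epsilon>) ^ CARD('n)) * emeasure lborel (u ` Y'))"
      by (intro mult_left_mono Y') auto
    also have "\<dots> = ennreal ((1 + \<epsilon>) * (1 + \<epsilon>) ^ CARD('n)) * emeasure lborel (u ` Y')"
    proof -
      have "ennreal ((1 + \<epsilon>) * (1 + \<epsilon>) ^ CARD('n)) = ennreal (1 + \<epsilon>) * ennreal ((1 + \<epsilon>) ^ CARD('n))"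
        using \<epsilon> by (intro ennreal_mult) auto
      then show ?thesis by (simp only: mult.assoc)
    qed
    finally show ?thesis using Y' by blast
  qed (auto simp: Y_def)
  then have "\<forall>j. \<exists>Y'. Y' \<subseteq> Y j \<and> u ` Y' \<in> sets borel \<and> (\<integral>\<^sup>+x\<in>Y j. \<bar>det (grad x)\<bar> \<partial>lborel) \<le> ennreal ((1 + \<epsilon>) * (1 + \<epsilon>) ^ CARD('n)) * emeasure lborel (u ` Y')"
    by (rule allI)
  from choice[OF this] obtain Y' where Y'': "\<forall>j. Y' j \<subseteq> Y j \<and> u ` Y' j \<in> sets borel \<and> (\<integral>\<^sup>+x\<in>Y j. \<bar>det (grad x)\<bar> \<partial>lborel) \<le> ennreal ((1 + \<epsilon>) * (1 + \<epsilon>) ^ CARD('n)) * emeasure lborel (u ` Y' j)"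
    by (rule exE)
  have Y': "Y' j \<subseteq> Y j" "u ` Y' j \<in> sets borel"
    "(\<integral>\<^sup>+x\<in>Y j. \<bar>det (grad x)\<bar> \<partial>lborel) \<le> ennreal ((1 + \<epsilon>) * (1 + \<epsilon>) ^ CARD('n)) * emeasure lborel (u ` Y' j)" for j
  proof -
    note p = Y''[THEN spec, of j]
    show "Y' j \<subseteq> Y j" by (rule p[THEN conjunct1])
    show "u ` Y' j \<in> sets borel" by (rule p[THEN conjunct2, THEN conjunct1])
    show "(\<integral>\<^sup>+x\<in>Y j. \<bar>det (grad x)\<bar> \<partial>lborel) \<le> ennreal ((1 + \<epsilon>) * (1 + \<epsilon>) ^ CARD('n)) * emeasure lborel (u ` Y' j)"
      by (rule p[THEN conjunct2, THEN conjunct2])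
  qed
  \<comment> \<open>Almost everywhere in \<open>V\<close> outside the pieces the integrand vanishes,
    so the integral over \<open>V\<close> is bounded by the one over the pieces.\<close>
  have cover: "AE x in lborel. x \<in> V \<longrightarrow> det (grad x) \<noteq> 0 \<longrightarrow> x \<in> (\<Union>j. Y j)"
  proof -
    have "AE x in lebesgue. \<forall>i\<in>Q \<times> (UNIV::nat set). x \<in> V \<and> dev (($) (fst i)) x < 1 / real (Suc (snd i)) \<longrightarrow> x \<in> (\<Union>l. F (fst i) (snd i) l)"
      using Q(1) F(4) by (subst AE_ball_countable) auto
    then have "AE x in lebesgue. x \<in> V \<longrightarrow> det (grad x) \<noteq> 0 \<longrightarrow> x \<in> (\<Union>j. Y j)"
    proof (rule eventually_mono, intro impI)
      fix x assume all: "\<forall>i\<in>Q \<times> (UNIV::nat set). x \<in> V \<and> dev (($) (fst i)) x < 1 / real (Suc (snd i)) \<longrightarrow> x \<in> (\<Union>l. F (fst i) (snd i) l)"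
        and x: "x \<in> V" "det (grad x) \<noteq> 0"
      obtain c k where ck: "c \<in> Q" "good_pair \<epsilon> c k" "(\<Sum>i\<in>UNIV. norm (grad x $ i - c $ i)) < 1 / real (Suc k)"
        using ex_good_pair[OF x(2) \<epsilon> Q(2)] by blast
      have d: "dev (($) c) x < 1 / real (Suc k)" using ck(3) x VK by (auto simp: dev_def grad_def)
      then obtain l where l: "x \<in> F c k l" using all x ck(1) by force
      then have "x \<in> Z (c, k, l)" using d x by (simp add: Z_def)
      moreover have "(c, k, l) \<in> I" using ck by (simp add: I_def)
      ultimately show "x \<in> (\<Union>j. Y j)" unfolding YU by blast
    qed
    then show ?thesis using V by (subst (asm) AE_completion_iff) auto
  qed
  have "(\<integral>\<^sup>+x\<in>V. \<bar>det (grad x)\<bar> \<partial>lborel) \<le> (\<integral>\<^sup>+x\<in>(\<Union>j. Y j). \<bar>det (grad x)\<bar> \<partial>lborel)"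
    using cover by (intro nn_integral_mono_AE) (auto simp: indicator_def elim!: eventually_mono)
  also have "\<dots> = emeasure (density lborel (\<lambda>x. ennreal \<bar>det (grad x)\<bar>)) (\<Union>j. Y j)"
    by (subst emeasure_density) auto
  also have "\<dots> = (\<Sum>j. emeasure (density lborel (\<lambda>x. ennreal \<bar>det (grad x)\<bar>)) (Y j))"
    using Ydisj by (intro suminf_emeasure[symmetric]) auto
  also have "\<dots> = (\<Sum>j. \<integral>\<^sup>+x\<in>Y j. \<bar>det (grad x)\<bar> \<partial>lborel)"
    by (subst emeasure_density) auto
  also have "\<dots> \<le> (\<Sum>j. ennreal ((1 + \<epsilon>) * (1 + \<epsilon>) ^ CARD('n)) * emeasure lborel (u ` Y' j))"
    by (intro suminf_le Y' summableI)
  also have "\<dots> = ennreal ((1 + \<epsilon>) * (1 + \<epsilon>) ^ CARD('n)) * (\<Sum>j. emeasure lborel (u ` Y' j))" by simp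
  also have "(\<Sum>j. emeasure lborel (u ` Y' j)) = emeasure lborel (\<Union>j. u ` Y' j)"
  proof (rule suminf_emeasure)
    show "disjoint_family (\<lambda>j. u ` Y' j)" unfolding disjoint_family_on_def
    proof (intro ballI impI)
      fix i j :: nat assume "i \<noteq> j"
      then have "Y' i \<inter> Y' j = {}" using Ydisj Y'(1) unfolding disjoint_family_on_def by blast
      moreover have "Y' i \<subseteq> K" "Y' j \<subseteq> K" using Y'(1) YK by blast+
      ultimately show "u ` Y' i \<inter> u ` Y' j = {}" using inj_on_image_Int[OF inj_u, of "Y' i" "Y' j"] by simp
    qed
  qed (use Y'(2) in auto)
  also have "\<dots> \<le> emeasure lborel (u ` K)"
  proof (rule emeasure_mono)
    have "compact (u ` K)" by (intro compact_continuous_image contu compactK)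
    then show "u ` K \<in> sets lborel" by (simp add: borel_compact)
    show "(\<Union>j. u ` Y' j) \<subseteq> u ` K" using Y'(1) YK by blast
  qed
  finally show ?thesis by (simp add: mult_left_mono)
qed

lemma area_le:
  assumes V: "open V" and sub: "\<And>x. x \<in> V \<Longrightarrow> cball x \<rho> \<subseteq> K" and \<rho>: "\<rho> > 0"
  shows "(\<integral>\<^sup>+x\<in>V. \<bar>det (grad x)\<bar> \<partial>lborel) \<le> emeasure lborel (u ` K)"
proof -
  have "compact (u ` K)" by (intro compact_continuous_image contu compactK)
  then have "emeasure lborel (u ` K) < \<infinity>" by (rule emeasure_compact_finite)
  then obtain m where m: "emeasure lborel (u ` K) = ennreal m" "m \<ge> 0"
    by (metis emeasure_eq_ennreal_measure infinity_ennreal_def less_irrefl measure_nonneg)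
  define \<epsilon> where "\<epsilon> j = 1 / real (Suc (Suc j))" for j
  have le: "(\<integral>\<^sup>+x\<in>V. \<bar>det (grad x)\<bar> \<partial>lborel) \<le> ennreal ((1 + \<epsilon> j) * (1 + \<epsilon> j) ^ CARD('n) * m)" for j
    using area_le_eps[OF V sub \<rho>, of "\<epsilon> j"] m by (simp add: \<epsilon>_def ennreal_mult')
  have "\<epsilon> \<longlonglongrightarrow> 0" unfolding \<epsilon>_def using LIMSEQ_Suc[OF LIMSEQ_Suc[OF lim_1_over_n]] by simp
  then have "(\<lambda>j. ennreal ((1 + \<epsilon> j) * (1 + \<epsilon> j) ^ CARD('n) * m)) \<longlonglongrightarrow> ennreal ((1 + 0) * (1 + 0) ^ CARD('n) * m)"
    by (intro tendsto_ennrealI tendsto_intros)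
  then have "(\<integral>\<^sup>+x\<in>V. \<bar>det (grad x)\<bar> \<partial>lborel) \<le> ennreal ((1 + 0) * (1 + 0) ^ CARD('n) * m)"
    using le by (intro LIMSEQ_le_const) auto
  then show ?thesis using m by simp
qed

end

section \<open>Equi-integrability\<close>

text \<open>A uniform L^1 bound together with uniform absolute continuity. The index type is
  arbitrary, so that families indexed by pairs, such as difference quotients of a sequence, are
  covered.\<close>

definition equi_int :: "'a measure \<Rightarrow> ('i \<Rightarrow> 'a \<Rightarrow> 'b::real_normed_vector) \<Rightarrow> bool" where
  "equi_int M h \<longleftrightarrow> (\<exists>C::real. \<forall>i. (\<integral>\<^sup>+x. norm (h i x) \<partial>M) \<le> ennreal C) \<and>
     (\<forall>e>0. \<exists>d>0. \<forall>i. \<forall>A\<in>sets M. emeasure M A < ennreal d \<longrightarrow> (\<integral>\<^sup>+x\<in>A. norm (h i x) \<partial>M) \<le> ennreal e)"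

lemma equi_int_bound:
  assumes "equi_int M h" obtains C where "C \<ge> 0" "\<And>i. (\<integral>\<^sup>+x. norm (h i x) \<partial>M) \<le> ennreal C"
proof -
  obtain C where C: "\<And>i. (\<integral>\<^sup>+x. norm (h i x) \<partial>M) \<le> ennreal C" using assms by (auto simp: equi_int_def)
  have "(\<integral>\<^sup>+x. norm (h i x) \<partial>M) \<le> ennreal (max C 0)" for i
    using C[of i] by (rule order_trans) (auto intro: ennreal_leI)
  then show thesis using that[of "max C 0"] by simp
qed

lemma equi_int_small:
  assumes "equi_int M h" "e > 0"
  obtains d where "d > 0" "\<And>i A. A \<in> sets M \<Longrightarrow> emeasure M A < ennreal d \<Longrightarrow> (\<integral>\<^sup>+x\<in>A. norm (h i x) \<partial>M) \<le> ennreal e"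
  using assms unfolding equi_int_def by meson

lemma integrable_if_equi_int:
  fixes h :: "'i \<Rightarrow> 'a \<Rightarrow> 'b::{banach, second_countable_topology}"
  assumes "equi_int M h" "h i \<in> borel_measurable M" shows "integrable M (h i)"
proof -
  obtain C where "(\<integral>\<^sup>+x. norm (h i x) \<partial>M) \<le> ennreal C" using assms(1) unfolding equi_int_def by blast
  then show ?thesis using assms(2) by (intro integrableI_bounded) (auto simp: le_less_trans[OF _ ennreal_less_top])
qed

lemma equi_int_single:
  fixes f :: "'a \<Rightarrow> 'b::{banach, second_countable_topology}"
  assumes f: "integrable M f" shows "equi_int M (\<lambda>_. f)"
  unfolding equi_int_def
proof (intro conjI allI impI)
  have "(\<integral>\<^sup>+x. norm (f x) \<partial>M) = ennreal (LINT x|M. norm (f x))"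
    using f by (intro nn_integral_eq_integral) auto
  then show "\<exists>C. \<forall>i. (\<integral>\<^sup>+x. norm (f x) \<partial>M) \<le> ennreal C" by auto
  fix e :: real assume "e > 0"
  from integrable_small_on_small_sets[OF f this]
  show "\<exists>d>0. \<forall>i. \<forall>A\<in>sets M. emeasure M A < ennreal d \<longrightarrow> (\<integral>\<^sup>+x\<in>A. norm (f x) \<partial>M) \<le> ennreal e" by metis
qed

text \<open>Vitali's convergence theorem on a set of finite measure. Fatou's lemma makes the limit
  integrable; the difference is at most \<eta> outside a set of small measure, on which
  equi-integrability and absolute continuity bound the two functions separately.\<close>

lemma vitali_convergence:
  fixes h :: "nat \<Rightarrow> 'a \<Rightarrow> 'b::{banach, second_countable_topology}"
  assumes K: "K \<in> sets M" "emeasure M K < \<infinity>" and h: "\<And>m. h m \<in> borel_measurable M" and d: "d \<in> borel_measurable M"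
    and ei: "equi_int M h" and lim: "AE x in M. (\<lambda>m. h m x) \<longlonglongrightarrow> d x"
    and out: "\<And>m x. x \<in> space M \<Longrightarrow> x \<notin> K \<Longrightarrow> h m x = 0" "\<And>x. x \<in> space M \<Longrightarrow> x \<notin> K \<Longrightarrow> d x = 0"
  shows "integrable M d" "(\<lambda>m. LINT x|M. norm (h m x - d x)) \<longlonglongrightarrow> 0"
proof -
  note [measurable] = h d K(1)
  have hi: "integrable M (h m)" for m by (rule integrable_if_equi_int[OF ei h])
  obtain C where C: "C \<ge> 0" "\<And>m. (\<integral>\<^sup>+x. norm (h m x) \<partial>M) \<le> ennreal C" using equi_int_bound[OF ei] by blast
  have "(\<integral>\<^sup>+x. norm (d x) \<partial>M) \<le> (\<integral>\<^sup>+x. liminf (\<lambda>m. ennreal (norm (h m x))) \<partial>M)"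
  proof (rule nn_integral_mono_AE, use lim in eventually_elim)
    case (elim x)
    then have "(\<lambda>m. ennreal (norm (h m x))) \<longlonglongrightarrow> ennreal (norm (d x))"
      by (intro tendsto_ennrealI tendsto_norm)
    then show ?case by (simp add: tendsto_iff_Liminf_eq_Limsup)
  qed
  also have "\<dots> \<le> liminf (\<lambda>m. \<integral>\<^sup>+x. norm (h m x) \<partial>M)" by (rule nn_integral_liminf) simp
  also have "\<dots> \<le> ennreal C" using C(2) by (intro Liminf_le) auto
  finally show di: "integrable M d" by (intro integrableI_bounded) (auto simp: le_less_trans[OF _ ennreal_less_top])
  show "(\<lambda>m. LINT x|M. norm (h m x - d x)) \<longlonglongrightarrow> 0"
  proof (rule LIMSEQ_I)
    fix r :: real assume r: "0 < r"
    define e where "e = r / 4"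
    have e: "e > 0" using r by (simp add: e_def)
    define k where "k = measure M K"
    define \<eta> where "\<eta> = e / (k + 1)"
    have \<eta>: "\<eta> > 0" "\<eta> * k \<le> e" using e by (auto simp: \<eta>_def k_def field_simps add_pos_nonneg)
    obtain \<delta>1 where \<delta>1: "\<delta>1 > 0" "\<And>i A. A \<in> sets M \<Longrightarrow> emeasure M A < ennreal \<delta>1 \<Longrightarrow> (\<integral>\<^sup>+x\<in>A. norm (h i x) \<partial>M) \<le> ennreal e"
      using equi_int_small[OF ei e] by blast
    obtain \<delta>2 where \<delta>2: "\<delta>2 > 0" "\<And>A. A \<in> sets M \<Longrightarrow> emeasure M A < ennreal \<delta>2 \<Longrightarrow> (\<integral>\<^sup>+x\<in>A. norm (d x) \<partial>M) \<le> ennreal e"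
      using integrable_small_on_small_sets[OF di e] by blast
    define A where "A m = {x \<in> space M. \<eta> < norm (h m x - d x)}" for m
    have Am[measurable]: "A m \<in> sets M" for m unfolding A_def by measurable
    have AK: "A m \<subseteq> K" for m using out \<eta> by (force simp: A_def)
    have "(\<lambda>m. \<integral>\<^sup>+x. indicator (A m) x \<partial>M) \<longlonglongrightarrow> (\<integral>\<^sup>+x. 0 \<partial>M)"
    proof (rule nn_integral_dominated_convergence[where w="indicator K"])
      show "(\<integral>\<^sup>+x. indicator K x \<partial>M) < \<infinity>" using K by simp
      show "AE x in M. (\<lambda>m. indicator (A m) x :: ennreal) \<longlonglongrightarrow> 0"
        using lim
      proof eventually_elim
        case (elim x)
        have "\<forall>\<^sub>F m in sequentially. dist (h m x) (d x) < \<eta>" using elim \<eta>(1) by (rule tendstoD)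
        then have "\<forall>\<^sub>F m in sequentially. (indicator (A m) x :: ennreal) = 0"
          by eventually_elim (auto simp: A_def dist_norm)
        then show ?case by (rule tendsto_eventually)
      qed
      show "\<And>j. AE x in M. (indicator (A j) x :: ennreal) \<le> indicator K x"
        using AK by (auto simp: indicator_def)
    qed auto
    then have "(\<lambda>m. emeasure M (A m)) \<longlonglongrightarrow> 0" by simp
    then have "\<forall>\<^sub>F m in sequentially. emeasure M (A m) < ennreal (min \<delta>1 \<delta>2)"
      using \<delta>1 \<delta>2 by (intro order_tendstoD(2)) auto
    then obtain N where N: "\<And>m. m \<ge> N \<Longrightarrow> emeasure M (A m) < ennreal (min \<delta>1 \<delta>2)" by (auto simp: eventually_sequentially)
    have "norm ((LINT x|M. norm (h m x - d x)) - 0) < r" if m: "m \<ge> N" for m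
    proof -
      have i: "integrable M (\<lambda>x. norm (h m x - d x))" using hi di by auto
      have "ennreal (LINT x|M. norm (h m x - d x)) = (\<integral>\<^sup>+x. norm (h m x - d x) \<partial>M)"
        by (rule nn_integral_eq_integral[symmetric, OF i]) auto
      also have "\<dots> \<le> (\<integral>\<^sup>+x. ennreal \<eta> * indicator K x + (ennreal (norm (h m x)) * indicator (A m) x + ennreal (norm (d x)) * indicator (A m) x) \<partial>M)"
      proof (rule nn_integral_mono)
        fix x assume x: "x \<in> space M"
        show "ennreal (norm (h m x - d x)) \<le> ennreal \<eta> * indicator K x + (ennreal (norm (h m x)) * indicator (A m) x + ennreal (norm (d x)) * indicator (A m) x)"
        proof (cases "x \<in> A m")
          case True
          have "ennreal (norm (h m x - d x)) \<le> ennreal (norm (h m x)) + ennreal (norm (d x))"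
            by (simp add: ennreal_plus[symmetric] norm_triangle_ineq4 ennreal_leI del: ennreal_plus)
          also have "\<dots> \<le> ennreal \<eta> * indicator K x + (ennreal (norm (h m x)) + ennreal (norm (d x)))" by simp
          finally show ?thesis using True by simp
        next
          case False
          then show ?thesis using x out[of x] \<eta>(1) by (cases "x \<in> K") (auto simp: A_def not_less intro: ennreal_leI)
        qed
      qed
      also have "\<dots> = ennreal \<eta> * emeasure M K + ((\<integral>\<^sup>+x\<in>A m. norm (h m x) \<partial>M) + (\<integral>\<^sup>+x\<in>A m. norm (d x) \<partial>M))"
        by (simp add: nn_integral_add nn_integral_cmult_indicator)
      also have "\<dots> \<le> ennreal \<eta> * emeasure M K + (ennreal e + ennreal e)"
        using N[OF m] \<delta>1 \<delta>2 by (intro add_mono order_refl \<delta>1 \<delta>2 Am) (auto simp: ennreal_less_iff min_def split: if_splits intro: less_le_trans ennreal_leI)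
      also have "emeasure M K = ennreal k" unfolding k_def using K(2) by (intro emeasure_eq_ennreal_measure) auto
      also have "ennreal \<eta> * ennreal k + (ennreal e + ennreal e) = ennreal (\<eta> * k + 2 * e)"
        using \<eta> e by (simp add: k_def ennreal_mult'[symmetric] ennreal_plus[symmetric] del: ennreal_plus)
      also have "\<dots> \<le> ennreal (3 * e)" using \<eta>(2) by (intro ennreal_leI) simp
      finally have "(LINT x|M. norm (h m x - d x)) \<le> 3 * e" using e by (subst (asm) ennreal_le_iff) auto
      then show ?thesis using r by (simp add: e_def)
    qed
    then show "\<exists>N. \<forall>m\<ge>N. norm ((LINT x|M. norm (h m x - d x)) - 0) < r" by blast
  qed
qed

text \<open>By Tonelli, the integral of an average over a set A is bounded by integrals of w over
  translates of A. All translates have the same measure, hence the same bounds serve for all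
  displacements.\<close>

lemma equi_int_line_averages:
  fixes w :: "'j \<Rightarrow> real^'n \<Rightarrow> 'b::euclidean_space" and h :: "'i \<Rightarrow> real^'n"
  assumes ei: "equi_int lborel w" and wm: "\<And>j. w j \<in> borel_measurable borel"
  shows "equi_int lborel (\<lambda>(i, j) x. LINT s|lborel. indicator {0..1::real} s *\<^sub>R w j (x + s *\<^sub>R h i))"
proof -
  have [measurable]: "\<And>j. w j \<in> borel_measurable borel" by (rule wm)
  have key: "(\<integral>\<^sup>+x\<in>A. norm (LINT s|lborel. indicator {0..1::real} s *\<^sub>R w j (x + s *\<^sub>R h i)) \<partial>lborel) \<le> ennreal e"
    if A[measurable]: "A \<in> sets borel" and
      b: "\<And>s. (\<integral>\<^sup>+y\<in>{y. y - s *\<^sub>R h i \<in> A}. norm (w j y) \<partial>lborel) \<le> ennreal e" for A i j e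
  proof -
    have wi: "integrable lborel (w j)" by (rule integrable_if_equi_int[OF ei]) simp
    have "AE x in lborel. integrable lborel (\<lambda>s::real. indicator {0..1} s *\<^sub>R w j (x + s *\<^sub>R h i))"
      using lborel_pair.AE_integrable_fst[OF integrable_pair_translate[OF wi, of "h i"]] by simp
    note ae = this
    have "(\<integral>\<^sup>+x\<in>A. norm (LINT s|lborel. indicator {0..1::real} s *\<^sub>R w j (x + s *\<^sub>R h i)) \<partial>lborel)
       \<le> (\<integral>\<^sup>+x. (\<integral>\<^sup>+s. ennreal (norm (w j (x + s *\<^sub>R h i))) * indicator {0..1::real} s * indicator A x \<partial>lborel) \<partial>lborel)"
    proof (rule nn_integral_mono_AE, use ae in eventually_elim)
      case (elim x)
      have "ennreal (norm (LINT s|lborel. indicator {0..1::real} s *\<^sub>R w j (x + s *\<^sub>R h i)))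
         \<le> (\<integral>\<^sup>+s. norm (indicator {0..1::real} s *\<^sub>R w j (x + s *\<^sub>R h i)) \<partial>lborel)"
        by (rule integral_norm_bound_ennreal[OF elim])
      also have "\<dots> = (\<integral>\<^sup>+s. ennreal (norm (w j (x + s *\<^sub>R h i))) * indicator {0..1::real} s \<partial>lborel)"
        by (intro nn_integral_cong) (auto simp: indicator_def)
      finally show ?case by (auto simp: indicator_def)
    qed
    also have "\<dots> = (\<integral>\<^sup>+s. (\<integral>\<^sup>+x. ennreal (norm (w j (x + s *\<^sub>R h i))) * indicator {0..1::real} s * indicator A x \<partial>lborel) \<partial>lborel)"
      by (rule lborel_pair.Fubini'[symmetric]) measurable
    also have "\<dots> \<le> (\<integral>\<^sup>+s. ennreal e * indicator {0..1::real} s \<partial>lborel)"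
    proof (rule nn_integral_mono)
      fix s :: real
      have "(\<integral>\<^sup>+x. ennreal (norm (w j (x + s *\<^sub>R h i))) * indicator A x \<partial>lborel) =
          (\<integral>\<^sup>+x. (\<lambda>y. ennreal (norm (w j y)) * indicator {y. y - s *\<^sub>R h i \<in> A} y) (x + s *\<^sub>R h i) \<partial>lborel)"
        by (simp add: indicator_def)
      also have "\<dots> = (\<integral>\<^sup>+y\<in>{y. y - s *\<^sub>R h i \<in> A}. norm (w j y) \<partial>lborel)"
        by (rule nn_integral_lborel_translate) measurable
      also have "\<dots> \<le> ennreal e" by (rule b)
      finally show "(\<integral>\<^sup>+x. ennreal (norm (w j (x + s *\<^sub>R h i))) * indicator {0..1::real} s * indicator A x \<partial>lborel) \<le> ennreal e * indicator {0..1::real} s"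
        by (auto simp: indicator_def)
    qed
    also have "\<dots> = ennreal e" by (simp add: nn_integral_cmult_indicator)
    finally show ?thesis .
  qed
  show ?thesis unfolding equi_int_def
  proof (intro conjI allI impI)
    obtain C where C: "\<And>j. (\<integral>\<^sup>+x. norm (w j x) \<partial>lborel) \<le> ennreal C" using equi_int_bound[OF ei] by blast
    have "(\<integral>\<^sup>+x. norm (LINT s|lborel. indicator {0..1::real} s *\<^sub>R w j (x + s *\<^sub>R h i)) \<partial>lborel) \<le> ennreal C" for i j
      using key[where A=UNIV and i=i and j=j and e=C] C[of j] by simp
    then show "\<exists>C. \<forall>ij. (\<integral>\<^sup>+x. norm ((case ij of (i, j) \<Rightarrow> \<lambda>x. LINT s|lborel. indicator {0..1::real} s *\<^sub>R w j (x + s *\<^sub>R h i)) x) \<partial>lborel) \<le> ennreal C"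
      by (auto split: prod.splits)
    fix e :: real assume e0: "e > 0"
    obtain d where d: "d > 0" "\<And>j A. A \<in> sets lborel \<Longrightarrow> emeasure lborel A < ennreal d \<Longrightarrow> (\<integral>\<^sup>+x\<in>A. norm (w j x) \<partial>lborel) \<le> ennreal e"
      by (rule equi_int_small[OF ei e0], rule that)
    have "(\<integral>\<^sup>+x\<in>A. norm (LINT s|lborel. indicator {0..1::real} s *\<^sub>R w j (x + s *\<^sub>R h i)) \<partial>lborel) \<le> ennreal e"
      if A[measurable]: "A \<in> sets borel" and Ad: "emeasure lborel A < ennreal d" for A i j
    proof (rule key[OF A])
      fix s :: real
      have m[measurable]: "{y. y - s *\<^sub>R h i \<in> A} \<in> sets borel"
      proof -
        have "(\<lambda>y. y - s *\<^sub>R h i) -` A \<inter> space borel \<in> sets borel" by (rule measurable_sets[OF _ A]) simp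
        then show ?thesis by (simp add: vimage_def)
      qed
      have "emeasure lborel {y. y - s *\<^sub>R h i \<in> A} = (\<integral>\<^sup>+y. indicator {y. y - s *\<^sub>R h i \<in> A} y \<partial>lborel)"
        using m by simp
      also have "\<dots> = (\<integral>\<^sup>+y. indicator A (y + (- (s *\<^sub>R h i))) \<partial>lborel)"
        by (intro nn_integral_cong) (simp add: indicator_def)
      also have "\<dots> = emeasure lborel A" using A by (subst nn_integral_lborel_translate) auto
      finally show "(\<integral>\<^sup>+y\<in>{y. y - s *\<^sub>R h i \<in> A}. norm (w j y) \<partial>lborel) \<le> ennreal e"
        using Ad by (intro d) auto
    qed
    then show "\<exists>d>0. \<forall>ij. \<forall>A\<in>sets lborel. emeasure lborel A < ennreal d \<longrightarrow>
        (\<integral>\<^sup>+x\<in>A. norm ((case ij of (i, j) \<Rightarrow> \<lambda>x. LINT s|lborel. indicator {0..1::real} s *\<^sub>R w j (x + s *\<^sub>R h i)) x) \<partial>lborel) \<le> ennreal e"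
      using d(1) by (intro exI[of _ d]) (auto split: prod.splits)
  qed
qed

text \<open>Fatou's lemma preserves both bounds, with the same constants, under limits almost
  everywhere.\<close>

lemma equi_int_limit:
  fixes g :: "'i \<Rightarrow> nat \<Rightarrow> 'a \<Rightarrow> 'b::{banach, second_countable_topology}"
  assumes ei: "equi_int M (\<lambda>(i, j). g i j)" and m: "\<And>i j. g i j \<in> borel_measurable M"
    and lim: "\<And>i. AE x in M. (\<lambda>j. g i j x) \<longlonglongrightarrow> G i x"
  shows "equi_int M G"
proof -
  note [measurable] = m
  have key: "(\<integral>\<^sup>+x\<in>A. norm (G i x) \<partial>M) \<le> ennreal e"
    if A[measurable]: "A \<in> sets M" and b: "\<And>j. (\<integral>\<^sup>+x\<in>A. norm (g i j x) \<partial>M) \<le> ennreal e" for A i e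
  proof -
    have "(\<integral>\<^sup>+x\<in>A. norm (G i x) \<partial>M) \<le> (\<integral>\<^sup>+x. liminf (\<lambda>j. ennreal (norm (g i j x)) * indicator A x) \<partial>M)"
    proof (rule nn_integral_mono_AE, use lim[of i] in eventually_elim)
      case (elim x)
      then have "(\<lambda>j. ennreal (norm (g i j x))) \<longlonglongrightarrow> ennreal (norm (G i x))"
        by (intro tendsto_ennrealI tendsto_norm)
      then have "(\<lambda>j. ennreal (norm (g i j x)) * indicator A x) \<longlonglongrightarrow> ennreal (norm (G i x)) * indicator A x"
        by (cases "x \<in> A") auto
      then show ?case by (simp add: tendsto_iff_Liminf_eq_Limsup)
    qed
    also have "\<dots> \<le> liminf (\<lambda>j. \<integral>\<^sup>+x\<in>A. norm (g i j x) \<partial>M)" by (rule nn_integral_liminf) simp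
    also have "\<dots> \<le> ennreal e" using b by (intro Liminf_le) auto
    finally show ?thesis .
  qed
  show ?thesis unfolding equi_int_def
  proof (intro conjI allI impI)
    obtain C where C: "\<And>ij. (\<integral>\<^sup>+x. norm ((case ij of (i, j) \<Rightarrow> g i j) x) \<partial>M) \<le> ennreal C" using equi_int_bound[OF ei] by blast
    have "(\<integral>\<^sup>+x. norm (G i x) \<partial>M) \<le> ennreal C" for i
    proof -
      have "(\<integral>\<^sup>+x. norm (G i x) \<partial>M) = (\<integral>\<^sup>+x\<in>space M. norm (G i x) \<partial>M)" by (intro nn_integral_cong) auto
      also have "\<dots> \<le> ennreal C"
      proof (rule key)
        fix j
        have "(\<integral>\<^sup>+x\<in>space M. norm (g i j x) \<partial>M) = (\<integral>\<^sup>+x. norm (g i j x) \<partial>M)" by (intro nn_integral_cong) auto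
        then show "(\<integral>\<^sup>+x\<in>space M. norm (g i j x) \<partial>M) \<le> ennreal C" using C[of "(i, j)"] by simp
      qed simp
      finally show ?thesis .
    qed
    then show "\<exists>C. \<forall>i. (\<integral>\<^sup>+x. norm (G i x) \<partial>M) \<le> ennreal C" by blast
    fix e :: real assume e0: "e > 0"
    obtain d where d: "d > 0" "\<And>ij A. A \<in> sets M \<Longrightarrow> emeasure M A < ennreal d \<Longrightarrow> (\<integral>\<^sup>+x\<in>A. norm ((case ij of (i, j) \<Rightarrow> g i j) x) \<partial>M) \<le> ennreal e"
      by (rule equi_int_small[OF ei e0], rule that)
    have "(\<integral>\<^sup>+x\<in>A. norm (G i x) \<partial>M) \<le> ennreal e" if "A \<in> sets M" "emeasure M A < ennreal d" for A i
      using that d(2)[of A "(i, _)"] by (intro key) auto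
    then show "\<exists>d>0. \<forall>i. \<forall>A\<in>sets M. emeasure M A < ennreal d \<longrightarrow> (\<integral>\<^sup>+x\<in>A. norm (G i x) \<partial>M) \<le> ennreal e"
      using d(1) by blast
  qed
qed

lemma equi_int_dominated:
  assumes ei: "equi_int M h" and le: "\<And>i. AE x in M. norm (g i x) \<le> norm (h (\<pi> i) x)"
  shows "equi_int M g"
proof -
  have *: "(\<integral>\<^sup>+x\<in>A. norm (g i x) \<partial>M) \<le> (\<integral>\<^sup>+x\<in>A. norm (h (\<pi> i) x) \<partial>M)" for A i
    by (rule nn_integral_mono_AE, use le[of i] in eventually_elim) (auto intro!: mult_right_mono ennreal_leI)
  have **: "(\<integral>\<^sup>+x. norm (g i x) \<partial>M) \<le> (\<integral>\<^sup>+x. norm (h (\<pi> i) x) \<partial>M)" for i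
    by (rule nn_integral_mono_AE, use le[of i] in eventually_elim) (auto intro!: ennreal_leI)
  show ?thesis unfolding equi_int_def
  proof (intro conjI allI impI)
    obtain C where C: "\<And>i. (\<integral>\<^sup>+x. norm (h i x) \<partial>M) \<le> ennreal C" using equi_int_bound[OF ei] by blast
    show "\<exists>C. \<forall>i. (\<integral>\<^sup>+x. norm (g i x) \<partial>M) \<le> ennreal C" using order_trans[OF ** C] by blast
    fix e :: real assume e0: "e > 0"
    obtain d where d: "d > 0" "\<And>i A. A \<in> sets M \<Longrightarrow> emeasure M A < ennreal d \<Longrightarrow> (\<integral>\<^sup>+x\<in>A. norm (h i x) \<partial>M) \<le> ennreal e"
      by (rule equi_int_small[OF ei e0], rule that)
    show "\<exists>d>0. \<forall>i. \<forall>A\<in>sets M. emeasure M A < ennreal d \<longrightarrow> (\<integral>\<^sup>+x\<in>A. norm (g i x) \<partial>M) \<le> ennreal e"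
      by (intro exI[of _ d] conjI d(1) allI ballI impI order_trans[OF * d(2)])
  qed
qed

text \<open>With e a lower bound for the distance to the complement, V consists of the points at
  distance less than e/4 from K, and balls of radius e/4 about them stay in the closed
  e/2-neighbourhood K'.\<close>

lemma compact_nbhd:
  fixes K :: "'a::euclidean_space set"
  assumes K: "compact K" "K \<subseteq> \<Omega>" and \<Omega>: "open \<Omega>"
  obtains \<rho> V K' where "\<rho> > 0" "open V" "K \<subseteq> V" "compact K'" "K' \<subseteq> \<Omega>" "V \<subseteq> K'" "\<And>x. x \<in> V \<Longrightarrow> cball x \<rho> \<subseteq> K'"
proof -
  obtain e where e: "e > 0" "(\<Union>x\<in>K. ball x e) \<subseteq> \<Omega>"
  proof (cases "K = {} \<or> \<Omega> = UNIV")
    case False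
    have "compact K" "closed (- \<Omega>)" "K \<inter> - \<Omega> = {}" using K \<Omega> by auto
    then obtain e where "e > 0" "\<And>x y. x \<in> K \<Longrightarrow> y \<in> - \<Omega> \<Longrightarrow> e \<le> dist x y" using separate_compact_closed by metis
    then have "(\<Union>x\<in>K. ball x e) \<subseteq> \<Omega>" by (force simp: not_less)
    then show thesis using that \<open>e > 0\<close> by blast
  next
    case True
    then show thesis using that[of 1] by auto
  qed
  define V where "V = (\<Union>x\<in>K. ball x (e / 4))"
  define K' where "K' = {x + y | x y. x \<in> K \<and> y \<in> cball 0 (e / 2)}"
  have "compact K'" unfolding K'_def by (intro compact_sums K compact_cball)
  moreover have "K' \<subseteq> \<Omega>"
  proof
    fix z assume "z \<in> K'"
    then obtain x y where "x \<in> K" "norm y \<le> e / 2" "z = x + y" by (auto simp: K'_def)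
    then have "z \<in> ball x e" using e(1) by (auto simp: dist_norm)
    then show "z \<in> \<Omega>" using e(2) \<open>x \<in> K\<close> by blast
  qed
  moreover have sub: "cball x (e / 4) \<subseteq> K'" if xV: "x \<in> V" for x
  proof
    fix z assume z: "z \<in> cball x (e / 4)"
    obtain y where y: "y \<in> K" "x \<in> ball y (e / 4)" using xV unfolding V_def by blast
    then have "dist y x < e / 4" by simp
    then have "dist y z \<le> e / 2" using dist_triangle[of y z x] z by simp
    then show "z \<in> K'" unfolding K'_def using y(1) by (intro CollectI exI[of _ y] exI[of _ "z - y"]) (auto simp: dist_norm norm_minus_commute)
  qed
  moreover have "V \<subseteq> K'"
  proof
    fix x assume "x \<in> V" then show "x \<in> K'" using sub[of x] e(1) by auto
  qed
  moreover have "open V" "K \<subseteq> V" "e / 4 > 0" using e(1) by (auto simp: V_def)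
  ultimately show thesis using that by blast
qed

section \<open>Weak partial derivatives of limits\<close>

text \<open>Sobolev data are Lebesgue measurable, whereas product measures and translations are
  handled with Borel functions; the coordinates are replaced by Borel versions one by one.\<close>

lemma lebesgue_integrable_borel_version:
  fixes g :: "'a::euclidean_space \<Rightarrow> 'b::euclidean_space"
  assumes g: "integrable lebesgue g"
  obtains g' where "integrable lborel g'" "AE x in lebesgue. g' x = g x"
proof -
  have "\<exists>g'\<in>borel_measurable lborel. (AE x in lborel. g x \<bullet> b = g' x)" for b
    using g by (intro completion_ex_borel_measurable_real) (auto dest: borel_measurable_integrable)
  then obtain gb where gb: "\<And>b. gb b \<in> borel_measurable lborel" "\<And>b. AE x in lborel. g x \<bullet> b = gb b x"
    by metis
  define g' where "g' x = (\<Sum>b\<in>Basis. gb b x *\<^sub>R b)" for x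
  have m: "g' \<in> borel_measurable lborel"
    unfolding g'_def using gb(1) by (intro borel_measurable_sum borel_measurable_scaleR) auto
  have "AE x in lborel. \<forall>b\<in>Basis. g x \<bullet> b = gb b x"
    using gb(2) by (intro AE_finite_allI) auto
  then have "AE x in lborel. g' x = g x"
  proof eventually_elim
    case (elim x)
    have "g' x = (\<Sum>b\<in>Basis. (g x \<bullet> b) *\<^sub>R b)" unfolding g'_def by (intro sum.cong) (use elim in auto)
    then show ?case by (simp add: euclidean_representation)
  qed
  then have ae: "AE x in lebesgue. g' x = g x" by (rule AE_completion)
  have "integrable lebesgue g'"
  proof (rule integrable_cong_AE_imp[OF g])
    show "g' \<in> borel_measurable lebesgue" using m by (rule measurable_completion)
    show "AE x in lebesgue. g x = g' x" using ae by eventually_elim simp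
  qed
  then have "integrable lborel g'" using m by (simp add: integrable_completion)
  then show thesis using that ae by blast
qed

text \<open>Translates the definition of weak partial derivatives, stated with gauge integrals over
  D and Lebesgue measurable derivatives, into Bochner integrals of Borel versions cut off by K.
  Bumps supported in K vanish outside it, so the integrals over D and over K agree.\<close>

lemma w11_local_exists:
  fixes u :: "real^'n \<Rightarrow> real^'m"
  assumes contu: "continuous_on D u" and wp: "weak_partials D u v" and K: "compact K" "K \<subseteq> D"
  obtains w where "w11_local u w K" "\<And>i. AE x in lebesgue. w i x = indicator K x *\<^sub>R v i x"
proof -
  have vi: "integrable lebesgue (\<lambda>x. indicator K x *\<^sub>R v i x)" for i
    using wp K by (auto simp: weak_partials_def locally_L1_def set_integrable_def)
  have "\<exists>w. integrable lborel w \<and> (AE x in lebesgue. w x = indicator K x *\<^sub>R v i x)" for i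
    by (rule lebesgue_integrable_borel_version[OF vi[of i]]) blast
  then have "\<forall>i. \<exists>w. integrable lborel w \<and> (AE x in lebesgue. w x = indicator K x *\<^sub>R v i x)" by blast
  from choice[OF this] obtain w where "\<forall>i. integrable lborel (w i) \<and> (AE x in lebesgue. w i x = indicator K x *\<^sub>R v i x)"
    by (rule exE)
  then have w: "\<And>i. integrable lborel (w i)" "\<And>i. AE x in lebesgue. w i x = indicator K x *\<^sub>R v i x"
    by simp_all
  have "w11_local u w K"
  proof
    show "compact K" by (rule K)
    show cK: "continuous_on K u" using contu K(2) by (rule continuous_on_subset)
    show "integrable lborel (w i)" for i by (rule w)
    fix a b :: "real^'n" and m i
    assume ne: "box a b \<noteq> {}" and sub: "cbox a b \<subseteq> K"
    define \<phi> where "\<phi> = box_bump a b m"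
    have tf: "test_fun D \<phi>" unfolding \<phi>_def using ne sub K(2) by (intro test_fun_box_bump) auto
    have out: "\<phi> x = 0" "pd \<phi> x i = 0" if "x \<notin> K" for x
    proof -
      have "x \<notin> closure {x. \<phi> x \<noteq> 0}" using box_bump_support[of a b m] sub that by (auto simp: \<phi>_def)
      then show "pd \<phi> x i = 0" by (rule test_fun_pd(4)[OF tf])
      show "\<phi> x = 0" using that sub box_subset_cbox by (auto simp: \<phi>_def intro!: box_bump_outside)
    qed
    have 1: "(LINT x|lborel. pd \<phi> x i *\<^sub>R (indicator K x *\<^sub>R u x)) = integral D (\<lambda>x. pd \<phi> x i *\<^sub>R u x)"
    proof -
      have "continuous_on K (\<lambda>x. pd \<phi> x i *\<^sub>R u x)"
        by (intro continuous_intros cK continuous_on_subset[OF test_fun_pd(2)[OF tf]]) auto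
      then have i: "integrable lborel (\<lambda>x. pd \<phi> x i *\<^sub>R (indicator K x *\<^sub>R u x))"
        using borel_integrable_compact[OF K(1), of "\<lambda>x. pd \<phi> x i *\<^sub>R u x"] by (simp add: mult.commute)
      have "integral D (\<lambda>x. pd \<phi> x i *\<^sub>R u x) = integral UNIV (\<lambda>x. if x \<in> D then pd \<phi> x i *\<^sub>R u x else 0)"
        by (simp add: integral_restrict_UNIV)
      also have "(\<lambda>x. if x \<in> D then pd \<phi> x i *\<^sub>R u x else 0) = (\<lambda>x. pd \<phi> x i *\<^sub>R (indicator K x *\<^sub>R u x))"
        using out K(2) by (auto simp: indicator_def fun_eq_iff)
      also have "integral UNIV \<dots> = (LINT x|lborel. pd \<phi> x i *\<^sub>R (indicator K x *\<^sub>R u x))"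
        by (rule integral_lborel[OF i])
      finally show ?thesis by simp
    qed
    have 2: "(LINT x|lborel. \<phi> x *\<^sub>R w i x) = integral D (\<lambda>x. \<phi> x *\<^sub>R v i x)"
    proof -
      have iw: "integrable lborel (\<lambda>x. \<phi> x *\<^sub>R w i x)" unfolding \<phi>_def by (rule integrable_box_bump[OF ne w(1)])
      have mphi: "\<phi> \<in> borel_measurable lebesgue"
        using test_fun_pd(1)[OF tf] by (intro measurable_completion) (auto intro: borel_measurable_continuous_onI)
      have ae: "AE x in lebesgue. \<phi> x *\<^sub>R (indicator K x *\<^sub>R v i x) = \<phi> x *\<^sub>R w i x" using w(2)[of i] by eventually_elim simp
      have iv: "integrable lebesgue (\<lambda>x. \<phi> x *\<^sub>R (indicator K x *\<^sub>R v i x))"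
      proof (rule integrable_cong_AE_imp)
        show "integrable lebesgue (\<lambda>x. \<phi> x *\<^sub>R w i x)" using iw by (subst integrable_completion) auto
        show "(\<lambda>x. \<phi> x *\<^sub>R (indicator K x *\<^sub>R v i x)) \<in> borel_measurable lebesgue"
          using mphi borel_measurable_integrable[OF vi[of i]] by (rule borel_measurable_scaleR)
        show "AE x in lebesgue. \<phi> x *\<^sub>R w i x = \<phi> x *\<^sub>R (indicator K x *\<^sub>R v i x)" using ae by eventually_elim simp
      qed
      have "integral D (\<lambda>x. \<phi> x *\<^sub>R v i x) = integral UNIV (\<lambda>x. if x \<in> D then \<phi> x *\<^sub>R v i x else 0)"
        by (simp add: integral_restrict_UNIV)
      also have "(\<lambda>x. if x \<in> D then \<phi> x *\<^sub>R v i x else 0) = (\<lambda>x. \<phi> x *\<^sub>R (indicator K x *\<^sub>R v i x))"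
        using out K(2) by (auto simp: indicator_def fun_eq_iff)
      also have "integral UNIV \<dots> = (LINT x|lebesgue. \<phi> x *\<^sub>R (indicator K x *\<^sub>R v i x))"
        by (rule integral_lebesgue[OF iv])
      also have "\<dots> = (LINT x|lebesgue. \<phi> x *\<^sub>R w i x)"
        by (rule integral_cong_AE) (use iv iw ae in \<open>auto intro: borel_measurable_integrable measurable_completion\<close>)
      also have "\<dots> = (LINT x|lborel. \<phi> x *\<^sub>R w i x)" using iw by (intro integral_completion) auto
      finally show ?thesis by simp
    qed
    show "(LINT x|lborel. pd (box_bump a b m) x i *\<^sub>R (indicator K x *\<^sub>R u x)) = - (LINT x|lborel. box_bump a b m x *\<^sub>R w i x)"
    proof -
      have "integral D (\<lambda>x. pd \<phi> x i *\<^sub>R u x) = - integral D (\<lambda>x. \<phi> x *\<^sub>R v i x)"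
        using wp[unfolded weak_partials_def, THEN conjunct2, THEN spec, THEN spec, THEN mp, OF tf] .
      then show ?thesis using 1 2 by (simp add: \<phi>_def)
    qed
  qed
  then show thesis using that w(2) by blast
qed

lemma has_partial_imp_deriv:
  fixes f :: "real^'n \<Rightarrow> 'b::real_normed_vector"
  assumes "has_partial f (x + s *\<^sub>R axis i 1) i"
  shows "((\<lambda>t. f (x + t *\<^sub>R axis i 1)) has_vector_derivative pd f (x + s *\<^sub>R axis i 1) i) (at s)"
proof -
  let ?g = "\<lambda>t. f (x + s *\<^sub>R axis i 1 + t *\<^sub>R axis i 1)"
  have "(?g has_vector_derivative pd f (x + s *\<^sub>R axis i 1) i) (at 0)"
    using assms unfolding has_partial_def pd_def by (simp add: vector_derivative_works)
  then have "((?g \<circ> (\<lambda>t. t - s)) has_vector_derivative (1 *\<^sub>R pd f (x + s *\<^sub>R axis i 1) i)) (at s)"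
    by (intro vector_diff_chain_at) (auto intro!: derivative_eq_intros)
  then show ?thesis by (simp add: comp_def algebra_simps)
qed

text \<open>A difference quotient of \<open>us j\<close> is the average of its weak derivative along
  a segment, so these quotients are equi-integrable uniformly in the step and in j. This survives
  the limit in j. Existence of the partial derivative gives convergence almost everywhere as the
  step tends to 0, and Vitali's theorem upgrades it to convergence in L^1.\<close>

lemma weak_partial_of_limit_local:
  fixes u :: "real^'n \<Rightarrow> 'b::euclidean_space" and us :: "nat \<Rightarrow> real^'n \<Rightarrow> 'b"
  assumes \<Omega>: "open \<Omega>" and cus: "\<And>j. continuous_on \<Omega> (us j)" and cu: "continuous_on \<Omega> u"
    and lim: "\<forall>x\<in>\<Omega>. (\<lambda>j. us j x) \<longlonglongrightarrow> u x"
    and loc: "\<forall>K. compact K \<and> K \<subseteq> \<Omega> \<longrightarrow> (\<exists>w. (\<forall>j. w11_local (us j) (w j) K) \<and> equi_int lborel (\<lambda>j. w j i))"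
    and part: "AE x in lebesgue. x \<in> \<Omega> \<longrightarrow> has_partial u x i"
    and K: "compact K" "K \<subseteq> \<Omega>"
  obtains t K' d where "\<And>m. t m > (0::real)" "t \<longlonglongrightarrow> 0" "compact K'" "K' \<subseteq> \<Omega>" "K \<subseteq> K'"
    "\<And>x m. x \<in> K \<Longrightarrow> x + t m *\<^sub>R axis i 1 \<in> K'"
    "integrable lborel d" "AE x in lebesgue. d x = indicator K x *\<^sub>R pd u x i"
    "\<And>m. integrable lborel (\<lambda>x. indicator K x *\<^sub>R ((u (x + t m *\<^sub>R axis i 1) - u x) /\<^sub>R t m))"
    "(\<lambda>m. LINT x|lborel. norm (indicator K x *\<^sub>R ((u (x + t m *\<^sub>R axis i 1) - u x) /\<^sub>R t m) - d x)) \<longlonglongrightarrow> 0"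
proof -
  obtain \<rho> V K' where nb: "\<rho> > 0" "open V" "K \<subseteq> V" "compact K'" "K' \<subseteq> \<Omega>" "V \<subseteq> K'" "\<And>x. x \<in> V \<Longrightarrow> cball x \<rho> \<subseteq> K'"
    using compact_nbhd[OF K \<Omega>] by blast
  obtain w where w: "\<And>j. w11_local (us j) (w j) K'" "equi_int lborel (\<lambda>j. w j i)"
    using loc nb(4,5) by blast
  define t where "t m = \<rho> / real (Suc m)" for m
  have t: "t m > 0" "t m \<le> \<rho>" for m using nb(1) by (auto simp: t_def field_simps)
  have t0: "t \<longlonglongrightarrow> 0" unfolding t_def using tendsto_mult[OF tendsto_const LIMSEQ_Suc[OF lim_1_over_n], of \<rho>] by simp
  define e where "e = (axis i 1 :: real^'n)"
  have sh: "x + s *\<^sub>R (t m *\<^sub>R e) \<in> K'" if "x \<in> V" "0 \<le> s" "s \<le> 1" for x m s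
  proof -
    have "norm (s *\<^sub>R (t m *\<^sub>R e)) = s * t m" using that t[of m] by (simp add: e_def)
    also have "\<dots> \<le> \<rho>" using that t[of m] mult_mono[of s 1 "t m" \<rho>] by simp
    finally have "x + s *\<^sub>R (t m *\<^sub>R e) \<in> cball x \<rho>" by (simp add: dist_norm)
    then show ?thesis using nb(7)[OF that(1)] by blast
  qed
  have sh1: "x + t m *\<^sub>R e \<in> K'" if "x \<in> K" for x m using sh[of x 1 m] that nb(3) by auto
  have Kb[measurable]: "K \<in> sets borel" using K(1) by (rule borel_compact)
  define H where "H m x = indicator K x *\<^sub>R ((u (x + t m *\<^sub>R e) - u x) /\<^sub>R t m)" for m x
  define g where "g m j x = indicator K x *\<^sub>R ((us j (x + t m *\<^sub>R e) - us j x) /\<^sub>R t m)" for m j x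
  have dq_meas: "(\<lambda>x. indicator K x *\<^sub>R ((f (x + t m *\<^sub>R e) - f x) /\<^sub>R t m)) \<in> borel_measurable borel"
    if "continuous_on \<Omega> f" for f :: "real^'n \<Rightarrow> 'b" and m
  proof (rule borel_measurable_continuous_on_indicator[OF Kb])
    show "continuous_on K (\<lambda>x. (f (x + t m *\<^sub>R e) - f x) /\<^sub>R t m)"
      using sh1 nb(5) K(2) by (intro continuous_intros continuous_on_compose2[OF that]) auto
  qed
  have Hm[measurable]: "H m \<in> borel_measurable borel" for m unfolding H_def by (rule dq_meas[OF cu])
  have gm: "g m j \<in> borel_measurable borel" for m j unfolding g_def by (rule dq_meas[OF cus])
  have eia: "equi_int lborel (\<lambda>(m, j) x. LINT s|lborel. indicator {0..1::real} s *\<^sub>R w j i (x + s *\<^sub>R (t m *\<^sub>R e)))"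
  proof (rule equi_int_line_averages[OF w(2)])
    show "w j i \<in> borel_measurable borel" for j
      using borel_measurable_integrable[OF w11_local.intw[OF w(1)]] by simp
  qed
  have eig: "equi_int lborel (\<lambda>(m, j). g m j)"
  proof (rule equi_int_dominated[OF eia, where \<pi>="\<lambda>mj. mj"])
    fix mj :: "nat \<times> nat"
    obtain m j where mj: "mj = (m, j)" by (cases mj)
    interpret w11_local "us j" "w j" K' by (rule w(1))
    have Wt: "W (t m *\<^sub>R e) x = t m *\<^sub>R w j i x" for x
      by (simp add: W_def e_def axis_def if_distrib[where f="\<lambda>a. _ * a"] if_distrib[where f="\<lambda>a. a *\<^sub>R _"] cong: if_cong)
    have "AE x in lborel. x \<in> V \<longrightarrow> U (x + t m *\<^sub>R e) - U x = (LINT s|lborel. indicator {0..1} s *\<^sub>R W (t m *\<^sub>R e) (x + s *\<^sub>R (t m *\<^sub>R e)))"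
      by (rule AE_line[OF nb(2)]) (rule sh)
    then show "AE x in lborel. norm ((case mj of (m, j) \<Rightarrow> g m j) x) \<le> norm ((case mj of (m, j) \<Rightarrow> \<lambda>x. LINT s|lborel. indicator {0..1::real} s *\<^sub>R w j i (x + s *\<^sub>R (t m *\<^sub>R e))) x)"
    proof eventually_elim
      case (elim x)
      show ?case
      proof (cases "x \<in> K")
        case True
        then have xV: "x \<in> V" using nb(3) by blast
        have "us j (x + t m *\<^sub>R e) - us j x = (LINT s|lborel. t m *\<^sub>R (indicator {0..1} s *\<^sub>R w j i (x + s *\<^sub>R (t m *\<^sub>R e))))"
          using elim xV sh1[OF True] nb(6) by (auto simp: U_def Wt mult.commute)
        then have "us j (x + t m *\<^sub>R e) - us j x = t m *\<^sub>R (LINT s|lborel. indicator {0..1} s *\<^sub>R w j i (x + s *\<^sub>R (t m *\<^sub>R e)))"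
          by (simp only: integral_scaleR_right)
        then show ?thesis using True t(1)[of m] by (simp add: g_def mj)
      qed (simp add: g_def mj)
    qed
  qed
  have eiH: "equi_int lborel H"
  proof (rule equi_int_limit[OF eig])
    show "g m j \<in> borel_measurable lborel" for m j using gm by simp
    show "AE x in lborel. (\<lambda>j. g m j x) \<longlonglongrightarrow> H m x" for m
    proof (rule AE_I2)
      fix x
      show "(\<lambda>j. g m j x) \<longlonglongrightarrow> H m x"
      proof (cases "x \<in> K")
        case True
        then show ?thesis unfolding g_def H_def using sh1[OF True, of m] nb(5) K(2)
          by (intro tendsto_intros lim[rule_format]) auto
      qed (simp add: g_def H_def)
    qed
  qed
  \<comment> \<open>Defined by \<open>lim\<close> so that it is Borel measurable; almost everywhere
    it equals the truncated partial derivative.\<close>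
  define d where "d x = lim (\<lambda>m. H m x)" for x
  have dm[measurable]: "d \<in> borel_measurable borel" unfolding d_def by (rule borel_measurable_lim_metric) simp
  have conv: "AE x in lebesgue. (\<lambda>m. H m x) \<longlonglongrightarrow> indicator K x *\<^sub>R pd u x i"
    using part
  proof eventually_elim
    case (elim x)
    show ?case
    proof (cases "x \<in> K")
      case True
      then have "has_partial u (x + 0 *\<^sub>R axis i 1) i" using elim K(2) by auto
      note hd = has_partial_imp_deriv[OF this]
      have "((\<lambda>s. (u (x + s *\<^sub>R e) - u x) /\<^sub>R s) \<longlongrightarrow> pd u x i) (at 0)"
      proof -
        let ?p = "pd u x i"
        have "(\<lambda>s. (u (x + s *\<^sub>R e) - u x - s *\<^sub>R ?p) /\<^sub>R \<bar>s\<bar>) \<midarrow>0\<rightarrow> 0"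
          using hd by (simp add: has_vector_derivative_def has_derivative_def e_def)
        then have "(\<lambda>s. norm ((u (x + s *\<^sub>R e) - u x - s *\<^sub>R ?p) /\<^sub>R \<bar>s\<bar>)) \<midarrow>0\<rightarrow> 0"
          by (rule tendsto_norm_zero)
        moreover have "norm ((X - s *\<^sub>R ?p) /\<^sub>R \<bar>s\<bar>) = norm (X /\<^sub>R s - ?p)" if "s \<noteq> 0" for s X
        proof -
          have "X /\<^sub>R s - ?p = (X - s *\<^sub>R ?p) /\<^sub>R s" using that by (simp add: scaleR_diff_right)
          then show ?thesis by simp
        qed
        then have "\<forall>\<^sub>F s in at 0. norm ((u (x + s *\<^sub>R e) - u x - s *\<^sub>R ?p) /\<^sub>R \<bar>s\<bar>) = norm ((u (x + s *\<^sub>R e) - u x) /\<^sub>R s - ?p)"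
          unfolding eventually_at_filter by (intro always_eventually allI impI)
        ultimately have "(\<lambda>s. norm ((u (x + s *\<^sub>R e) - u x) /\<^sub>R s - ?p)) \<midarrow>0\<rightarrow> 0"
          by (rule Lim_transform_eventually)
        then have "(\<lambda>s. (u (x + s *\<^sub>R e) - u x) /\<^sub>R s - ?p) \<midarrow>0\<rightarrow> 0" by (rule tendsto_norm_zero_cancel)
        then show ?thesis by (rule LIM_zero_cancel)
      qed
      moreover have "filterlim t (at 0) sequentially"
        using t0 t(1) by (intro filterlim_atI) (auto simp: less_imp_neq[symmetric] intro!: always_eventually)
      ultimately have "(\<lambda>m. (u (x + t m *\<^sub>R e) - u x) /\<^sub>R t m) \<longlonglongrightarrow> pd u x i"
        by (rule filterlim_compose)
      then show ?thesis using True by (simp add: H_def)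
    qed (simp add: H_def)
  qed
  have dae: "AE x in lebesgue. d x = indicator K x *\<^sub>R pd u x i"
    using conv by eventually_elim (simp add: d_def limI)
  have convd: "AE x in lborel. (\<lambda>m. H m x) \<longlonglongrightarrow> d x"
  proof -
    have "AE x in lebesgue. (\<lambda>m. H m x) \<longlonglongrightarrow> d x" using conv by eventually_elim (simp add: d_def limI)
    then show ?thesis by (simp add: AE_completion_iff)
  qed
  have fin: "emeasure lborel K < \<infinity>" using emeasure_compact_finite[OF K(1)] .
  have dz: "d x = 0" if "x \<notin> K" for x using that by (simp add: d_def H_def limI)
  have Hz: "H m x = 0" if "x \<notin> K" for x m using that by (simp add: H_def)
  have "K \<in> sets lborel" by simp
  note vit = vitali_convergence[OF this fin _ _ eiH convd]
  have v: "integrable lborel d" "(\<lambda>m. LINT x|lborel. norm (H m x - d x)) \<longlonglongrightarrow> 0"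
    using Hz dz by (auto intro!: vit)
  have Hi: "integrable lborel (H m)" for m by (rule integrable_if_equi_int[OF eiH]) simp
  show thesis
    by (rule that[OF t(1) t0 nb(4,5) _ _ v(1) dae]) (use nb sh1 Hi v(2) in \<open>auto simp: H_def[abs_def] e_def\<close>)
qed

text \<open>Passage from Bochner integrals of Borel functions on the whole space to gauge integrals
  on a set, allowing a null set of disagreement.\<close>

lemma absolutely_integrable_AE_eq:
  fixes f g :: "'a::euclidean_space \<Rightarrow> 'b::euclidean_space"
  assumes f: "integrable lborel f" and ae: "AE x in lebesgue. f x = indicator K x *\<^sub>R g x" and K: "K \<in> sets lebesgue"
  shows "g absolutely_integrable_on K" "integral\<^sup>L lborel f = integral K g"
proof -
  obtain N where N: "negligible N" "{x. f x \<noteq> indicator K x *\<^sub>R g x} \<subseteq> N"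
    using ae by (auto simp: eventually_ae_filter_negligible)
  have eq: "f x = indicator K x *\<^sub>R g x" if "x \<notin> N" for x using N(2) that by blast
  have "integrable lebesgue f" using f by (subst integrable_completion) auto
  then have fU: "f absolutely_integrable_on UNIV" by (simp add: set_integrable_def)
  then have fK: "f absolutely_integrable_on K" using K by (rule set_integrable_subset) auto
  show "g absolutely_integrable_on K"
    by (rule absolutely_integrable_spike[OF fK N(1)]) (auto simp: eq)
  have "integral\<^sup>L lborel f = integral UNIV f" by (rule integral_lborel[OF f, symmetric])
  also have "\<dots> = integral UNIV (\<lambda>x. if x \<in> K then g x else 0)"
    by (rule integral_spike[OF N(1)]) (auto simp: eq)
  also have "\<dots> = integral K g" by (simp add: integral_restrict_UNIV)
  finally show "integral\<^sup>L lborel f = integral K g" .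
qed

text \<open>Discrete integration by parts: translation moves the difference quotient from u to the
  test function. One side converges by L^1 convergence of the quotients of u, the other by dominated
  convergence, with the mean value theorem bounding the quotients of \<phi>.\<close>

lemma weak_partial_of_limit:
  fixes u :: "real^'n \<Rightarrow> 'b::euclidean_space" and us :: "nat \<Rightarrow> real^'n \<Rightarrow> 'b"
  assumes \<Omega>: "open \<Omega>" and cus: "\<And>j. continuous_on \<Omega> (us j)" and cu: "continuous_on \<Omega> u"
    and lim: "\<forall>x\<in>\<Omega>. (\<lambda>j. us j x) \<longlonglongrightarrow> u x"
    and loc: "\<forall>K. compact K \<and> K \<subseteq> \<Omega> \<longrightarrow> (\<exists>w. (\<forall>j. w11_local (us j) (w j) K) \<and> equi_int lborel (\<lambda>j. w j i))"
    and part: "AE x in lebesgue. x \<in> \<Omega> \<longrightarrow> has_partial u x i"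
  shows weak_partial_of_limit_integrable: "locally_L1 (\<lambda>x. pd u x i) \<Omega>"
    and weak_partial_of_limit_test: "test_fun \<Omega> \<phi> \<Longrightarrow> integral \<Omega> (\<lambda>x. pd \<phi> x i *\<^sub>R u x) = - integral \<Omega> (\<lambda>x. \<phi> x *\<^sub>R pd u x i)"
proof -
  note local = weak_partial_of_limit_local[OF \<Omega> cus cu lim loc part]
  show "locally_L1 (\<lambda>x. pd u x i) \<Omega>"
    unfolding locally_L1_def
  proof (intro allI impI)
    fix K :: "(real^'n) set" assume K: "compact K \<and> K \<subseteq> \<Omega>"
    then obtain d where d: "integrable lborel d" "AE x in lebesgue. d x = indicator K x *\<^sub>R pd u x i"
      by (elim conjE) (rule local)
    show "(\<lambda>x. pd u x i) absolutely_integrable_on K"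
      by (rule absolutely_integrable_AE_eq(1)[OF d]) (use K in \<open>auto intro: lmeasurable_compact fmeasurableD\<close>)
  qed
  assume tf: "test_fun \<Omega> \<phi>"
  define K where "K = closure {x. \<phi> x \<noteq> 0}"
  have K: "compact K" "K \<subseteq> \<Omega>" using tf by (auto simp: test_fun_def K_def)
  define e where "e = (axis i 1 :: real^'n)"
  obtain t K' d where *: "\<And>m. t m > (0::real)" "t \<longlonglongrightarrow> 0" "compact K'" "K' \<subseteq> \<Omega>" "K \<subseteq> K'"
    "\<And>x m. x \<in> K \<Longrightarrow> x + t m *\<^sub>R e \<in> K'"
    "integrable lborel d" "AE x in lebesgue. d x = indicator K x *\<^sub>R pd u x i"
    "\<And>m. integrable lborel (\<lambda>x. indicator K x *\<^sub>R ((u (x + t m *\<^sub>R e) - u x) /\<^sub>R t m))"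
    "(\<lambda>m. LINT x|lborel. norm (indicator K x *\<^sub>R ((u (x + t m *\<^sub>R e) - u x) /\<^sub>R t m) - d x)) \<longlonglongrightarrow> 0"
    by (rule local[OF K, folded e_def], rule that)
  define H where "H m x = indicator K x *\<^sub>R ((u (x + t m *\<^sub>R e) - u x) /\<^sub>R t m)" for m x
  define U where "U x = indicator K' x *\<^sub>R u x" for x
  have iU: "integrable lborel U" unfolding U_def
    by (rule borel_integrable_compact[OF *(3)]) (rule continuous_on_subset[OF cu *(4)])
  have c\<phi>: "continuous_on UNIV \<phi>" and cp: "continuous_on UNIV (\<lambda>x. pd \<phi> x i)" by (rule test_fun_pd[OF tf])+
  have out: "\<phi> x = 0" "pd \<phi> x i = 0" if "x \<notin> K" for x
    using test_fun_pd(4)[OF tf] that closure_subset[of "{x. \<phi> x \<noteq> 0}"] by (auto simp: K_def)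
  have [measurable]: "\<phi> \<in> borel_measurable borel" "(\<lambda>x. pd \<phi> x i) \<in> borel_measurable borel"
    using c\<phi> cp by (auto intro: borel_measurable_continuous_onI)
  have bnd: "\<exists>B\<ge>0. \<forall>x. norm (f x) \<le> B" if c: "continuous_on UNIV f" and o: "\<And>x. x \<notin> K \<Longrightarrow> f x = 0" for f :: "real^'n \<Rightarrow> real"
  proof -
    have "bounded (f ` K)" by (intro compact_imp_bounded compact_continuous_image K continuous_on_subset[OF c]) auto
    then obtain B where B: "\<And>x. x \<in> K \<Longrightarrow> norm (f x) \<le> B" by (auto simp: bounded_iff)
    have "norm (f x) \<le> max B 0" for x using B[of x] o[of x] by (cases "x \<in> K") auto
    then show ?thesis by (intro exI[of _ "max B 0"]) auto
  qed
  obtain B0 where B0: "B0 \<ge> 0" "\<And>x. norm (\<phi> x) \<le> B0" using bnd[OF c\<phi> out(1)] by auto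
  obtain B1 where B1: "B1 \<ge> 0" "\<And>x. norm (pd \<phi> x i) \<le> B1" using bnd[OF cp out(2)] by auto
  have ibd: "integrable lborel (\<lambda>x. f x *\<^sub>R G x)"
    if "integrable lborel G" "f \<in> borel_measurable borel" "\<And>y. norm (f y) \<le> B" "0 \<le> B" for f and G :: "real^'n \<Rightarrow> 'b" and B
  proof (rule Bochner_Integration.integrable_bound[where f="\<lambda>x. B *\<^sub>R G x"])
    show "AE x in lborel. norm (f x *\<^sub>R G x) \<le> norm (B *\<^sub>R G x)"
    proof (intro AE_I2)
      fix x
      have "norm (f x) * norm (G x) \<le> \<bar>B\<bar> * norm (G x)"
        by (rule mult_right_mono) (use that(3)[of x] that(4) in auto)
      then show "norm (f x *\<^sub>R G x) \<le> norm (B *\<^sub>R G x)" by simp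
    qed
  qed (use that in auto)
  have iH: "integrable lborel (H m)" for m unfolding H_def by (rule *(9))
  have dq: "norm ((\<phi> (y - t m *\<^sub>R e) - \<phi> y) / t m) \<le> B1" for y m
  proof -
    have der: "((\<lambda>s. \<phi> (y + s *\<^sub>R e)) has_real_derivative pd \<phi> (y + s *\<^sub>R e) i) (at s)" for s
      using has_partial_imp_deriv[OF test_fun_pd(3)[OF tf], where x=y and s=s and i=i] by (simp add: e_def has_real_derivative_iff_has_vector_derivative)
    have "- t m < 0" using *(1) by simp
    from MVT2[OF this, of "\<lambda>s. \<phi> (y + s *\<^sub>R e)" "\<lambda>s. pd \<phi> (y + s *\<^sub>R e) i"] der
    obtain z where "\<phi> (y + 0 *\<^sub>R e) - \<phi> (y + (- t m) *\<^sub>R e) = (0 - (- t m)) * pd \<phi> (y + z *\<^sub>R e) i" by auto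
    then have "\<phi> (y - t m *\<^sub>R e) - \<phi> y = - (t m * pd \<phi> (y + z *\<^sub>R e) i)" by simp
    then have "(\<phi> (y - t m *\<^sub>R e) - \<phi> y) / t m = - pd \<phi> (y + z *\<^sub>R e) i" using *(1)[of m] by (simp add: field_simps)
    then show ?thesis using B1(2)[of "y + z *\<^sub>R e"] by simp
  qed
  have swap: "(LINT x|lborel. \<phi> x *\<^sub>R H m x) = (LINT y|lborel. ((\<phi> (y - t m *\<^sub>R e) - \<phi> y) / t m) *\<^sub>R U y)" for m
  proof -
    have eq: "\<phi> x *\<^sub>R H m x = (1 / t m) *\<^sub>R (\<phi> x *\<^sub>R U (x + t m *\<^sub>R e) - \<phi> x *\<^sub>R U x)" for x
    proof (cases "x \<in> K")
      case True
      then have "x \<in> K'" "x + t m *\<^sub>R e \<in> K'" using *(5,6) by auto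
      then show ?thesis using True by (simp add: H_def U_def scaleR_diff_right divide_inverse mult.commute)
    qed (simp add: out)
    have i1: "integrable lborel (\<lambda>x. \<phi> x *\<^sub>R U (x + t m *\<^sub>R e))" by (rule ibd[OF _ _ B0(2,1)]) (auto intro: lborel_integrable_translate iU)
    have i2: "integrable lborel (\<lambda>x. \<phi> x *\<^sub>R U x)" by (rule ibd[OF _ _ B0(2,1)]) (auto intro: iU)
    have i3: "integrable lborel (\<lambda>x. \<phi> (x - t m *\<^sub>R e) *\<^sub>R U x)"
      by (rule ibd[OF iU _ _ B0(1)]) (use B0(2) in auto)
    have "(LINT x|lborel. \<phi> x *\<^sub>R H m x) = (1 / t m) *\<^sub>R ((LINT x|lborel. \<phi> x *\<^sub>R U (x + t m *\<^sub>R e)) - (LINT x|lborel. \<phi> x *\<^sub>R U x))"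
      unfolding eq by (simp only: integral_scaleR_right Bochner_Integration.integral_diff[OF i1 i2])
    also have "(LINT x|lborel. \<phi> x *\<^sub>R U (x + t m *\<^sub>R e)) = (LINT y|lborel. \<phi> (y - t m *\<^sub>R e) *\<^sub>R U y)"
      using lborel_integral_translate[of "\<lambda>y. \<phi> (y - t m *\<^sub>R e) *\<^sub>R U y" "t m *\<^sub>R e"] by simp
    also have "(1 / t m) *\<^sub>R ((LINT y|lborel. \<phi> (y - t m *\<^sub>R e) *\<^sub>R U y) - (LINT x|lborel. \<phi> x *\<^sub>R U x)) =
        (LINT y|lborel. (1 / t m) *\<^sub>R (\<phi> (y - t m *\<^sub>R e) *\<^sub>R U y - \<phi> y *\<^sub>R U y))"
      by (simp only: integral_scaleR_right Bochner_Integration.integral_diff[OF i3 i2])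
    also have "\<dots> = (LINT y|lborel. ((\<phi> (y - t m *\<^sub>R e) - \<phi> y) / t m) *\<^sub>R U y)"
      by (intro Bochner_Integration.integral_cong refl) (simp add: algebra_simps diff_divide_distrib)
    finally show ?thesis .
  qed
  have L: "(\<lambda>m. LINT x|lborel. \<phi> x *\<^sub>R H m x) \<longlonglongrightarrow> (LINT x|lborel. \<phi> x *\<^sub>R d x)"
  proof (rule LIM_zero_cancel, rule Lim_null_comparison[where g="\<lambda>m. B0 * (LINT x|lborel. norm (H m x - d x))"])
    show "(\<lambda>m. B0 * (LINT x|lborel. norm (H m x - d x))) \<longlonglongrightarrow> 0"
      using tendsto_mult[OF tendsto_const *(10), of B0] by (simp add: H_def)
    show "\<forall>\<^sub>F m in sequentially. norm ((LINT x|lborel. \<phi> x *\<^sub>R H m x) - (LINT x|lborel. \<phi> x *\<^sub>R d x)) \<le> B0 * (LINT x|lborel. norm (H m x - d x))"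
    proof (rule always_eventually, rule allI)
      fix m
      have i1: "integrable lborel (\<lambda>x. \<phi> x *\<^sub>R H m x)" by (rule ibd[OF iH _ B0(2,1)]) simp
      have i2: "integrable lborel (\<lambda>x. \<phi> x *\<^sub>R d x)" by (rule ibd[OF *(7) _ B0(2,1)]) simp
      have i3: "integrable lborel (\<lambda>x. norm (H m x - d x))" using iH *(7) by auto
      have "norm ((LINT x|lborel. \<phi> x *\<^sub>R H m x) - (LINT x|lborel. \<phi> x *\<^sub>R d x)) = norm (LINT x|lborel. \<phi> x *\<^sub>R H m x - \<phi> x *\<^sub>R d x)"
        by (simp only: Bochner_Integration.integral_diff[OF i1 i2])
      also have "\<dots> \<le> (LINT x|lborel. B0 * norm (H m x - d x))"
      proof (rule Bochner_Integration.integral_norm_bound_integral)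
        show "norm (\<phi> x *\<^sub>R H m x - \<phi> x *\<^sub>R d x) \<le> B0 * norm (H m x - d x)" for x
          using B0(2)[of x] by (simp add: scaleR_diff_right[symmetric] mult_right_mono)
      qed (use i1 i2 i3 in auto)
      finally show "norm ((LINT x|lborel. \<phi> x *\<^sub>R H m x) - (LINT x|lborel. \<phi> x *\<^sub>R d x)) \<le> B0 * (LINT x|lborel. norm (H m x - d x))"
        by simp
    qed
  qed
  have R: "(\<lambda>m. LINT y|lborel. ((\<phi> (y - t m *\<^sub>R e) - \<phi> y) / t m) *\<^sub>R U y) \<longlonglongrightarrow> (LINT y|lborel. (- pd \<phi> y i) *\<^sub>R U y)"
  proof (rule integral_dominated_convergence[where w="\<lambda>y. B1 * norm (U y)"])
    show "AE y in lborel. (\<lambda>m. ((\<phi> (y - t m *\<^sub>R e) - \<phi> y) / t m) *\<^sub>R U y) \<longlonglongrightarrow> (- pd \<phi> y i) *\<^sub>R U y"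
    proof (rule AE_I2)
      fix y
      have "((\<lambda>s. \<phi> (y + s *\<^sub>R e)) has_real_derivative pd \<phi> (y + 0 *\<^sub>R e) i) (at 0)"
        using has_partial_imp_deriv[OF test_fun_pd(3)[OF tf], where x=y and s=0 and i=i] by (simp add: e_def has_real_derivative_iff_has_vector_derivative)
      then have "((\<lambda>s. (\<phi> (y + s *\<^sub>R e) - \<phi> y) / s) \<longlongrightarrow> pd \<phi> y i) (at 0)"
        by (simp add: has_field_derivative_iff)
      moreover have "filterlim (\<lambda>m. - t m) (at 0) sequentially"
        using tendsto_minus[OF *(2)] *(1) by (intro filterlim_atI) (auto simp: less_imp_neq[symmetric] intro!: always_eventually)
      ultimately have "(\<lambda>m. (\<phi> (y + (- t m) *\<^sub>R e) - \<phi> y) / (- t m)) \<longlonglongrightarrow> pd \<phi> y i" by (rule filterlim_compose)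
      then have "(\<lambda>m. - ((\<phi> (y + (- t m) *\<^sub>R e) - \<phi> y) / (- t m))) \<longlonglongrightarrow> - pd \<phi> y i" by (rule tendsto_minus)
      then have "(\<lambda>m. (\<phi> (y - t m *\<^sub>R e) - \<phi> y) / t m) \<longlonglongrightarrow> - pd \<phi> y i" by simp
      then show "(\<lambda>m. ((\<phi> (y - t m *\<^sub>R e) - \<phi> y) / t m) *\<^sub>R U y) \<longlonglongrightarrow> (- pd \<phi> y i) *\<^sub>R U y" by (intro tendsto_intros)
    qed
    show "AE y in lborel. norm (((\<phi> (y - t m *\<^sub>R e) - \<phi> y) / t m) *\<^sub>R U y) \<le> B1 * norm (U y)" for m
      using dq[of _ m] by (intro AE_I2) (simp only: norm_scaleR real_norm_def[symmetric] mult_right_mono norm_ge_zero)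
    have [measurable]: "U \<in> borel_measurable borel" using iU by (auto dest: borel_measurable_integrable)
    show "(\<lambda>y. (- pd \<phi> y i) *\<^sub>R U y) \<in> borel_measurable lborel" by measurable
    show "(\<lambda>y. ((\<phi> (y - t m *\<^sub>R e) - \<phi> y) / t m) *\<^sub>R U y) \<in> borel_measurable lborel" for m by measurable
  qed (use iU in auto)
  have main: "(LINT x|lborel. \<phi> x *\<^sub>R d x) = - (LINT y|lborel. pd \<phi> y i *\<^sub>R U y)"
    using LIMSEQ_unique[OF L R[folded swap]] by simp
  have "(LINT x|lborel. \<phi> x *\<^sub>R d x) = integral \<Omega> (\<lambda>x. \<phi> x *\<^sub>R pd u x i)"
  proof (rule absolutely_integrable_AE_eq(2))
    show "integrable lborel (\<lambda>x. \<phi> x *\<^sub>R d x)" by (rule ibd[OF *(7) _ B0(2,1)]) simp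
    show "AE x in lebesgue. \<phi> x *\<^sub>R d x = indicator \<Omega> x *\<^sub>R (\<phi> x *\<^sub>R pd u x i)"
      using *(8) by eventually_elim (use out K(2) in \<open>auto simp: indicator_def\<close>)
    show "\<Omega> \<in> sets lebesgue" using \<Omega> by simp
  qed
  moreover have "(LINT y|lborel. pd \<phi> y i *\<^sub>R U y) = integral \<Omega> (\<lambda>x. pd \<phi> x i *\<^sub>R u x)"
  proof (rule absolutely_integrable_AE_eq(2))
    show "integrable lborel (\<lambda>x. pd \<phi> x i *\<^sub>R U x)" by (rule ibd[OF iU _ B1(2,1)]) simp
    show "AE x in lebesgue. pd \<phi> x i *\<^sub>R U x = indicator \<Omega> x *\<^sub>R (pd \<phi> x i *\<^sub>R u x)"
    proof (intro AE_I2)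
      fix x
      show "pd \<phi> x i *\<^sub>R U x = indicator \<Omega> x *\<^sub>R (pd \<phi> x i *\<^sub>R u x)"
      proof (cases "x \<in> K")
        case True
        then have "x \<in> K'" "x \<in> \<Omega>" using *(5) K(2) by blast+
        then show ?thesis by (simp add: U_def)
      qed (simp add: out)
    qed
    show "\<Omega> \<in> sets lebesgue" using \<Omega> by simp
  qed
  ultimately have "integral \<Omega> (\<lambda>x. \<phi> x *\<^sub>R pd u x i) = - integral \<Omega> (\<lambda>x. pd \<phi> x i *\<^sub>R u x)"
    using main by (simp only:)
  then show "integral \<Omega> (\<lambda>x. pd \<phi> x i *\<^sub>R u x) = - integral \<Omega> (\<lambda>x. \<phi> x *\<^sub>R pd u x i)"
    by (simp only: minus_minus)
qed

text \<open>The preceding result for the constant sequence u shows that its classical partial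
  derivative is also a weak one; two weak partial derivatives agree almost everywhere by testing
  their difference with bumps.\<close>

lemma pd_eq_weak_partial:
  fixes u :: "real^'n \<Rightarrow> real^'m"
  assumes D: "open \<Omega>" and cu: "continuous_on \<Omega> u" and wp: "weak_partials \<Omega> u v"
    and part: "AE x in lebesgue. x \<in> \<Omega> \<longrightarrow> has_partial u x i"
  shows "AE x in lebesgue. x \<in> \<Omega> \<longrightarrow> pd u x i = v i x"
proof -
  have loc: "\<exists>w. (\<forall>j::nat. w11_local u (w j) K) \<and> equi_int lborel (\<lambda>j. w j i)" if K: "compact K" "K \<subseteq> \<Omega>" for K
  proof -
    obtain w where w: "w11_local u w K" by (rule w11_local_exists[OF cu wp K])
    have "equi_int lborel (\<lambda>_::nat. w i)" by (rule equi_int_single) (rule w11_local.intw[OF w])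
    then show ?thesis using w by (intro exI[of _ "\<lambda>_. w"]) auto
  qed
  then have loc': "\<forall>K. compact K \<and> K \<subseteq> \<Omega> \<longrightarrow> (\<exists>w. (\<forall>j::nat. w11_local u (w j) K) \<and> equi_int lborel (\<lambda>j. w j i))" by blast
  have lim: "\<forall>x\<in>\<Omega>. (\<lambda>j::nat. u x) \<longlonglongrightarrow> u x" by simp
  note W = weak_partial_of_limit_integrable[OF D cu cu lim loc' part]
    weak_partial_of_limit_test[OF D cu cu lim loc' part]
  have local: "AE x in lebesgue. x \<in> box a b \<longrightarrow> pd u x i = v i x" if ab: "cbox a b \<subseteq> \<Omega>" for a b
  proof -
    have "(\<lambda>x. pd u x i - v i x) absolutely_integrable_on cbox a b"
      using W(1) wp ab by (intro set_integral_diff) (auto simp: locally_L1_def weak_partials_def)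
    then have iz: "integrable lebesgue (\<lambda>x. indicator (cbox a b) x *\<^sub>R (pd u x i - v i x))" by (simp add: set_integrable_def)
    obtain z where z: "integrable lborel z" "AE x in lebesgue. z x = indicator (cbox a b) x *\<^sub>R (pd u x i - v i x)"
      by (rule lebesgue_integrable_borel_version[OF iz])
    have "AE x in lborel. x \<in> box a b \<longrightarrow> z x = 0"
    proof (rule AE_zero_if_box_bump_integrals_zero[OF open_box z(1)])
      fix c d m assume ne: "box c d \<noteq> {}" and sub: "cbox c d \<subseteq> box a b"
      define \<phi> where "\<phi> = box_bump c d m"
      have sub': "cbox c d \<subseteq> \<Omega>" "cbox c d \<subseteq> cbox a b" using sub ab box_subset_cbox by blast+
      have tf: "test_fun \<Omega> \<phi>" unfolding \<phi>_def by (rule test_fun_box_bump[OF ne sub'(1)])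
      have out: "\<phi> x = 0" if "x \<notin> cbox c d" for x
        using that box_subset_cbox by (auto simp: \<phi>_def intro!: box_bump_outside)
      have int: "(\<lambda>x. \<phi> x *\<^sub>R g x) absolutely_integrable_on \<Omega>"
        if g: "g absolutely_integrable_on cbox c d" for g :: "real^'n \<Rightarrow> real^'m"
      proof -
        obtain h where h: "integrable lborel h" "AE x in lebesgue. h x = indicator (cbox c d) x *\<^sub>R g x"
          by (rule lebesgue_integrable_borel_version[OF g[unfolded set_integrable_def]])
        show ?thesis
        proof (rule absolutely_integrable_AE_eq(1))
          show "integrable lborel (\<lambda>x. \<phi> x *\<^sub>R h x)" unfolding \<phi>_def by (rule integrable_box_bump[OF ne h(1)])
          show "AE x in lebesgue. \<phi> x *\<^sub>R h x = indicator \<Omega> x *\<^sub>R (\<phi> x *\<^sub>R g x)"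
            using h(2) by eventually_elim (use out sub'(1) in \<open>auto simp: indicator_def\<close>)
          show "\<Omega> \<in> sets lebesgue" using D by simp
        qed
      qed
      have ig: "(\<lambda>x. pd u x i) absolutely_integrable_on cbox c d" "v i absolutely_integrable_on cbox c d"
        using W(1) wp sub'(1) by (auto simp: locally_L1_def weak_partials_def)
      have "(LINT x|lborel. \<phi> x *\<^sub>R z x) = integral \<Omega> (\<lambda>x. \<phi> x *\<^sub>R (pd u x i - v i x))"
      proof (rule absolutely_integrable_AE_eq(2))
        show "integrable lborel (\<lambda>x. \<phi> x *\<^sub>R z x)" unfolding \<phi>_def by (rule integrable_box_bump[OF ne z(1)])
        show "AE x in lebesgue. \<phi> x *\<^sub>R z x = indicator \<Omega> x *\<^sub>R (\<phi> x *\<^sub>R (pd u x i - v i x))"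
          using z(2) by eventually_elim (use out sub' in \<open>auto simp: indicator_def\<close>)
        show "\<Omega> \<in> sets lebesgue" using D by simp
      qed
      also have "\<dots> = integral \<Omega> (\<lambda>x. \<phi> x *\<^sub>R pd u x i) - integral \<Omega> (\<lambda>x. \<phi> x *\<^sub>R v i x)"
        unfolding scaleR_diff_right using int[OF ig(1)] int[OF ig(2)]
        by (intro integral_diff) (auto simp: absolutely_integrable_on_def)
      also have "\<dots> = 0"
        using W(2)[OF tf] wp tf unfolding weak_partials_def by force
      finally show "(LINT x|lborel. box_bump c d m x *\<^sub>R z x) = 0" by (simp add: \<phi>_def)
    qed
    then have "AE x in lebesgue. x \<in> box a b \<longrightarrow> z x = 0" by (rule AE_completion)
    with z(2) show ?thesis by eventually_elim (use box_subset_cbox in \<open>auto simp: indicator_def split: if_splits\<close>)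
  qed
  obtain \<D> where \<D>: "countable \<D>" "\<D> \<subseteq> Pow \<Omega>" "\<And>X. X \<in> \<D> \<Longrightarrow> \<exists>a b. X = cbox a b" "\<Union>\<D> = \<Omega>"
    using open_countable_Union_open_cbox[OF D] by metis
  have "AE x in lebesgue. x \<in> X \<longrightarrow> pd u x i = v i x" if X: "X \<in> \<D>" for X
  proof -
    obtain a b where ab: "X = cbox a b" using \<D>(3)[OF X] by blast
    have "AE x in lebesgue. x \<notin> cbox a b - box a b"
      using negligible_frontier_interval[of a b] unfolding negligible_iff_null_sets by (rule AE_not_in)
    moreover have "AE x in lebesgue. x \<in> box a b \<longrightarrow> pd u x i = v i x"
      by (rule local) (use \<D>(2) X ab in auto)
    ultimately show ?thesis unfolding ab by eventually_elim auto
  qed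
  then have "AE x in lebesgue. \<forall>X\<in>\<D>. x \<in> X \<longrightarrow> pd u x i = v i x"
    by (subst AE_ball_countable[OF \<D>(1)]) blast
  then show ?thesis by eventually_elim (use \<D>(4) in auto)
qed

section \<open>The dilatation and the integrand\<close>

text \<open>A superlevel set of a monotone function is upward closed, hence empty or a ray starting
  at its infimum.\<close>

lemma borel_measurable_mono_ennreal:
  fixes g :: "ennreal \<Rightarrow> ennreal"
  assumes g: "mono g" shows "g \<in> borel_measurable borel"
proof (rule borel_measurableI_greater)
  fix a
  define S where "S = {x. a < g x}"
  have up: "y \<in> S" if "x \<in> S" "x \<le> y" for x y
    using that monoD[OF g, of x y] by (auto simp: S_def intro: less_le_trans)
  have "S \<in> sets borel"
  proof (cases "S = {}")
    case False
    have "S = {Inf S..} \<or> S = {Inf S<..}"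
    proof (cases "Inf S \<in> S")
      case True
      then have "S = {Inf S..}" using up by (auto intro: Inf_lower)
      then show ?thesis ..
    next
      case False
      have "x \<in> S" if "Inf S < x" for x
        using that up unfolding Inf_less_iff by (meson less_imp_le)
      moreover have "Inf S < x" if "x \<in> S" for x
        using that False Inf_lower[OF that] by (metis order_le_imp_less_or_eq)
      ultimately have "S = {Inf S<..}" by auto
      then show ?thesis ..
    qed
    then show ?thesis by (metis atLeast_borel greaterThan_borel)
  qed simp
  then show "{x \<in> space borel. a < g x} \<in> sets borel" by (simp add: S_def)
qed

section \<open>The growth function and its affine minorants\<close>

lemma strictly_convex_Phi_mono:
  assumes "strictly_convex_Phi \<Phi>" "1 \<le> s" "s \<le> t" shows "\<Phi> s \<le> \<Phi> t"
  using assms by (auto simp: strictly_convex_Phi_def)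

text \<open>Superlinear growth gives \<open>\<Phi>\<close> \<ge> k t for t \<ge> s, and for smaller
  t the left side is 0 because \<open>ennreal\<close> truncates negative numbers.\<close>

lemma Phi_superlinear:
  assumes Phi: "strictly_convex_Phi \<Phi>" and k: "k > 0"
  obtains s where "s \<ge> 1" "\<And>t::real. 1 \<le> t \<Longrightarrow> ennreal (k * (t - s)) \<le> \<Phi> (ennreal t)"
proof -
  have "((\<lambda>t::real. \<Phi> (ennreal t) / ennreal t) \<longlongrightarrow> \<infinity>) at_top" using Phi by (simp add: strictly_convex_Phi_def)
  then have "\<forall>\<^sub>F t::real in at_top. ennreal k < \<Phi> (ennreal t) / ennreal t"
    by (intro order_tendstoD(1)) auto
  then obtain s where s: "\<And>t::real. t \<ge> s \<Longrightarrow> ennreal k < \<Phi> (ennreal t) / ennreal t"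
    by (auto simp: eventually_at_top_linorder)
  have "ennreal (k * (t - max 1 s)) \<le> \<Phi> (ennreal t)" if t: "1 \<le> t" for t :: real
  proof (cases "t \<ge> max 1 s")
    case True
    have "ennreal k \<le> \<Phi> (ennreal t) / ennreal t" using s[of t] True by auto
    then have "ennreal k * ennreal t \<le> \<Phi> (ennreal t) / ennreal t * ennreal t" by (rule mult_right_mono) simp
    also have "\<dots> = \<Phi> (ennreal t) * (ennreal t / ennreal t)" by (rule ennreal_divide_times)
    also have "\<dots> = \<Phi> (ennreal t)" using t by (simp add: ennreal_divide_self)
    finally have "ennreal (k * t) \<le> \<Phi> (ennreal t)" using k t by (simp add: ennreal_mult')
    moreover have "ennreal (k * (t - max 1 s)) \<le> ennreal (k * t)" using k by (intro ennreal_leI) auto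
    ultimately show ?thesis by (rule order_trans[rotated])
  next
    case False
    then have "t - max 1 s \<le> 0" by linarith
    then have "k * (t - max 1 s) \<le> 0" using k by (simp only: mult_le_0_iff) simp
    then show ?thesis by (simp add: ennreal_neg)
  qed
  then show thesis using that[of "max 1 s"] by auto
qed

lemma Phi_top:
  assumes Phi: "strictly_convex_Phi \<Phi>" shows "\<Phi> \<infinity> = \<infinity>"
proof (rule ccontr)
  assume "\<Phi> \<infinity> \<noteq> \<infinity>"
  then obtain r where r: "\<Phi> \<infinity> = ennreal r" "r \<ge> 0" by (cases "\<Phi> \<infinity>") auto
  obtain s where s: "s \<ge> 1" "\<And>t::real. 1 \<le> t \<Longrightarrow> ennreal (1 * (t - s)) \<le> \<Phi> (ennreal t)"
    using Phi_superlinear[OF Phi, of 1] by auto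
  have "ennreal (r + 1) \<le> \<Phi> (ennreal (r + s + 1))" using s(2)[of "r + s + 1"] s(1) r by simp
  also have "\<dots> \<le> \<Phi> \<infinity>" using s(1) r by (intro strictly_convex_Phi_mono[OF Phi]) (auto simp: one_ennreal_def[symmetric] ennreal_1[symmetric] simp del: ennreal_1 intro: ennreal_leI)
  finally show False using r by simp
qed

text \<open>A supporting line is taken at a point \<sigma> slightly to the left of \<tau>, since
  \<tau> may be the endpoint of the interval where \<open>\<Phi>\<close> is finite, and a supporting
  line of finite slope may fail to exist there. Left continuity at \<open>Phi_T\<close> ensures that
  little is lost. If \<open>\<Phi>\<close> is infinite already before \<tau>, a line through a zero
  before \<tau> does; at \<tau> = 1 a constant does.\<close>

lemma Phi_minorant:
  fixes \<tau> c :: real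
  assumes Phi: "strictly_convex_Phi \<Phi>" and lc: "left_cont_at_T \<Phi>" and \<tau>: "1 \<le> \<tau>" and c: "0 \<le> c" "ennreal c < \<Phi> (ennreal \<tau>)"
  obtains \<alpha> \<beta> :: real where "\<beta> \<ge> 0" "\<And>t::real. 1 \<le> t \<Longrightarrow> ennreal (\<alpha> + \<beta> * t) \<le> \<Phi> (ennreal t)" "\<alpha> + \<beta> * \<tau> \<ge> c"
proof -
  have one: "1 \<le> ennreal t \<longleftrightarrow> 1 \<le> t" for t :: real by (metis ennreal_1 ennreal_le_iff2 not_one_le_zero ennreal_ge_1)
  have mono: "\<Phi> (ennreal s) \<le> \<Phi> (ennreal t)" if "1 \<le> s" "s \<le> t" for s t :: real
    using that by (intro strictly_convex_Phi_mono[OF Phi]) (auto simp: one ennreal_leI)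
  consider (one) "\<tau> = 1" | (inf) \<sigma> where "1 < \<sigma>" "\<sigma> < \<tau>" "\<Phi> (ennreal \<sigma>) = \<infinity>"
    | (fin) "1 < \<tau>" "\<And>\<sigma>. 1 < \<sigma> \<Longrightarrow> \<sigma> < \<tau> \<Longrightarrow> \<Phi> (ennreal \<sigma>) < \<infinity>"
    using \<tau> by (metis infinity_ennreal_def less_eq_real_def top.not_eq_extremum)
  then show thesis
  proof cases
    case one
    show thesis
    proof (rule that[of 0 c])
      show "ennreal (c + 0 * t) \<le> \<Phi> (ennreal t)" if "1 \<le> t" for t
        using mono[of 1 t] that c(2) one by simp
    qed auto
  next
    case inf
    \<comment> \<open>The line vanishes at \<sigma> and takes the value c at \<tau>; beyond \<sigma>
      it lies below \<open>\<Phi>\<close>, which is infinite there.\<close>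
    define \<beta> where "\<beta> = c / (\<tau> - \<sigma>)"
    have \<beta>: "\<beta> \<ge> 0" using c(1) inf by (simp add: \<beta>_def)
    show thesis
    proof (rule that[of \<beta> "- \<beta> * \<sigma>"])
      show "ennreal (- \<beta> * \<sigma> + \<beta> * t) \<le> \<Phi> (ennreal t)" if t: "1 \<le> t" for t
      proof (cases "t \<le> \<sigma>")
        case True
        then have "- \<beta> * \<sigma> + \<beta> * t \<le> 0" using mult_left_mono[OF True \<beta>] by simp
        then show ?thesis by (simp add: ennreal_neg)
      next
        case False
        then have "\<Phi> (ennreal t) = \<infinity>" using mono[of \<sigma> t] inf by (simp add: top_unique)
        then show ?thesis by simp
      qed
      have "- \<beta> * \<sigma> + \<beta> * \<tau> = \<beta> * (\<tau> - \<sigma>)" by (simp add: algebra_simps)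
      also have "\<dots> = c" using inf by (simp add: \<beta>_def)
      finally show "c \<le> - \<beta> * \<sigma> + \<beta> * \<tau>" by simp
    qed (rule \<beta>)
  next
    case fin
    define I where "I = {t::real. 1 \<le> t \<and> \<Phi> (ennreal t) < \<infinity>}"
    define \<phi> where "\<phi> t = enn2real (\<Phi> (ennreal t))" for t
    have \<phi>: "\<Phi> (ennreal t) = ennreal (\<phi> t)" if "t \<in> I" for t using that by (simp add: I_def \<phi>_def)
    have \<phi>0: "0 \<le> \<phi> t" for t by (simp add: \<phi>_def)
    have down: "s \<in> I" if "t \<in> I" "1 \<le> s" "s \<le> t" for s t
      using that mono[of s t] by (auto simp: I_def intro: le_less_trans)
    have cI: "convex I" unfolding is_interval_convex_1[symmetric] is_interval_1 using down by (auto simp: I_def)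
    have cvx: "convex_on I \<phi>"
    proof (rule convex_onI)
      fix l x y assume l: "(0::real) < l" "l < 1" and x: "x \<in> I" and y: "y \<in> I"
      have "(1 - l) * x + l * y \<in> I" using convexD[OF cI x y, of "1 - l" l] l by simp
      note in_I = this
      have "\<Phi> (ennreal ((1 - l) * x + l * y)) \<le> ennreal (1 - l) * \<Phi> (ennreal x) + ennreal l * \<Phi> (ennreal y)"
        using Phi x y l unfolding strictly_convex_Phi_def I_def
        by (elim conjE allE[of _ x] allE[of _ y] allE[of _ "1 - l"]) (auto dest: spec[of _ x] spec[of _ y] spec[of _ "1 - l"])
      then have "ennreal (\<phi> ((1 - l) * x + l * y)) \<le> ennreal ((1 - l) * \<phi> x + l * \<phi> y)"
        using l \<phi>[OF in_I] \<phi>[OF x] \<phi>[OF y] \<phi>0 by (simp add: ennreal_mult'[symmetric] ennreal_plus[symmetric] del: ennreal_plus)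
      then have "\<phi> ((1 - l) * x + l * y) \<le> (1 - l) * \<phi> x + l * \<phi> y"
        using l \<phi>0 by (subst (asm) ennreal_le_iff) auto
      then show "\<phi> ((1 - l) *\<^sub>R x + l *\<^sub>R y) \<le> (1 - l) * \<phi> x + l * \<phi> y" by simp
    qed (rule cI)
    have sub: "{1<..<\<tau>} \<subseteq> I" using fin(2) by (auto simp: I_def)
    have "\<exists>\<sigma>. 1 < \<sigma> \<and> \<sigma> < \<tau> \<and> c \<le> \<phi> \<sigma>"
    proof -
      \<comment> \<open>The denominator n + 2 keeps every \<open>X n\<close> strictly between 1 and
        \<tau>.\<close>
      define X where "X n = \<tau> - (\<tau> - 1) / (real n + 2)" for n :: nat
      have Xb: "1 < X n" "X n < \<tau>" for n
      proof -
        define y where "y = (\<tau> - 1) / (real n + 2)"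
        have "y \<le> (\<tau> - 1) / 2" unfolding y_def using fin(1) by (intro divide_left_mono) auto
        moreover have "0 < y" using fin(1) by (simp add: y_def)
        moreover have "X n = \<tau> - y" by (simp add: X_def y_def)
        ultimately show "1 < X n" "X n < \<tau>" using fin(1) by auto
      qed
      have Xl: "X \<longlonglongrightarrow> \<tau>"
      proof -
        have "(\<lambda>n. (\<tau> - 1) * (1 / (real n + 2))) \<longlonglongrightarrow> (\<tau> - 1) * 0"
          using LIMSEQ_Suc[OF LIMSEQ_Suc[OF lim_1_over_n]] by (intro tendsto_mult tendsto_const) (simp add: add.commute)
        then have "(\<lambda>n. \<tau> - (\<tau> - 1) * (1 / (real n + 2))) \<longlonglongrightarrow> \<tau> - 0" by (intro tendsto_diff tendsto_const) simp
        then show ?thesis by (simp add: X_def[abs_def])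
      qed
      have XI: "X n \<in> I" for n using sub Xb[of n] by auto
      have le_T: "ennreal \<tau> \<le> Phi_T \<Phi>"
      proof (rule LIMSEQ_le_const2[where X="\<lambda>n. ennreal (X n)"])
        show "(\<lambda>n. ennreal (X n)) \<longlonglongrightarrow> ennreal \<tau>" by (intro tendsto_ennrealI Xl)
        have "ennreal (X n) \<le> Phi_T \<Phi>" for n
          unfolding Phi_T_def using XI[of n] by (intro Sup_upper) (auto simp: I_def one)
        then show "\<exists>N. \<forall>n\<ge>N. ennreal (X n) \<le> Phi_T \<Phi>" by blast
      qed
      have "\<exists>n. ennreal c < \<Phi> (ennreal (X n))"
      \<comment> \<open>At the endpoint \<open>Phi_T\<close> the left continuity hypothesis applies;
        otherwise \<tau> is interior to the interval of finiteness, where convex functions are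
        continuous.\<close>
      proof (cases "ennreal \<tau> = Phi_T \<Phi>")
        case True
        have "(\<Phi> \<longlongrightarrow> \<Phi> (ennreal \<tau>)) (at (ennreal \<tau>) within {1..<ennreal \<tau>})"
          using lc by (simp add: left_cont_at_T_def True[symmetric])
        moreover have "filterlim (\<lambda>n. ennreal (X n)) (at (ennreal \<tau>) within {1..<ennreal \<tau>}) sequentially"
        proof -
          have lt: "ennreal (X n) < ennreal \<tau>" and ge: "1 \<le> ennreal (X n)" for n
            using Xb[of n] by (auto simp: ennreal_less_iff one)
          then have "\<forall>n. ennreal (X n) \<in> {1..<ennreal \<tau>} \<and> ennreal (X n) \<noteq> ennreal \<tau>"
            using less_imp_neq[OF lt] by simp
          then show ?thesis using tendsto_ennrealI[OF Xl] unfolding filterlim_at by (intro conjI always_eventually)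
        qed
        ultimately have "(\<lambda>n. \<Phi> (ennreal (X n))) \<longlonglongrightarrow> \<Phi> (ennreal \<tau>)" by (rule filterlim_compose)
        then have "\<forall>\<^sub>F n in sequentially. ennreal c < \<Phi> (ennreal (X n))" using c(2) by (rule order_tendstoD)
        then show ?thesis by (auto simp: eventually_sequentially)
      next
        case False
        then have "ennreal \<tau> < Phi_T \<Phi>" using le_T by simp
        then obtain t1 where t1: "1 \<le> t1" "\<Phi> t1 < \<infinity>" "ennreal \<tau> < t1" by (auto simp: Phi_T_def less_Sup_iff)
        then have "t1 \<noteq> \<infinity>" using Phi_top[OF Phi] by auto
        then obtain r where r: "t1 = ennreal r" "r \<ge> 0" by (cases t1) auto
        have r\<tau>: "\<tau> < r" using t1(3) r \<tau> by (simp add: ennreal_less_iff)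
        have rI: "r \<in> I" using t1 r by (auto simp: I_def one)
        then have sub2: "{1<..<r} \<subseteq> I" using down by auto
        have "continuous_on {1<..<r} \<phi>"
          by (rule convex_on_continuous) (use convex_on_subset[OF cvx sub2] in auto)
        then have "isCont \<phi> \<tau>" using fin(1) r\<tau> by (simp add: continuous_on_eq_continuous_at)
        then have "(\<lambda>n. \<phi> (X n)) \<longlonglongrightarrow> \<phi> \<tau>" using Xl by (rule isCont_tendsto_compose)
        moreover have "c < \<phi> \<tau>" using c \<phi>[of \<tau>] down[OF rI \<tau>] r\<tau> \<phi>0 by (simp add: ennreal_less_iff)
        ultimately have "\<forall>\<^sub>F n in sequentially. c < \<phi> (X n)" by (rule order_tendstoD)
        then obtain n where "c < \<phi> (X n)" by (auto simp: eventually_sequentially)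
        then show ?thesis using \<phi>[OF XI] c(1) by (intro exI[of _ n]) (simp add: ennreal_less_iff)
      qed
      then obtain n where "ennreal c < \<Phi> (ennreal (X n))" by blast
      then have "c < \<phi> (X n)" using \<phi>[OF XI[of n]] c(1) by (simp add: ennreal_less_iff)
      then show ?thesis using Xb[of n] by (intro exI[of _ "X n"]) auto
    qed
    then obtain \<sigma> where \<sigma>: "1 < \<sigma>" "\<sigma> < \<tau>" "c \<le> \<phi> \<sigma>" by blast
    have "\<sigma> \<in> interior I"
      using interior_maximal[OF sub open_greaterThanLessThan] \<sigma> by auto
    then obtain \<beta> where \<beta>: "\<And>y. y \<in> I \<Longrightarrow> \<phi> \<sigma> + \<beta> * (y - \<sigma>) \<le> \<phi> y"
      using convex_le_Inf_differential[OF cvx] by blast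
    have \<sigma>I: "\<sigma> \<in> I" using sub \<sigma> by auto
    \<comment> \<open>A negative slope would contradict monotonicity between (1 + \<sigma>)/2 and
      \<sigma>.\<close>
    have \<beta>0: "\<beta> \<ge> 0"
    proof (rule ccontr)
      assume "\<not> \<beta> \<ge> 0"
      define y where "y = (1 + \<sigma>) / 2"
      have y: "y \<in> I" "y < \<sigma>" using \<sigma> down[OF \<sigma>I, of y] by (auto simp: y_def)
      have "\<phi> y \<le> \<phi> \<sigma>" using mono[of y \<sigma>] y \<phi>[OF y(1)] \<phi>[OF \<sigma>I] \<phi>0 by (simp add: I_def)
      moreover have "\<beta> * (y - \<sigma>) > 0" using \<open>\<not> \<beta> \<ge> 0\<close> y by (simp add: mult_neg_neg)
      ultimately show False using \<beta>[OF y(1)] by simp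
    qed
    show thesis
    proof (rule that[of \<beta> "\<phi> \<sigma> - \<beta> * \<sigma>"])
      show "ennreal (\<phi> \<sigma> - \<beta> * \<sigma> + \<beta> * t) \<le> \<Phi> (ennreal t)" if "1 \<le> t" for t
      proof (cases "t \<in> I")
        case True
        have "\<phi> \<sigma> - \<beta> * \<sigma> + \<beta> * t \<le> \<phi> t" using \<beta>[OF True] by (simp add: algebra_simps)
        then show ?thesis using \<phi>[OF True] by (simp add: ennreal_leI)
      next
        case False
        then have "\<Phi> (ennreal t) = \<infinity>" using that by (simp add: I_def flip: less_top)
        then show ?thesis by simp
      qed
      have "0 \<le> \<beta> * (\<tau> - \<sigma>)" using \<beta>0 \<sigma> by simp
      then show "c \<le> \<phi> \<sigma> - \<beta> * \<sigma> + \<beta> * \<tau>" using \<sigma>(3) by (simp add: algebra_simps)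
    qed (rule \<beta>0)
  qed
qed

text \<open>The rows of the matrices below are the partial derivatives, i.e. they are transposes of Jacobian matrices;
  hence \<open>row_map (pd_mat f x)\<close> is \<open>dmap f x\<close>.\<close>

definition row_map :: "real^'m^'n \<Rightarrow> real^'n \<Rightarrow> real^'m" where
  "row_map A h = (\<Sum>i\<in>UNIV. h$i *\<^sub>R A$i)"

definition pd_mat :: "(real^'n \<Rightarrow> real^'m) \<Rightarrow> real^'n \<Rightarrow> real^'m^'n" where
  "pd_mat f x = (\<chi> i. pd f x i)"

lemma dmap_row_map: "dmap f x = row_map (pd_mat f x)"
  by (simp add: dmap_def row_map_def pd_mat_def fun_eq_iff)

lemma bounded_linear_row_map: "bounded_linear (row_map A)"
  unfolding linear_conv_bounded_linear[symmetric]
  by (auto intro!: linearI simp: row_map_def scaleR_add_left sum.distrib scaleR_sum_right)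

lemma dnorm_onorm:
  fixes f :: "real^'n \<Rightarrow> real^'m"
  shows "dnorm f x = onorm (row_map (pd_mat f x))"
proof -
  let ?A = "row_map (pd_mat f x)"
  have "dnorm f x = Sup {norm (?A h) | h. norm h = 1}" by (simp add: dnorm_def dmap_row_map)
  also have "\<dots> = onorm ?A"
  proof (rule antisym)
    have ne: "{norm (?A h) | h. norm h = 1} \<noteq> {}" using norm_axis_1 by blast
    show "Sup {norm (?A h) | h. norm h = 1} \<le> onorm ?A"
    proof (rule cSup_least[OF ne])
      fix y assume "y \<in> {norm (?A h) | h. norm h = 1}"
      then show "y \<le> onorm ?A" using onorm[OF bounded_linear_row_map, of "pd_mat f x"] by auto (metis mult.right_neutral)
    qed
    have bdd: "bdd_above {norm (?A h) | h. norm h = 1}"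
      using onorm[OF bounded_linear_row_map, of "pd_mat f x"] by (auto simp: bdd_above_def) (metis mult.right_neutral)
    have le: "norm (?A h) \<le> Sup {norm (?A h) | h. norm h = 1} * norm h" for h
    proof (cases "h = 0")
      case False
      have "norm (?A (h /\<^sub>R norm h)) \<le> Sup {norm (?A h) | h. norm h = 1}"
        using False by (intro cSup_upper[OF _ bdd]) auto
      moreover have "?A (h /\<^sub>R norm h) = ?A h /\<^sub>R norm h"
        by (rule linear_cmul[OF bounded_linear.linear[OF bounded_linear_row_map]])
      ultimately show ?thesis using False by (simp add: divide_inverse[symmetric] mult.commute pos_divide_le_eq flip: divide_inverse) (simp add: field_simps)
    qed (simp add: row_map_def)
    show "onorm ?A \<le> Sup {norm (?A h) | h. norm h = 1}"
      by (rule onorm_le) (rule le)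
  qed
  finally show ?thesis .
qed

lemma continuous_onorm_row_map: "continuous_on UNIV (\<lambda>A :: real^'m^'n. onorm (row_map A))"
proof -
  have diff: "onorm (row_map A) \<le> onorm (row_map B) + norm (A - B) * CARD('n)" for A B :: "real^'m^'n"
  proof -
    have "row_map A = (\<lambda>h. row_map B h + row_map (A - B) h)"
      by (simp add: row_map_def fun_eq_iff sum.distrib[symmetric] scaleR_add_right[symmetric])
    then have "onorm (row_map A) \<le> onorm (row_map B) + onorm (row_map (A - B))"
      using onorm_triangle[OF bounded_linear_row_map bounded_linear_row_map, of B "A - B"] by simp
    moreover have "onorm (row_map (A - B)) \<le> norm (A - B) * CARD('n)"
    proof (rule onorm_le)
      fix h
      have "norm (row_map (A - B) h) \<le> (\<Sum>i\<in>(UNIV::'n set). norm h * norm (A - B))"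
        unfolding row_map_def
        by (intro order_trans[OF norm_sum] sum_mono) (auto simp del: vector_minus_component intro!: mult_mono component_le_norm_cart Finite_Cartesian_Product.norm_nth_le)
      then show "norm (row_map (A - B) h) \<le> norm (A - B) * real CARD('n) * norm h" by (simp add: mult_ac)
    qed
    ultimately show ?thesis by linarith
  qed
  show ?thesis unfolding continuous_on_iff
  proof (intro ballI allI impI)
    fix A :: "real^'m^'n" and e :: real assume e: "0 < e"
    show "\<exists>d>0. \<forall>B\<in>UNIV. dist B A < d \<longrightarrow> dist (onorm (row_map B)) (onorm (row_map A)) < e"
    proof (intro exI[of _ "e / CARD('n)"] conjI ballI impI)
      fix B :: "real^'m^'n" assume "dist B A < e / real CARD('n)"
      then have "norm (A - B) * CARD('n) < e" "norm (B - A) * CARD('n) < e"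
        by (auto simp: dist_norm norm_minus_commute field_simps)
      then show "dist (onorm (row_map B)) (onorm (row_map A)) < e"
        using diff[of A B] diff[of B A] by (simp add: dist_real_def abs_less_iff)
    qed (use e in simp)
  qed
qed

section \<open>Determinant, operator norm and finite dilatation\<close>

lemma jac_eq_det_pd_mat: "jac f x = det (pd_mat f x)"
proof -
  have "(\<chi> k i. (pd f x i) $ k) = transpose (pd_mat f x)" by (simp add: transpose_def pd_mat_def)
  then show ?thesis by (simp add: jac_def det_transpose)
qed

lemma det_matrix_row_map: "det (matrix (row_map A)) = det (A :: real^'n^'n)"
proof -
  have "matrix (row_map A) = transpose A"
    by (simp add: matrix_def row_map_def transpose_def vec_eq_iff axis_def if_distrib[where f="\<lambda>a. a * _"] cong: if_cong)
  then show ?thesis by (simp add: det_transpose)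
qed

text \<open>The image of the unit ball lies in the ball whose radius is the operator norm; comparing
  volumes gives the bound.\<close>

lemma abs_det_le_onorm:
  fixes A :: "real^'n^'n"
  shows "\<bar>det A\<bar> \<le> onorm (row_map A) ^ CARD('n)"
proof -
  let ?N = "onorm (row_map A)"
  have N0: "?N \<ge> 0" by (rule onorm_pos_le[OF bounded_linear_row_map])
  have lin: "linear (row_map A)" using bounded_linear_row_map by (rule bounded_linear.linear)
  have "row_map A ` cball 0 1 \<subseteq> cball 0 ?N"
  proof
    fix y assume "y \<in> row_map A ` cball 0 1"
    then obtain h where h: "norm h \<le> 1" "y = row_map A h" by auto
    have "norm y \<le> ?N * norm h" using h onorm[OF bounded_linear_row_map] by simp
    also have "\<dots> \<le> ?N" using h N0 by (simp add: mult_left_le)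
    finally show "y \<in> cball 0 ?N" by simp
  qed
  moreover have "measure lebesgue (row_map A ` cball 0 1) = \<bar>det A\<bar> * measure lebesgue (cball 0 1 :: (real^'n) set)"
    and "row_map A ` cball 0 1 \<in> lmeasurable"
    using measure_linear_image_finite[OF lin, of "cball 0 1"] by (auto simp: det_matrix_row_map)
  ultimately have "\<bar>det A\<bar> * measure lebesgue (cball 0 1 :: (real^'n) set) \<le> measure lebesgue (cball 0 ?N :: (real^'n) set)"
    by (metis fmeasurableD lmeasurable_cball measure_mono_fmeasurable)
  also have "measure lebesgue (cball 0 ?N :: (real^'n) set) = ?N ^ CARD('n) * measure lebesgue (cball 0 1 :: (real^'n) set)"
    using N0 by (simp add: content_cball)
  finally show ?thesis using content_cball_pos[of 1 "0::real^'n"] by simp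
qed

text \<open>A finite dilatation forces the matrix to be invertible or zero. In the first case P = J
  (N/J)^(1+q) with q = 1/(n-1), because n q = 1 + q; the lower bounds are the tangents of the convex
  function r^(1+q) at s, multiplied by J and evaluated at r = N/J. In the second case N and J vanish
  and the bound is trivial.\<close>

lemma Pdil_cases:
  fixes f :: "real^'n \<Rightarrow> real^'n"
  assumes n2: "CARD('n) \<ge> 2" and fin: "Pdil f x \<noteq> \<infinity>"
  obtains P where "Pdil f x = ennreal P" "P \<ge> 1" "has_all_partials f x"
    "\<And>s. s \<ge> 0 \<Longrightarrow> P \<ge> (1 + 1 / (real CARD('n) - 1)) * s powr (1 / (real CARD('n) - 1)) * onorm (row_map (pd_mat f x))
        - (1 / (real CARD('n) - 1)) * s powr (1 + 1 / (real CARD('n) - 1)) * \<bar>det (pd_mat f x)\<bar>"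
    "det (pd_mat f x) \<noteq> 0 \<Longrightarrow> P = (onorm (row_map (pd_mat f x)) ^ CARD('n) / \<bar>det (pd_mat f x)\<bar>) powr (1 / (real CARD('n) - 1))"
    "det (pd_mat f x) = 0 \<Longrightarrow> pd_mat f x = 0"
proof -
  define q where "q = 1 / (real CARD('n) - 1)"
  have q: "q > 0" using n2 by (simp add: q_def)
  have nq: "real CARD('n) * q = 1 + q" using n2 by (simp add: q_def field_simps)
  define N where "N = onorm (row_map (pd_mat f x))"
  define J where "J = \<bar>det (pd_mat f x)\<bar>"
  have J: "0 \<le> J" "J \<le> N ^ CARD('n)" using abs_det_le_onorm[of "pd_mat f x"] by (auto simp: N_def J_def)
  have N0: "0 \<le> N" unfolding N_def by (rule onorm_pos_le[OF bounded_linear_row_map])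
  have ofin: "outer_dil f x \<noteq> \<infinity>" using fin by (auto simp: Pdil_def)
  have hp: "has_all_partials f x" by (rule ccontr) (use ofin in \<open>simp add: outer_dil_def\<close>)
  consider (pos) "jac f x \<noteq> 0" | (zero) "jac f x = 0" "\<forall>i. pd f x i = 0"
    using ofin hp by (auto simp: outer_dil_def split: if_splits)
  then show thesis
  proof cases
    case pos
    then have Jp: "J > 0" by (simp add: J_def jac_eq_det_pd_mat)
    have Np: "N > 0"
    proof (rule ccontr)
      assume "\<not> N > 0"
      then have "N = 0" using N0 by simp
      then show False using J Jp n2 by (simp add: power_0_left)
    qed
    have P: "Pdil f x = ennreal ((N ^ CARD('n) / J) powr q)"
      using ofin hp pos by (simp add: Pdil_def outer_dil_def N_def J_def jac_eq_det_pd_mat dnorm_onorm q_def onorm_pos_le[OF bounded_linear_row_map])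
    show thesis
    proof (rule that[OF P _ hp])
      have "1 \<le> N ^ CARD('n) / J" using J(2) Jp by simp
      then show "1 \<le> (N ^ CARD('n) / J) powr q" using q by (intro ge_one_powr_ge_zero) auto
      fix s :: real assume s: "s \<ge> 0"
      have eq: "(N ^ CARD('n) / J) powr q = J * (N / J) powr (1 + q)"
      proof -
        have "(N ^ CARD('n) / J) powr q = N powr (1 + q) * J powr (- q)"
        proof -
          have "(N ^ CARD('n) / J) powr q = (N ^ CARD('n)) powr q / J powr q" by (rule powr_divide)
          also have "(N ^ CARD('n)) powr q = N powr (1 + q)"
            using Np by (simp only: powr_realpow[symmetric] powr_powr nq)
          finally show ?thesis by (simp add: powr_minus divide_inverse)
        qed
        also have "J powr (- q) = J * J powr (- (1 + q))"
        proof -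
          have "J * J powr (- (1 + q)) = J powr 1 * J powr (- (1 + q))" using Jp by simp
          also have "\<dots> = J powr (1 + - (1 + q))" by (rule powr_add[symmetric])
          finally show ?thesis by simp
        qed
        also have "N powr (1 + q) * (J * J powr (- (1 + q))) = J * (N / J) powr (1 + q)"
          by (simp only: powr_divide) (simp only: powr_minus divide_inverse mult_ac)
        finally show ?thesis .
      qed
      \<comment> \<open>Young's inequality with weights 1/(1+q) and q/(1+q), applied to z = r/s and
        the constant 1 and then multiplied by s^(1+q).\<close>
      have young: "r powr (1 + q) \<ge> (1 + q) * s powr q * r - q * s powr (1 + q)" if r: "r > 0" for r
      proof (cases "s = 0")
        case False
        then have sp: "s > 0" using s by simp
        define z where "z = r / s"
        have zp: "z > 0" using r sp by (simp add: z_def)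
        have "(z powr (1 + q)) powr (1 / (1 + q)) * 1 powr (q / (1 + q)) \<le> (1 / (1 + q)) * z powr (1 + q) + (q / (1 + q)) * 1"
          using q zp by (intro Youngs_inequality_0) (auto simp: field_simps)
        then have "z \<le> (1 / (1 + q)) * z powr (1 + q) + (q / (1 + q))"
          using zp q by (simp add: powr_powr)
        then have "(1 + q) * z \<le> (1 + q) * ((1 / (1 + q)) * z powr (1 + q) + (q / (1 + q)))" using q by (intro mult_left_mono) auto
        also have "\<dots> = z powr (1 + q) + q" using q by (simp add: distrib_left)
        finally have "s powr (1 + q) * ((1 + q) * z) \<le> s powr (1 + q) * (z powr (1 + q) + q)" by (intro mult_left_mono) auto
        moreover have "s powr (1 + q) * z powr (1 + q) = r powr (1 + q)" using sp r by (simp add: z_def powr_divide)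
        moreover have "s powr (1 + q) * z = s powr q * r" using sp by (simp add: z_def powr_add)
        ultimately show ?thesis by (simp add: algebra_simps)
      qed (use q in simp)
      have "J * ((1 + q) * s powr q * (N / J) - q * s powr (1 + q)) \<le> J * (N / J) powr (1 + q)"
        using Np Jp by (intro mult_left_mono young) auto
      then have "(1 + q) * s powr q * N - q * s powr (1 + q) * J \<le> (N ^ CARD('n) / J) powr q"
        unfolding eq using Jp by (simp add: algebra_simps)
      then show "(1 + 1 / (real CARD('n) - 1)) * s powr (1 / (real CARD('n) - 1)) * onorm (row_map (pd_mat f x))
        - (1 / (real CARD('n) - 1)) * s powr (1 + 1 / (real CARD('n) - 1)) * \<bar>det (pd_mat f x)\<bar> \<le> (N ^ CARD('n) / J) powr q"
        by (simp add: q_def N_def J_def)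
    qed (use pos in \<open>auto simp: jac_eq_det_pd_mat N_def J_def q_def\<close>)
  next
    case zero
    have P: "Pdil f x = ennreal 1" using hp zero by (simp add: Pdil_def outer_dil_def)
    have pz: "pd_mat f x = 0" using zero by (simp add: pd_mat_def vec_eq_iff)
    have oz: "onorm (row_map (0 :: real^'n^'n)) = 0" by (simp add: row_map_def[abs_def] onorm_zero)
    show thesis
      by (rule that[OF P _ hp]) (use zero n2 in \<open>auto simp: pz oz jac_eq_det_pd_mat\<close>)
  qed
qed

lemma Pdil_ge_1:
  fixes f :: "real^'n \<Rightarrow> real^'n"
  assumes "CARD('n) \<ge> 2" shows "1 \<le> Pdil f x"
proof (cases "Pdil f x = \<infinity>")
  case False
  from Pdil_cases[OF assms False] obtain P where "Pdil f x = ennreal P" "P \<ge> 1" by metis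
  then show ?thesis by (simp add: ennreal_ge_1)
qed simp

section \<open>Measurability of the energy density\<close>

lemma has_vector_derivative_0_iff_quotient:
  fixes g :: "real \<Rightarrow> 'b::real_normed_vector"
  shows "(g has_vector_derivative p) (at 0) \<longleftrightarrow> ((\<lambda>s. (g s - g 0) /\<^sub>R s) \<longlongrightarrow> p) (at 0)"
proof -
  have eq: "norm ((X - s *\<^sub>R p) /\<^sub>R \<bar>s\<bar>) = norm (X /\<^sub>R s - p)" if "s \<noteq> 0" for s X
  proof -
    have "X /\<^sub>R s - p = (X - s *\<^sub>R p) /\<^sub>R s" using that by (simp add: scaleR_diff_right)
    then show ?thesis by simp
  qed
  have "(g has_vector_derivative p) (at 0) \<longleftrightarrow> ((\<lambda>s. (g s - g 0 - s *\<^sub>R p) /\<^sub>R \<bar>s\<bar>) \<longlongrightarrow> 0) (at 0)"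
    by (simp add: has_vector_derivative_def has_derivative_def bounded_linear_scaleR_left)
  also have "\<dots> \<longleftrightarrow> ((\<lambda>s. norm ((g s - g 0 - s *\<^sub>R p) /\<^sub>R \<bar>s\<bar>)) \<longlongrightarrow> 0) (at 0)"
    by (simp only: tendsto_norm_zero_iff)
  also have "\<dots> \<longleftrightarrow> ((\<lambda>s. norm ((g s - g 0) /\<^sub>R s - p)) \<longlongrightarrow> 0) (at 0)"
    by (rule tendsto_cong) (simp only: eventually_at_filter, intro always_eventually allI impI eq)
  also have "\<dots> \<longleftrightarrow> ((\<lambda>s. (g s - g 0) /\<^sub>R s) \<longlongrightarrow> p) (at 0)"
    by (simp only: tendsto_norm_zero_iff LIM_zero_iff)
  finally show ?thesis .
qed

lemma has_partial_quotient:
  fixes u :: "real^'n \<Rightarrow> 'b::real_normed_vector"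
  assumes "has_partial u x i"
  shows "((\<lambda>s. (u (x + s *\<^sub>R axis i 1) - u x) /\<^sub>R s) \<longlongrightarrow> pd u x i) (at 0)"
  using has_partial_imp_deriv[of u x 0 i] assms has_vector_derivative_0_iff_quotient[of "\<lambda>s. u (x + s *\<^sub>R axis i 1)" "pd u x i"]
  by simp

text \<open>Away from t = 0 the difference quotient is continuous in t for small t, so its limit at
  0 may be tested on rational steps; the candidate limit is taken along the steps 1/(n+1). This
  describes the set of existence by countably many Borel conditions.\<close>

lemma has_partial_borel:
  fixes u :: "real^'n \<Rightarrow> 'b::euclidean_space"
  assumes \<Omega>: "open \<Omega>" and cu: "continuous_on \<Omega> u"
  obtains l where "l \<in> borel_measurable borel" "{x \<in> \<Omega>. has_partial u x i} \<in> sets borel"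
    "\<And>x. x \<in> \<Omega> \<Longrightarrow> has_partial u x i \<Longrightarrow> pd u x i = l x"
proof -
  define e where "e = (axis i 1 :: real^'n)"
  define U where "U x = indicator \<Omega> x *\<^sub>R u x" for x
  have [measurable]: "U \<in> borel_measurable borel" unfolding U_def
    by (rule borel_measurable_continuous_on_indicator) (use \<Omega> cu in auto)
  have [measurable]: "\<Omega> \<in> sets borel" using \<Omega> by simp
  define q where "q t x = (U (x + t *\<^sub>R e) - U x) /\<^sub>R t" for t x
  have [measurable]: "q t \<in> borel_measurable borel" for t unfolding q_def by measurable
  define \<tau> where "\<tau> n = 1 / real (Suc n)" for n
  have \<tau>0: "\<tau> n > 0" for n by (simp add: \<tau>_def)
  have \<tau>l: "\<tau> \<longlonglongrightarrow> 0" unfolding \<tau>_def by (rule LIMSEQ_Suc[OF lim_1_over_n])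
  define l where "l x = lim (\<lambda>n. q (\<tau> n) x)" for x
  have lm[measurable]: "l \<in> borel_measurable borel" unfolding l_def by (rule borel_measurable_lim_metric) simp
  define T where "T m = {t \<in> \<rat>. t \<noteq> 0 \<and> \<bar>t\<bar> < \<tau> m}" for m
  define P where "P = \<Omega> \<inter> (\<Inter>n. \<Union>m. \<Inter>t\<in>T m. {x. norm (q t x - l x) \<le> \<tau> n})"
  have Tc: "countable (T m)" for m unfolding T_def by (rule countable_subset[OF _ countable_rat]) auto
  have Pb: "P \<in> sets borel"
  proof -
    have "{x. norm (q t x - l x) \<le> c} \<in> sets borel" for t c
    proof -
      have "{x \<in> space borel. norm (q t x - l x) \<le> c} \<in> sets borel" by measurable
      then show ?thesis by simp
    qed
    then have "(\<Inter>t\<in>T m. {x. norm (q t x - l x) \<le> \<tau> n}) \<in> sets borel" for m n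
      using Tc by (intro sets.countable_INT'') auto
    then show ?thesis unfolding P_def by (intro sets.Int sets.countable_INT'' sets.countable_UN) auto
  qed
  have near: "\<exists>r>0. \<forall>t. \<bar>t\<bar> < r \<longrightarrow> x + t *\<^sub>R e \<in> \<Omega>" if "x \<in> \<Omega>" for x
  proof -
    obtain r where r: "r > 0" "ball x r \<subseteq> \<Omega>" using \<Omega> \<open>x \<in> \<Omega>\<close> open_contains_ball by blast
    then show ?thesis by (intro exI[of _ r]) (auto simp: subset_iff dist_norm e_def)
  qed
  have qlim: "((\<lambda>t. q t x) \<longlongrightarrow> p) (at 0) \<longleftrightarrow> ((\<lambda>s. (u (x + s *\<^sub>R e) - u x) /\<^sub>R s) \<longlongrightarrow> p) (at 0)" if x: "x \<in> \<Omega>" for x p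
  proof (rule tendsto_cong)
    obtain r where "r > 0" "\<And>t. \<bar>t\<bar> < r \<Longrightarrow> x + t *\<^sub>R e \<in> \<Omega>" using near[OF x] by blast
    then show "\<forall>\<^sub>F t in at 0. q t x = (u (x + t *\<^sub>R e) - u x) /\<^sub>R t"
      unfolding eventually_at using x by (intro exI[of _ r]) (auto simp: q_def U_def)
  qed
  have fwd: "l x = pd u x i \<and> x \<in> P" if x: "x \<in> \<Omega>" and hp: "has_partial u x i" for x
  proof -
    have L: "((\<lambda>t. q t x) \<longlongrightarrow> pd u x i) (at 0)" using has_partial_quotient[OF hp] qlim[OF x] by (simp add: e_def)
    have "filterlim \<tau> (at 0) sequentially"
      using \<tau>l \<tau>0 by (intro filterlim_atI) (auto simp: less_imp_neq[symmetric] intro!: always_eventually)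
    then have "(\<lambda>n. q (\<tau> n) x) \<longlonglongrightarrow> pd u x i" by (rule filterlim_compose[OF L])
    then have lx: "l x = pd u x i" by (simp add: l_def limI)
    have "\<exists>m. \<forall>t\<in>T m. norm (q t x - l x) \<le> \<tau> n" for n
    proof -
      have "\<forall>\<^sub>F t in at 0. dist (q t x) (pd u x i) < \<tau> n" using L \<tau>0 by (rule tendstoD)
      then obtain d where d: "d > 0" "\<And>t. t \<noteq> 0 \<Longrightarrow> \<bar>t\<bar> < d \<Longrightarrow> dist (q t x) (pd u x i) < \<tau> n" by (auto simp: eventually_at)
      obtain m where "\<tau> m < d" using nat_approx_posE[OF d(1)] by (auto simp: \<tau>_def)
      then show ?thesis using d(2) lx by (intro exI[of _ m]) (auto simp: T_def dist_norm intro!: less_imp_le)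
    qed
    then show ?thesis using lx x by (auto simp: P_def)
  qed
  have bwd: "has_partial u x i" if x: "x \<in> P" for x
  proof -
    have x\<Omega>: "x \<in> \<Omega>" and mT: "\<And>n. \<exists>m. \<forall>t\<in>T m. norm (q t x - l x) \<le> \<tau> n" using x by (auto simp: P_def)
    obtain r where r: "r > 0" "\<And>t. \<bar>t\<bar> < r \<Longrightarrow> x + t *\<^sub>R e \<in> \<Omega>" using near[OF x\<Omega>] by blast
    have cq: "isCont (\<lambda>t. q t x) t" if t: "t \<noteq> 0" "\<bar>t\<bar> < r" for t
    proof -
      have "continuous_on {s. \<bar>s\<bar> < r \<and> s \<noteq> 0} (\<lambda>s. (u (x + s *\<^sub>R e) - u x) /\<^sub>R s)"
        by (intro continuous_intros continuous_on_compose2[OF cu]) (use r in auto)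
      then have "continuous_on {s. \<bar>s\<bar> < r \<and> s \<noteq> 0} (\<lambda>s. q s x)"
        by (rule continuous_on_cong[THEN iffD1, rotated -1]) (use r x\<Omega> in \<open>auto simp: q_def U_def\<close>)
      moreover have "open {s. \<bar>s\<bar> < r \<and> s \<noteq> (0::real)}"
        by (intro open_Collect_conj open_Collect_less open_Collect_neq continuous_intros)
      ultimately show ?thesis using t by (simp add: continuous_on_eq_continuous_at)
    qed
    have "((\<lambda>t. q t x) \<longlongrightarrow> l x) (at 0)"
    proof (rule tendstoI)
      fix \<epsilon> :: real assume "0 < \<epsilon>"
      then obtain n where n: "\<tau> n < \<epsilon>" using nat_approx_posE by (auto simp: \<tau>_def)
      obtain m where m: "\<And>t. t \<in> T m \<Longrightarrow> norm (q t x - l x) \<le> \<tau> n" using mT by blast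
      have "norm (q t x - l x) \<le> \<tau> n" if t: "t \<noteq> 0" "\<bar>t\<bar> < min r (\<tau> m)" for t
      proof -
        \<comment> \<open>Rational steps tending to t transfer the bound to t by continuity of the
          quotient.\<close>
        have "\<exists>s\<in>\<rat>. t < s \<and> s < t + 1 / real (Suc k)" for k by (rule Rats_dense_in_real) simp
        then obtain s where s: "\<And>k. s k \<in> \<rat>" "\<And>k. t < s k" "\<And>k. s k < t + 1 / real (Suc k)" by metis
        have sl: "s \<longlonglongrightarrow> t"
        proof (rule tendsto_sandwich[of "\<lambda>_. t" _ _ "\<lambda>k. t + 1 / real (Suc k)"])
          show "(\<lambda>k. t + 1 / real (Suc k)) \<longlonglongrightarrow> t"
            using tendsto_add[OF tendsto_const LIMSEQ_Suc[OF lim_1_over_n], of t] by simp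
        qed (use s in \<open>auto intro!: always_eventually less_imp_le\<close>)
        have "(\<lambda>k. norm (q (s k) x - l x)) \<longlonglongrightarrow> norm (q t x - l x)"
          using t by (intro tendsto_intros isCont_tendsto_compose[OF cq sl]) auto
        moreover have "\<forall>\<^sub>F k in sequentially. s k \<noteq> 0 \<and> \<bar>s k\<bar> < \<tau> m"
        proof -
          have "\<forall>\<^sub>F k in sequentially. dist (s k) t < min \<bar>t\<bar> (\<tau> m - \<bar>t\<bar>)"
            using sl t by (intro tendstoD) auto
          then show ?thesis by eventually_elim (auto simp: dist_real_def)
        qed
        then have "\<forall>\<^sub>F k in sequentially. norm (q (s k) x - l x) \<le> \<tau> n"
          by eventually_elim (use s(1) in \<open>auto intro!: m simp: T_def\<close>)
        ultimately show ?thesis by (rule tendsto_upperbound) simp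
      qed
      then show "\<forall>\<^sub>F t in at 0. dist (q t x) (l x) < \<epsilon>"
        unfolding eventually_at using r(1) \<tau>0[of m] n
        by (intro exI[of _ "min r (\<tau> m)"]) (auto simp: dist_norm intro: le_less_trans)
    qed
    then have "((\<lambda>s. u (x + s *\<^sub>R e)) has_vector_derivative l x) (at 0)"
      using qlim[OF x\<Omega>] has_vector_derivative_0_iff_quotient[of "\<lambda>s. u (x + s *\<^sub>R e)" "l x"] by simp
    then show ?thesis unfolding has_partial_def e_def[symmetric]
      by (auto simp: differentiable_def has_vector_derivative_def)
  qed
  have "P \<subseteq> \<Omega>" by (simp add: P_def)
  then have eq: "{x \<in> \<Omega>. has_partial u x i} = P" using fwd bwd by blast
  show thesis
  proof (rule that[OF lm])
    show "{x \<in> \<Omega>. has_partial u x i} \<in> sets borel" unfolding eq by (rule Pb)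
    show "pd u x i = l x" if "x \<in> \<Omega>" "has_partial u x i" for x
      using fwd[OF that, THEN conjunct1, symmetric] .
  qed
qed

lemma measurable_Phi_Pdil:
  fixes u :: "real^'n \<Rightarrow> real^'n"
  assumes n2: "CARD('n) \<ge> 2" and Phi: "strictly_convex_Phi \<Phi>" and \<Omega>: "open \<Omega>" and cu: "continuous_on \<Omega> u"
  shows "(\<lambda>x. \<Phi> (Pdil u x) * indicator \<Omega> x) \<in> borel_measurable borel"
proof -
  have "\<forall>i. \<exists>l. l \<in> borel_measurable borel \<and> {x \<in> \<Omega>. has_partial u x i} \<in> sets borel \<and>
    (\<forall>x. x \<in> \<Omega> \<longrightarrow> has_partial u x i \<longrightarrow> pd u x i = l x)"
  proof
    fix i
    show "\<exists>l. l \<in> borel_measurable borel \<and> {x \<in> \<Omega>. has_partial u x i} \<in> sets borel \<and>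
      (\<forall>x. x \<in> \<Omega> \<longrightarrow> has_partial u x i \<longrightarrow> pd u x i = l x)"
      by (rule has_partial_borel[OF \<Omega> cu, of i]) blast
  qed
  then obtain l where l: "\<And>i. l i \<in> borel_measurable borel" "\<And>i. {x \<in> \<Omega>. has_partial u x i} \<in> sets borel"
    "\<And>i x. x \<in> \<Omega> \<Longrightarrow> has_partial u x i \<Longrightarrow> pd u x i = l i x" by metis
  define P where "P = (\<Inter>i. {x \<in> \<Omega>. has_partial u x i})"
  have Pm[measurable]: "P \<in> sets borel" unfolding P_def using l(2) by (intro sets.countable_INT'') auto
  have [measurable]: "\<Omega> \<in> sets borel" using \<Omega> by simp
  define A where "A x = (\<chi> i. l i x)" for x
  have Am[measurable]: "A \<in> borel_measurable borel"
  proof -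
    have "continuous_on UNIV (axis i :: real^'n \<Rightarrow> real^'n^'n)" for i :: 'n
      by (intro linear_continuous_on linear_conv_bounded_linear[THEN iffD1] linearI) (auto simp: axis_def vec_eq_iff)
    then have "(\<lambda>x. axis i (l i x)) \<in> borel_measurable borel" for i
      by (intro measurable_compose[OF l(1)] borel_measurable_continuous_onI)
    then have "(\<lambda>x. \<Sum>i\<in>UNIV. axis i (l i x)) \<in> borel_measurable borel" by (intro borel_measurable_sum)
    moreover have "(\<Sum>i\<in>UNIV. axis i (l i x)) = A x" for x
      by (simp add: A_def vec_eq_iff axis_def if_distrib[where f="\<lambda>a. a $ _"] cong: if_cong)
    ultimately show ?thesis by simp
  qed
  have cdet: "continuous_on UNIV (det :: real^'n^'n \<Rightarrow> real)" unfolding det_def by (intro continuous_intros)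
  have dm[measurable]: "(\<lambda>x. det (A x)) \<in> borel_measurable borel"
    by (rule measurable_compose[OF Am borel_measurable_continuous_onI[OF cdet]])
  have nm[measurable]: "(\<lambda>x. onorm (row_map (A x))) \<in> borel_measurable borel"
    by (rule measurable_compose[OF Am borel_measurable_continuous_onI[OF continuous_onorm_row_map]])
  define g where "g x = (if x \<in> P then (if det (A x) \<noteq> 0 then ennreal (onorm (row_map (A x)) ^ CARD('n) / \<bar>det (A x)\<bar>)
     else if A x = 0 then 1 else \<infinity>) else (\<infinity>::ennreal))" for x
  have gm[measurable]: "g \<in> borel_measurable borel" unfolding g_def by measurable
  have og: "outer_dil u x = g x" if x: "x \<in> \<Omega>" for x
  proof -
    have hp: "has_all_partials u x \<longleftrightarrow> x \<in> P" using x by (auto simp: has_all_partials_def P_def)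
    have Ax: "pd_mat u x = A x" if "x \<in> P" using that l(3) x by (auto simp: pd_mat_def A_def P_def vec_eq_iff)
    have "(\<forall>i. pd u x i = 0) \<longleftrightarrow> pd_mat u x = 0" by (simp add: pd_mat_def vec_eq_iff)
    then show ?thesis using hp Ax by (simp add: outer_dil_def g_def jac_eq_det_pd_mat dnorm_onorm)
  qed
  define k where "k x = (if g x = \<infinity> then \<infinity> else ennreal (enn2real (g x) powr (1 / (real CARD('n) - 1))))" for x
  have km[measurable]: "k \<in> borel_measurable borel" unfolding k_def by measurable
  have pk: "Pdil u x = k x" if "x \<in> \<Omega>" for x using og[OF that] by (simp add: Pdil_def k_def)
  \<comment> \<open>Monotonicity of \<open>\<Phi>\<close> is known only on [1, \<infinity>];
    composing with the maximum with 1 gives a monotone, hence Borel, function and changes nothing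
    since the dilatation is at least 1.\<close>
  have "mono (\<lambda>t. \<Phi> (max 1 t))"
    by (intro monoI strictly_convex_Phi_mono[OF Phi]) (auto simp: max_def)
  from borel_measurable_mono_ennreal[OF this]
  have m: "(\<lambda>x. \<Phi> (max 1 (k x)) * indicator \<Omega> x) \<in> borel_measurable borel"
    by (intro borel_measurable_times_ennreal measurable_compose[OF km] borel_measurable_indicator) simp_all
  have "\<Phi> (Pdil u x) * indicator \<Omega> x = \<Phi> (max 1 (k x)) * indicator \<Omega> x" for x
    using pk[of x] Pdil_ge_1[OF n2, of u x] by (cases "x \<in> \<Omega>") (auto simp: max_def)
  then show ?thesis using m by (simp cong: measurable_cong)
qed

text \<open>Finite energy makes the density finite almost everywhere, and \<open>\<Phi>\<close> is
  infinite at infinity. As the dilatation is infinite where a partial derivative is missing, this is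
  the source of the classical partial derivatives.\<close>

lemma AE_Pdil_finite:
  fixes u :: "real^'n \<Rightarrow> real^'n"
  assumes n2: "CARD('n) \<ge> 2" and Phi: "strictly_convex_Phi \<Phi>" and \<Omega>: "open \<Omega>" and cu: "continuous_on \<Omega> u"
    and fin: "set_nn_integral lebesgue \<Omega> (\<lambda>x. \<Phi> (Pdil u x)) < \<infinity>"
  shows "AE x in lebesgue. x \<in> \<Omega> \<longrightarrow> Pdil u x \<noteq> \<infinity>"
proof -
  have "AE x in lebesgue. \<Phi> (Pdil u x) * indicator \<Omega> x \<noteq> \<infinity>"
  proof (rule nn_integral_PInf_AE)
    have "(\<lambda>x. \<Phi> (Pdil u x) * indicator \<Omega> x) \<in> borel_measurable lborel"
      using measurable_Phi_Pdil[OF n2 Phi \<Omega> cu] by simp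
    then show "(\<lambda>x. \<Phi> (Pdil u x) * indicator \<Omega> x) \<in> borel_measurable lebesgue"
      by (rule measurable_completion)
  qed (use fin in auto)
  then show ?thesis by eventually_elim (use Phi_top[OF Phi] in auto)
qed

lemma borel_measurable_lebesgue_AE_eq:
  assumes f: "f \<in> lebesgue \<rightarrow>\<^sub>M N" and ae: "AE x in lebesgue. f x = g x" and g: "\<And>x. g x \<in> space N"
  shows "g \<in> lebesgue \<rightarrow>\<^sub>M N"
proof (rule measurableI)
  fix A assume A: "A \<in> sets N"
  have 1: "f -` A \<inter> space lebesgue \<in> sets lebesgue" using f A by (rule measurable_sets)
  have 2: "AE x in lebesgue. x \<in> f -` A \<inter> space lebesgue \<longleftrightarrow> x \<in> g -` A \<inter> space lebesgue"
    using ae by eventually_elim (simp del: space_completion space_lborel)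
  show "g -` A \<inter> space lebesgue \<in> sets lebesgue"
    by (rule completion.in_sets_AE[OF 2 1]) blast
qed (use g in simp)

text \<open>An open set is exhausted by compact sets, each having a neighbourhood to which the local
  area inequality applies; monotone convergence collects them. Measurability of the determinant
  comes from its agreement almost everywhere with Borel versions.\<close>

lemma area_le_open:
  fixes u :: "real^'n \<Rightarrow> real^'n"
  assumes V: "open V" "V \<subseteq> D" and cu: "continuous_on D u" and wp: "weak_partials D u v" and inj: "inj_on u D"
  shows "u ` V \<in> sets borel" "(\<integral>\<^sup>+x\<in>V. \<bar>det (\<chi> i. v i x)\<bar> \<partial>lebesgue) \<le> emeasure lborel (u ` V)"
proof -
  obtain C :: "nat \<Rightarrow> (real^'n) set" where C: "\<And>n. compact (C n)" "\<And>n. C n \<subseteq> V" "\<And>n. C n \<subseteq> interior (C (Suc n))" "\<Union>(range C) = V"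
    using open_Union_compact_subsets[OF V(1)] by metis
  have uV: "u ` V = (\<Union>n. u ` C n)" using C(4) by blast
  have "compact (u ` C n)" for n
    by (intro compact_continuous_image C(1) continuous_on_subset[OF cu subset_trans[OF C(2) V(2)]])
  then show b: "u ` V \<in> sets borel" unfolding uV by (auto intro: borel_compact)
  have inc: "incseq C" using C(3) interior_subset by (intro incseq_SucI) blast
  have det_borel: "\<exists>g. g \<in> borel_measurable borel \<and> (AE x in lebesgue. x \<in> C n \<longrightarrow> \<bar>det (\<chi> i. v i x)\<bar> = g x) \<and>
      (\<integral>\<^sup>+x\<in>C n. g x \<partial>lborel) \<le> emeasure lborel (u ` V)" for n
  proof -
    obtain \<rho> W K' where nb: "\<rho> > 0" "open W" "C n \<subseteq> W" "compact K'" "K' \<subseteq> V" "W \<subseteq> K'" "\<And>x. x \<in> W \<Longrightarrow> cball x \<rho> \<subseteq> K'"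
      using compact_nbhd[OF C(1) C(2) V(1)] by blast
    obtain w where w: "w11_local u w K'" "\<And>i. AE x in lebesgue. w i x = indicator K' x *\<^sub>R v i x"
      by (rule w11_local_exists[OF cu wp nb(4) subset_trans[OF nb(5) V(2)]], rule that)
    interpret w11_local u w K' by (rule w(1))
    interpret w11_injective u w K'
      by unfold_locales (use inj nb(5) V(2) inj_on_subset in blast)
    have ae: "AE x in lebesgue. \<forall>i. w i x = indicator K' x *\<^sub>R v i x" using w(2) by (simp add: AE_all_countable)
    have "AE x in lebesgue. x \<in> C n \<longrightarrow> \<bar>det (\<chi> i. v i x)\<bar> = \<bar>det (grad x)\<bar>"
      using ae by eventually_elim (use nb(3,6) in \<open>auto simp: grad_def\<close>)
    moreover have "(\<integral>\<^sup>+x\<in>C n. \<bar>det (grad x)\<bar> \<partial>lborel) \<le> (\<integral>\<^sup>+x\<in>W. \<bar>det (grad x)\<bar> \<partial>lborel)"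
      using nb(3) by (intro nn_integral_mono) (auto simp: indicator_def)
    moreover have "\<dots> \<le> emeasure lborel (u ` K')" by (rule area_le[OF nb(2) nb(7) nb(1)])
    moreover have "\<dots> \<le> emeasure lborel (u ` V)" using nb(5) b by (intro emeasure_mono) auto
    ultimately show ?thesis by (intro exI[of _ "\<lambda>x. \<bar>det (grad x)\<bar>"]) (auto intro: order_trans)
  qed
  have lem: "(\<lambda>x. ennreal \<bar>det (\<chi> i. v i x)\<bar> * indicator (C n) x) \<in> borel_measurable lebesgue \<and>
     (\<integral>\<^sup>+x\<in>C n. \<bar>det (\<chi> i. v i x)\<bar> \<partial>lebesgue) \<le> emeasure lborel (u ` V)" for n
  proof -
    obtain g where g: "g \<in> borel_measurable borel" "AE x in lebesgue. x \<in> C n \<longrightarrow> \<bar>det (\<chi> i. v i x)\<bar> = g x"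
      "(\<integral>\<^sup>+x\<in>C n. g x \<partial>lborel) \<le> emeasure lborel (u ` V)" using det_borel by blast
    have Cb: "C n \<in> sets borel" using C(1) by (rule borel_compact)
    have gm: "(\<lambda>x. ennreal (g x) * indicator (C n) x) \<in> borel_measurable lborel" using g(1) Cb by simp
    have ae: "AE x in lebesgue. ennreal (g x) * indicator (C n) x = ennreal \<bar>det (\<chi> i. v i x)\<bar> * indicator (C n) x"
      using g(2) by eventually_elim (auto simp: indicator_def)
    have "(\<lambda>x. ennreal \<bar>det (\<chi> i. v i x)\<bar> * indicator (C n) x) \<in> borel_measurable lebesgue"
      by (rule borel_measurable_lebesgue_AE_eq[OF measurable_completion[OF gm] ae]) simp
    moreover have "(\<integral>\<^sup>+x\<in>C n. \<bar>det (\<chi> i. v i x)\<bar> \<partial>lebesgue) = (\<integral>\<^sup>+x\<in>C n. g x \<partial>lebesgue)"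
      by (rule nn_integral_cong_AE) (use ae in eventually_elim, simp)
    moreover have "(\<integral>\<^sup>+x\<in>C n. g x \<partial>lebesgue) = (\<integral>\<^sup>+x\<in>C n. g x \<partial>lborel)" by (rule nn_integral_completion)
    ultimately show ?thesis using g(3) by simp
  qed
  have "(\<integral>\<^sup>+x\<in>V. \<bar>det (\<chi> i. v i x)\<bar> \<partial>lebesgue) = (\<integral>\<^sup>+x. (SUP n. ennreal \<bar>det (\<chi> i. v i x)\<bar> * indicator (C n) x) \<partial>lebesgue)"
  proof (rule nn_integral_cong)
    fix x
    have "(SUP n. indicator (C n) x :: ennreal) = indicator V x" using C(4) by (auto simp: indicator_def intro!: antisym SUP_least intro: SUP_upper2)
    then show "ennreal \<bar>det (\<chi> i. v i x)\<bar> * indicator V x = (SUP n. ennreal \<bar>det (\<chi> i. v i x)\<bar> * indicator (C n) x)"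
      by (simp add: SUP_mult_left_ennreal[symmetric])
  qed
  also have "\<dots> = (SUP n. \<integral>\<^sup>+x\<in>C n. \<bar>det (\<chi> i. v i x)\<bar> \<partial>lebesgue)"
    using lem inc by (intro nn_integral_monotone_convergence_SUP) (auto simp: incseq_def le_fun_def indicator_def)
  also have "\<dots> \<le> emeasure lborel (u ` V)" using lem by (intro SUP_least) auto
  finally show "(\<integral>\<^sup>+x\<in>V. \<bar>det (\<chi> i. v i x)\<bar> \<partial>lebesgue) \<le> emeasure lborel (u ` V)" .
qed

section \<open>Rescaled test functions and their moments against affine maps\<close>

lemma pd_rescale:
  fixes \<psi> :: "real^'n \<Rightarrow> real"
  assumes "has_partial \<psi> (c *\<^sub>R (x - a)) i"
  shows "has_partial (\<lambda>x. k * \<psi> (c *\<^sub>R (x - a))) x i" "pd (\<lambda>x. k * \<psi> (c *\<^sub>R (x - a))) x i = k * c * pd \<psi> (c *\<^sub>R (x - a)) i"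
proof -
  let ?z = "c *\<^sub>R (x - a)"
  have "((\<lambda>t. \<psi> (?z + t *\<^sub>R axis i 1)) has_real_derivative pd \<psi> ?z i) (at (c * 0))"
    using has_partial_imp_deriv[of \<psi> ?z 0 i] assms by (simp add: has_real_derivative_iff_has_vector_derivative)
  then have "((\<lambda>t. \<psi> (?z + (c * t) *\<^sub>R axis i 1)) has_real_derivative pd \<psi> ?z i * c) (at 0)"
    by (rule DERIV_chain2) (auto intro!: derivative_eq_intros)
  then have "((\<lambda>t. k * \<psi> (?z + (c * t) *\<^sub>R axis i 1)) has_real_derivative k * (pd \<psi> ?z i * c)) (at 0)"
    by (rule DERIV_cmult)
  moreover have "?z + (c * t) *\<^sub>R axis i 1 = c *\<^sub>R (x + t *\<^sub>R axis i 1 - a)" for t by (simp add: algebra_simps)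
  ultimately have "((\<lambda>t. k * \<psi> (c *\<^sub>R (x + t *\<^sub>R axis i 1 - a))) has_vector_derivative k * c * pd \<psi> ?z i) (at 0)"
    by (simp add: has_real_derivative_iff_has_vector_derivative mult_ac)
  then show "has_partial (\<lambda>x. k * \<psi> (c *\<^sub>R (x - a))) x i" "pd (\<lambda>x. k * \<psi> (c *\<^sub>R (x - a))) x i = k * c * pd \<psi> ?z i"
    by (auto simp: has_partial_def pd_def vector_derivative_at differentiable_def has_vector_derivative_def)
qed

lemma test_fun_rescale:
  fixes \<phi> :: "real^'n \<Rightarrow> real"
  assumes tf: "test_fun UNIV \<phi>" and r: "r > 0"
    and sub: "\<And>x. x \<in> closure {x. \<phi> x \<noteq> 0} \<Longrightarrow> a + r *\<^sub>R x \<in> U"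
  shows "test_fun U (\<lambda>x. \<phi> ((1 / r) *\<^sub>R (x - a)))" "pd (\<lambda>x. \<phi> ((1 / r) *\<^sub>R (x - a))) x i = (1 / r) * pd \<phi> ((1 / r) *\<^sub>R (x - a)) i"
proof -
  define c where "c = 1 / r"
  define \<phi>r where "\<phi>r x = \<phi> (c *\<^sub>R (x - a))" for x
  have sm: "continuous_on UNIV (iter_pd is \<phi>)" "has_partial (iter_pd is \<phi>) x i" for "is" x i
    using tf by (auto simp: test_fun_def smooth_fun_def)
  have iter: "iter_pd is \<phi>r = (\<lambda>x. c ^ length is * iter_pd is \<phi> (c *\<^sub>R (x - a)))" for "is"
  proof (induction "is")
    case (Cons i "is")
    show ?case
    proof
      fix x
      show "iter_pd (i # is) \<phi>r x = c ^ length (i # is) * iter_pd (i # is) \<phi> (c *\<^sub>R (x - a))"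
        using pd_rescale(2)[OF sm(2)[of "is" "c *\<^sub>R (x - a)" i], where k="c ^ length is"] by (simp add: Cons mult_ac)
    qed
  qed (simp add: \<phi>r_def[abs_def])
  have "smooth_fun \<phi>r" unfolding smooth_fun_def iter
    by (intro allI conjI continuous_intros continuous_on_compose2[OF sm(1)] pd_rescale(1) sm(2)) auto
  moreover have cl: "closure {x. \<phi>r x \<noteq> 0} \<subseteq> (\<lambda>x. a + r *\<^sub>R x) ` closure {x. \<phi> x \<noteq> 0}"
  proof (rule closure_minimal)
    show "{x. \<phi>r x \<noteq> 0} \<subseteq> (\<lambda>x. a + r *\<^sub>R x) ` closure {x. \<phi> x \<noteq> 0}"
    proof
      fix x assume "x \<in> {x. \<phi>r x \<noteq> 0}"
      then have "c *\<^sub>R (x - a) \<in> closure {x. \<phi> x \<noteq> 0}" by (auto simp: \<phi>r_def intro: closure_subset[THEN subsetD])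
      then show "x \<in> (\<lambda>x. a + r *\<^sub>R x) ` closure {x. \<phi> x \<noteq> 0}"
        by (rule rev_image_eqI) (use r in \<open>simp add: c_def\<close>)
    qed
    have "compact ((\<lambda>x. a + r *\<^sub>R x) ` closure {x. \<phi> x \<noteq> 0})"
      using tf by (intro compact_continuous_image continuous_intros) (auto simp: test_fun_def)
    then show "closed ((\<lambda>x. a + r *\<^sub>R x) ` closure {x. \<phi> x \<noteq> 0})" by (rule compact_imp_closed)
  qed
  moreover have "compact (closure {x. \<phi>r x \<noteq> 0})"
  proof -
    have "compact ((\<lambda>x. a + r *\<^sub>R x) ` closure {x. \<phi> x \<noteq> 0})"
      using tf by (intro compact_continuous_image continuous_intros) (auto simp: test_fun_def)
    then show ?thesis using cl by (metis closed_closure compact_Int_closed inf.absorb2)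
  qed
  moreover have "closure {x. \<phi>r x \<noteq> 0} \<subseteq> U" using cl sub by blast
  ultimately have "test_fun U \<phi>r" by (simp add: test_fun_def)
  then show "test_fun U (\<lambda>x. \<phi> ((1 / r) *\<^sub>R (x - a)))" by (simp add: \<phi>r_def[abs_def] c_def)
  show "pd (\<lambda>x. \<phi> ((1 / r) *\<^sub>R (x - a))) x i = (1 / r) * pd \<phi> ((1 / r) *\<^sub>R (x - a)) i"
    using pd_rescale(2)[OF sm(2)[of "[]" "(1 / r) *\<^sub>R (x - a)" i], where k=1] by simp
qed

text \<open>The increments F(x + e) - F(x) integrate to 0 by translation invariance. Written as
  averages of F' over segments they integrate, by Fubini, to the full integral of F'.\<close>

lemma integral_partial_zero:
  fixes F F' :: "real^'n \<Rightarrow> 'b::euclidean_space"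
  assumes F: "integrable lborel F" and F': "integrable lborel F'" and c: "continuous_on UNIV F'"
    and der: "\<And>x s. ((\<lambda>t. F (x + t *\<^sub>R e)) has_vector_derivative F' (x + s *\<^sub>R e)) (at s)"
  shows "(LINT x|lborel. F' x) = 0"
proof -
  have line: "(LINT s|lborel. indicator {0..1} s *\<^sub>R F' (x + s *\<^sub>R e)) = F (x + e) - F x" for x
  proof -
    have "(LINT s|lborel. indicator {0..1} s *\<^sub>R F' (x + s *\<^sub>R e)) = F (x + 1 *\<^sub>R e) - F (x + 0 *\<^sub>R e)"
      by (rule integral_FTC_Icc[OF _ has_vector_derivative_at_within[OF der]])
         (auto intro!: continuous_intros continuous_on_compose2[OF c])
    then show ?thesis by simp
  qed
  have p: "integrable (lborel \<Otimes>\<^sub>M lborel) (\<lambda>(x, s::real). indicator {0..1} s *\<^sub>R F' (x + s *\<^sub>R e))"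
    by (rule integrable_pair_translate[OF F'])
  have "0 = (LINT x|lborel. F (x + e) - F x)"
    using F lborel_integrable_translate[OF F, of e] by (simp add: lborel_integral_translate)
  also have "\<dots> = (LINT x|lborel. LINT s|lborel. indicator {0..1} s *\<^sub>R F' (x + s *\<^sub>R e))" by (simp only: line)
  also have "\<dots> = (LINT s|lborel. LINT x|lborel. indicator {0..1::real} s *\<^sub>R F' (x + s *\<^sub>R e))"
    by (subst lborel_pair.Fubini_integral[OF p]) simp
  also have "\<dots> = (LINT s|lborel. indicator {0..1::real} s *\<^sub>R (LINT x|lborel. F' x))"
    by (simp only: integral_scaleR_right lborel_integral_translate)
  also have "\<dots> = (LINT x|lborel. F' x)" by simp
  finally show ?thesis by simp
qed

lemma test_fun_integrable:
  fixes \<phi> :: "real^'n \<Rightarrow> real"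
  assumes tf: "test_fun U \<phi>" and g: "continuous_on UNIV g"
  shows "integrable lborel (\<lambda>x. \<phi> x *\<^sub>R (g x :: 'b::euclidean_space))" "integrable lborel (\<lambda>x. pd \<phi> x i *\<^sub>R g x)"
proof -
  define K where "K = closure {x. \<phi> x \<noteq> 0}"
  have K: "compact K" using tf by (simp add: test_fun_def K_def)
  have out: "\<phi> x = 0" "pd \<phi> x i = 0" if "x \<notin> K" for x
    using test_fun_pd(4)[OF tf] that closure_subset[of "{x. \<phi> x \<noteq> 0}"] by (auto simp: K_def)
  have "integrable lborel (\<lambda>x. indicator K x *\<^sub>R (f x *\<^sub>R g x))" if "continuous_on UNIV f" for f :: "real^'n \<Rightarrow> real"
    by (intro borel_integrable_compact K continuous_intros continuous_on_subset[OF that] continuous_on_subset[OF g]) auto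
  from this[OF test_fun_pd(1)[OF tf]] this[OF test_fun_pd(2)[OF tf, of i]]
  have "integrable lborel (\<lambda>x. indicator K x *\<^sub>R (\<phi> x *\<^sub>R g x))" "integrable lborel (\<lambda>x. indicator K x *\<^sub>R (pd \<phi> x i *\<^sub>R g x))" .
  moreover have "indicator K x *\<^sub>R (\<phi> x *\<^sub>R g x) = \<phi> x *\<^sub>R g x" "indicator K x *\<^sub>R (pd \<phi> x i *\<^sub>R g x) = pd \<phi> x i *\<^sub>R g x" for x
    by (cases "x \<in> K"; simp add: out)+
  ultimately show "integrable lborel (\<lambda>x. \<phi> x *\<^sub>R g x)" "integrable lborel (\<lambda>x. pd \<phi> x i *\<^sub>R g x)"
    by (simp_all only:)
qed

lemma continuous_row_map: "continuous_on S (\<lambda>x. row_map A (x - x0))"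
  unfolding row_map_def by (intro continuous_intros)

text \<open>Integration by parts for the product of \<phi> with an affine map, whose i-th partial
  derivative is the constant row \<open>A $ i\<close>.\<close>

lemma test_fun_affine_moment:
  fixes \<phi> :: "real^'n \<Rightarrow> real" and A :: "real^'m^'n"
  assumes tf: "test_fun U \<phi>"
  shows "(LINT x|lborel. pd \<phi> x i *\<^sub>R (b + row_map A (x - x0))) = - ((LINT x|lborel. \<phi> x) *\<^sub>R A $ i)"
proof -
  let ?l = "\<lambda>x. b + row_map A (x - x0)"
  have cl: "continuous_on UNIV ?l" by (intro continuous_intros continuous_row_map)
  have i1: "integrable lborel (\<lambda>x. \<phi> x *\<^sub>R ?l x)" "integrable lborel (\<lambda>x. pd \<phi> x i *\<^sub>R ?l x)"
    by (rule test_fun_integrable[OF tf cl])+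
  have i2: "integrable lborel (\<lambda>x. \<phi> x *\<^sub>R A $ i)" by (rule test_fun_integrable(1)[OF tf]) simp
  have i3: "integrable lborel \<phi>" using test_fun_integrable(1)[OF tf, of "\<lambda>_. 1 :: real"] by simp
  have rm: "row_map A (x + t *\<^sub>R axis i 1 - x0) = row_map A (x - x0) + t *\<^sub>R A $ i" for x t
    by (simp add: row_map_def axis_def algebra_simps sum.distrib sum_subtractf if_distrib[where f="\<lambda>a. _ * a"]
        if_distrib[where f="\<lambda>a. a *\<^sub>R _"] cong: if_cong)
  have "(LINT x|lborel. pd \<phi> x i *\<^sub>R ?l x + \<phi> x *\<^sub>R A $ i) = 0"
  proof (rule integral_partial_zero[where e="axis i 1" and F="\<lambda>x. \<phi> x *\<^sub>R ?l x"])
    show "integrable lborel (\<lambda>x. pd \<phi> x i *\<^sub>R ?l x + \<phi> x *\<^sub>R A $ i)" using i1 i2 by simp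
    show "continuous_on UNIV (\<lambda>x. pd \<phi> x i *\<^sub>R ?l x + \<phi> x *\<^sub>R A $ i)"
      by (intro continuous_intros cl test_fun_pd[OF tf])
    fix x s
    have d1: "((\<lambda>t. \<phi> (x + t *\<^sub>R axis i 1)) has_real_derivative pd \<phi> (x + s *\<^sub>R axis i 1) i) (at s)"
      using has_partial_imp_deriv[OF test_fun_pd(3)[OF tf], where x=x and s=s and i=i]
      by (simp add: has_real_derivative_iff_has_vector_derivative)
    have d2: "((\<lambda>t. ?l (x + t *\<^sub>R axis i 1)) has_vector_derivative A $ i) (at s)"
      unfolding rm by (auto intro!: derivative_eq_intros)
    from has_vector_derivative_scaleR[OF d1 d2]
    show "((\<lambda>t. \<phi> (x + t *\<^sub>R axis i 1) *\<^sub>R ?l (x + t *\<^sub>R axis i 1)) has_vector_derivative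
        pd \<phi> (x + s *\<^sub>R axis i 1) i *\<^sub>R ?l (x + s *\<^sub>R axis i 1) + \<phi> (x + s *\<^sub>R axis i 1) *\<^sub>R A $ i) (at s)"
      by (simp add: add.commute)
  qed (rule i1)
  then have "(LINT x|lborel. pd \<phi> x i *\<^sub>R ?l x) + (LINT x|lborel. \<phi> x) *\<^sub>R A $ i = 0"
    using i1 i2 i3 by (simp add: Bochner_Integration.integral_add)
  then show ?thesis by (simp add: eq_neg_iff_add_eq_0)
qed

lemma lborel_integral_rescale:
  fixes g :: "real^'n \<Rightarrow> real"
  assumes r: "r > 0" and g: "g \<in> borel_measurable borel"
  shows "(LINT x|lborel. g ((1 / r) *\<^sub>R (x - a))) = r ^ CARD('n) * (LINT x|lborel. g x)"
proof -
  have g': "(\<lambda>x. g ((1 / r) *\<^sub>R (x - a))) \<in> borel_measurable borel" using g by measurable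
  have "(LINT x|lborel. g ((1 / r) *\<^sub>R (x - a))) = (LINT x|density (distr lborel borel (\<lambda>x. a + r *\<^sub>R x)) (\<lambda>_. ennreal (\<bar>r\<bar> ^ DIM(real^'n))). g ((1 / r) *\<^sub>R (x - a)))"
    using lborel_affine[of r a] r by simp
  also have "\<dots> = (LINT x|distr lborel borel (\<lambda>x. a + r *\<^sub>R x). \<bar>r\<bar> ^ DIM(real^'n) *\<^sub>R g ((1 / r) *\<^sub>R (x - a)))"
    by (rule integral_density) (use g' in auto)
  also have "\<dots> = (LINT x|lborel. \<bar>r\<bar> ^ DIM(real^'n) *\<^sub>R g ((1 / r) *\<^sub>R (a + r *\<^sub>R x - a)))"
    by (rule integral_distr) (use g' in auto)
  also have "\<dots> = r ^ CARD('n) * (LINT x|lborel. g x)" using r by simp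
  finally show ?thesis .
qed

lemma ennreal_integral_le:
  fixes X :: "'a \<Rightarrow> real"
  assumes X: "integrable M X" shows "ennreal (LINT x|M. X x) \<le> (\<integral>\<^sup>+x. ennreal (X x) \<partial>M)"
proof -
  have i: "integrable M (\<lambda>x. max 0 (X x))" using X by auto
  have "ennreal (LINT x|M. X x) \<le> ennreal (LINT x|M. max 0 (X x))"
    by (intro ennreal_leI integral_mono X i) auto
  also have "\<dots> = (\<integral>\<^sup>+x. ennreal (max 0 (X x)) \<partial>M)" by (rule nn_integral_eq_integral[symmetric, OF i]) auto
  also have "\<dots> = (\<integral>\<^sup>+x. ennreal (X x) \<partial>M)" by (intro nn_integral_cong) (simp add: max_def ennreal_neg)
  finally show ?thesis .
qed

section \<open>Local lower bounds for the energy\<close>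

text \<open>What the estimates use of a homeomorphism of finite energy. The dilatation being finite
  almost everywhere makes the classical partial derivatives exist and agree with the weak ones
  \<open>v\<close>.\<close>

locale admissible_map =
  fixes \<Phi> :: "ennreal \<Rightarrow> ennreal" and \<Omega> :: "(real^'n) set" and u :: "real^'n \<Rightarrow> real^'n" and v :: "'n \<Rightarrow> real^'n \<Rightarrow> real^'n"
    and q :: real
  assumes q: "q = 1 / (real CARD('n) - 1)" and n2: "CARD('n) \<ge> 2" and Phi: "strictly_convex_Phi \<Phi>" and open_Omega: "open \<Omega>"
    and cu: "continuous_on \<Omega> u" and inj: "inj_on u \<Omega>" and wp: "weak_partials \<Omega> u v"
    and finite_dil: "AE x in lebesgue. x \<in> \<Omega> \<longrightarrow> Pdil u x \<noteq> \<infinity>"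
begin

lemma pd_eq: "AE x in lebesgue. x \<in> \<Omega> \<longrightarrow> (\<forall>i. pd u x i = v i x)"
proof -
  have "AE x in lebesgue. x \<in> \<Omega> \<longrightarrow> pd u x i = v i x" for i
  proof (rule pd_eq_weak_partial[OF open_Omega cu wp])
    show "AE x in lebesgue. x \<in> \<Omega> \<longrightarrow> has_partial u x i"
      using finite_dil
    proof eventually_elim
      case (elim x)
      show ?case
      proof
        assume "x \<in> \<Omega>"
        then have "Pdil u x \<noteq> \<infinity>" using elim by blast
        from Pdil_cases[OF n2 this] have "has_all_partials u x" by metis
        then show "has_partial u x i" by (simp add: has_all_partials_def)
      qed
    qed
  qed
  then have "AE x in lebesgue. \<forall>i. x \<in> \<Omega> \<longrightarrow> pd u x i = v i x" unfolding AE_all_countable by blast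
  then show ?thesis by eventually_elim blast
qed

definition vmat where "vmat x = (\<chi> i. v i x)"

lemma tangent_bound:
  assumes s: "s \<ge> 0"
  shows "AE x in lebesgue. x \<in> \<Omega> \<longrightarrow> (\<exists>P\<ge>1. Pdil u x = ennreal P \<and>
    P \<ge> (1 + q) * s powr q * onorm (row_map (vmat x)) - q * s powr (1 + q) * \<bar>det (vmat x)\<bar>)"
  using finite_dil pd_eq
proof eventually_elim
  case (elim x)
  show ?case
  proof
    assume x: "x \<in> \<Omega>"
    then have fin: "Pdil u x \<noteq> \<infinity>" and eq: "pd_mat u x = vmat x" using elim by (auto simp: pd_mat_def vmat_def)
    obtain P where "Pdil u x = ennreal P" "P \<ge> 1"
      "\<And>s. s \<ge> 0 \<Longrightarrow> P \<ge> (1 + q) * s powr q * onorm (row_map (pd_mat u x)) - q * s powr (1 + q) * \<bar>det (pd_mat u x)\<bar>"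
      unfolding q by (rule Pdil_cases[OF n2 fin]) blast
    then show "\<exists>P\<ge>1. Pdil u x = ennreal P \<and>
      P \<ge> (1 + q) * s powr q * onorm (row_map (vmat x)) - q * s powr (1 + q) * \<bar>det (vmat x)\<bar>"
      using s unfolding eq by blast
  qed
qed

text \<open>The area inequality turns the measure of the image into an L^1 bound for the Jacobian.
  Measurability on V is obtained from an exhaustion by compact sets, since \<open>v\<close> is only
  locally integrable.\<close>

lemma integrable_det:
  assumes V: "open V" "V \<subseteq> \<Omega>" and fin: "emeasure lborel (u ` V) = ennreal m" and m: "0 \<le> m"
  shows "integrable lebesgue (\<lambda>x. indicator V x * \<bar>det (vmat x)\<bar>)" "(LINT x|lebesgue. indicator V x * \<bar>det (vmat x)\<bar>) \<le> m"
proof -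
  have le: "(\<integral>\<^sup>+x\<in>V. \<bar>det (vmat x)\<bar> \<partial>lebesgue) \<le> ennreal m"
    using area_le_open(2)[OF V cu wp inj] fin by (simp add: vmat_def)
  have vm: "(\<lambda>x. indicator V x *\<^sub>R v i x) \<in> borel_measurable lebesgue" for i
  proof -
    obtain C :: "nat \<Rightarrow> (real^'n) set" where C: "\<And>n. compact (C n)" "\<And>n. C n \<subseteq> V" "\<And>n. C n \<subseteq> interior (C (Suc n))" "\<Union>(range C) = V"
      using open_Union_compact_subsets[OF V(1)] by metis
    have inc: "incseq C" using C(3) interior_subset by (intro incseq_SucI) blast
    have m: "(\<lambda>x. indicator (C n) x *\<^sub>R v i x) \<in> borel_measurable lebesgue" for n
    proof -
      have "v i absolutely_integrable_on C n"
        using wp C(1) subset_trans[OF C(2) V(2)] by (auto simp: weak_partials_def locally_L1_def)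
      then show ?thesis by (auto simp: set_integrable_def dest: borel_measurable_integrable)
    qed
    show ?thesis
    proof (rule borel_measurable_LIMSEQ_metric[OF m])
      fix x
      show "(\<lambda>n. indicator (C n) x *\<^sub>R v i x) \<longlonglongrightarrow> indicator V x *\<^sub>R v i x"
        using LIMSEQ_indicator_incseq[OF inc, of x] unfolding C(4)
        by (intro tendsto_scaleR tendsto_const)
    qed
  qed
  have "(\<lambda>x. indicator V x * \<bar>det (\<chi> i. indicator V x *\<^sub>R v i x)\<bar>) \<in> borel_measurable lebesgue"
  proof -
    have comp: "(\<lambda>x. (indicator V x *\<^sub>R v i x) $ k) \<in> borel_measurable lebesgue" for i k
      by (rule measurable_compose[OF vm, of "\<lambda>z. z $ k"]) (intro borel_measurable_continuous_onI continuous_intros)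
    have "(\<lambda>x. det (\<chi> i. indicator V x *\<^sub>R v i x)) \<in> borel_measurable lebesgue"
      unfolding det_def by (intro borel_measurable_sum borel_measurable_times borel_measurable_prod borel_measurable_const) (simp add: comp[simplified])
    moreover have "V \<in> sets lebesgue" using V(1) by simp
    ultimately show ?thesis by (intro borel_measurable_times borel_measurable_abs borel_measurable_indicator)
  qed
  moreover have "indicator V x * \<bar>det (\<chi> i. indicator V x *\<^sub>R v i x)\<bar> = indicator V x * \<bar>det (vmat x)\<bar>" for x
    by (auto simp: indicator_def vmat_def)
  ultimately have meas: "(\<lambda>x. indicator V x * \<bar>det (vmat x)\<bar>) \<in> borel_measurable lebesgue" by simp
  have eq: "(\<integral>\<^sup>+x. ennreal (indicator V x * \<bar>det (vmat x)\<bar>) \<partial>lebesgue) = (\<integral>\<^sup>+x\<in>V. \<bar>det (vmat x)\<bar> \<partial>lebesgue)"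
    by (intro nn_integral_cong) (auto simp: indicator_def)
  show i: "integrable lebesgue (\<lambda>x. indicator V x * \<bar>det (vmat x)\<bar>)"
  proof (rule integrableI_bounded[OF meas])
    have "(\<integral>\<^sup>+x. ennreal (norm (indicator V x * \<bar>det (vmat x)\<bar>)) \<partial>lebesgue) = (\<integral>\<^sup>+x\<in>V. \<bar>det (vmat x)\<bar> \<partial>lebesgue)"
      by (intro nn_integral_cong) (auto simp: indicator_def)
    also have "\<dots> < \<infinity>" using le by (auto intro: le_less_trans)
    finally show "(\<integral>\<^sup>+x. ennreal (norm (indicator V x * \<bar>det (vmat x)\<bar>)) \<partial>lebesgue) < \<infinity>" .
  qed
  have "ennreal (LINT x|lebesgue. indicator V x * \<bar>det (vmat x)\<bar>) = (\<integral>\<^sup>+x. ennreal (indicator V x * \<bar>det (vmat x)\<bar>) \<partial>lebesgue)"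
    by (rule nn_integral_eq_integral[symmetric, OF i]) (auto simp: indicator_def)
  also have "\<dots> \<le> ennreal m" unfolding eq by (rule le)
  finally show "(LINT x|lebesgue. indicator V x * \<bar>det (vmat x)\<bar>) \<le> m" using m by (simp add: ennreal_le_iff)
qed

text \<open>Integration by parts moves the derivative to the rescaled bump, where \<open>u\<close>
  is replaced by its affine approximation: the error is \<delta> r times the integral of the
  derivative of the bump, which scales like r^(n-1). For the affine map the result is exactly the
  row \<open>A $ i\<close> times the mass of the bump.\<close>

lemma weighted_gradient:
  fixes \<phi>1 :: "real^'n \<Rightarrow> real" and A :: "real^'n^'n"
  assumes tf1: "test_fun UNIV \<phi>1" and supp: "closure {x. \<phi>1 x \<noteq> 0} \<subseteq> cbox (vec (-1)) (vec 1)"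
    and r: "r > 0" and sub: "cbox (x0 - vec r) (x0 + vec r) \<subseteq> \<Omega>"
    and near: "\<And>x. x \<in> cbox (x0 - vec r) (x0 + vec r) \<Longrightarrow> norm (u x - (b + row_map A (x - x0))) \<le> \<delta> * r"
  defines "\<phi> \<equiv> \<lambda>x. \<phi>1 ((1 / r) *\<^sub>R (x - x0))" and "Q \<equiv> cbox (x0 - vec r) (x0 + vec r)"
  shows "integrable lebesgue (\<lambda>x. \<phi> x *\<^sub>R (indicator Q x *\<^sub>R v i x))"
    and "norm ((LINT x|lebesgue. \<phi> x *\<^sub>R (indicator Q x *\<^sub>R v i x)) - (r ^ CARD('n) * (LINT x|lborel. \<phi>1 x)) *\<^sub>R A $ i)
       \<le> r ^ CARD('n) * (\<delta> * (LINT x|lborel. \<bar>pd \<phi>1 x i\<bar>))"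
proof -
  have sc: "x0 + r *\<^sub>R x \<in> Q" if "x \<in> cbox (vec (-1)) (vec 1)" for x
  proof -
    have "\<bar>x $ k\<bar> \<le> 1" for k using that by (auto simp: mem_box_cart abs_le_iff)
    then have rk: "\<bar>r * x $ k\<bar> \<le> r" for k using r by (simp add: abs_mult mult_left_le)
    have "x0 $ k - r \<le> x0 $ k + r * x $ k \<and> x0 $ k + r * x $ k \<le> x0 $ k + r" for k
      using abs_le_D1[OF rk[of k]] abs_le_D2[OF rk[of k]] by linarith
    then show ?thesis by (simp add: Q_def mem_box_cart)
  qed
  have tfU: "test_fun \<Omega> \<phi>" and pdphi: "pd \<phi> x i = (1 / r) * pd \<phi>1 ((1 / r) *\<^sub>R (x - x0)) i" for x
    unfolding \<phi>_def using supp sc sub Q_def by (intro test_fun_rescale[OF tf1 r]; blast)+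
  have out: "\<phi> x = 0" "pd \<phi> x i = 0" if "x \<notin> Q" for x
  proof -
    have z: "(1 / r) *\<^sub>R (x - x0) \<notin> closure {x. \<phi>1 x \<noteq> 0}"
    proof
      assume "(1 / r) *\<^sub>R (x - x0) \<in> closure {x. \<phi>1 x \<noteq> 0}"
      then have "x0 + r *\<^sub>R ((1 / r) *\<^sub>R (x - x0)) \<in> Q" using supp by (intro sc) blast
      then show False using that r by simp
    qed
    then show "\<phi> x = 0" using closure_subset[of "{x. \<phi>1 x \<noteq> 0}"] by (auto simp: \<phi>_def)
    show "pd \<phi> x i = 0" using test_fun_pd(4)[OF tf1 z] by (simp add: pdphi)
  qed
  have Qc: "compact Q" "Q \<in> sets lebesgue" "Q \<subseteq> \<Omega>" using sub by (auto simp: Q_def)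
  have iv: "integrable lebesgue (\<lambda>x. indicator Q x *\<^sub>R v i x)"
    using wp Qc by (auto simp: weak_partials_def locally_L1_def set_integrable_def)
  obtain w where w: "integrable lborel w" "AE x in lebesgue. w x = indicator Q x *\<^sub>R v i x"
    by (rule lebesgue_integrable_borel_version[OF iv])
  have c\<phi>: "continuous_on UNIV \<phi>" "continuous_on UNIV (\<lambda>x. pd \<phi> x i)" using test_fun_pd[OF tfU] by auto
  then have [measurable]: "\<phi> \<in> borel_measurable borel" "(\<lambda>x. pd \<phi> x i) \<in> borel_measurable borel" "(\<lambda>x. pd \<phi>1 x i) \<in> borel_measurable borel" "\<phi>1 \<in> borel_measurable borel"
    using test_fun_pd(1,2)[OF tf1] by (auto intro: borel_measurable_continuous_onI)
  obtain B where B: "\<And>x. norm (\<phi> x) \<le> B" "B \<ge> 0"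
  proof -
    have "bounded (\<phi> ` Q)" by (intro compact_imp_bounded compact_continuous_image Qc continuous_on_subset[OF c\<phi>(1)]) auto
    then obtain B where B: "\<And>x. x \<in> Q \<Longrightarrow> norm (\<phi> x) \<le> B" by (auto simp: bounded_iff)
    have "norm (\<phi> x) \<le> max B 0" for x using B[of x] out[of x] by (cases "x \<in> Q") auto
    then show thesis using that[of "max B 0"] by auto
  qed
  have iw: "integrable lborel (\<lambda>x. \<phi> x *\<^sub>R w x)"
  proof (rule Bochner_Integration.integrable_bound[where f="\<lambda>x. B *\<^sub>R w x"])
    show "AE x in lborel. norm (\<phi> x *\<^sub>R w x) \<le> norm (B *\<^sub>R w x)"
    proof (intro AE_I2)
      fix x
      have "norm (\<phi> x) * norm (w x) \<le> \<bar>B\<bar> * norm (w x)" by (rule mult_right_mono) (use B(1)[of x] B(2) in auto)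
      then show "norm (\<phi> x *\<^sub>R w x) \<le> norm (B *\<^sub>R w x)" by simp
    qed
    show "(\<lambda>x. \<phi> x *\<^sub>R w x) \<in> borel_measurable lborel" using w(1) by (auto dest: borel_measurable_integrable)
  qed (use w in auto)
  have ae: "AE x in lebesgue. \<phi> x *\<^sub>R w x = indicator \<Omega> x *\<^sub>R (\<phi> x *\<^sub>R v i x)"
    using w(2) by eventually_elim (use out Qc(3) in \<open>auto simp: indicator_def\<close>)
  have ae2: "AE x in lebesgue. \<phi> x *\<^sub>R w x = \<phi> x *\<^sub>R (indicator Q x *\<^sub>R v i x)"
    using w(2) by eventually_elim simp
  have iwl: "integrable lebesgue (\<lambda>x. \<phi> x *\<^sub>R w x)" using iw by (subst integrable_completion) auto
  have ml: "(\<lambda>x. \<phi> x *\<^sub>R (indicator Q x *\<^sub>R v i x)) \<in> borel_measurable lebesgue"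
    by (rule borel_measurable_lebesgue_AE_eq[OF borel_measurable_integrable[OF iwl] ae2]) simp
  show "integrable lebesgue (\<lambda>x. \<phi> x *\<^sub>R (indicator Q x *\<^sub>R v i x))"
    by (rule integrable_cong_AE_imp[OF iwl ml]) (use ae2 in eventually_elim, simp)
  have "(LINT x|lebesgue. \<phi> x *\<^sub>R (indicator Q x *\<^sub>R v i x)) = (LINT x|lebesgue. \<phi> x *\<^sub>R w x)"
    by (rule integral_cong_AE[OF ml borel_measurable_integrable[OF iwl]]) (use ae2 in eventually_elim, simp)
  also have "\<dots> = (LINT x|lborel. \<phi> x *\<^sub>R w x)" using iw by (intro integral_completion) auto
  also have "\<dots> = integral \<Omega> (\<lambda>x. \<phi> x *\<^sub>R v i x)"
    by (rule absolutely_integrable_AE_eq(2)[OF iw ae]) (use open_Omega in simp)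
  also have "\<dots> = - integral \<Omega> (\<lambda>x. pd \<phi> x i *\<^sub>R u x)"
    using wp[unfolded weak_partials_def, THEN conjunct2, THEN spec, THEN spec, THEN mp, OF tfU, of i] by simp
  also have "integral \<Omega> (\<lambda>x. pd \<phi> x i *\<^sub>R u x) = (LINT x|lborel. pd \<phi> x i *\<^sub>R (indicator Q x *\<^sub>R u x))"
  proof (rule absolutely_integrable_AE_eq(2)[symmetric])
    have "integrable lborel (\<lambda>x. indicator Q x *\<^sub>R (pd \<phi> x i *\<^sub>R u x))"
      by (intro borel_integrable_compact Qc continuous_intros continuous_on_subset[OF c\<phi>(2)] continuous_on_subset[OF cu]) auto
    then show "integrable lborel (\<lambda>x. pd \<phi> x i *\<^sub>R (indicator Q x *\<^sub>R u x))" by (simp add: mult.commute)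
    show "AE x in lebesgue. pd \<phi> x i *\<^sub>R (indicator Q x *\<^sub>R u x) = indicator \<Omega> x *\<^sub>R (pd \<phi> x i *\<^sub>R u x)"
      by (rule AE_I2) (use out Qc(3) in \<open>auto simp: indicator_def\<close>)
  qed (use open_Omega in simp)
  finally have I: "(LINT x|lebesgue. \<phi> x *\<^sub>R (indicator Q x *\<^sub>R v i x)) = - (LINT x|lborel. pd \<phi> x i *\<^sub>R (indicator Q x *\<^sub>R u x))" .
  let ?l = "\<lambda>x. b + row_map A (x - x0)"
  have cl: "continuous_on S ?l" for S by (intro continuous_intros continuous_row_map)
  have i1: "integrable lborel (\<lambda>x. pd \<phi> x i *\<^sub>R ?l x)" by (rule test_fun_integrable(2)[OF tfU cl])
  have i2: "integrable lborel (\<lambda>x. pd \<phi> x i *\<^sub>R (indicator Q x *\<^sub>R u x))"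
  proof -
    have "integrable lborel (\<lambda>x. indicator Q x *\<^sub>R (pd \<phi> x i *\<^sub>R u x))"
      by (intro borel_integrable_compact Qc continuous_intros continuous_on_subset[OF c\<phi>(2)] continuous_on_subset[OF cu]) auto
    then show ?thesis by (simp add: mult.commute)
  qed
  have ab: "integrable lborel (\<lambda>x. \<bar>pd \<phi> x i\<bar>)"
    using test_fun_integrable(2)[OF tfU, of "\<lambda>_. 1 :: real" i] by simp
  have mom: "(LINT x|lborel. pd \<phi> x i *\<^sub>R ?l x) = - ((r ^ CARD('n) * (LINT x|lborel. \<phi>1 x)) *\<^sub>R A $ i)"
    unfolding test_fun_affine_moment[OF tfU] by (simp add: \<phi>_def lborel_integral_rescale[OF r])
  have scal: "(LINT x|lborel. \<bar>pd \<phi> x i\<bar>) = r ^ CARD('n) * ((1 / r) * (LINT x|lborel. \<bar>pd \<phi>1 x i\<bar>))"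
  proof -
    have "(LINT x|lborel. \<bar>pd \<phi> x i\<bar>) = (LINT x|lborel. (\<lambda>y. (1 / r) * \<bar>pd \<phi>1 y i\<bar>) ((1 / r) *\<^sub>R (x - x0)))"
      using r by (simp add: pdphi abs_mult)
    also have "\<dots> = r ^ CARD('n) * (LINT y|lborel. (1 / r) * \<bar>pd \<phi>1 y i\<bar>)" by (rule lborel_integral_rescale[OF r]) measurable
    finally show ?thesis by simp
  qed
  have "norm ((LINT x|lebesgue. \<phi> x *\<^sub>R (indicator Q x *\<^sub>R v i x)) - (r ^ CARD('n) * (LINT x|lborel. \<phi>1 x)) *\<^sub>R A $ i)
     = norm ((LINT x|lborel. pd \<phi> x i *\<^sub>R ?l x) - (LINT x|lborel. pd \<phi> x i *\<^sub>R (indicator Q x *\<^sub>R u x)))"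
    unfolding I mom by (rule arg_cong[where f = norm]) simp
  also have "\<dots> = norm (LINT x|lborel. pd \<phi> x i *\<^sub>R ?l x - pd \<phi> x i *\<^sub>R (indicator Q x *\<^sub>R u x))"
    by (simp only: Bochner_Integration.integral_diff[OF i1 i2])
  also have "\<dots> \<le> (LINT x|lborel. (\<delta> * r) * \<bar>pd \<phi> x i\<bar>)"
  proof (rule Bochner_Integration.integral_norm_bound_integral)
    fix x
    show "norm (pd \<phi> x i *\<^sub>R ?l x - pd \<phi> x i *\<^sub>R (indicator Q x *\<^sub>R u x)) \<le> (\<delta> * r) * \<bar>pd \<phi> x i\<bar>"
    proof (cases "x \<in> Q")
      case True
      then have "norm (?l x - u x) \<le> \<delta> * r" using near[of x] by (simp add: Q_def norm_minus_commute)
      then have "\<bar>pd \<phi> x i\<bar> * norm (?l x - u x) \<le> \<bar>pd \<phi> x i\<bar> * (\<delta> * r)" by (intro mult_left_mono) auto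
      then show ?thesis using True by (simp add: scaleR_diff_right[symmetric] mult.commute)
    qed (simp add: out)
  qed (use i1 i2 ab in auto)
  also have "\<dots> = r ^ CARD('n) * (\<delta> * (LINT x|lborel. \<bar>pd \<phi>1 x i\<bar>))" using r by (simp add: scal)
  finally show "norm ((LINT x|lebesgue. \<phi> x *\<^sub>R (indicator Q x *\<^sub>R v i x)) - (r ^ CARD('n) * (LINT x|lborel. \<phi>1 x)) *\<^sub>R A $ i)
       \<le> r ^ CARD('n) * (\<delta> * (LINT x|lborel. \<bar>pd \<phi>1 x i\<bar>))" .
qed

text \<open>The function X in the proof bounds \<open>\<Phi>\<close> of the dilatation from below
  almost everywhere on the cube: affine minorant, then tangent inequality, with the operator norm
  replaced by a bilinear expression in y and h, and with a bump as weight. Its integral is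
  controlled by the previous estimate in the part linear in the gradient and by the area inequality
  in the Jacobian part, which has a negative sign.\<close>

lemma local_lower_bound:
  fixes \<phi>1 :: "real^'n \<Rightarrow> real" and A :: "real^'n^'n"
  assumes tf1: "test_fun UNIV \<phi>1" and supp: "closure {x. \<phi>1 x \<noteq> 0} \<subseteq> cbox (vec (-1)) (vec 1)"
    and out1: "\<And>x. x \<notin> box (vec (-1)) (vec 1) \<Longrightarrow> \<phi>1 x = 0" and b01: "\<And>x. 0 \<le> \<phi>1 x" "\<And>x. \<phi>1 x \<le> 1"
    and r: "r > 0" and sub: "cbox (x0 - vec r) (x0 + vec r) \<subseteq> \<Omega>"
    and near: "\<And>x. x \<in> cbox (x0 - vec r) (x0 + vec r) \<Longrightarrow> norm (u x - (b + row_map A (x - x0))) \<le> \<delta> * r"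
    and minor: "\<And>t::real. 1 \<le> t \<Longrightarrow> ennreal (\<alpha> + \<beta> * t) \<le> \<Phi> (ennreal t)" and \<beta>: "\<beta> \<ge> 0" and s: "s \<ge> 0"
    and h: "norm h \<le> 1" and y: "norm y \<le> 1"
    and fin: "emeasure lborel (u ` box (x0 - vec r) (x0 + vec r)) = ennreal m" and m: "0 \<le> m"
  defines "\<theta> \<equiv> (LINT x|lborel. \<phi>1 x)" and "C \<equiv> (\<Sum>i\<in>UNIV. LINT x|lborel. \<bar>pd \<phi>1 x i\<bar>)"
  shows "ennreal (r ^ CARD('n) * (\<alpha> * \<theta> + \<beta> * ((1 + q) * s powr q) * ((y \<bullet> row_map A h) * \<theta> - \<delta> * C)) - \<beta> * (q * s powr (1 + q)) * m)
     \<le> set_nn_integral lebesgue (box (x0 - vec r) (x0 + vec r)) (\<lambda>x. \<Phi> (Pdil u x))"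
proof -
  define \<phi> where "\<phi> x = \<phi>1 ((1 / r) *\<^sub>R (x - x0))" for x
  define Q where "Q = cbox (x0 - vec r) (x0 + vec r)"
  define B where "B = box (x0 - vec r) (x0 + vec r)"
  define a where "a = (1 + q) * s powr q"
  define k where "k = q * s powr (1 + q)"
  have q0: "q > 0" using n2 by (simp add: q)
  have a0: "a \<ge> 0" and k0: "k \<ge> 0" using q0 by (auto simp: a_def k_def)
  have BQ: "B \<subseteq> Q" using box_subset_cbox by (auto simp: B_def Q_def)
  have B\<Omega>: "B \<subseteq> \<Omega>" using BQ sub by (auto simp: Q_def)
  have outB: "\<phi> x = 0" if "x \<notin> B" for x
  proof -
    have "(1 / r) *\<^sub>R (x - x0) \<notin> box (vec (-1)) (vec 1)"
    proof
      assume "(1 / r) *\<^sub>R (x - x0) \<in> box (vec (-1)) (vec 1)"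
      then have *: "- 1 < (x $ i - x0 $ i) / r" "(x $ i - x0 $ i) / r < 1" for i by (auto simp: mem_box_cart)
      have "x0 $ i - r < x $ i \<and> x $ i < x0 $ i + r" for i
        using *[of i] r by (simp add: pos_divide_less_eq pos_less_divide_eq)
      then show False using that by (simp add: B_def mem_box_cart)
    qed
    then show ?thesis using out1 by (simp add: \<phi>_def)
  qed
  define I where "I i = (LINT x|lebesgue. \<phi> x *\<^sub>R (indicator Q x *\<^sub>R v i x))" for i
  note wg = weighted_gradient[OF tf1 supp r sub near, folded Q_def \<phi>_def]
  have Ii: "integrable lebesgue (\<lambda>x. \<phi> x *\<^sub>R (indicator Q x *\<^sub>R v i x))" for i
    using wg(1)[of i] by (simp add: \<phi>_def Q_def)
  have In: "norm (I i - (r ^ CARD('n) * \<theta>) *\<^sub>R A $ i) \<le> r ^ CARD('n) * (\<delta> * (LINT x|lborel. \<bar>pd \<phi>1 x i\<bar>))" for i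
    using wg(2)[of i] by (simp add: I_def \<phi>_def Q_def \<theta>_def)
  have det_i: "integrable lebesgue (\<lambda>x. indicator B x * \<bar>det (vmat x)\<bar>)" "(LINT x|lebesgue. indicator B x * \<bar>det (vmat x)\<bar>) \<le> m"
    using integrable_det[OF _ B\<Omega>, of m] fin m by (simp_all add: B_def open_box)
  have tfr: "test_fun UNIV \<phi>" unfolding \<phi>_def by (rule test_fun_rescale(1)[OF tf1 r]) simp
  have \<phi>i: "integrable lborel \<phi>" using test_fun_integrable(1)[OF tfr, of "\<lambda>_. 1 :: real"] by simp
  have \<phi>il: "integrable lebesgue \<phi>" using \<phi>i by (subst integrable_completion) auto
  have \<phi>I: "(LINT x|lebesgue. \<phi> x) = r ^ CARD('n) * \<theta>"
  proof -
    have "(LINT x|lebesgue. \<phi> x) = (LINT x|lborel. \<phi> x)" using \<phi>i by (intro integral_completion) auto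
    also have "\<dots> = r ^ CARD('n) * \<theta>" unfolding \<phi>_def \<theta>_def
      by (rule lborel_integral_rescale[OF r]) (use test_fun_pd(1)[OF tf1] in \<open>auto intro: borel_measurable_continuous_onI\<close>)
    finally show ?thesis .
  qed
  define X where "X x = \<alpha> * \<phi> x + \<beta> * a * (\<Sum>i\<in>UNIV. h $ i * (y \<bullet> (\<phi> x *\<^sub>R (indicator Q x *\<^sub>R v i x)))) - \<beta> * k * (indicator B x * \<bar>det (vmat x)\<bar>)" for x
  have Xi: "integrable lebesgue X" unfolding X_def
    by (intro Bochner_Integration.integrable_diff Bochner_Integration.integrable_add integrable_mult_right Bochner_Integration.integrable_sum integrable_inner_right Ii \<phi>il det_i) 
  have XI: "(LINT x|lebesgue. X x) = \<alpha> * (r ^ CARD('n) * \<theta>) + \<beta> * a * (\<Sum>i\<in>UNIV. h $ i * (y \<bullet> I i)) - \<beta> * k * (LINT x|lebesgue. indicator B x * \<bar>det (vmat x)\<bar>)"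
  proof -
    have s1: "integrable lebesgue (\<lambda>x. \<Sum>i\<in>UNIV. h $ i * (y \<bullet> (\<phi> x *\<^sub>R (indicator Q x *\<^sub>R v i x))))"
      by (intro Bochner_Integration.integrable_sum integrable_mult_right integrable_inner_right Ii)
    have "(LINT x|lebesgue. (\<Sum>i\<in>UNIV. h $ i * (y \<bullet> (\<phi> x *\<^sub>R (indicator Q x *\<^sub>R v i x))))) = (\<Sum>i\<in>UNIV. h $ i * (y \<bullet> I i))"
      unfolding I_def
      by (subst Bochner_Integration.integral_sum)
         (auto intro!: integrable_mult_right integrable_inner_right Ii sum.cong simp del: inner_scaleR_right scaleR_scaleR simp: integral_inner_right[OF Ii])
    then show ?thesis unfolding X_def using s1 \<phi>il det_i(1)
      by (simp only: Bochner_Integration.integral_diff Bochner_Integration.integral_add integrable_mult_right integral_mult_right_zero Bochner_Integration.integrable_add \<phi>I)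
  qed
  have low: "(y \<bullet> row_map A h) * (r ^ CARD('n) * \<theta>) - r ^ CARD('n) * (\<delta> * C) \<le> (\<Sum>i\<in>UNIV. h $ i * (y \<bullet> I i))"
  proof -
    have t: "h $ i * (y \<bullet> I i) \<ge> (r ^ CARD('n) * \<theta>) * (h $ i * (y \<bullet> A $ i)) - r ^ CARD('n) * (\<delta> * (LINT x|lborel. \<bar>pd \<phi>1 x i\<bar>))" for i
    proof -
      let ?E = "I i - (r ^ CARD('n) * \<theta>) *\<^sub>R A $ i"
      have "\<bar>h $ i * (y \<bullet> ?E)\<bar> \<le> 1 * (1 * norm ?E)"
        unfolding abs_mult using h y component_le_norm_cart[of h i]
        by (intro mult_mono order_trans[OF Cauchy_Schwarz_ineq2]) auto
      then have "h $ i * (y \<bullet> ?E) \<ge> - (r ^ CARD('n) * (\<delta> * (LINT x|lborel. \<bar>pd \<phi>1 x i\<bar>)))" using In[of i] by linarith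
      then show ?thesis by (simp add: inner_diff_right algebra_simps)
    qed
    have "(\<Sum>i\<in>UNIV. h $ i * (y \<bullet> I i)) \<ge> (\<Sum>i\<in>UNIV. (r ^ CARD('n) * \<theta>) * (h $ i * (y \<bullet> A $ i)) - r ^ CARD('n) * (\<delta> * (LINT x|lborel. \<bar>pd \<phi>1 x i\<bar>)))"
      by (intro sum_mono t)
    moreover have "y \<bullet> row_map A h = (\<Sum>i\<in>UNIV. h $ i * (y \<bullet> A $ i))" by (simp add: row_map_def inner_sum_right)
    ultimately show ?thesis by (simp add: sum_subtractf C_def sum_distrib_left sum_distrib_right mult_ac)
  qed
  have "r ^ CARD('n) * (\<alpha> * \<theta> + \<beta> * a * ((y \<bullet> row_map A h) * \<theta> - \<delta> * C)) - \<beta> * k * m \<le> (LINT x|lebesgue. X x)"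
  proof -
    have "\<beta> * a * ((y \<bullet> row_map A h) * (r ^ CARD('n) * \<theta>) - r ^ CARD('n) * (\<delta> * C)) \<le> \<beta> * a * (\<Sum>i\<in>UNIV. h $ i * (y \<bullet> I i))"
      using \<beta> a0 low by (intro mult_left_mono) auto
    moreover have "\<beta> * k * (LINT x|lebesgue. indicator B x * \<bar>det (vmat x)\<bar>) \<le> \<beta> * k * m"
      using \<beta> k0 det_i(2) by (intro mult_left_mono) auto
    ultimately show ?thesis unfolding XI by (simp add: algebra_simps)
  qed
  then have "ennreal (r ^ CARD('n) * (\<alpha> * \<theta> + \<beta> * a * ((y \<bullet> row_map A h) * \<theta> - \<delta> * C)) - \<beta> * k * m) \<le> ennreal (LINT x|lebesgue. X x)"
    by (rule ennreal_leI)
  also have "\<dots> \<le> (\<integral>\<^sup>+x. ennreal (X x) \<partial>lebesgue)" by (rule ennreal_integral_le[OF Xi])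
  also have "\<dots> \<le> set_nn_integral lebesgue B (\<lambda>x. \<Phi> (Pdil u x))"
  proof (rule nn_integral_mono_AE, use tangent_bound[OF s] in eventually_elim)
    case (elim x)
    show ?case
    proof (cases "x \<in> B")
      case True
      then have xO: "x \<in> \<Omega>" and xQ: "x \<in> Q" using B\<Omega> BQ by auto
      obtain P where P: "P \<ge> 1" "Pdil u x = ennreal P" "P \<ge> a * onorm (row_map (vmat x)) - k * \<bar>det (vmat x)\<bar>"
        using elim xO by (auto simp: a_def k_def)
      define J where "J = \<bar>det (vmat x)\<bar>"
      define N where "N = onorm (row_map (vmat x))"
      have "y \<bullet> row_map (vmat x) h \<le> norm y * norm (row_map (vmat x) h)" by (rule norm_cauchy_schwarz)
      also have "\<dots> \<le> 1 * (N * norm h)" unfolding N_def using y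
        by (intro mult_mono onorm[OF bounded_linear_row_map]) auto
      also have "\<dots> \<le> N" using h onorm_pos_le[OF bounded_linear_row_map, of "vmat x"] by (simp add: N_def mult_left_le)
      finally have yN: "y \<bullet> row_map (vmat x) h \<le> N" .
      have "X x = \<phi> x * (\<alpha> + \<beta> * a * (y \<bullet> row_map (vmat x) h)) - \<beta> * k * J"
        using True xQ by (simp add: X_def J_def row_map_def vmat_def inner_sum_right sum_distrib_left algebra_simps)
      \<comment> \<open>In X the bump multiplies only the first part; since the Jacobian term is
        subtracted, weighting it as well can only increase the value.\<close>
      also have "\<dots> \<le> \<phi> x * (\<alpha> + \<beta> * a * N) - \<phi> x * (\<beta> * k * J)"
      proof -
        have "\<phi> x * (\<beta> * k * J) \<le> \<beta> * k * J" using b01 \<beta> k0 by (intro mult_left_le_one_le) (auto simp: \<phi>_def J_def)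
        moreover have "\<phi> x * (\<alpha> + \<beta> * a * (y \<bullet> row_map (vmat x) h)) \<le> \<phi> x * (\<alpha> + \<beta> * a * N)"
          using b01 yN \<beta> a0 by (intro mult_left_mono add_left_mono) (auto simp: \<phi>_def)
        ultimately show ?thesis by linarith
      qed
      also have "\<dots> = \<phi> x * (\<alpha> + \<beta> * (a * N - k * J))" by (simp add: algebra_simps)
      also have "\<dots> \<le> \<phi> x * (\<alpha> + \<beta> * P)"
        using b01 \<beta> P(3) by (intro mult_left_mono add_left_mono) (auto simp: \<phi>_def N_def J_def)
      finally have "ennreal (X x) \<le> ennreal (\<phi> x * (\<alpha> + \<beta> * P))" by (rule ennreal_leI)
      \<comment> \<open>The bump factor is dropped only after passing to the positive part, since
        \<alpha> + \<beta> P may be negative.\<close>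
      also have "\<dots> \<le> ennreal (max 0 (\<alpha> + \<beta> * P))"
        using b01[of "(1 / r) *\<^sub>R (x - x0)"] mult_left_le_one_le[of "max 0 (\<alpha> + \<beta> * P)" "\<phi> x"] mult_left_mono[of "\<alpha> + \<beta> * P" "max 0 (\<alpha> + \<beta> * P)" "\<phi> x"]
        by (intro ennreal_leI) (simp add: \<phi>_def)
      also have "\<dots> \<le> \<Phi> (ennreal P)" using minor[OF P(1)] by (simp add: max_def ennreal_neg)
      finally show ?thesis using True P(2) by simp
    next
      case False
      then have "X x = 0" using outB[OF False] by (simp add: X_def)
      then show ?thesis by simp
    qed
  qed
  finally show ?thesis by (simp add: a_def k_def B_def)
qed

end

section \<open>Choice of parameters and images of small cubes\<close>

lemma row_map_near_onorm:
  fixes A :: "real^'n^'n"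
  assumes "N < onorm (row_map A)" "0 \<le> N"
  obtains h y where "norm h \<le> 1" "norm y \<le> 1" "y \<bullet> row_map A h > N"
proof -
  interpret bounded_linear "row_map A" by (rule bounded_linear_row_map)
  have "\<exists>x. norm (row_map A x) > N * norm x"
    using onorm_le[of "row_map A" N] assms(1) by (meson not_le)
  then obtain x where x: "norm (row_map A x) > N * norm x" by blast
  have x0: "x \<noteq> 0" using x by (auto simp: zero)
  define h where "h = (1 / norm x) *\<^sub>R x"
  have h: "norm (row_map A h) > N" using x x0 by (simp add: h_def scale field_simps)
  show thesis
  proof
    show "norm h \<le> 1" using x0 by (simp add: h_def)
    show "norm (sgn (row_map A h)) \<le> 1" by (simp add: norm_sgn)
    have "sgn (row_map A h) \<bullet> row_map A h = norm (row_map A h)"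
      by (cases "row_map A h = 0") (simp_all add: sgn_div_norm power2_norm_eq_inner[symmetric] power2_eq_square)
    then show "sgn (row_map A h) \<bullet> row_map A h > N" using h by simp
  qed
qed

text \<open>The parameter \<open>s\<close> is the ratio of operator norm and determinant, where the tangent inequality for the dilatation
  is an equality, if the determinant is nonzero. If only the determinant vanishes, the term with \<open>s powr (1 + q)\<close> drops out
  and \<open>s\<close> is taken large.\<close>

lemma Pdil_lower_parameters:
  fixes f :: "real^'n \<Rightarrow> real^'n"
  assumes n2: "CARD('n) \<ge> 2" and Phi: "strictly_convex_Phi \<Phi>" and lc: "left_cont_at_T \<Phi>"
    and all: "has_all_partials f x" and c: "0 \<le> c" "ennreal c < \<Phi> (Pdil f x)" and q: "q = 1 / (real CARD('n) - 1)"
  obtains \<alpha> \<beta> s :: real and h y where "\<beta> \<ge> 0" "\<And>t::real. 1 \<le> t \<Longrightarrow> ennreal (\<alpha> + \<beta> * t) \<le> \<Phi> (ennreal t)"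
    "s \<ge> 0" "norm h \<le> 1" "norm y \<le> 1"
    "c < \<alpha> + \<beta> * ((1 + q) * s powr q) * (y \<bullet> row_map (pd_mat f x) h) - \<beta> * (q * s powr (1 + q)) * \<bar>det (pd_mat f x)\<bar>"
proof -
  define A where "A = pd_mat f x"
  have q0: "q > 0" using n2 by (simp add: q)
  obtain z where "ennreal c < z" "z < \<Phi> (Pdil f x)" using c(2) dense by blast
  then obtain c' where c': "c < c'" "ennreal c' < \<Phi> (Pdil f x)"
    by (cases z) (use c(1) in \<open>auto simp: ennreal_less_iff\<close>)
  have one: "(1 :: ennreal) = ennreal 1" by simp
  consider (inf) "Pdil f x = \<infinity>" | (zero) "det A = 0" "Pdil f x \<noteq> \<infinity>" | (pos) "det A \<noteq> 0" "Pdil f x \<noteq> \<infinity>" by blast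
  then show thesis
  proof cases
    case inf
    then have "outer_dil f x = \<infinity>" by (auto simp: Pdil_def split: if_splits)
    then have d: "det A = 0" "\<not> (\<forall>i. pd f x i = 0)"
      using all by (auto simp: outer_dil_def jac_eq_det_pd_mat A_def split: if_splits)
    then obtain i where i: "pd f x i \<noteq> 0" by blast
    define g where "g = norm (pd f x i)"
    have g: "g > 0" using i by (simp add: g_def)
    have rm: "row_map A (axis i 1) = pd f x i"
      by (simp add: row_map_def A_def pd_mat_def axis_def if_distrib[where f = "\<lambda>a. a *\<^sub>R _"] cong: if_cong)
    have yg: "sgn (pd f x i) \<bullet> row_map A (axis i 1) = g"
      using i by (simp add: rm g_def sgn_div_norm power2_norm_eq_inner[symmetric] power2_eq_square)
    obtain s0 where s0: "s0 \<ge> 1" "\<And>t::real. 1 \<le> t \<Longrightarrow> ennreal (1 * (t - s0)) \<le> \<Phi> (ennreal t)"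
      using Phi_superlinear[OF Phi, of 1] by (metis zero_less_one)
    \<comment> \<open>Chosen so that the gradient term equals c + \<open>s0\<close> + 1, which with
      the minorant t - \<open>s0\<close> of slope 1 leaves c + 1; the determinant is 0.\<close>
    define w where "w = (c + s0 + 1) / ((1 + q) * g)"
    have w: "w > 0" using c s0(1) q0 g by (simp add: w_def)
    define s where "s = w powr (1 / q)"
    have sq: "s powr q = w" using w q0 by (simp add: s_def powr_powr)
    show thesis
    proof (rule that[of 1 "- s0" s "axis i 1" "sgn (pd f x i)"])
      show "ennreal (- s0 + 1 * t) \<le> \<Phi> (ennreal t)" if "1 \<le> t" for t
        using s0(2)[OF that] by simp
      have "(1 + q) * w * g = c + s0 + 1" using q0 g by (simp add: w_def)
      then show "c < - s0 + 1 * ((1 + q) * s powr q) * (sgn (pd f x i) \<bullet> row_map (pd_mat f x) (axis i 1)) - 1 * (q * s powr (1 + q)) * \<bar>det (pd_mat f x)\<bar>"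
        using d(1) yg sq by (simp add: A_def)
    qed (auto simp: s_def norm_sgn)
  next
    case zero
    have "A = 0" by (rule Pdil_cases[OF n2 zero(2)]) (use zero(1) in \<open>auto simp: A_def\<close>)
    then have "pd f x i = 0" for i by (simp add: A_def pd_mat_def vec_eq_iff)
    then have P1: "Pdil f x = 1"
      using all zero(1) by (simp add: Pdil_def outer_dil_def jac_eq_det_pd_mat A_def)
    show thesis
    proof (rule that[of 0 c' 0 0 0])
      show "ennreal (c' + 0 * t) \<le> \<Phi> (ennreal t)" if "1 \<le> t" for t
        using strictly_convex_Phi_mono[OF Phi, of 1 "ennreal t"] c'(2) that unfolding P1 one by (simp add: ennreal_leI)
    qed (use c' in auto)
  next
    case pos
    define N where "N = onorm (row_map A)"
    define J where "J = \<bar>det A\<bar>"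
    have J: "J > 0" using pos(1) by (simp add: J_def)
    obtain P where P: "Pdil f x = ennreal P" "P \<ge> 1" "P = (N ^ CARD('n) / J) powr q"
      by (rule Pdil_cases[OF n2 pos(2)]) (use pos(1) in \<open>auto simp: A_def N_def J_def q\<close>)
    have N: "N > 0"
    proof (rule ccontr)
      assume "\<not> N > 0"
      then have "N = 0" using onorm_pos_le[OF bounded_linear_row_map, of A] by (simp add: N_def)
      then show False using P(2,3) by (simp add: power_0_left)
    qed
    define s where "s = N / J"
    have s: "s > 0" using N J by (simp add: s_def)
    \<comment> \<open>Both \<open>s powr q * N\<close> and \<open>s powr (1 + q) * J\<close> equal
      \<open>P\<close>, so the coefficients 1 + q and q of the tangent leave exactly
      \<open>P\<close>.\<close>
    have PN: "P = s powr q * N"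
    proof -
      have "real CARD('n) * q = 1 + q" using n2 by (simp add: q field_simps)
      then have "(N ^ CARD('n)) powr q = N powr (1 + q)" using N by (simp add: powr_powr flip: powr_realpow)
      moreover have "N powr (1 + q) = N powr q * N" using N by (simp add: powr_add)
      moreover have "P = (N ^ CARD('n)) powr q / J powr q" unfolding P(3) by (rule powr_divide)
      moreover have "s powr q = N powr q / J powr q" unfolding s_def by (rule powr_divide)
      ultimately show ?thesis by simp
    qed
    have sJ: "s powr (1 + q) * J = P" proof -
      have "s * J = N" using J by (simp add: s_def)
      moreover have "s powr (1 + q) * J = s powr q * (s * J)" 
        unfolding powr_add using s by simp
      ultimately show ?thesis by (simp only: PN)
    qed
    obtain \<alpha> \<beta> where ab: "\<beta> \<ge> 0" "\<And>t::real. 1 \<le> t \<Longrightarrow> ennreal (\<alpha> + \<beta> * t) \<le> \<Phi> (ennreal t)" "\<alpha> + \<beta> * P \<ge> c'"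
      by (rule Phi_minorant[OF Phi lc P(2), of c']) (use c' c(1) P(1) in auto)
    define a where "a = \<beta> * ((1 + q) * s powr q)"
    have a: "a \<ge> 0" using ab(1) q0 by (simp add: a_def)
    \<comment> \<open>Approximating the operator norm costs \<open>a * \<epsilon>\<close>, which
      must stay below the reserve c' - c; the cap \<open>N\<close> keeps
      \<open>N - \<epsilon>\<close> nonnegative.\<close>
    define \<epsilon> where "\<epsilon> = min N ((c' - c) / (a + 1))"
    have \<epsilon>: "\<epsilon> > 0" "a * \<epsilon> < c' - c" "\<epsilon> \<le> N"
    proof -
      show e: "\<epsilon> > 0" using N c' a by (simp add: \<epsilon>_def)
      have "(a + 1) * \<epsilon> \<le> (a + 1) * ((c' - c) / (a + 1))" using a by (intro mult_left_mono) (auto simp: \<epsilon>_def)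
      also have "\<dots> = c' - c" using a by simp
      finally have "(a + 1) * \<epsilon> \<le> c' - c" .
      then show "a * \<epsilon> < c' - c" using e by (simp add: algebra_simps)
    qed (simp add: \<epsilon>_def)
    obtain h y where hy: "norm h \<le> 1" "norm y \<le> 1" "y \<bullet> row_map A h > N - \<epsilon>"
      by (rule row_map_near_onorm[of "N - \<epsilon>" A]) (use \<epsilon> in \<open>auto simp: N_def\<close>)
    show thesis
    proof (rule that[of \<beta> \<alpha> s h y])
      have "a * (N - \<epsilon>) \<le> a * (y \<bullet> row_map A h)" using hy a by (intro mult_left_mono) auto
      moreover have "a * N = \<beta> * P + \<beta> * q * P" by (simp add: a_def PN algebra_simps)
      moreover have "\<beta> * (q * s powr (1 + q)) * J = \<beta> * q * P" by (simp flip: sJ)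
      moreover have "a * (N - \<epsilon>) = a * N - a * \<epsilon>" by (simp add: algebra_simps)
      ultimately have "c < \<alpha> + a * (y \<bullet> row_map A h) - \<beta> * (q * s powr (1 + q)) * J"
        using ab(3) \<epsilon>(2) by linarith
      then show "c < \<alpha> + \<beta> * ((1 + q) * s powr q) * (y \<bullet> row_map (pd_mat f x) h) - \<beta> * (q * s powr (1 + q)) * \<bar>det (pd_mat f x)\<bar>"
        by (simp add: a_def A_def J_def)
    qed (use ab hy s in auto)
  qed
qed

text \<open>After rescaling by 1/r the image of the cube lies in the \<delta>-neighbourhood of a
  fixed compact set S, the linear image of the cube of side 2. Outer regularity gives an open set
  around S of measure at most that of S plus e, so \<delta> depends on A and e alone. Singular A are
  included; S is then null.\<close>

lemma emeasure_near_linear_cube_image: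
  fixes A :: "real^'n^'n"
  assumes "e > 0"
  obtains \<delta> where "\<delta> > 0"
    "\<And>r x0 b u. r > 0 \<Longrightarrow> (\<And>x. x \<in> cbox (x0 - vec r) (x0 + vec r) \<Longrightarrow> norm (u x - (b + row_map A (x - x0))) \<le> \<delta> * r)
       \<Longrightarrow> emeasure lebesgue (u ` box (x0 - vec r) (x0 + vec r)) \<le> ennreal (r ^ CARD('n) * (\<bar>det A\<bar> * 2 ^ CARD('n) + e))"
proof -
  interpret bounded_linear "row_map A" by (rule bounded_linear_row_map)
  define S where "S = row_map A ` cbox (vec (-1)) (vec 1)"
  have cS: "compact S" unfolding S_def
    by (intro compact_continuous_image compact_cbox linear_continuous_on bounded_linear_row_map)
  have Sl: "S \<in> lmeasurable" by (rule lmeasurable_compact[OF cS])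
  have "measure lborel (cbox (vec (-1)) (vec 1) :: (real^'n) set) = (\<Prod>i\<in>(UNIV :: 'n set). 2)"
    by (subst content_cbox_cart) (auto simp: interval_ne_empty_cart)
  then have mc: "measure lebesgue (cbox (vec (-1)) (vec 1) :: (real^'n) set) = 2 ^ CARD('n)" by simp
  have mS: "measure lebesgue S = \<bar>det A\<bar> * 2 ^ CARD('n)"
    unfolding S_def by (subst measure_linear_image_finite(2)[OF linear lmeasurable_cbox]) (simp only: mc det_matrix_row_map)
  obtain T where T: "open T" "S \<subseteq> T" "T - S \<in> lmeasurable" "emeasure lebesgue (T - S) < ennreal e"
    by (rule sets_lebesgue_outer_open[OF fmeasurableD[OF Sl] assms])
  have eT: "emeasure lebesgue T \<le> ennreal (\<bar>det A\<bar> * 2 ^ CARD('n) + e)"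
  proof -
    have "emeasure lebesgue T = emeasure lebesgue S + emeasure lebesgue (T - S)"
      using T Sl by (subst plus_emeasure) (auto simp: Un_absorb1)
    also have "\<dots> \<le> ennreal (\<bar>det A\<bar> * 2 ^ CARD('n)) + ennreal e"
      using T(4) by (intro add_mono) (auto simp: emeasure_eq_measure2[OF Sl] mS)
    finally show ?thesis using assms by (simp add: ennreal_plus)
  qed
  obtain \<delta> where \<delta>: "\<delta> > 0" "(\<Union>x\<in>S. cball x \<delta>) \<subseteq> T"
    by (rule compact_subset_open_imp_cball_epsilon_subset[OF cS T(1,2)])
  show thesis
  proof (rule that[OF \<delta>(1)])
    fix r :: real and x0 b :: "real^'n" and u
    assume r: "r > 0" and near: "\<And>x. x \<in> cbox (x0 - vec r) (x0 + vec r) \<Longrightarrow> norm (u x - (b + row_map A (x - x0))) \<le> \<delta> * r"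
    have "u ` box (x0 - vec r) (x0 + vec r) \<subseteq> (\<lambda>t. r *\<^sub>R t + b) ` T"
    proof
      fix t assume "t \<in> u ` box (x0 - vec r) (x0 + vec r)"
      then obtain x where x: "t = u x" "x \<in> cbox (x0 - vec r) (x0 + vec r)" using box_subset_cbox by blast
      define z where "z = (1 / r) *\<^sub>R (x - x0)"
      have z: "z \<in> cbox (vec (-1)) (vec 1)"
      proof -
        have "- r \<le> x $ i - x0 $ i \<and> x $ i - x0 $ i \<le> r" for i using x(2) by (simp add: mem_box_cart) (metis add.commute diff_le_eq le_diff_eq uminus_add_conv_diff)
        then show ?thesis using r by (simp add: z_def mem_box_cart field_simps)
      qed
      define w where "w = (1 / r) *\<^sub>R (u x - b)"
      have wz: "r *\<^sub>R (w - row_map A z) = u x - (b + row_map A (x - x0))"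
      proof -
        have "row_map A z = (1 / r) *\<^sub>R row_map A (x - x0)" by (simp only: z_def scale)
        then show ?thesis using r by (simp add: w_def algebra_simps)
      qed
      have "r * norm (w - row_map A z) \<le> \<delta> * r"
        using near[OF x(2)] r unfolding wz[symmetric] by simp
      then have "dist (row_map A z) w \<le> \<delta>" using r by (simp add: dist_norm norm_minus_commute mult.commute)
      then have "w \<in> cball (row_map A z) \<delta>" by simp
      then have "w \<in> T" using \<delta>(2) z unfolding S_def by blast
      moreover have "t = r *\<^sub>R w + b" using r x(1) by (simp add: w_def)
      ultimately show "t \<in> (\<lambda>t. r *\<^sub>R t + b) ` T" by blast
    qed
    moreover have "(\<lambda>t. r *\<^sub>R t + b) ` T \<in> sets lebesgue"
      using open_affinity[OF T(1), of r b] r by (simp add: add.commute)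
    ultimately have "emeasure lebesgue (u ` box (x0 - vec r) (x0 + vec r)) \<le> emeasure lebesgue ((\<lambda>t. r *\<^sub>R t + b) ` T)"
      by (rule emeasure_mono)
    also have "\<dots> = ennreal (r ^ CARD('n)) * emeasure lebesgue T" using r by (simp add: emeasure_lebesgue_affine)
    also have "\<dots> \<le> ennreal (r ^ CARD('n)) * ennreal (\<bar>det A\<bar> * 2 ^ CARD('n) + e)" by (intro mult_left_mono eT) simp
    also have "\<dots> = ennreal (r ^ CARD('n) * (\<bar>det A\<bar> * 2 ^ CARD('n) + e))" using r assms by (simp add: ennreal_mult)
    finally show "emeasure lebesgue (u ` box (x0 - vec r) (x0 + vec r)) \<le> ennreal (r ^ CARD('n) * (\<bar>det A\<bar> * 2 ^ CARD('n) + e))" .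
  qed
qed

section \<open>Lower semicontinuity\<close>

lemma derivative_row_map:
  fixes f :: "real^'n \<Rightarrow> real^'m"
  assumes "(f has_derivative f') (at x)"
  shows "f' = row_map (pd_mat f x)"
proof
  fix h :: "real^'n"
  interpret bounded_linear f' using assms by (rule has_derivative_bounded_linear)
  have "f' h = f' (\<Sum>i\<in>UNIV. h $ i *\<^sub>R axis i 1)"
    using basis_expansion[of h] by (simp add: scalar_mult_eq_scaleR)
  also have "\<dots> = row_map (pd_mat f x) h"
    using has_derivative_pd(2)[OF assms] by (simp add: sum scale row_map_def pd_mat_def)
  finally show "f' h = row_map (pd_mat f x) h" .
qed

lemma norm_le_cube:
  fixes x x0 :: "real^'n"
  assumes "x \<in> cbox (x0 - vec r) (x0 + vec r)"
  shows "norm (x - x0) \<le> real CARD('n) * r"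
proof -
  have "norm (x - x0) \<le> (\<Sum>i\<in>UNIV. \<bar>(x - x0) $ i\<bar>)" by (rule norm_le_l1_cart)
  also have "\<dots> \<le> (\<Sum>i\<in>(UNIV :: 'n set). r)"
  proof (rule sum_mono)
    fix i
    have "x0 $ i - r \<le> x $ i \<and> x $ i \<le> x0 $ i + r" using assms by (simp add: mem_box_cart)
    then show "\<bar>(x - x0) $ i\<bar> \<le> r" by (simp add: abs_le_iff)
  qed
  finally show ?thesis by simp
qed

lemma integral_cube_bump_tendsto:
  "(\<lambda>m. LINT x|lborel. box_bump (vec (-1)) (vec 1) m (x :: real^'n)) \<longlonglongrightarrow> 2 ^ CARD('n)"
proof -
  let ?B = "box (vec (-1)) (vec 1) :: (real^'n) set"
  have e: "emeasure lborel ?B = ennreal (2 ^ CARD('n))" by (subst emeasure_lborel_box_cart) auto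
  have i: "integrable lborel (indicator ?B :: _ \<Rightarrow> real)" 
    using emeasure_lborel_box_finite[of "vec (-1) :: real^'n" "vec 1"] by (simp add: integrable_indicator_iff)
  have "(\<lambda>m. LINT x|lborel. box_bump (vec (-1)) (vec 1) m (x :: real^'n)) \<longlonglongrightarrow> (LINT x|lborel. indicator ?B x)"
  proof (rule integral_dominated_convergence[where w = "indicator ?B"])
    show "(\<lambda>x. box_bump (vec (-1)) (vec 1) m (x :: real^'n)) \<in> borel_measurable lborel" for m
      using test_fun_pd(1)[OF test_fun_box_bump[of "vec (-1) :: real^'n" "vec 1" UNIV]]
      by (auto simp: interval_ne_empty_cart intro: borel_measurable_continuous_onI)
    show "AE x in lborel. norm (box_bump (vec (-1)) (vec 1) m x) \<le> indicator ?B x" for m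
      by (intro AE_I2) (auto simp: indicator_def box_bump_outside box_bump_bounds)
  qed (use i in \<open>auto intro: box_bump_tendsto\<close>)
  moreover have "(LINT x|lborel. indicator ?B x :: real) = 2 ^ CARD('n)" using e by (simp add: measure_def flip: vec_1)
  ultimately show ?thesis by simp
qed

text \<open>The order of choices matters. The minorant, s, h and y are fixed by the derivative of
  the limit map; next comes a bump so close to the indicator of the cube that the strict inequality
  survives; only then the closeness to the affine map, because the admissible error depends on the
  derivatives of the bump.\<close>

lemma energy_lower_density:
  fixes f :: "real^'n \<Rightarrow> real^'n"
  assumes lc: "left_cont_at_T \<Phi>"
    and adm: "\<And>j. admissible_map \<Phi> \<Omega> (fs j) (v j) q"
    and unif: "\<And>K. compact K \<Longrightarrow> K \<subseteq> \<Omega> \<Longrightarrow> uniform_limit K fs f sequentially"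
    and x0: "x0 \<in> \<Omega>" and diff: "f differentiable (at x0)" and c: "0 \<le> c" "ennreal c < \<Phi> (Pdil f x0)"
  shows "\<exists>r0>0. \<forall>r. 0 < r \<and> r < r0 \<longrightarrow> (\<forall>\<^sub>F j in sequentially.
     ennreal (c * (2 * r) ^ CARD('n)) \<le> set_nn_integral lebesgue (box (x0 - vec r) (x0 + vec r)) (\<lambda>x. \<Phi> (Pdil (fs j) x)))"
proof -
  let ?n = "CARD('n)"
  note a = adm[of 0]
  note n2 = admissible_map.n2[OF a] and Phi = admissible_map.Phi[OF a] and q = admissible_map.q[OF a] and open_Omega = admissible_map.open_Omega[OF a]
  have q0: "q > 0" using n2 by (simp add: q)
  obtain f' where f': "(f has_derivative f') (at x0)" using diff by (auto simp: differentiable_def)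
  define A where "A = pd_mat f x0"
  have f'A: "f' = row_map A" unfolding A_def by (rule derivative_row_map[OF f'])
  have all: "has_all_partials f x0" using has_derivative_pd(1)[OF f'] by (simp add: has_all_partials_def)
  obtain \<alpha> \<beta> s :: real and h y where ab: "\<beta> \<ge> 0" "\<And>t::real. 1 \<le> t \<Longrightarrow> ennreal (\<alpha> + \<beta> * t) \<le> \<Phi> (ennreal t)"
    "s \<ge> 0" "norm h \<le> 1" "norm y \<le> 1"
    "c < \<alpha> + \<beta> * ((1 + q) * s powr q) * (y \<bullet> row_map A h) - \<beta> * (q * s powr (1 + q)) * \<bar>det A\<bar>"
    unfolding A_def by (rule Pdil_lower_parameters[OF n2 Phi lc all c q]) blast
  define B where "B = \<beta> * ((1 + q) * s powr q)"
  define k where "k = \<beta> * (q * s powr (1 + q))"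
  define g where "g = y \<bullet> row_map A h"
  define D where "D = \<bar>det A\<bar> * 2 ^ ?n"
  have B0: "B \<ge> 0" and k0: "k \<ge> 0" using ab(1) q0 by (auto simp: B_def k_def)
  define \<theta> where "\<theta> m = (LINT x|lborel. box_bump (vec (-1)) (vec 1) m (x :: real^'n))" for m
  have "(\<lambda>m. \<alpha> * \<theta> m + B * (g * \<theta> m) - k * D) \<longlonglongrightarrow> \<alpha> * 2 ^ ?n + B * (g * 2 ^ ?n) - k * D"
    unfolding \<theta>_def by (intro tendsto_intros integral_cube_bump_tendsto)
  moreover have "\<alpha> * 2 ^ ?n + B * (g * 2 ^ ?n) - k * D > c * 2 ^ ?n"
  proof -
    have "c * 2 ^ ?n < (\<alpha> + B * g - k * \<bar>det A\<bar>) * 2 ^ ?n"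
      using ab(6) by (intro mult_strict_right_mono) (auto simp: B_def g_def k_def)
    then show ?thesis by (simp add: D_def algebra_simps)
  qed
  ultimately have "\<forall>\<^sub>F m in sequentially. c * 2 ^ ?n < \<alpha> * \<theta> m + B * (g * \<theta> m) - k * D"
    by (rule order_tendstoD(1))
  then obtain m where m: "c * 2 ^ ?n < \<alpha> * \<theta> m + B * (g * \<theta> m) - k * D"
    by (auto simp: eventually_sequentially)
  define \<phi>1 where "\<phi>1 = (box_bump (vec (-1)) (vec 1) m :: real^'n \<Rightarrow> real)"
  define C where "C = (\<Sum>i\<in>UNIV. LINT x|lborel. \<bar>pd \<phi>1 x i\<bar>)"
  have C0: "C \<ge> 0" unfolding C_def by (intro sum_nonneg Bochner_Integration.integral_nonneg) auto
  define gap where "gap = \<alpha> * \<theta> m + B * (g * \<theta> m) - k * D - c * 2 ^ ?n"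
  have gap: "gap > 0" using m by (simp add: gap_def)
  \<comment> \<open>Half of the reserve pays for the excess area of the image and half for the error
    of the gradient term. The summands 1 in the denominators guard against vanishing
    coefficients.\<close>
  define e where "e = gap / (2 * (k + 1))"
  define \<delta>2 where "\<delta>2 = gap / (2 * (B * C + 1))"
  have BC: "B * C \<ge> 0" using B0 C0 by simp
  have e: "e > 0" "k * e \<le> gap / 2" using gap k0 by (auto simp: e_def field_simps)
  have \<delta>2: "\<delta>2 > 0" "B * C * \<delta>2 \<le> gap / 2"
  proof -
    show "\<delta>2 > 0" using gap BC by (simp add: \<delta>2_def)
    define Z where "Z = B * C"
    have "Z \<ge> 0" using BC by (simp add: Z_def)
    then have "Z * (gap / (2 * (Z + 1))) \<le> gap / 2" using gap by (simp add: field_simps)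
    then show "B * C * \<delta>2 \<le> gap / 2" by (simp add: \<delta>2_def Z_def)
  qed
  obtain \<delta>1 where \<delta>1: "\<delta>1 > 0"
    "\<And>r x0 b u. r > 0 \<Longrightarrow> (\<And>x. x \<in> cbox (x0 - vec r) (x0 + vec r) \<Longrightarrow> norm (u x - (b + row_map A (x - x0))) \<le> \<delta>1 * r)
       \<Longrightarrow> emeasure lebesgue (u ` box (x0 - vec r) (x0 + vec r)) \<le> ennreal (r ^ ?n * (D + e))"
    unfolding D_def by (rule emeasure_near_linear_cube_image[OF e(1), of A]) blast
  define \<delta> where "\<delta> = min \<delta>1 \<delta>2"
  have \<delta>: "\<delta> > 0" "\<delta> \<le> \<delta>1" "\<delta> \<le> \<delta>2" using \<delta>1(1) \<delta>2(1) by (auto simp: \<delta>_def)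
  have n0: "real ?n > 0" by simp
  \<comment> \<open>Differentiability contributes \<delta> r / 2 on the cube, whose points have
    distance at most n r from \<open>x0\<close>; uniform convergence contributes the other
    half.\<close>
  obtain d where d: "d > 0" "\<And>x. norm (x - x0) < d \<Longrightarrow> norm (f x - f x0 - row_map A (x - x0)) \<le> \<delta> / (2 * real ?n) * norm (x - x0)"
    using f' \<delta>(1) n0 unfolding has_derivative_at_alt f'A by (metis divide_pos_pos zero_less_mult_iff zero_less_numeral)
  obtain \<rho> where \<rho>: "\<rho> > 0" "ball x0 \<rho> \<subseteq> \<Omega>" using open_Omega x0 open_contains_ball by blast
  define r0 where "r0 = min d \<rho> / real ?n"
  show ?thesis
  proof (intro exI[of _ r0] conjI allI impI)
    show "r0 > 0" using d(1) \<rho>(1) n0 by (simp add: r0_def)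
    fix r assume r: "0 < r \<and> r < r0"
    define Q where "Q = cbox (x0 - vec r) (x0 + vec r)"
    have rd: "real ?n * r < d" "real ?n * r < \<rho>" using r n0 by (auto simp: r0_def field_simps)
    have Qs: "Q \<subseteq> \<Omega>"
    proof
      fix x assume "x \<in> Q"
      then have "norm (x - x0) < \<rho>" using norm_le_cube[of x x0 r] rd unfolding Q_def by linarith
      then show "x \<in> \<Omega>" using \<rho>(2) by (auto simp: dist_norm norm_minus_commute)
    qed
    have "\<forall>\<^sub>F j in sequentially. \<forall>x\<in>Q. dist (fs j x) (f x) < \<delta> * r / 2"
      by (rule uniform_limitD[OF unif[OF _ Qs]]) (use \<delta>(1) r in \<open>auto simp: Q_def\<close>)
    then show "\<forall>\<^sub>F j in sequentially. ennreal (c * (2 * r) ^ ?n) \<le> set_nn_integral lebesgue (box (x0 - vec r) (x0 + vec r)) (\<lambda>x. \<Phi> (Pdil (fs j) x))"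
    proof eventually_elim
      case (elim j)
      have near: "norm (fs j x - (f x0 + row_map A (x - x0))) \<le> \<delta> * r" if x: "x \<in> Q" for x
      proof -
        have n: "norm (x - x0) \<le> real ?n * r" using norm_le_cube[of x x0 r] x by (simp add: Q_def)
        have "norm (f x - f x0 - row_map A (x - x0)) \<le> \<delta> / (2 * real ?n) * norm (x - x0)"
          using n rd(1) by (intro d(2)) linarith
        also have "\<dots> \<le> \<delta> / (2 * real ?n) * (real ?n * r)" using n \<delta>(1) by (intro mult_left_mono) auto
        also have "\<dots> = \<delta> * r / 2" using n0 by simp
        finally have "norm (f x - f x0 - row_map A (x - x0)) \<le> \<delta> * r / 2" .
        moreover have "norm (fs j x - f x) \<le> \<delta> * r / 2" using elim x by (auto simp: dist_norm less_imp_le)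
        moreover have "fs j x - (f x0 + row_map A (x - x0)) = (fs j x - f x) + (f x - f x0 - row_map A (x - x0))" by simp
        ultimately show ?thesis using norm_triangle_ineq[of "fs j x - f x" "f x - f x0 - row_map A (x - x0)"]
          by (simp only:)
      qed
      let ?V = "box (x0 - vec r) (x0 + vec r)"
      note aj = adm[of j]
      have V: "?V \<subseteq> \<Omega>" using Qs box_subset_cbox by (auto simp: Q_def)
      have bor: "fs j ` ?V \<in> sets borel"
        by (rule area_le_open(1)[OF open_box V admissible_map.cu[OF aj] admissible_map.wp[OF aj] admissible_map.inj[OF aj]])
      have le1: "emeasure lebesgue (fs j ` ?V) \<le> ennreal (r ^ ?n * (D + e))"
      proof (rule \<delta>1(2))
        show "r > 0" using r by simp
        show "norm (fs j x - (f x0 + row_map A (x - x0))) \<le> \<delta>1 * r" if "x \<in> cbox (x0 - vec r) (x0 + vec r)" for x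
        proof -
          have "\<delta> * r \<le> \<delta>1 * r" using \<delta>(2) r by (intro mult_right_mono) auto
          then show ?thesis using near[of x] that unfolding Q_def by linarith
        qed
      qed
      have De: "D + e \<ge> 0" using e by (simp add: D_def)
      have rn: "r ^ ?n \<ge> 0" using r by simp
      have le: "emeasure lborel (fs j ` ?V) \<le> ennreal (r ^ ?n * (D + e))" using le1 bor by simp
      define \<mu> where "\<mu> = enn2real (emeasure lborel (fs j ` ?V))"
      have \<mu>: "emeasure lborel (fs j ` ?V) = ennreal \<mu>" "\<mu> \<ge> 0" "\<mu> \<le> r ^ ?n * (D + e)"
      proof -
        show "emeasure lborel (fs j ` ?V) = ennreal \<mu>" unfolding \<mu>_def
          using le by (intro ennreal_enn2real[symmetric]) (auto intro: le_less_trans)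
        then show "\<mu> \<le> r ^ ?n * (D + e)" using le De rn by (simp add: ennreal_le_iff)
      qed (simp add: \<mu>_def)
      have ne: "box (vec (-1)) (vec 1 :: real^'n) \<noteq> {}" by (simp add: interval_ne_empty_cart)
      have "ennreal (r ^ ?n * (\<alpha> * \<theta> m + B * (g * \<theta> m - \<delta> * C)) - k * \<mu>)
         \<le> set_nn_integral lebesgue ?V (\<lambda>x. \<Phi> (Pdil (fs j) x))"
        unfolding B_def k_def g_def \<theta>_def C_def \<phi>1_def
        by (rule admissible_map.local_lower_bound[OF aj test_fun_box_bump[OF ne] box_bump_support box_bump_outside box_bump_bounds, where b = "f x0" and A = A and m = \<mu>, folded \<phi>1_def])
           (use r Qs near ab \<mu> in \<open>auto simp: Q_def\<close>)
      moreover have "c * (2 * r) ^ ?n \<le> r ^ ?n * (\<alpha> * \<theta> m + B * (g * \<theta> m - \<delta> * C)) - k * \<mu>"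
      proof -
        have "B * C * \<delta> \<le> gap / 2" using \<delta>2(2) \<delta>(3) BC mult_left_mono[of \<delta> \<delta>2 "B * C"] by linarith
        then have "c * 2 ^ ?n \<le> \<alpha> * \<theta> m + B * (g * \<theta> m - \<delta> * C) - k * (D + e)"
          using e(2) by (simp add: gap_def algebra_simps)
        then have "r ^ ?n * (c * 2 ^ ?n) \<le> r ^ ?n * (\<alpha> * \<theta> m + B * (g * \<theta> m - \<delta> * C) - k * (D + e))"
          using rn by (rule mult_left_mono)
        moreover have "k * \<mu> \<le> k * (r ^ ?n * (D + e))" using \<mu>(3) k0 by (rule mult_left_mono)
        ultimately show ?thesis by (simp add: power_mult_distrib algebra_simps)
      qed
      ultimately show ?case by (meson ennreal_leI order_trans)
    qed
  qed
qed

text \<open>Averaging over translated cubes preserves the total integral: by Tonelli the kernel is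
  integrated in the other variable, where it has mass 1 as well.\<close>

lemma nn_integral_cube_kernel:
  fixes F :: "real^'n \<Rightarrow> ennreal"
  assumes [measurable]: "F \<in> borel_measurable borel" and r: "r > 0"
  defines "H \<equiv> \<lambda>x. ennreal (1 / (2 * r) ^ CARD('n)) * (\<integral>\<^sup>+y. indicator (box (vec (-r)) (vec r)) (y - x) * F y \<partial>lborel)"
  shows "H \<in> borel_measurable borel" "(\<integral>\<^sup>+x. H x \<partial>lborel) = (\<integral>\<^sup>+y. F y \<partial>lborel)"
proof -
  let ?B = "box (vec (-r)) (vec r) :: (real^'n) set"
  have [measurable]: "?B \<in> sets borel" by simp
  have [measurable]: "(\<lambda>(x, y). indicator ?B (y - x) * F y) \<in> borel_measurable (lborel \<Otimes>\<^sub>M lborel)"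
    by measurable
  show "H \<in> borel_measurable borel" unfolding H_def by measurable
  have k: "(\<integral>\<^sup>+x. indicator ?B (y - x) \<partial>lborel) = ennreal ((2 * r) ^ CARD('n))" for y
  proof -
    have "(\<integral>\<^sup>+x. indicator ?B (y - x) \<partial>lborel) = (\<integral>\<^sup>+x. indicator (box (y - vec r) (y + vec r)) x \<partial>lborel)"
    proof (rule nn_integral_cong)
      fix x
      have "y - x \<in> ?B \<longleftrightarrow> x \<in> box (y - vec r) (y + vec r)"
        unfolding mem_box_cart by (rule iff_allI) (auto simp: algebra_simps)
      then show "indicator ?B (y - x) = indicator (box (y - vec r) (y + vec r)) x" by (simp add: indicator_def)
    qed
    also have "\<dots> = ennreal ((2 * r) ^ CARD('n))" using r by (simp add: emeasure_lborel_box_cart)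
    finally show ?thesis .
  qed
  have "(\<integral>\<^sup>+x. H x \<partial>lborel) = ennreal (1 / (2 * r) ^ CARD('n)) * (\<integral>\<^sup>+x. \<integral>\<^sup>+y. indicator ?B (y - x) * F y \<partial>lborel \<partial>lborel)"
    unfolding H_def by (rule nn_integral_cmult) measurable
  also have "(\<integral>\<^sup>+x. \<integral>\<^sup>+y. indicator ?B (y - x) * F y \<partial>lborel \<partial>lborel) = (\<integral>\<^sup>+y. \<integral>\<^sup>+x. indicator ?B (y - x) * F y \<partial>lborel \<partial>lborel)"
    by (rule lborel_pair.Fubini'[symmetric]) measurable
  also have "\<dots> = (\<integral>\<^sup>+y. ennreal ((2 * r) ^ CARD('n)) * F y \<partial>lborel)"
    by (intro nn_integral_cong) (simp add: nn_integral_multc k)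
  also have "\<dots> = ennreal ((2 * r) ^ CARD('n)) * (\<integral>\<^sup>+y. F y \<partial>lborel)" by (rule nn_integral_cmult) measurable
  finally show "(\<integral>\<^sup>+x. H x \<partial>lborel) = (\<integral>\<^sup>+y. F y \<partial>lborel)"
    using r by (simp add: mult.assoc[symmetric] ennreal_mult[symmetric])
qed

text \<open>Cube averages of the energy density of \<open>fs j\<close> keep the total energy, and
  their iterated lower limit dominates \<open>\<Phi>\<close> of the dilatation of the limit map at
  every point of differentiability. Fatou's lemma for both limits gives the claim, in place of a
  covering argument.\<close>

lemma lower_semicontinuity_admissible:
  fixes f :: "real^'n \<Rightarrow> real^'n"
  assumes lc: "left_cont_at_T \<Phi>"
    and adm: "\<And>j. admissible_map \<Phi> \<Omega> (fs j) (v j) q"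
    and unif: "\<And>K. compact K \<Longrightarrow> K \<subseteq> \<Omega> \<Longrightarrow> uniform_limit K fs f sequentially"
    and diff: "AE x in lebesgue. x \<in> \<Omega> \<longrightarrow> f differentiable (at x)"
  shows "set_nn_integral lebesgue \<Omega> (\<lambda>x. \<Phi> (Pdil f x)) \<le> liminf (\<lambda>j. set_nn_integral lebesgue \<Omega> (\<lambda>x. \<Phi> (Pdil (fs j) x)))"
proof -
  let ?n = "CARD('n)"
  note a = adm[of 0]
  note n2 = admissible_map.n2[OF a] and Phi = admissible_map.Phi[OF a] and open_Omega = admissible_map.open_Omega[OF a]
  define F where "F j x = \<Phi> (Pdil (fs j) x) * indicator \<Omega> x" for j x
  have Fm: "F j \<in> borel_measurable borel" for j
    unfolding F_def by (rule measurable_Phi_Pdil[OF n2 Phi open_Omega admissible_map.cu[OF adm]])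
  define r where "r m = inverse (real (Suc m))" for m
  have r: "r m > 0" for m by (simp add: r_def)
  have r_lim: "r \<longlonglongrightarrow> 0" unfolding r_def by (rule LIMSEQ_inverse_real_of_nat)
  define H where "H m j x = ennreal (1 / (2 * r m) ^ ?n) * (\<integral>\<^sup>+y. indicator (box (vec (- r m)) (vec (r m))) (y - x) * F j y \<partial>lborel)" for m j and x :: "real^'n"
  have Hm: "H m j \<in> borel_measurable borel" and Hi: "(\<integral>\<^sup>+x. H m j x \<partial>lborel) = (\<integral>\<^sup>+y. F j y \<partial>lborel)" for m j
    unfolding H_def by (rule nn_integral_cube_kernel[OF Fm r])+
  have point: "\<Phi> (Pdil f x) \<le> liminf (\<lambda>m. liminf (\<lambda>j. H m j x))" if x: "x \<in> \<Omega>" "f differentiable (at x)" for x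
  proof (rule dense_le)
    fix z assume z: "z < \<Phi> (Pdil f x)"
    then obtain c where c: "c \<ge> 0" "z = ennreal c" by (cases z) auto
    obtain r0 where r0: "r0 > 0" "\<And>r. 0 < r \<Longrightarrow> r < r0 \<Longrightarrow> (\<forall>\<^sub>F j in sequentially.
     ennreal (c * (2 * r) ^ ?n) \<le> set_nn_integral lebesgue (box (x - vec r) (x + vec r)) (\<lambda>x. \<Phi> (Pdil (fs j) x)))"
      using energy_lower_density[OF lc adm unif x c(1) z[unfolded c(2)]] by blast
    obtain \<rho> where \<rho>: "\<rho> > 0" "ball x \<rho> \<subseteq> \<Omega>" using open_Omega x(1) open_contains_ball by blast
    \<comment> \<open>The bound \<rho>/n keeps the cube inside \<Omega>, since its points have
      distance at most n r from x.\<close>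
    define r1 where "r1 = min r0 (\<rho> / real ?n)"
    have "r1 > 0" using r0(1) \<rho>(1) by (simp add: r1_def)
    then have "\<forall>\<^sub>F m in sequentially. r m < r1" using order_tendstoD(2)[OF r_lim] by blast
    then have "\<forall>\<^sub>F m in sequentially. z \<le> liminf (\<lambda>j. H m j x)"
    proof eventually_elim
      case (elim m)
      let ?V = "box (x - vec (r m)) (x + vec (r m))"
      have V: "y \<in> \<Omega>" if y: "y \<in> ?V" for y
      proof -
        have "norm (y - x) \<le> real ?n * r m" using norm_le_cube[of y x "r m"] y box_subset_cbox by blast
        also have "\<dots> < \<rho>" using elim by (simp add: r1_def field_simps)
        finally show ?thesis using \<rho>(2) by (auto simp: dist_norm norm_minus_commute)
      qed
      have eq: "H m j x = ennreal (1 / (2 * r m) ^ ?n) * set_nn_integral lebesgue ?V (\<lambda>x. \<Phi> (Pdil (fs j) x))" for j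
      proof -
        have "(\<integral>\<^sup>+y. indicator (box (vec (- r m)) (vec (r m))) (y - x) * F j y \<partial>lborel) = (\<integral>\<^sup>+y. \<Phi> (Pdil (fs j) y) * indicator ?V y \<partial>lborel)"
        proof (rule nn_integral_cong)
          fix y
          have "y - x \<in> box (vec (- r m)) (vec (r m)) \<longleftrightarrow> y \<in> ?V"
            unfolding mem_box_cart by (rule iff_allI) (auto simp: algebra_simps)
          then show "indicator (box (vec (- r m)) (vec (r m))) (y - x) * F j y = \<Phi> (Pdil (fs j) y) * indicator ?V y"
            using V by (auto simp: F_def indicator_def)
        qed
        then show ?thesis by (simp add: H_def nn_integral_completion)
      qed
      have "\<forall>\<^sub>F j in sequentially. z \<le> H m j x"
      proof -
        have "r m < r0" using elim by (simp add: r1_def)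
        from r0(2)[OF r this] show ?thesis
        proof eventually_elim
          case le: (elim j)
        have "z = ennreal (1 / (2 * r m) ^ ?n) * ennreal (c * (2 * r m) ^ ?n)"
          using r[of m] c by (simp add: ennreal_mult[symmetric])
        also have "\<dots> \<le> H m j x" unfolding eq using le by (intro mult_left_mono) auto
        finally show "z \<le> H m j x" .
        qed
      qed
      then show ?case by (rule Liminf_bounded)
    qed
    then show "z \<le> liminf (\<lambda>m. liminf (\<lambda>j. H m j x))" by (rule Liminf_bounded)
  qed
  have "set_nn_integral lebesgue \<Omega> (\<lambda>x. \<Phi> (Pdil f x)) \<le> (\<integral>\<^sup>+x. liminf (\<lambda>m. liminf (\<lambda>j. H m j x)) \<partial>lebesgue)"
    by (rule nn_integral_mono_AE, use diff in eventually_elim) (auto simp: point split: split_indicator)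
  also have "\<dots> = (\<integral>\<^sup>+x. liminf (\<lambda>m. liminf (\<lambda>j. H m j x)) \<partial>lborel)" by (rule nn_integral_completion)
  also have "\<dots> \<le> liminf (\<lambda>m. \<integral>\<^sup>+x. liminf (\<lambda>j. H m j x) \<partial>lborel)"
    by (rule nn_integral_liminf) (use Hm in measurable)
  also have "\<dots> \<le> liminf (\<lambda>m::nat. liminf (\<lambda>j. \<integral>\<^sup>+y. F j y \<partial>lborel))"
  proof (intro Liminf_mono always_eventually allI)
    fix m
    have "(\<integral>\<^sup>+x. liminf (\<lambda>j. H m j x) \<partial>lborel) \<le> liminf (\<lambda>j. \<integral>\<^sup>+x. H m j x \<partial>lborel)"
      by (rule nn_integral_liminf) (use Hm in measurable)
    then show "(\<integral>\<^sup>+x. liminf (\<lambda>j. H m j x) \<partial>lborel) \<le> liminf (\<lambda>j. \<integral>\<^sup>+y. F j y \<partial>lborel)" by (simp add: Hi)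
  qed
  also have "\<dots> = liminf (\<lambda>j. set_nn_integral lebesgue \<Omega> (\<lambda>x. \<Phi> (Pdil (fs j) x)))"
    by (simp add: Liminf_const F_def nn_integral_completion)
  finally show ?thesis by simp
qed

section \<open>Weak convergence against bounded functions\<close>

text \<open>The multipliers tend to 0 in L^1 by dominated convergence. The set where a multiplier is
  at least \<eta> is small by Chebyshev's inequality, so equi-integrability applies there; elsewhere
  the uniform L^1 bound does. All bounds are independent of i.\<close>

lemma equi_int_vanishing_multiplier:
  fixes h :: "'i \<Rightarrow> real^'n \<Rightarrow> 'b::euclidean_space"
  assumes ei: "equi_int lborel h" and hm: "\<And>i. h i \<in> borel_measurable borel"
    and \<psi>m: "\<And>m. \<psi> m \<in> borel_measurable borel" and le: "\<And>m x. \<bar>\<psi> m x\<bar> \<le> indicator (box a b) x"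
    and lim: "\<And>x. (\<lambda>m. \<psi> m x) \<longlonglongrightarrow> 0" and e: "e > 0"
  shows "\<forall>\<^sub>F m in sequentially. \<forall>i. norm (LINT x|lborel. \<psi> m x *\<^sub>R h i x) \<le> e"
proof -
  note [measurable] = hm \<psi>m
  obtain C where C: "C \<ge> 0" "\<And>i. (\<integral>\<^sup>+x. norm (h i x) \<partial>lborel) \<le> ennreal C" by (rule equi_int_bound[OF ei]) blast
  define \<eta> where "\<eta> = e / (2 * (C + 1))"
  have \<eta>: "\<eta> > 0" "\<eta> * C \<le> e / 2" using e C(1) by (auto simp: \<eta>_def field_simps)
  obtain d where d: "d > 0" "\<And>i A. A \<in> sets lborel \<Longrightarrow> emeasure lborel A < ennreal d \<Longrightarrow> (\<integral>\<^sup>+x\<in>A. norm (h i x) \<partial>lborel) \<le> ennreal (e / 2)"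
    by (rule equi_int_small[OF ei, of "e / 2"]) (use e in auto)
  have fin: "integrable lborel (indicator (box a b) :: _ \<Rightarrow> real)"
    using emeasure_lborel_box_finite[of a b] by (simp add: integrable_indicator_iff)
  have "(\<lambda>m. LINT x|lborel. \<bar>\<psi> m x\<bar>) \<longlonglongrightarrow> (LINT x|(lborel :: (real^'n) measure). 0)"
    by (rule integral_dominated_convergence[where w = "indicator (box a b) :: _ \<Rightarrow> real"])
      (use fin le tendsto_rabs_zero[OF lim] in auto)
  then have "\<forall>\<^sub>F m in sequentially. (LINT x|lborel. \<bar>\<psi> m x\<bar>) < \<eta> * d"
    using \<eta>(1) d(1) by (intro order_tendstoD(2)[of _ 0]) auto
  then show ?thesis
  proof (eventually_elim, intro allI)
    fix m i
    assume small: "(LINT x|lborel. \<bar>\<psi> m x\<bar>) < \<eta> * d"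
    have \<psi>i: "integrable lborel (\<psi> m)" by (rule Bochner_Integration.integrable_bound[OF fin]) (use le in auto)
    define A where "A = {x. \<bar>\<psi> m x\<bar> \<ge> \<eta>}"
    have [measurable]: "A \<in> sets borel" unfolding A_def by measurable
    have "ennreal \<eta> * emeasure lborel A = (\<integral>\<^sup>+x. ennreal \<eta> * indicator A x \<partial>lborel)" by (simp add: nn_integral_cmult_indicator)
    also have "\<dots> \<le> (\<integral>\<^sup>+x. ennreal \<bar>\<psi> m x\<bar> \<partial>lborel)"
      by (intro nn_integral_mono) (auto simp: A_def indicator_def ennreal_leI)
    also have "\<dots> = ennreal (LINT x|lborel. \<bar>\<psi> m x\<bar>)" by (intro nn_integral_eq_integral) (use \<psi>i in auto)
    also have "\<dots> < ennreal (\<eta> * d)" using small \<eta>(1) d(1) by (simp add: ennreal_less_iff)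
    also have "\<dots> = ennreal \<eta> * ennreal d" using \<eta>(1) d(1) by (simp add: ennreal_mult)
    finally have "emeasure lborel A < ennreal d"
      by (meson leD leI mult_left_mono zero_le)
    then have sm: "(\<integral>\<^sup>+x\<in>A. norm (h i x) \<partial>lborel) \<le> ennreal (e / 2)" by (intro d(2)) auto
    have one: "\<bar>\<psi> m x\<bar> \<le> 1" for x using le[of m x] by (cases "x \<in> box a b") auto
    have hi: "integrable lborel (h i)" by (rule integrable_if_equi_int[OF ei]) simp
    have int: "integrable lborel (\<lambda>x. \<psi> m x *\<^sub>R h i x)"
      by (rule Bochner_Integration.integrable_bound[OF hi]) (use one in \<open>auto intro!: mult_left_le_one_le\<close>)
    have "ennreal (norm (LINT x|lborel. \<psi> m x *\<^sub>R h i x)) \<le> (\<integral>\<^sup>+x. norm (\<psi> m x *\<^sub>R h i x) \<partial>lborel)"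
      by (rule integral_norm_bound_ennreal[OF int])
    also have "\<dots> \<le> (\<integral>\<^sup>+x. ennreal \<eta> * ennreal (norm (h i x)) + ennreal (norm (h i x)) * indicator A x \<partial>lborel)"
    proof (rule nn_integral_mono)
      fix x
      show "ennreal (norm (\<psi> m x *\<^sub>R h i x)) \<le> ennreal \<eta> * ennreal (norm (h i x)) + ennreal (norm (h i x)) * indicator A x"
      proof (cases "x \<in> A")
        case True
        have "ennreal (norm (\<psi> m x *\<^sub>R h i x)) \<le> ennreal (norm (h i x))"
          using one[of x] by (intro ennreal_leI) (simp add: mult_left_le_one_le)
        then show ?thesis using True by (simp add: add_increasing)
      next
        case False
        then have "ennreal (norm (\<psi> m x *\<^sub>R h i x)) \<le> ennreal (\<eta> * norm (h i x))"
          by (intro ennreal_leI) (simp add: A_def mult_right_mono)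
        then show ?thesis using False \<eta>(1) by (simp add: ennreal_mult)
      qed
    qed
    also have "\<dots> = ennreal \<eta> * (\<integral>\<^sup>+x. norm (h i x) \<partial>lborel) + (\<integral>\<^sup>+x\<in>A. norm (h i x) \<partial>lborel)"
      by (simp add: nn_integral_add nn_integral_cmult)
    also have "\<dots> \<le> ennreal \<eta> * ennreal C + ennreal (e / 2)" by (intro add_mono mult_left_mono C(2) sm) auto
    also have "\<dots> = ennreal (\<eta> * C + e / 2)" using \<eta>(1) C(1) e by (simp add: ennreal_mult ennreal_plus)
    also have "\<dots> \<le> ennreal e" using \<eta>(2) by (intro ennreal_leI) simp
    finally show "norm (LINT x|lborel. \<psi> m x *\<^sub>R h i x) \<le> e" using e by (simp add: ennreal_le_iff)
  qed
qed

lemma tendsto_by_uniform_approximation: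
  fixes b :: "nat \<Rightarrow> 'b::real_normed_vector"
  assumes lim: "\<And>m. (\<lambda>j. a m j) \<longlonglongrightarrow> L m"
    and ab: "\<And>e. e > 0 \<Longrightarrow> \<forall>\<^sub>F m in sequentially. \<forall>j. norm (a m j - b j) \<le> e"
    and LL: "\<And>e. e > 0 \<Longrightarrow> \<forall>\<^sub>F m in sequentially. norm (L m - L') \<le> e"
  shows "b \<longlonglongrightarrow> L'"
proof (rule tendstoI)
  fix e :: real assume e: "e > 0"
  have "\<forall>\<^sub>F m in sequentially. (\<forall>j. norm (a m j - b j) \<le> e / 4) \<and> norm (L m - L') \<le> e / 4"
    using e by (intro eventually_conj ab LL) auto
  then obtain m where m: "\<And>j. norm (a m j - b j) \<le> e / 4" "norm (L m - L') \<le> e / 4"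
    by (auto simp: eventually_sequentially)
  have "\<forall>\<^sub>F j in sequentially. dist (a m j) (L m) < e / 4" using lim[of m] e by (intro tendstoD) auto
  then show "\<forall>\<^sub>F j in sequentially. dist (b j) L' < e"
  proof eventually_elim
    case (elim j)
    have "dist (b j) L' \<le> dist (b j) (a m j) + dist (a m j) (L m) + dist (L m) L'"
      using dist_triangle[of "b j" L' "a m j"] dist_triangle[of "a m j" L' "L m"] by linarith
    moreover have "dist (b j) (a m j) \<le> e / 4" "dist (L m) L' \<le> e / 4"
      using m by (auto simp: dist_norm norm_minus_commute)
    ultimately show ?case using elim e by linarith
  qed
qed

text \<open>The device for enlarging the class of multipliers: if convergence holds for every g m,
  and the g m tend pointwise to k with differences bounded by the indicator of one box, then
  equi-integrability makes the approximation uniform in j and the limits may be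
  interchanged.\<close>

lemma tendsto_integral_vanishing_multiplier:
  fixes w :: "nat \<Rightarrow> real^'n \<Rightarrow> 'b::euclidean_space"
  assumes ei: "equi_int lborel w" and wm: "\<And>j. w j \<in> borel_measurable borel" and w': "integrable lborel w'"
    and gm: "\<And>m. g m \<in> borel_measurable borel" and km: "k \<in> borel_measurable borel"
    and bd: "\<And>x. \<bar>k x\<bar> \<le> B" and le: "\<And>m x. \<bar>g m x - k x\<bar> \<le> indicator (box a b) x"
    and lim: "\<And>x. (\<lambda>m. g m x) \<longlonglongrightarrow> k x"
    and conv: "\<And>m. (\<lambda>j. LINT x|lborel. g m x *\<^sub>R w j x) \<longlonglongrightarrow> (LINT x|lborel. g m x *\<^sub>R w' x)"
  shows "(\<lambda>j. LINT x|lborel. k x *\<^sub>R w j x) \<longlonglongrightarrow> (LINT x|lborel. k x *\<^sub>R w' x)"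
proof (rule tendsto_by_uniform_approximation[OF conv])
  note [measurable] = gm km
  have bk: "integrable lborel (\<lambda>x. k x *\<^sub>R z x)" if "integrable lborel z" for z :: "real^'n \<Rightarrow> 'b"
  proof (rule Bochner_Integration.integrable_bound[OF integrable_scaleR_right[OF that, of B]])
    show "AE x in lborel. norm (k x *\<^sub>R z x) \<le> norm (B *\<^sub>R z x)"
      using bd by (intro AE_I2) (auto intro!: mult_right_mono intro: order_trans[OF bd])
  qed (use that in measurable)
  have bg: "integrable lborel (\<lambda>x. g m x *\<^sub>R z x)" if "integrable lborel z" for z :: "real^'n \<Rightarrow> 'b" and m
  proof (rule Bochner_Integration.integrable_bound[OF integrable_scaleR_right[OF that, of "B + 1"]])
    show "AE x in lborel. norm (g m x *\<^sub>R z x) \<le> norm ((B + 1) *\<^sub>R z x)"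
    proof (rule AE_I2)
      fix x
      have "\<bar>g m x - k x\<bar> \<le> 1" using le[of m x] by (cases "x \<in> box a b") auto
      then have "\<bar>g m x\<bar> \<le> \<bar>B + 1\<bar>" using bd[of x] by linarith
      then show "norm (g m x *\<^sub>R z x) \<le> norm ((B + 1) *\<^sub>R z x)" by (simp add: mult_right_mono)
    qed
  qed (use that in measurable)
  have diff: "(LINT x|lborel. g m x *\<^sub>R z x) - (LINT x|lborel. k x *\<^sub>R z x) = (LINT x|lborel. (g m x - k x) *\<^sub>R z x)"
    if "integrable lborel z" for z :: "real^'n \<Rightarrow> 'b" and m
    using bg[OF that] bk[OF that] by (simp add: scaleR_diff_left)
  have l0: "(\<lambda>m. g m x - k x) \<longlonglongrightarrow> 0" for x using lim by (simp add: LIM_zero_iff)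
  fix e :: real assume e: "e > 0"
  have wi: "integrable lborel (w j)" for j by (rule integrable_if_equi_int[OF ei]) (simp add: wm)
  show "\<forall>\<^sub>F m in sequentially. \<forall>j. norm ((LINT x|lborel. g m x *\<^sub>R w j x) - (LINT x|lborel. k x *\<^sub>R w j x)) \<le> e"
    unfolding diff[OF wi]
    by (rule equi_int_vanishing_multiplier[OF ei wm _ le l0 e]) simp
  have "\<forall>\<^sub>F m in sequentially. \<forall>i::unit. norm (LINT x|lborel. (g m x - k x) *\<^sub>R w' x) \<le> e"
    by (rule equi_int_vanishing_multiplier[OF equi_int_single[OF w'] _ _ le l0 e]) (use w' in auto)
  then show "\<forall>\<^sub>F m in sequentially. norm ((LINT x|lborel. g m x *\<^sub>R w' x) - (LINT x|lborel. k x *\<^sub>R w' x)) \<le> e"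
    unfolding diff[OF w'] by simp
qed

text \<open>For a bump the derivative moves to the test function, and dominated convergence applies
  to the uniformly bounded maps. The bumps of a box then approximate its indicator.\<close>

lemma tendsto_integral_box:
  fixes us :: "nat \<Rightarrow> real^'n \<Rightarrow> 'b::euclidean_space"
  assumes ws: "\<And>j. w11_local (us j) (w j) K" and w': "w11_local u w' K"
    and ei: "equi_int lborel (\<lambda>j. w j i)"
    and lim: "\<And>x. x \<in> K \<Longrightarrow> (\<lambda>j. us j x) \<longlonglongrightarrow> u x" and bd: "\<And>j x. x \<in> K \<Longrightarrow> norm (us j x) \<le> R"
    and sub: "cbox a b \<subseteq> K"
  shows "(\<lambda>j. LINT x|lborel. indicator (box a b) x *\<^sub>R w j i x) \<longlonglongrightarrow> (LINT x|lborel. indicator (box a b) x *\<^sub>R w' i x)"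
proof (cases "box a b = {}")
  case False
  have bm: "box_bump a b m \<in> borel_measurable borel" for m
    using test_fun_pd(1)[OF test_fun_box_bump[OF False, of UNIV]] by (auto intro: borel_measurable_continuous_onI)
  have wm: "w j i \<in> borel_measurable borel" for j using w11_local.intw[OF ws] by auto
  show ?thesis
  proof (rule tendsto_integral_vanishing_multiplier[OF ei wm w11_local.intw[OF w'], where g = "box_bump a b" and a = a and b = b and B = 1])
    show "\<bar>box_bump a b m x - indicator (box a b) x\<bar> \<le> indicator (box a b) x" for m x
      using box_bump_bounds[of a b m x] by (auto simp: indicator_def box_bump_outside)
    show "(\<lambda>m. box_bump a b m x) \<longlonglongrightarrow> indicator (box a b) x" for x by (rule box_bump_tendsto)
    fix m
    have tf: "test_fun UNIV (box_bump a b m)" by (rule test_fun_box_bump[OF False]) simp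
    have pm: "(\<lambda>x. pd (box_bump a b m) x i) \<in> borel_measurable borel"
      using test_fun_pd(2)[OF tf] by (auto intro: borel_measurable_continuous_onI)
    have pi: "integrable lborel (\<lambda>x. \<bar>pd (box_bump a b m) x i\<bar>)"
      using test_fun_integrable(2)[OF tf, of "\<lambda>_. 1 :: real" i] by simp
    have um: "(\<lambda>x. indicator K x *\<^sub>R z x) \<in> borel_measurable borel" if "continuous_on K z" for z :: "real^'n \<Rightarrow> 'b"
      using borel_integrable_compact[OF w11_local.compactK[OF w'] that] by auto
    have "(\<lambda>j. LINT x|lborel. pd (box_bump a b m) x i *\<^sub>R (indicator K x *\<^sub>R us j x)) \<longlonglongrightarrow>
      (LINT x|lborel. pd (box_bump a b m) x i *\<^sub>R (indicator K x *\<^sub>R u x))"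
    proof (rule integral_dominated_convergence[where w = "\<lambda>x. R * \<bar>pd (box_bump a b m) x i\<bar>"])
      have "0 \<le> R" if "x \<in> K" for x using bd[OF that, of 0] norm_ge_zero[of "us 0 x"] by linarith
      moreover have "a \<in> cbox a b" using False by (auto simp: box_eq_empty cbox_def less_imp_le)
      ultimately have R0: "0 \<le> R" using sub by blast
      show "AE x in lborel. norm (pd (box_bump a b m) x i *\<^sub>R (indicator K x *\<^sub>R us j x)) \<le> R * \<bar>pd (box_bump a b m) x i\<bar>" for j
      proof (rule AE_I2)
        fix x
        have "norm (indicator K x *\<^sub>R us j x) \<le> R" using bd[of x j] R0 by (auto simp: indicator_def)
        then show "norm (pd (box_bump a b m) x i *\<^sub>R (indicator K x *\<^sub>R us j x)) \<le> R * \<bar>pd (box_bump a b m) x i\<bar>"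
          using mult_left_mono[of "norm (indicator K x *\<^sub>R us j x)" R "\<bar>pd (box_bump a b m) x i\<bar>"]
          unfolding norm_scaleR[of "pd (box_bump a b m) x i"] mult.commute[of R] by (metis abs_ge_zero)
      qed
      show "AE x in lborel. (\<lambda>j. pd (box_bump a b m) x i *\<^sub>R (indicator K x *\<^sub>R us j x)) \<longlonglongrightarrow> pd (box_bump a b m) x i *\<^sub>R (indicator K x *\<^sub>R u x)"
      proof (rule AE_I2)
        fix x
        have "(\<lambda>j. indicator K x *\<^sub>R us j x) \<longlonglongrightarrow> indicator K x *\<^sub>R u x"
          using lim[of x] by (cases "x \<in> K") auto
        then show "(\<lambda>j. pd (box_bump a b m) x i *\<^sub>R (indicator K x *\<^sub>R us j x)) \<longlonglongrightarrow> pd (box_bump a b m) x i *\<^sub>R (indicator K x *\<^sub>R u x)"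
          by (rule tendsto_scaleR[OF tendsto_const])
      qed
      show "integrable lborel (\<lambda>x. R * \<bar>pd (box_bump a b m) x i\<bar>)" using pi by simp
    qed (use pm um[OF w11_local.contu[OF ws]] um[OF w11_local.contu[OF w']] in \<open>auto simp del: scaleR_scaleR intro!: borel_measurable_scaleR\<close>)
    from tendsto_minus[OF this]
    show "(\<lambda>j. LINT x|lborel. box_bump a b m x *\<^sub>R w j i x) \<longlonglongrightarrow> (LINT x|lborel. box_bump a b m x *\<^sub>R w' i x)"
      unfolding w11_local.weak[OF ws False sub] w11_local.weak[OF w' False sub] by simp
  qed (use bm in \<open>auto simp: indicator_def\<close>)
qed simp

text \<open>Dynkin induction with every set intersected with one fixed box: complements become
  differences within the box, and disjoint unions are limits of finite sums whose remainders live in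
  the box.\<close>

lemma tendsto_integral_borel_set:
  fixes w :: "nat \<Rightarrow> real^'n \<Rightarrow> 'b::euclidean_space"
  assumes ei: "equi_int lborel w" and wm: "\<And>j. w j \<in> borel_measurable borel" and w': "integrable lborel w'"
    and boxes: "\<And>c d. box c d \<noteq> {} \<Longrightarrow> box c d \<subseteq> box a b \<Longrightarrow>
      (\<lambda>j. LINT x|lborel. indicator (box c d) x *\<^sub>R w j x) \<longlonglongrightarrow> (LINT x|lborel. indicator (box c d) x *\<^sub>R w' x)"
    and A: "A \<in> sets borel"
  shows "(\<lambda>j. LINT x|lborel. indicator (A \<inter> box a b) x *\<^sub>R w j x) \<longlonglongrightarrow> (LINT x|lborel. indicator (A \<inter> box a b) x *\<^sub>R w' x)"
proof -
  let ?G = "range (\<lambda>(c, d). box c d :: (real^'n) set)"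
  have borel: "sets borel = sigma_sets UNIV ?G" unfolding borel_eq_box by (rule sets_measure_of) simp
  have wi: "integrable lborel (w j)" for j by (rule integrable_if_equi_int[OF ei]) (simp add: wm)
  have "Int_stable ?G" by (auto simp: Int_stable_def box_Int_box)
  moreover have "?G \<subseteq> Pow UNIV" by simp
  moreover have "A \<in> sigma_sets UNIV ?G" using A borel by simp
  ultimately show ?thesis
  proof (induction rule: sigma_sets_induct_disjoint)
    case (basic A)
    then obtain c d where "A \<inter> box a b = box c d" using box_Int_box by auto blast
    moreover have "A \<inter> box a b \<subseteq> box a b" by simp
    ultimately show ?case using boxes[of c d] by (cases "box c d = {}") auto
  next
    case empty
    show ?case by simp
  next
    case (compl A)
    have [measurable]: "A \<in> sets lborel" using compl(1) borel by simp
    have eq: "(LINT x|lborel. indicator ((UNIV - A) \<inter> box a b) x *\<^sub>R z x) =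
      (LINT x|lborel. indicator (box a b) x *\<^sub>R z x) - (LINT x|lborel. indicator (A \<inter> box a b) x *\<^sub>R z x)"
      if z: "integrable lborel z" for z :: "real^'n \<Rightarrow> 'b"
    proof -
      have "(LINT x|lborel. indicator ((UNIV - A) \<inter> box a b) x *\<^sub>R z x) = (LINT x|lborel. indicator (box a b) x *\<^sub>R z x - indicator (A \<inter> box a b) x *\<^sub>R z x)"
        by (intro Bochner_Integration.integral_cong) (auto simp: indicator_def)
      also have "\<dots> = (LINT x|lborel. indicator (box a b) x *\<^sub>R z x) - (LINT x|lborel. indicator (A \<inter> box a b) x *\<^sub>R z x)"
        by (intro Bochner_Integration.integral_diff integrable_mult_indicator z) auto
      finally show ?thesis .
    qed
    have "(\<lambda>j. LINT x|lborel. indicator (box a b) x *\<^sub>R w j x) \<longlonglongrightarrow> (LINT x|lborel. indicator (box a b) x *\<^sub>R w' x)"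
      by (cases "box a b = {}") (auto intro: boxes)
    then show ?case unfolding eq[OF wi] eq[OF w'] by (intro tendsto_diff compl(2))
  next
    case (union A)
    have [measurable]: "A i \<in> sets lborel" for i using union(2) borel by auto
    have Ab: "A i \<in> sets borel" for i using union(2) borel by auto
    let ?Q = "box a b"
    let ?g = "\<lambda>m x. \<Sum>i<m. indicator (A i \<inter> ?Q) x :: real"
    have g: "?g m x = indicator ((\<Union>i<m. A i) \<inter> ?Q) x" for m x
    proof -
      have "?g m x = indicator (\<Union>i\<in>{..<m}. A i \<inter> ?Q) x"
        by (rule indicator_UN_disjoint[symmetric]) (use union(1) in \<open>auto simp: disjoint_family_on_def\<close>)
      also have "(\<Union>i\<in>{..<m}. A i \<inter> ?Q) = (\<Union>i<m. A i) \<inter> ?Q" by blast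
      finally show ?thesis .
    qed
    show ?case
    proof (rule tendsto_integral_vanishing_multiplier[OF ei wm w', where g = ?g and a = a and b = b and B = 1])
      show "\<bar>?g m x - indicator ((\<Union>i. A i) \<inter> ?Q) x\<bar> \<le> indicator ?Q x" for m x
        unfolding g by (auto simp: indicator_def)
      show "(\<lambda>m. ?g m x) \<longlonglongrightarrow> indicator ((\<Union>i. A i) \<inter> ?Q) x" for x
      proof -
        have "incseq (\<lambda>m. (\<Union>i<m. A i) \<inter> ?Q)" by (force simp: incseq_def)
        moreover have "(\<Union>m. (\<Union>i<m. A i) \<inter> ?Q) = (\<Union>i. A i) \<inter> ?Q" by auto
        ultimately show ?thesis unfolding g using LIMSEQ_indicator_incseq by metis
      qed
      have s: "(LINT x|lborel. ?g m x *\<^sub>R z x) = (\<Sum>i<m. LINT x|lborel. indicator (A i \<inter> ?Q) x *\<^sub>R z x)"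
        if "integrable lborel z" for m and z :: "real^'n \<Rightarrow> 'b"
        unfolding scaleR_sum_left
        by (intro Bochner_Integration.integral_sum integrable_mult_indicator that) auto
      show "(\<lambda>j. LINT x|lborel. ?g m x *\<^sub>R w j x) \<longlonglongrightarrow> (LINT x|lborel. ?g m x *\<^sub>R w' x)" for m
        unfolding s[OF wi] s[OF w'] by (intro tendsto_sum union(3))
    qed (use Ab in \<open>auto simp: indicator_def intro!: borel_measurable_sum borel_measurable_indicator\<close>)
  qed
qed

text \<open>Rounding h down to multiples of 1/(m+1) gives functions with finitely many values, hence
  finite combinations of indicators of Borel sets.\<close>

lemma tendsto_integral_bounded_on_box:
  fixes w :: "nat \<Rightarrow> real^'n \<Rightarrow> 'b::euclidean_space"
  assumes ei: "equi_int lborel w" and wm: "\<And>j. w j \<in> borel_measurable borel" and w': "integrable lborel w'"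
    and boxes: "\<And>c d. box c d \<noteq> {} \<Longrightarrow> box c d \<subseteq> box a b \<Longrightarrow>
      (\<lambda>j. LINT x|lborel. indicator (box c d) x *\<^sub>R w j x) \<longlonglongrightarrow> (LINT x|lborel. indicator (box c d) x *\<^sub>R w' x)"
    and hm: "h \<in> borel_measurable borel" and bd: "\<And>x. \<bar>h x\<bar> \<le> B"
  shows "(\<lambda>j. LINT x|lborel. (indicator (box a b) x * h x) *\<^sub>R w j x) \<longlonglongrightarrow> (LINT x|lborel. (indicator (box a b) x * h x) *\<^sub>R w' x)"
proof -
  note [measurable] = hm
  let ?Q = "box a b"
  have wi: "integrable lborel (w j)" for j by (rule integrable_if_equi_int[OF ei]) (simp add: wm)
  define k where "k m x = \<lfloor>real (Suc m) * h x\<rfloor>" for m x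
  define g where "g m x = indicator ?Q x * (real_of_int (k m x) / real (Suc m))" for m x
  have err: "\<bar>real_of_int (k m x) / real (Suc m) - h x\<bar> \<le> 1 / real (Suc m)" for m x
  proof -
    have "\<bar>real_of_int (k m x) - real (Suc m) * h x\<bar> \<le> 1" unfolding k_def by linarith
    then have "\<bar>real_of_int (k m x) - real (Suc m) * h x\<bar> / real (Suc m) \<le> 1 / real (Suc m)" by (intro divide_right_mono) auto
    moreover have "real_of_int (k m x) / real (Suc m) - h x = (real_of_int (k m x) - real (Suc m) * h x) / real (Suc m)"
      by (simp add: diff_divide_distrib)
    ultimately show ?thesis by (simp add: abs_divide)
  qed
  show ?thesis
  proof (rule tendsto_integral_vanishing_multiplier[OF ei wm w', where g = g and a = a and b = b and B = B])
    show "g m \<in> borel_measurable borel" for m unfolding g_def k_def by measurable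
    show "(\<lambda>x. indicator ?Q x * h x) \<in> borel_measurable borel" by measurable
    have B0: "B \<ge> 0" using bd[of 0] by linarith
    show "\<bar>indicator ?Q x * h x\<bar> \<le> B" for x using bd[of x] B0 by (auto simp: indicator_def)
    show "\<bar>g m x - indicator ?Q x * h x\<bar> \<le> indicator ?Q x" for m x
    proof -
      have "1 / real (Suc m) \<le> 1" by simp
      then have "\<bar>real_of_int (k m x) / real (Suc m) - h x\<bar> \<le> 1" using err[of m x] by linarith
      then show ?thesis by (auto simp: g_def indicator_def)
    qed
    show "(\<lambda>m. g m x) \<longlonglongrightarrow> indicator ?Q x * h x" for x
    proof -
      have "(\<lambda>m. real_of_int (k m x) / real (Suc m) - h x) \<longlonglongrightarrow> 0"
        by (rule Lim_null_comparison[of _ "\<lambda>m. inverse (real (Suc m))"])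
          (use err LIMSEQ_inverse_real_of_nat in \<open>auto simp: divide_inverse\<close>)
      then have "(\<lambda>m. real_of_int (k m x) / real (Suc m)) \<longlonglongrightarrow> h x" by (rule LIM_zero_cancel)
      then show ?thesis unfolding g_def by (intro tendsto_mult tendsto_const)
    qed
    fix m
    \<comment> \<open>The scaled values lie between -(m+1) B and (m+1) B; the extra unit at each end
      absorbs the rounding.\<close>
    define S where "S = {- \<lceil>real (Suc m) * B\<rceil> - 1 .. \<lceil>real (Suc m) * B\<rceil> + 1}"
    have kS: "k m x \<in> S" for x
    proof -
      have "\<bar>real (Suc m) * h x\<bar> \<le> real (Suc m) * B" unfolding abs_mult using bd[of x] by (simp add: mult_left_mono)
      then show ?thesis unfolding S_def k_def atLeastAtMost_iff by linarith
    qed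
    have gS: "g m x = (\<Sum>l\<in>S. (real_of_int l / real (Suc m)) * indicator ({x. k m x = l} \<inter> ?Q) x)" for x
    proof -
      have "(\<Sum>l\<in>S. (real_of_int l / real (Suc m)) * indicator ({x. k m x = l} \<inter> ?Q) x) =
        (\<Sum>l\<in>S. if l = k m x then (real_of_int l / real (Suc m)) * indicator ?Q x else 0)"
        by (intro sum.cong) (auto simp: indicator_def)
      also have "\<dots> = (real_of_int (k m x) / real (Suc m)) * indicator ?Q x" using kS[of x] by (simp add: S_def)
      finally show ?thesis by (simp add: g_def)
    qed
    have [measurable]: "{x. k m x = l} \<in> sets borel" for l unfolding k_def by measurable
    have s: "(LINT x|lborel. g m x *\<^sub>R z x) = (\<Sum>l\<in>S. (real_of_int l / real (Suc m)) *\<^sub>R (LINT x|lborel. indicator ({x. k m x = l} \<inter> ?Q) x *\<^sub>R z x))"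
      if z: "integrable lborel z" for z :: "real^'n \<Rightarrow> 'b"
    proof -
      have iz: "integrable lborel (\<lambda>x. indicator ({x. k m x = l} \<inter> ?Q) x *\<^sub>R z x)" for l
        by (intro integrable_mult_indicator z) measurable
      have "(LINT x|lborel. g m x *\<^sub>R z x) = (LINT x|lborel. (\<Sum>l\<in>S. (real_of_int l / real (Suc m)) *\<^sub>R (indicator ({x. k m x = l} \<inter> ?Q) x *\<^sub>R z x)))"
        unfolding gS scaleR_sum_left by simp
      also have "\<dots> = (\<Sum>l\<in>S. LINT x|lborel. (real_of_int l / real (Suc m)) *\<^sub>R (indicator ({x. k m x = l} \<inter> ?Q) x *\<^sub>R z x))"
        by (intro Bochner_Integration.integral_sum integrable_scaleR_right iz)
      finally show ?thesis by (simp only: integral_scaleR_right)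
    qed
    show "(\<lambda>j. LINT x|lborel. g m x *\<^sub>R w j x) \<longlonglongrightarrow> (LINT x|lborel. g m x *\<^sub>R w' x)"
      unfolding s[OF wi] s[OF w']
      by (intro tendsto_sum tendsto_scaleR tendsto_const tendsto_integral_borel_set[OF ei wm w' boxes]) auto
  qed
qed

text \<open>A finite cover of the support by boxes is treated one box at a time: the part of the
  multiplier in the new box is split off, and the remainder vanishes outside the other boxes and
  keeps the bound B.\<close>

lemma tendsto_integral_bounded_compact_support:
  fixes w :: "nat \<Rightarrow> real^'n \<Rightarrow> 'b::euclidean_space"
  assumes ei: "equi_int lborel w" and wm: "\<And>j. w j \<in> borel_measurable borel" and w': "integrable lborel w'"
    and boxes: "\<And>c d. cbox c d \<subseteq> U \<Longrightarrow>
      (\<lambda>j. LINT x|lborel. indicator (box c d) x *\<^sub>R w j x) \<longlonglongrightarrow> (LINT x|lborel. indicator (box c d) x *\<^sub>R w' x)"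
    and U: "open U" and K: "compact K" "K \<subseteq> U"
    and hm: "h \<in> borel_measurable borel" and bd: "\<And>x. \<bar>h x\<bar> \<le> B" and out: "\<And>x. x \<notin> K \<Longrightarrow> h x = 0"
  shows "(\<lambda>j. LINT x|lborel. h x *\<^sub>R w j x) \<longlonglongrightarrow> (LINT x|lborel. h x *\<^sub>R w' x)"
proof -
  have wi: "integrable lborel (w j)" for j by (rule integrable_if_equi_int[OF ei]) (simp add: wm)
  let ?T = "{(a, b). cbox a b \<subseteq> U}"
  let ?f = "\<lambda>(a, b). box a b :: (real^'n) set"
  have "K \<subseteq> (\<Union>p\<in>?T. ?f p)"
  proof
    fix x assume "x \<in> K"
    then have "x \<in> U" using K(2) by blast
    then obtain a b where "x \<in> box a b" "cbox a b \<subseteq> U" by (rule open_contains_cbox[OF U]) blast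
    then have "(a, b) \<in> ?T" "x \<in> ?f (a, b)" by simp_all
    then show "x \<in> (\<Union>p\<in>?T. ?f p)" by (rule UN_I)
  qed
  then obtain T where T: "T \<subseteq> ?T" "finite T" "K \<subseteq> (\<Union>p\<in>T. ?f p)"
  proof (rule compactE_image[OF K(1), of ?T ?f, rotated])
    show "open (?f p)" for p by (cases p) (simp add: open_box)
  qed blast
  have "(\<lambda>j. LINT x|lborel. h x *\<^sub>R w j x) \<longlonglongrightarrow> (LINT x|lborel. h x *\<^sub>R w' x)"
    if "finite T" "T \<subseteq> ?T" "h \<in> borel_measurable borel" "\<And>x. \<bar>h x\<bar> \<le> B" "\<And>x. x \<notin> (\<Union>p\<in>T. ?f p) \<Longrightarrow> h x = 0" for h
    using that
  proof (induction T arbitrary: h rule: finite_induct)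
    case empty
    then show ?case by simp
  next
    case (insert p T)
    obtain a b where p: "p = (a, b)" "cbox a b \<subseteq> U" using insert.prems(1) by auto
    let ?h = "\<lambda>x. h x - indicator (box a b) x * h x"
    have hm [measurable]: "h \<in> borel_measurable borel" by (rule insert.prems)
    have B0: "B \<ge> 0" using insert.prems(3)[of 0] by linarith
    have 1: "(\<lambda>j. LINT x|lborel. ?h x *\<^sub>R w j x) \<longlonglongrightarrow> (LINT x|lborel. ?h x *\<^sub>R w' x)"
    proof (rule insert.IH)
      show "\<bar>?h x\<bar> \<le> B" for x using insert.prems(3)[of x] B0 by (auto simp: indicator_def)
      show "?h x = 0" if "x \<notin> (\<Union>p\<in>T. ?f p)" for x using insert.prems(4)[of x] that p(1) by (auto simp: indicator_def)
    qed (use insert.prems(1) in auto)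
    have 2: "(\<lambda>j. LINT x|lborel. (indicator (box a b) x * h x) *\<^sub>R w j x) \<longlonglongrightarrow> (LINT x|lborel. (indicator (box a b) x * h x) *\<^sub>R w' x)"
    proof (rule tendsto_integral_bounded_on_box[OF ei wm w' _ hm insert.prems(3)])
      fix c d assume cd: "box c d \<noteq> {}" "box c d \<subseteq> box a b"
      then have "closure (box c d) \<subseteq> closure (box a b)" by (intro closure_mono)
      moreover have "box a b \<noteq> {}" using cd by blast
      ultimately have "cbox c d \<subseteq> cbox a b" using cd(1) by (simp add: closure_box)
      then show "(\<lambda>j. LINT x|lborel. indicator (box c d) x *\<^sub>R w j x) \<longlonglongrightarrow> (LINT x|lborel. indicator (box c d) x *\<^sub>R w' x)"
        using p(2) by (intro boxes) blast
    qed
    have s: "(LINT x|lborel. h x *\<^sub>R z x) = (LINT x|lborel. ?h x *\<^sub>R z x) + (LINT x|lborel. (indicator (box a b) x * h x) *\<^sub>R z x)"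
      if z: "integrable lborel z" for z :: "real^'n \<Rightarrow> 'b"
    proof -
      have i: "integrable lborel (\<lambda>x. k x *\<^sub>R z x)" if [measurable]: "k \<in> borel_measurable borel" and "\<And>x. \<bar>k x\<bar> \<le> B" for k
      proof (rule Bochner_Integration.integrable_bound[OF integrable_scaleR_right[OF z, of B]])
        show "AE x in lborel. norm (k x *\<^sub>R z x) \<le> norm (B *\<^sub>R z x)"
          using that(2) by (intro AE_I2) (auto intro!: mult_right_mono intro: order_trans[OF that(2)])
      qed (use z in measurable)
      have i1: "integrable lborel (\<lambda>x. ?h x *\<^sub>R z x)"
        using insert.prems(3) B0 by (intro i) (auto simp: indicator_def)
      have i2: "integrable lborel (\<lambda>x. (indicator (box a b) x * h x) *\<^sub>R z x)"
        using insert.prems(3) B0 by (intro i) (auto simp: indicator_def)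
      show ?thesis unfolding Bochner_Integration.integral_add[OF i1 i2, symmetric]
        by (simp add: scaleR_diff_left)
    qed
    show ?case unfolding s[OF wi] s[OF w'] by (intro tendsto_add 1 2)
  qed
  from this[OF T(2,1) hm bd] show ?thesis using out T(3) by blast
qed

section \<open>Equi-integrability of gradients\<close>

context admissible_map
begin

text \<open>A small \<open>s\<close> makes the contribution of the Jacobian small, and then a large slope \<open>k\<close> of the minorant
  makes the contribution of the energy small.\<close>

lemma gradient_tail_bound:
  assumes s: "s > 0" and k: "k > 0" and s': "s' \<ge> 0"
    and minor: "\<And>t::real. 1 \<le> t \<Longrightarrow> ennreal (k * (t - s')) \<le> \<Phi> (ennreal t)"
    and V: "open V" "K \<subseteq> V" "V \<subseteq> \<Omega>" and K: "K \<in> sets lebesgue"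
    and fin: "emeasure lborel (u ` V) \<le> ennreal m" and m: "0 \<le> m"
    and energy: "set_nn_integral lebesgue \<Omega> (\<lambda>x. \<Phi> (Pdil u x)) \<le> ennreal M" and M: "0 \<le> M" and E: "E \<in> sets lebesgue"
  defines "c \<equiv> (1 + q) * s powr q"
  shows "(\<integral>\<^sup>+x\<in>E. norm (indicator K x *\<^sub>R v i x) \<partial>lebesgue)
    \<le> ennreal (s' / c) * emeasure lebesgue (E \<inter> K) + ennreal (M / (k * c) + s * q / (1 + q) * m)"
proof -
  have q0: "q > 0" using n2 by (simp add: q)
  have c0: "c > 0" using q0 s by (simp add: c_def)
  \<comment> \<open>The Jacobian coefficient of the tangent inequality divided by the gradient
    coefficient \<open>c\<close>; it is proportional to s.\<close>
  define b where "b = s * q / (1 + q)"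
  have b0: "b \<ge> 0" using s q0 by (simp add: b_def)
  have ab: "q * s powr (1 + q) = b * c"
    using s q0 by (simp add: b_def c_def powr_add)
  obtain \<mu> where \<mu>: "emeasure lborel (u ` V) = ennreal \<mu>" "0 \<le> \<mu>" "\<mu> \<le> m"
    using fin m by (cases "emeasure lborel (u ` V)") (auto simp: ennreal_le_iff top_unique)
  define J where "J x = indicator V x * \<bar>det (vmat x)\<bar>" for x
  have Ji: "integrable lebesgue J" "(LINT x|lebesgue. J x) \<le> m"
    unfolding J_def using integrable_det[OF V(1,3) \<mu>(1,2)] \<mu>(3) by auto
  have J0: "J x \<ge> 0" for x by (simp add: J_def)
  define F where "F x = \<Phi> (Pdil u x) * indicator \<Omega> x" for x
  have Fm: "F \<in> borel_measurable lebesgue"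
    unfolding F_def by (rule measurable_completion) (use measurable_Phi_Pdil[OF n2 Phi open_Omega cu] in simp)
  have Jm: "(\<lambda>x. ennreal (J x)) \<in> borel_measurable lebesgue" using Ji(1) by auto
  have Im: "indicator (E \<inter> K) \<in> borel_measurable lebesgue" using E K by auto
  have "AE x in lebesgue. ennreal (norm (indicator K x *\<^sub>R v i x)) * indicator E x
     \<le> ennreal (s' / c) * indicator (E \<inter> K) x + (ennreal (1 / (k * c)) * F x + ennreal b * ennreal (J x))"
    using tangent_bound[OF less_imp_le[OF s]]
  proof eventually_elim
    case (elim x)
    show ?case
    proof (cases "x \<in> E \<inter> K")
      case True
      then have x: "x \<in> \<Omega>" "x \<in> V" "x \<in> E" "x \<in> K" using V by auto
      define N where "N = onorm (row_map (vmat x))"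
      obtain P where P: "P \<ge> 1" "Pdil u x = ennreal P" "P \<ge> c * N - b * c * J x"
        using elim x by (auto simp: c_def N_def J_def ab)
      have "v i x = row_map (vmat x) (axis i 1)"
        by (simp add: row_map_def vmat_def axis_def if_distrib[where f = "\<lambda>a. a *\<^sub>R _"] cong: if_cong)
      then have vN: "norm (v i x) \<le> N" using onorm[OF bounded_linear_row_map, of "vmat x" "axis i 1"] by (simp add: N_def)
      \<comment> \<open>\<open>ennreal\<close> truncates the minorant at 0, so its positive part is
        what is compared with the energy density.\<close>
      define t where "t = max 0 (k * (P - s'))"
      have t: "ennreal t \<le> F x" using minor[OF P(1)] x(1) P(2) by (simp add: t_def F_def max_def ennreal_neg)
      have "k * P \<le> k * s' + t" by (simp add: t_def algebra_simps)
      moreover have "k * (c * N) \<le> k * (P + b * c * J x)" using P(3) k by (intro mult_left_mono) auto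
      ultimately have "(k * c) * N \<le> (k * c) * (s' / c + (t / (k * c) + b * J x))"
        using k c0 by (simp add: algebra_simps)
      then have "N \<le> s' / c + (t / (k * c) + b * J x)" using k c0 by (simp add: mult_le_cancel_left_pos)
      then have "ennreal (norm (v i x)) \<le> ennreal (s' / c + (t / (k * c) + b * J x))"
        using vN by (intro ennreal_leI) linarith
      also have "\<dots> = ennreal (s' / c) + (ennreal (1 / (k * c)) * ennreal t + ennreal b * ennreal (J x))"
        using s' c0 k b0 J0[of x] by (simp add: ennreal_plus ennreal_mult[symmetric] t_def)
      also have "\<dots> \<le> ennreal (s' / c) + (ennreal (1 / (k * c)) * F x + ennreal b * ennreal (J x))"
        using t by (intro add_mono mult_left_mono) auto
      finally show ?thesis using x by simp
    qed (auto simp: indicator_def)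
  qed
  then have "(\<integral>\<^sup>+x\<in>E. norm (indicator K x *\<^sub>R v i x) \<partial>lebesgue)
     \<le> (\<integral>\<^sup>+x. ennreal (s' / c) * indicator (E \<inter> K) x + (ennreal (1 / (k * c)) * F x + ennreal b * ennreal (J x)) \<partial>lebesgue)"
    by (rule nn_integral_mono_AE)
  also have "\<dots> = ennreal (s' / c) * emeasure lebesgue (E \<inter> K) + (ennreal (1 / (k * c)) * (\<integral>\<^sup>+x. F x \<partial>lebesgue) + ennreal b * (\<integral>\<^sup>+x. ennreal (J x) \<partial>lebesgue))"
    using Fm Jm Im E K by (simp add: nn_integral_add nn_integral_cmult borel_measurable_times nn_integral_cmult_indicator)
  also have "(\<integral>\<^sup>+x. ennreal (J x) \<partial>lebesgue) = ennreal (LINT x|lebesgue. J x)"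
    by (rule nn_integral_eq_integral[OF Ji(1)]) (simp add: J0)
  also have "ennreal (s' / c) * emeasure lebesgue (E \<inter> K) + (ennreal (1 / (k * c)) * (\<integral>\<^sup>+x. F x \<partial>lebesgue) + ennreal b * ennreal (LINT x|lebesgue. J x))
    \<le> ennreal (s' / c) * emeasure lebesgue (E \<inter> K) + (ennreal (1 / (k * c)) * ennreal M + ennreal b * ennreal m)"
    using energy Ji(2) by (intro add_mono mult_left_mono ennreal_leI) (auto simp: F_def)
  also have "ennreal (1 / (k * c)) * ennreal M + ennreal b * ennreal m = ennreal (M / (k * c) + b * m)"
    using k c0 M b0 m by (simp add: ennreal_plus ennreal_mult[symmetric])
  finally show ?thesis by (simp add: b_def)
qed

end

text \<open>Both requirements follow once the integral over any set E is at most L times the measure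
  of E \<inter> K plus an arbitrarily small constant, with L independent of j. The Jacobian
  integrals are bounded uniformly because the images of a neighbourhood of K stay in one
  ball.\<close>

lemma equi_int_gradients:
  fixes fs :: "nat \<Rightarrow> real^'n \<Rightarrow> real^'n"
  assumes adm: "\<And>j. admissible_map \<Phi> \<Omega> (fs j) (v j) q"
    and energy: "\<And>j. set_nn_integral lebesgue \<Omega> (\<lambda>x. \<Phi> (Pdil (fs j) x)) \<le> ennreal M" and M: "0 \<le> M"
    and bdd: "\<And>K. compact K \<Longrightarrow> K \<subseteq> \<Omega> \<Longrightarrow> \<exists>R. \<forall>j. \<forall>x\<in>K. norm (fs j x) \<le> R"
    and K: "compact K" "K \<subseteq> \<Omega>"
    and wm: "\<And>j. w j \<in> borel_measurable borel" and w: "\<And>j. AE x in lebesgue. w j x = indicator K x *\<^sub>R v j i x"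
  shows "equi_int lborel w"
proof -
  note a = adm[of 0]
  note n2 = admissible_map.n2[OF a] and Phi = admissible_map.Phi[OF a] and open_Omega = admissible_map.open_Omega[OF a] and q = admissible_map.q[OF a]
  have q0: "q > 0" using n2 by (simp add: q)
  obtain \<rho> V K' where nb: "\<rho> > (0::real)" "open V" "K \<subseteq> V" "compact K'" "K' \<subseteq> \<Omega>" "V \<subseteq> K'" "\<And>x. x \<in> V \<Longrightarrow> cball x \<rho> \<subseteq> K'"
    by (rule compact_nbhd[OF K open_Omega]) blast
  obtain R where R: "\<And>j x. x \<in> K' \<Longrightarrow> norm (fs j x) \<le> R" using bdd[OF nb(4,5)] by blast
  define m where "m = measure lborel (cball (0::real^'n) R)"
  have m0: "m \<ge> 0" by (simp add: m_def)
  have im: "emeasure lborel (fs j ` V) \<le> ennreal m" for j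
  proof -
    have "emeasure lborel (fs j ` V) \<le> emeasure lborel (cball (0::real^'n) R)"
      using R nb(6) by (intro emeasure_mono) auto
    also have "\<dots> = ennreal m" unfolding m_def
      by (rule emeasure_eq_ennreal_measure) (use emeasure_lborel_cball_finite[of "0::real^'n" R] in auto)
    finally show ?thesis .
  qed
  have Kl: "K \<in> sets lebesgue" using K(1) by (simp add: borel_compact)
  have Kf: "emeasure lborel K < \<infinity>" using K(1) by (rule emeasure_compact_finite)
  have key: "\<exists>L\<ge>0. \<forall>j. \<forall>E\<in>sets lborel. (\<integral>\<^sup>+x\<in>E. norm (w j x) \<partial>lborel) \<le> ennreal L * emeasure lborel (E \<inter> K) + ennreal e" if e: "e > 0" for e
  proof -
    \<comment> \<open>Half of e is reserved for the Jacobian part, which is at most s m; the slope k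
      makes the energy part M/(k c) at most the other half.\<close>
    define s where "s = (e / 2) / (m + 1)"
    have s: "s > 0" using e m0 by (simp add: s_def)
    define c where "c = (1 + q) * s powr q"
    have c0: "c > 0" using q0 s by (simp add: c_def)
    define k where "k = M / (c * (e / 2)) + 1"
    have k: "k > 0" using M c0 e by (simp add: k_def add_nonneg_pos)
    obtain s' where s': "s' \<ge> 1" "\<And>t::real. 1 \<le> t \<Longrightarrow> ennreal (k * (t - s')) \<le> \<Phi> (ennreal t)"
      by (rule Phi_superlinear[OF Phi k]) blast
    have "M / (k * c) \<le> e / 2"
    proof -
      have "k * (c * (e / 2)) = M + c * (e / 2)" using c0 e by (simp add: k_def distrib_right)
      then have "M \<le> (k * c) * (e / 2)" using c0 e by (simp add: mult.assoc)
      then show ?thesis using k c0 by (simp add: pos_divide_le_eq mult.commute)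
    qed
    moreover have "s * q / (1 + q) * m \<le> e / 2"
    proof -
      have "s * q / (1 + q) \<le> s" using s q0 by (simp add: pos_divide_le_eq)
      then have "s * q / (1 + q) * m \<le> s * m" using m0 by (rule mult_right_mono)
      also have "\<dots> \<le> s * (m + 1)" using s by simp
      also have "\<dots> = e / 2"
      proof -
        have "m + 1 \<noteq> 0" using m0 by linarith
        then show ?thesis unfolding s_def by (metis nonzero_divide_eq_eq)
      qed
      finally show ?thesis .
    qed
    ultimately have le: "M / (k * c) + s * q / (1 + q) * m \<le> e" by linarith
    show ?thesis
    proof (intro exI[of _ "s' / c"] conjI allI ballI)
      show "0 \<le> s' / c" using s'(1) c0 by simp
      fix j and E :: "(real^'n) set" assume E: "E \<in> sets lborel"
      have "(\<integral>\<^sup>+x\<in>E. norm (w j x) \<partial>lborel) = (\<integral>\<^sup>+x\<in>E. norm (w j x) \<partial>lebesgue)" by (rule nn_integral_completion[symmetric])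
      also have "\<dots> = (\<integral>\<^sup>+x\<in>E. norm (indicator K x *\<^sub>R v j i x) \<partial>lebesgue)"
        by (rule nn_integral_cong_AE, use w[of j] in eventually_elim) simp
      also have "\<dots> \<le> ennreal (s' / c) * emeasure lebesgue (E \<inter> K) + ennreal (M / (k * c) + s * q / (1 + q) * m)"
        unfolding c_def
        by (rule admissible_map.gradient_tail_bound[OF adm s k _ s'(2) nb(2,3) _ Kl im m0 energy M])
          (use s'(1) nb(5,6) E in auto)
      also have "emeasure lebesgue (E \<inter> K) = emeasure lborel (E \<inter> K)" using E borel_compact[OF K(1)] by simp
      also have "ennreal (s' / c) * emeasure lborel (E \<inter> K) + ennreal (M / (k * c) + s * q / (1 + q) * m) \<le> ennreal (s' / c) * emeasure lborel (E \<inter> K) + ennreal e"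
        by (intro add_left_mono ennreal_leI le)
      finally show "(\<integral>\<^sup>+x\<in>E. norm (w j x) \<partial>lborel) \<le> ennreal (s' / c) * emeasure lborel (E \<inter> K) + ennreal e" .
    qed
  qed
  show ?thesis
    unfolding equi_int_def
  proof (intro conjI allI impI)
    obtain L where L: "L \<ge> 0" "\<And>j E. E \<in> sets lborel \<Longrightarrow> (\<integral>\<^sup>+x\<in>E. norm (w j x) \<partial>lborel) \<le> ennreal L * emeasure lborel (E \<inter> K) + ennreal 1"
      using key[of 1] by auto
    have Ke: "emeasure lborel K = ennreal (measure lborel K)" using Kf by (intro emeasure_eq_ennreal_measure) auto
    show "\<exists>C::real. \<forall>j. (\<integral>\<^sup>+x. norm (w j x) \<partial>lborel) \<le> ennreal C"
    proof (intro exI[of _ "L * measure lborel K + 1"] allI)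
      fix j
      have "(\<integral>\<^sup>+x. norm (w j x) \<partial>lborel) \<le> ennreal L * emeasure lborel K + ennreal 1" using L(2)[of UNIV j] by simp
      also have "\<dots> = ennreal (L * measure lborel K + 1)" unfolding Ke using L(1) by (simp add: ennreal_mult ennreal_plus)
      finally show "(\<integral>\<^sup>+x. norm (w j x) \<partial>lborel) \<le> ennreal (L * measure lborel K + 1)" .
    qed
    fix e :: real assume e: "e > 0"
    obtain L where L: "L \<ge> 0" "\<And>j E. E \<in> sets lborel \<Longrightarrow> (\<integral>\<^sup>+x\<in>E. norm (w j x) \<partial>lborel) \<le> ennreal L * emeasure lborel (E \<inter> K) + ennreal (e / 2)"
      using key[of "e / 2"] e by auto
    define d where "d = (e / 2) / (L + 1)"
    have d: "d > 0" "L * d \<le> e / 2"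
    proof -
      show "d > 0" using e L(1) by (simp add: d_def)
      moreover have "(L + 1) * d = e / 2"
      proof -
        have "L + 1 \<noteq> 0" using L(1) by linarith
        then show ?thesis unfolding d_def by (metis mult.commute nonzero_divide_eq_eq)
      qed
      ultimately show "L * d \<le> e / 2" by (simp add: algebra_simps)
    qed
    show "\<exists>d>0. \<forall>j. \<forall>A\<in>sets lborel. emeasure lborel A < ennreal d \<longrightarrow> (\<integral>\<^sup>+x\<in>A. norm (w j x) \<partial>lborel) \<le> ennreal e"
    proof (intro exI[of _ d] conjI allI ballI impI d(1))
      fix j and A :: "(real^'n) set" assume A: "A \<in> sets lborel" "emeasure lborel A < ennreal d"
      have "emeasure lborel (A \<inter> K) \<le> ennreal d"
        using A by (meson emeasure_mono inf_le1 less_imp_le order_trans)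
      then have "ennreal L * emeasure lborel (A \<inter> K) + ennreal (e / 2) \<le> ennreal L * ennreal d + ennreal (e / 2)"
        by (intro add_right_mono mult_left_mono) auto
      also have "\<dots> = ennreal (L * d + e / 2)" using L(1) d(1) e by (simp add: ennreal_mult ennreal_plus)
      also have "\<dots> \<le> ennreal e" using d(2) by (intro ennreal_leI) simp
      finally show "(\<integral>\<^sup>+x\<in>A. norm (w j x) \<partial>lborel) \<le> ennreal e" using L(2)[OF A(1), of j] by (rule order_trans[rotated])
    qed
  qed
qed

section \<open>Passage to the limit under bounded energy\<close>

lemma uniformly_bounded_on_compact:
  fixes fs :: "nat \<Rightarrow> 'a::euclidean_space \<Rightarrow> 'b::real_normed_vector"
  assumes c: "\<And>j. continuous_on K (fs j)" and K: "compact K" and u: "uniform_limit K fs f sequentially"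
  shows "\<exists>R. \<forall>j. \<forall>x\<in>K. norm (fs j x) \<le> R"
proof -
  have "continuous_on K f"
    by (rule uniform_limit_theorem[OF _ u]) (use c in auto)
  then have "bounded (f ` K)" using K by (simp add: compact_continuous_image compact_imp_bounded)
  then obtain B where B: "\<And>x. x \<in> K \<Longrightarrow> norm (f x) \<le> B" by (auto simp: bounded_iff)
  have "\<forall>\<^sub>F j in sequentially. \<forall>x\<in>K. dist (fs j x) (f x) < 1" using u by (rule uniform_limitD) simp
  then obtain N where N: "\<And>j x. j \<ge> N \<Longrightarrow> x \<in> K \<Longrightarrow> dist (fs j x) (f x) < 1" by (auto simp: eventually_sequentially)
  have "\<exists>b. \<forall>x\<in>K. norm (fs j x) \<le> b" for j
    using compact_imp_bounded[OF compact_continuous_image[OF c K]] by (auto simp: bounded_iff)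
  then obtain b where b: "\<And>j x. x \<in> K \<Longrightarrow> norm (fs j x) \<le> b j" by metis
  show ?thesis
  proof (intro exI allI ballI)
    fix j x assume x: "x \<in> K"
    show "norm (fs j x) \<le> (B + 1) + (\<Sum>j<N. \<bar>b j\<bar>)"
    proof (cases "j < N")
      case True
      have "norm (fs j x) \<le> \<bar>b j\<bar>" using b[OF x, of j] by linarith
      also have "\<dots> \<le> (\<Sum>j<N. \<bar>b j\<bar>)" using True by (intro member_le_sum) auto
      finally show ?thesis using B[OF x] norm_ge_zero[of "f x"] by linarith
    next
      case False
      then have "norm (fs j x - f x) < 1" using N[of j x] x by (simp add: dist_norm)
      then have "norm (fs j x) \<le> B + 1" using B[OF x] norm_triangle_sub[of "fs j x" "f x"] by linarith
      then show ?thesis by (simp add: add_increasing2 sum_nonneg)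
    qed
  qed
qed

text \<open>Differentiability almost everywhere supplies classical partial derivatives of the limit
  map, and equi-integrability of the gradients along the sequence makes them weak ones.\<close>

lemma weak_partials_limit:
  fixes f :: "real^'n \<Rightarrow> real^'n"
  assumes adm: "\<And>j. admissible_map \<Phi> \<Omega> (fs j) (v j) q"
    and energy: "\<And>j. set_nn_integral lebesgue \<Omega> (\<lambda>x. \<Phi> (Pdil (fs j) x)) \<le> ennreal M" and M: "0 \<le> M"
    and unif: "\<And>K. compact K \<Longrightarrow> K \<subseteq> \<Omega> \<Longrightarrow> uniform_limit K fs f sequentially"
    and cf: "continuous_on \<Omega> f" and diff: "AE x in lebesgue. x \<in> \<Omega> \<longrightarrow> f differentiable (at x)"
  shows "weak_partials \<Omega> f (\<lambda>i x. pd f x i)"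
proof -
  note open_Omega = admissible_map.open_Omega[OF adm[of 0]]
  have bdd: "\<exists>R. \<forall>j. \<forall>x\<in>K. norm (fs j x) \<le> R" if "compact K" "K \<subseteq> \<Omega>" for K
    by (rule uniformly_bounded_on_compact[OF continuous_on_subset[OF admissible_map.cu[OF adm] that(2)] that(1) unif[OF that]])
  have lim: "\<forall>x\<in>\<Omega>. (\<lambda>j. fs j x) \<longlonglongrightarrow> f x"
  proof
    fix x assume "x \<in> \<Omega>"
    then show "(\<lambda>j. fs j x) \<longlonglongrightarrow> f x" using tendsto_uniform_limitI[OF unif[of "{x}"]] by simp
  qed
  have loc: "\<forall>K. compact K \<and> K \<subseteq> \<Omega> \<longrightarrow> (\<exists>w. (\<forall>j. w11_local (fs j) (w j) K) \<and> equi_int lborel (\<lambda>j. w j i))" for i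
  proof (intro allI impI)
    fix K assume "compact K \<and> K \<subseteq> \<Omega>"
    then have K: "compact K" "K \<subseteq> \<Omega>" by auto
    have "\<exists>w. w11_local (fs j) w K \<and> (\<forall>i. AE x in lebesgue. w i x = indicator K x *\<^sub>R v j i x)" for j
      by (rule w11_local_exists[OF admissible_map.cu[OF adm] admissible_map.wp[OF adm[of j]] K]) blast
    then have "\<forall>j. \<exists>w. w11_local (fs j) w K \<and> (\<forall>i. AE x in lebesgue. w i x = indicator K x *\<^sub>R v j i x)" by blast
    from choice[OF this] obtain w where "\<forall>j. w11_local (fs j) (w j) K \<and> (\<forall>i. AE x in lebesgue. w j i x = indicator K x *\<^sub>R v j i x)" by (rule exE)
    then have w: "\<And>j. w11_local (fs j) (w j) K" "\<And>j i. AE x in lebesgue. w j i x = indicator K x *\<^sub>R v j i x" by simp_all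
    have "equi_int lborel (\<lambda>j. w j i)"
      by (rule equi_int_gradients[OF adm energy M bdd K _ w(2)]) (use w11_local.intw[OF w(1)] in auto)
    then show "\<exists>w. (\<forall>j. w11_local (fs j) (w j) K) \<and> equi_int lborel (\<lambda>j. w j i)" using w(1) by blast
  qed
  have part: "AE x in lebesgue. x \<in> \<Omega> \<longrightarrow> has_partial f x i" for i
    using diff by eventually_elim (auto simp: differentiable_def dest: has_derivative_pd(1))
  show ?thesis
    unfolding weak_partials_def
    using weak_partial_of_limit_integrable[OF open_Omega admissible_map.cu[OF adm] cf lim loc part]
      weak_partial_of_limit_test[OF open_Omega admissible_map.cu[OF adm] cf lim loc part] by blast
qed

lemma weak_convergence_of_partials:
  fixes f :: "real^'n \<Rightarrow> real^'n"
  assumes adm: "\<And>j. admissible_map \<Phi> \<Omega> (fs j) (v j) q"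
    and energy: "\<And>j. set_nn_integral lebesgue \<Omega> (\<lambda>x. \<Phi> (Pdil (fs j) x)) \<le> ennreal M" and M: "0 \<le> M"
    and unif: "\<And>K. compact K \<Longrightarrow> K \<subseteq> \<Omega> \<Longrightarrow> uniform_limit K fs f sequentially"
    and cf: "continuous_on \<Omega> f" and g: "weak_partials \<Omega> f g"
  shows "weak_conv_L1_loc \<Omega> (\<lambda>j. v j i) (g i)"
  unfolding weak_conv_L1_loc_def
proof (intro allI impI)
  note open_Omega = admissible_map.open_Omega[OF adm[of 0]]
  have bdd: "\<exists>R. \<forall>j. \<forall>x\<in>K. norm (fs j x) \<le> R" if "compact K" "K \<subseteq> \<Omega>" for K
    by (rule uniformly_bounded_on_compact[OF continuous_on_subset[OF admissible_map.cu[OF adm] that(2)] that(1) unif[OF that]])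
  fix K and h :: "real^'n \<Rightarrow> real"
  assume "compact K \<and> K \<subseteq> \<Omega> \<and> h measurable_on K \<and> bounded (h ` K)"
  then have K: "compact K" "K \<subseteq> \<Omega>" and hm: "h measurable_on K" and hb: "bounded (h ` K)" by auto
  obtain \<rho> V K' where nb: "\<rho> > (0::real)" "open V" "K \<subseteq> V" "compact K'" "K' \<subseteq> \<Omega>" "V \<subseteq> K'" "\<And>x. x \<in> V \<Longrightarrow> cball x \<rho> \<subseteq> K'"
    by (rule compact_nbhd[OF K open_Omega]) blast
  have "\<exists>w. w11_local (fs j) w K' \<and> (\<forall>i. AE x in lebesgue. w i x = indicator K' x *\<^sub>R v j i x)" for j
    by (rule w11_local_exists[OF admissible_map.cu[OF adm] admissible_map.wp[OF adm[of j]] nb(4,5)]) blast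
  then have "\<forall>j. \<exists>w. w11_local (fs j) w K' \<and> (\<forall>i. AE x in lebesgue. w i x = indicator K' x *\<^sub>R v j i x)" by blast
  from choice[OF this] obtain w where "\<forall>j. w11_local (fs j) (w j) K' \<and> (\<forall>i. AE x in lebesgue. w j i x = indicator K' x *\<^sub>R v j i x)" by (rule exE)
  then have w: "\<And>j. w11_local (fs j) (w j) K'" "\<And>j i. AE x in lebesgue. w j i x = indicator K' x *\<^sub>R v j i x" by simp_all
  obtain w' where w': "w11_local f w' K'" "\<And>i. AE x in lebesgue. w' i x = indicator K' x *\<^sub>R g i x"
    by (rule w11_local_exists[OF cf g nb(4,5)]) blast
  have wm: "w j i \<in> borel_measurable borel" for j using w11_local.intw[OF w(1)] by auto
  have ei: "equi_int lborel (\<lambda>j. w j i)"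
    by (rule equi_int_gradients[OF adm energy M bdd nb(4,5) wm w(2)])
  obtain R where R: "\<And>j x. x \<in> K' \<Longrightarrow> norm (fs j x) \<le> R" using bdd[OF nb(4,5)] by blast
  have lim: "(\<lambda>j. fs j x) \<longlonglongrightarrow> f x" if "x \<in> K'" for x
    by (rule tendsto_uniform_limitI[OF unif[OF nb(4,5)] that])
  obtain B where B: "\<And>x. x \<in> K \<Longrightarrow> \<bar>h x\<bar> \<le> B" using hb by (auto simp: bounded_iff)
  define h0 where "h0 x = indicator K x * h x" for x
  have Kl: "K \<in> sets lebesgue" using K(1) by (simp add: borel_compact)
  have h0m: "h0 \<in> borel_measurable lebesgue"
  proof -
    have "h \<in> borel_measurable (lebesgue_on K)" using hm Kl by (simp add: measurable_on_iff_borel_measurable)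
    then have "(\<lambda>x. if x \<in> K then h x else 0) \<in> borel_measurable lebesgue" using Kl by (simp add: borel_measurable_if)
    moreover have "h0 = (\<lambda>x. if x \<in> K then h x else 0)" by (auto simp: h0_def)
    ultimately show ?thesis by simp
  qed
  define B' where "B' = \<bar>B\<bar>"
  have h0B: "\<bar>h0 x\<bar> \<le> B'" for x using B[of x] by (auto simp: h0_def indicator_def B'_def)
  have "integrable lebesgue h0"
  proof (rule Bochner_Integration.integrable_bound)
    show "integrable lebesgue (\<lambda>x. B' * indicator K x)"
      using Kl emeasure_compact_finite[OF K(1)] borel_compact[OF K(1)] by (simp add: integrable_indicator_iff)
    show "AE x in lebesgue. norm (h0 x) \<le> norm (B' * indicator K x)"
    proof (rule AE_I2)
      fix x
      show "norm (h0 x) \<le> norm (B' * indicator K x)"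
        using h0B[of x] by (cases "x \<in> K") (auto simp: h0_def B'_def)
    qed
  qed (rule h0m)
  then obtain h1 where h1: "integrable lborel h1" "AE x in lebesgue. h1 x = h0 x" by (rule lebesgue_integrable_borel_version)
  \<comment> \<open>The Borel version agrees with the multiplier only almost everywhere; truncation
    to [-B', B'] and the indicator of \<open>K\<close> restore bound and support at every
    point.\<close>
  define h2 where "h2 x = indicator K x * max (- B') (min B' (h1 x))" for x
  have Kb: "K \<in> sets borel" using K(1) by (rule borel_compact)
  have h2m: "h2 \<in> borel_measurable borel" unfolding h2_def using h1(1) Kb by auto
  have B'0: "B' \<ge> 0" by (simp add: B'_def)
  have h2B: "\<bar>h2 x\<bar> \<le> B'" for x using B'0 by (auto simp: h2_def indicator_def abs_le_iff)
  have h2: "AE x in lebesgue. h2 x = indicator K x * h x"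
    using h1(2)
  proof eventually_elim
    case (elim x)
    then have "max (- B') (min B' (h1 x)) = h0 x" using h0B[of x] by (simp add: abs_le_iff)
    then show ?case by (auto simp: h2_def h0_def indicator_def)
  qed
  have conv: "(\<lambda>j. LINT x|lborel. h2 x *\<^sub>R w j i x) \<longlonglongrightarrow> (LINT x|lborel. h2 x *\<^sub>R w' i x)"
  proof (rule tendsto_integral_bounded_compact_support[OF ei wm w11_local.intw[OF w'(1)] _ nb(2) K(1) nb(3) h2m h2B])
    fix c d assume "cbox c d \<subseteq> V"
    then have "cbox c d \<subseteq> K'" using nb(6) by blast
    then show "(\<lambda>j. LINT x|lborel. indicator (box c d) x *\<^sub>R w j i x) \<longlonglongrightarrow> (LINT x|lborel. indicator (box c d) x *\<^sub>R w' i x)"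
      by (intro tendsto_integral_box[OF w(1) w'(1) ei lim R])
  qed (simp add: h2_def)
  have eq: "(LINT x|lborel. h2 x *\<^sub>R z x) = integral K (\<lambda>x. h x *\<^sub>R y x)"
    if z: "integrable lborel z" "AE x in lebesgue. z x = indicator K' x *\<^sub>R y x" for z y :: "real^'n \<Rightarrow> real^'n"
  proof (rule absolutely_integrable_AE_eq(2)[OF _ _ Kl])
    show "integrable lborel (\<lambda>x. h2 x *\<^sub>R z x)"
    proof (rule Bochner_Integration.integrable_bound[OF integrable_scaleR_right[OF z(1), of B']])
      show "AE x in lborel. norm (h2 x *\<^sub>R z x) \<le> norm (B' *\<^sub>R z x)"
        using h2B B'0 by (intro AE_I2) (auto intro!: mult_right_mono)
    qed (use z(1) h2m in auto)
    show "AE x in lebesgue. h2 x *\<^sub>R z x = indicator K x *\<^sub>R (h x *\<^sub>R y x)"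
      using h2 z(2) by eventually_elim (use nb(3,6) in \<open>auto simp: indicator_def\<close>)
  qed
  show "(\<lambda>j. integral K (\<lambda>x. h x *\<^sub>R v j i x)) \<longlonglongrightarrow> integral K (\<lambda>x. h x *\<^sub>R g i x)"
    using conv unfolding eq[OF w11_local.intw[OF w(1)] w(2)] eq[OF w11_local.intw[OF w'(1)] w'(2)] .
qed

lemma weak_partials_subset:
  fixes u :: "real^'n \<Rightarrow> real^'m"
  assumes wp: "weak_partials D u v" and sub: "\<Omega> \<subseteq> D"
  shows "weak_partials \<Omega> u v"
  unfolding weak_partials_def
proof (intro conjI allI impI)
  show "locally_L1 (v i) \<Omega>" for i using wp sub by (auto simp: weak_partials_def locally_L1_def)
  fix \<phi> i assume tf: "test_fun \<Omega> \<phi>"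
  then have tfD: "test_fun D \<phi>" using sub by (auto simp: test_fun_def)
  have out: "x \<notin> \<Omega> \<Longrightarrow> \<phi> x = 0" "x \<notin> \<Omega> \<Longrightarrow> pd \<phi> x i = 0" for x
    using tf closure_subset[of "{x. \<phi> x \<noteq> 0}"] test_fun_pd(4)[OF tf, of x i] by (auto simp: test_fun_def)
  have eq: "integral D F = integral \<Omega> F" if "\<And>x. x \<notin> \<Omega> \<Longrightarrow> F x = 0" for F :: "real^'n \<Rightarrow> real^'m"
  proof -
    have "(\<lambda>x. if x \<in> D then F x else 0) = (\<lambda>x. if x \<in> \<Omega> then F x else 0)"
    proof
      fix x
      show "(if x \<in> D then F x else 0) = (if x \<in> \<Omega> then F x else 0)" using that[of x] sub by auto
    qed
    then show ?thesis using integral_restrict_UNIV[of D F] integral_restrict_UNIV[of \<Omega> F] by simp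
  qed
  have "integral D (\<lambda>x. pd \<phi> x i *\<^sub>R u x) = - integral D (\<lambda>x. \<phi> x *\<^sub>R v i x)"
    using wp tfD by (auto simp: weak_partials_def)
  moreover have "integral D (\<lambda>x. pd \<phi> x i *\<^sub>R u x) = integral \<Omega> (\<lambda>x. pd \<phi> x i *\<^sub>R u x)"
    by (rule eq) (simp add: out)
  moreover have "integral D (\<lambda>x. \<phi> x *\<^sub>R v i x) = integral \<Omega> (\<lambda>x. \<phi> x *\<^sub>R v i x)"
    by (rule eq) (simp add: out)
  ultimately show "integral \<Omega> (\<lambda>x. pd \<phi> x i *\<^sub>R u x) = - integral \<Omega> (\<lambda>x. \<phi> x *\<^sub>R v i x)" by simp
qed

lemma locally_uniform_conv_compact:
  assumes conv: "locally_uniform_conv D fs f" and K: "compact K" "K \<subseteq> D"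
  shows "uniform_limit K fs f sequentially"
proof -
  have "\<forall>x\<in>D. \<exists>e>0. uniform_limit (cball x e) fs f sequentially" using conv by (auto simp: locally_uniform_conv_def)
  then obtain e where e: "\<And>x. x \<in> D \<Longrightarrow> e x > 0 \<and> uniform_limit (cball x (e x)) fs f sequentially" by metis
  obtain T where T: "T \<subseteq> K" "finite T" "K \<subseteq> (\<Union>x\<in>T. ball x (e x))"
  proof (rule compactE_image[OF K(1), of K "\<lambda>x. ball x (e x)"])
    show "K \<subseteq> (\<Union>x\<in>K. ball x (e x))"
    proof
      fix x assume "x \<in> K"
      then have "x \<in> ball x (e x)" using e K(2) by auto
      then show "x \<in> (\<Union>x\<in>K. ball x (e x))" using \<open>x \<in> K\<close> by (rule UN_I[rotated])
    qed
  qed auto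
  have "uniform_limit (\<Union>x\<in>T. cball x (e x)) fs f sequentially"
    using e T(1) K(2) by (intro uniform_limit_on_UNION T(2)) auto
  moreover have "K \<subseteq> (\<Union>x\<in>T. cball x (e x))" using T(3) ball_subset_cball by blast
  ultimately show ?thesis by (rule uniform_limit_on_subset)
qed

lemma locally_uniform_limit_continuous:
  assumes conv: "locally_uniform_conv D fs f" and c: "\<And>j. continuous_on D (fs j)" and D: "open D"
  shows "continuous_on D f"
  unfolding continuous_on_eq_continuous_at[OF D]
proof
  fix x assume "x \<in> D"
  then obtain e where e: "e > 0" "cball x e \<subseteq> D" "uniform_limit (cball x e) fs f sequentially"
    using conv by (auto simp: locally_uniform_conv_def)
  have "continuous_on (cball x e) f"
    by (rule uniform_limit_theorem[OF _ e(3)]) (use continuous_on_subset[OF c e(2)] in auto)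
  then have "continuous_on (ball x e) f" by (rule continuous_on_subset) (rule ball_subset_cball)
  then show "isCont f x" using e(1) by (simp add: continuous_on_eq_continuous_at)
qed

theorem theorem6p1:
  fixes D :: "(real^'n) set"
    and fs :: "nat \<Rightarrow> real^'n \<Rightarrow> real^'n"
    and f :: "real^'n \<Rightarrow> real^'n"
    and \<Phi> :: "ennreal \<Rightarrow> ennreal"
  assumes n2: "CARD('n) \<ge> 2"
    and D: "open D" "connected D"
    and homeo: "\<And>j. \<exists>g. homeomorphism D (fs j ` D) (fs j) g"
    and sob: "\<And>j. W11_loc D (fs j)"
    and conv: "locally_uniform_conv D fs f"
    and diff_ae: "AE x in lebesgue. x \<in> D \<longrightarrow> f differentiable (at x)"
    and Phi: "strictly_convex_Phi \<Phi>"
    and Phi_lc: "left_cont_at_T \<Phi>"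
  shows "\<forall>\<Omega>. open \<Omega> \<and> \<Omega> \<subseteq> D \<longrightarrow>
     (set_nn_integral lebesgue \<Omega> (\<lambda>x. \<Phi> (Pdil f x))
        \<le> liminf (\<lambda>j. set_nn_integral lebesgue \<Omega> (\<lambda>x. \<Phi> (Pdil (fs j) x)))) \<and>
     (((\<exists>g. homeomorphism D (f ` D) f g) \<and>
       liminf (\<lambda>j. set_nn_integral lebesgue \<Omega> (\<lambda>x. \<Phi> (Pdil (fs j) x))) < \<infinity>) \<longrightarrow>
        W11_loc \<Omega> f \<and>
        (limsup (\<lambda>j. set_nn_integral lebesgue \<Omega> (\<lambda>x. \<Phi> (Pdil (fs j) x))) < \<infinity> \<longrightarrow>
           (\<forall>gs g. (\<forall>j. weak_partials \<Omega> (fs j) (gs j)) \<and> weak_partials \<Omega> f g \<longrightarrow>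
              (\<forall>i. weak_conv_L1_loc \<Omega> (\<lambda>j. gs j i) (g i)))))"
proof (intro allI impI)
  fix \<Omega> :: "(real^'n) set" assume "open \<Omega> \<and> \<Omega> \<subseteq> D"
  then have \<Omega>: "open \<Omega>" "\<Omega> \<subseteq> D" by auto
  define q where "q = 1 / (real CARD('n) - 1)"
  define E where "E j = set_nn_integral lebesgue \<Omega> (\<lambda>x. \<Phi> (Pdil (fs j) x))" for j
  have cD: "continuous_on D (fs j)" for j using homeo[of j] by (auto simp: homeomorphism_def)
  have inj: "inj_on (fs j) \<Omega>" for j
  proof -
    obtain g where "homeomorphism D (fs j ` D) (fs j) g" using homeo by blast
    then have "inj_on (fs j) D" by (auto simp: homeomorphism_def intro: inj_on_inverseI)
    then show ?thesis using \<Omega>(2) by (rule inj_on_subset)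
  qed
  have c\<Omega>: "continuous_on \<Omega> (fs j)" for j using cD \<Omega>(2) by (rule continuous_on_subset)
  have cf: "continuous_on \<Omega> f"
    using locally_uniform_limit_continuous[OF conv cD D(1)] \<Omega>(2) by (rule continuous_on_subset)
  have unif: "uniform_limit K fs f sequentially" if "compact K" "K \<subseteq> \<Omega>" for K
    using that \<Omega>(2) by (intro locally_uniform_conv_compact[OF conv]) auto
  have diff: "AE x in lebesgue. x \<in> \<Omega> \<longrightarrow> f differentiable (at x)"
    using diff_ae by eventually_elim (use \<Omega>(2) in blast)
  have adm: "admissible_map \<Phi> \<Omega> (fs j) v q" if v: "weak_partials \<Omega> (fs j) v" and fin: "E j < \<infinity>" for j v
  proof
    show "AE x in lebesgue. x \<in> \<Omega> \<longrightarrow> Pdil (fs j) x \<noteq> \<infinity>"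
      by (rule AE_Pdil_finite[OF n2 Phi \<Omega>(1) c\<Omega>]) (use fin in \<open>simp add: E_def\<close>)
  qed (use n2 Phi \<Omega> c\<Omega> inj v q_def in auto)
  have "\<forall>j. \<exists>v. weak_partials D (fs j) v" using sob by (auto simp: W11_loc_def)
  from choice[OF this] obtain v where "\<forall>j. weak_partials D (fs j) (v j)" by (rule exE)
  then have v: "weak_partials \<Omega> (fs j) (v j)" for j using weak_partials_subset[OF _ \<Omega>(2)] by blast
  have unif_sub: "uniform_limit K (\<lambda>j. fs (\<sigma> j)) f sequentially" if "strict_mono \<sigma>" "compact K" "K \<subseteq> \<Omega>" for K \<sigma>
    using filterlim_compose[OF unif[OF that(2,3)] filterlim_subseq[OF that(1)]] .
  \<comment> \<open>Some energies may be infinite, so the lower limit is realised along a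
    subsequence with energies at most l + 1, whose members are admissible.\<close>
  have sub: "\<exists>\<sigma> M. strict_mono \<sigma> \<and> 0 \<le> M \<and> (\<forall>j. E (\<sigma> j) \<le> ennreal M) \<and> (\<lambda>j. E (\<sigma> j)) \<longlonglongrightarrow> liminf E"
    if fin: "liminf E < \<infinity>"
  proof -
    obtain \<tau> where \<tau>: "strict_mono \<tau>" "(E \<circ> \<tau>) \<longlonglongrightarrow> liminf E" using liminf_subseq_lim by blast
    obtain l where l: "liminf E = ennreal l" "l \<ge> 0" using fin by (cases "liminf E") auto
    have "\<forall>\<^sub>F j in sequentially. (E \<circ> \<tau>) j < ennreal (l + 1)"
      using l by (intro order_tendstoD(2)[OF \<tau>(2)]) (simp add: ennreal_less_iff)
    then obtain J where J: "\<And>j. j \<ge> J \<Longrightarrow> E (\<tau> j) < ennreal (l + 1)" by (auto simp: eventually_sequentially)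
    show ?thesis
    proof (intro exI[of _ "\<lambda>j. \<tau> (j + J)"] exI[of _ "l + 1"] conjI allI)
      show "strict_mono (\<lambda>j. \<tau> (j + J))" using \<tau>(1) by (simp add: strict_mono_def)
      show "(\<lambda>j. E (\<tau> (j + J))) \<longlonglongrightarrow> liminf E" using LIMSEQ_ignore_initial_segment[OF \<tau>(2), of J] by (simp add: comp_def)
    qed (use l J in \<open>auto simp: less_imp_le\<close>)
  qed
  have part1: "set_nn_integral lebesgue \<Omega> (\<lambda>x. \<Phi> (Pdil f x)) \<le> liminf E"
  proof (cases "liminf E < \<infinity>")
    case True
    obtain \<sigma> M where \<sigma>: "strict_mono \<sigma>" "\<And>j. E (\<sigma> j) \<le> ennreal M" "(\<lambda>j. E (\<sigma> j)) \<longlonglongrightarrow> liminf E" using sub[OF True] by blast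
    have a: "admissible_map \<Phi> \<Omega> (fs (\<sigma> j)) (v (\<sigma> j)) q" for j
      by (rule adm[OF v]) (use \<sigma>(2)[of j] in \<open>auto intro: le_less_trans\<close>)
    have "set_nn_integral lebesgue \<Omega> (\<lambda>x. \<Phi> (Pdil f x)) \<le> liminf (\<lambda>j. E (\<sigma> j))"
      unfolding E_def by (rule lower_semicontinuity_admissible[OF Phi_lc a unif_sub[OF \<sigma>(1)] diff])
    also have "\<dots> = liminf E" by (rule lim_imp_Liminf[OF _ \<sigma>(3)]) simp
    finally show ?thesis .
  qed (simp add: not_less top_unique)
  have part2: "W11_loc \<Omega> f" if fin: "liminf E < \<infinity>"
  proof -
    obtain \<sigma> M where "strict_mono \<sigma> \<and> 0 \<le> M \<and> (\<forall>j. E (\<sigma> j) \<le> ennreal M) \<and> (\<lambda>j. E (\<sigma> j)) \<longlonglongrightarrow> liminf E"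
      using sub[OF fin] by (elim exE) (rule that)
    then have \<sigma>: "strict_mono \<sigma>" "0 \<le> M" "\<And>j. E (\<sigma> j) \<le> ennreal M" by simp_all
    have a: "admissible_map \<Phi> \<Omega> (fs (\<sigma> j)) (v (\<sigma> j)) q" for j
      by (rule adm[OF v]) (use \<sigma>(3)[of j] in \<open>auto intro: le_less_trans\<close>)
    have "weak_partials \<Omega> f (\<lambda>i x. pd f x i)"
      by (rule weak_partials_limit[OF a \<sigma>(3)[unfolded E_def] \<sigma>(2) unif_sub[OF \<sigma>(1)] cf diff])
    moreover have "f absolutely_integrable_on K" if "compact K" "K \<subseteq> \<Omega>" for K
      by (rule absolutely_integrable_AE_eq(1)[OF borel_integrable_compact[OF that(1) continuous_on_subset[OF cf that(2)]]])
        (use borel_compact[OF that(1)] in auto)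
    ultimately show ?thesis by (auto simp: W11_loc_def locally_L1_def)
  qed
  have part3: "weak_conv_L1_loc \<Omega> (\<lambda>j. gs j i) (g i)"
    if fin: "limsup E < \<infinity>" and gs: "\<And>j. weak_partials \<Omega> (fs j) (gs j)" and g: "weak_partials \<Omega> f g" for gs g i
  proof -
    obtain l where l: "limsup E = ennreal l" "l \<ge> 0" using fin by (cases "limsup E") auto
    then have "limsup E < ennreal (l + 1)" by (simp add: ennreal_less_iff)
    then have "\<forall>\<^sub>F j in sequentially. E j < ennreal (l + 1)" by (rule Limsup_lessD)
    then obtain J where J: "\<And>j. j \<ge> J \<Longrightarrow> E j < ennreal (l + 1)" by (auto simp: eventually_sequentially)
    \<comment> \<open>A finite upper limit leaves only finitely many members of infinite energy; the
      shift by \<open>J\<close> removes them and does not affect limits.\<close>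
    have sm: "strict_mono (\<lambda>j. j + J)" by (simp add: strict_mono_def)
    have le: "E (j + J) \<le> ennreal (l + 1)" for j using J[of "j + J"] by (simp add: less_imp_le)
    have a: "admissible_map \<Phi> \<Omega> (fs (j + J)) (gs (j + J)) q" for j
      by (rule adm[OF gs]) (use le[of j] in \<open>auto intro: le_less_trans\<close>)
    have l1: "0 \<le> l + 1" using l(2) by simp
    have "weak_conv_L1_loc \<Omega> (\<lambda>j. gs (j + J) i) (g i)"
      by (rule weak_convergence_of_partials[OF a le[unfolded E_def] l1 unif_sub[OF sm] cf g])
    note shifted = this[unfolded weak_conv_L1_loc_def]
    show ?thesis
      unfolding weak_conv_L1_loc_def
    proof (intro allI impI)
      fix K and h :: "real^'n \<Rightarrow> real"
      assume "compact K \<and> K \<subseteq> \<Omega> \<and> h measurable_on K \<and> bounded (h ` K)"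
      then have "(\<lambda>j. integral K (\<lambda>x. h x *\<^sub>R gs (j + J) i x)) \<longlonglongrightarrow> integral K (\<lambda>x. h x *\<^sub>R g i x)"
        using shifted by blast
      then show "(\<lambda>j. integral K (\<lambda>x. h x *\<^sub>R gs j i x)) \<longlonglongrightarrow> integral K (\<lambda>x. h x *\<^sub>R g i x)"
        by (rule LIMSEQ_offset)
    qed
  qed
  show "(set_nn_integral lebesgue \<Omega> (\<lambda>x. \<Phi> (Pdil f x))
        \<le> liminf (\<lambda>j. set_nn_integral lebesgue \<Omega> (\<lambda>x. \<Phi> (Pdil (fs j) x)))) \<and>
     (((\<exists>g. homeomorphism D (f ` D) f g) \<and>
       liminf (\<lambda>j. set_nn_integral lebesgue \<Omega> (\<lambda>x. \<Phi> (Pdil (fs j) x))) < \<infinity>) \<longrightarrow>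
        W11_loc \<Omega> f \<and>
        (limsup (\<lambda>j. set_nn_integral lebesgue \<Omega> (\<lambda>x. \<Phi> (Pdil (fs j) x))) < \<infinity> \<longrightarrow>
           (\<forall>gs g. (\<forall>j. weak_partials \<Omega> (fs j) (gs j)) \<and> weak_partials \<Omega> f g \<longrightarrow>
              (\<forall>i. weak_conv_L1_loc \<Omega> (\<lambda>j. gs j i) (g i)))))"
    using part1 part2 part3 unfolding E_def by blast
qed

end
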